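(* Let $(M,g,J)$ be a compact Kähler-Einstein manifold of complex dimension $m\ge 2$ with complex scalar curvature $R>0$. Let $B$ be its Bochner tensor. If $$|B|<\frac{2\sqrt{m^2-1}\,R}{3(m^2-2)}$$ at every point of $M$, then $(M,g,J)$ is biholomorphically homothetic to the complex projective space $\mathbb{C}P^m$.
   Context: Manifolds are connected. Let $(M,g,J)$ be a Kähler manifold of complex dimension $m$. In local complex coordinates $(z_\alpha)$, $g_{\alpha\bar\beta}$, $R_{\alpha\bar\beta}$, $R_{\alpha\bar\beta\gamma\bar\delta}$ are the components of the metric, the Ricci tensor (usual sign, positive on complex projective space) and the curvature tensor, the curvature sign convention being such that $R_{\alpha\bar\beta}=-g^{\gamma\bar\delta}R_{\alpha\bar\beta\gamma\bar\delta}$ (summation convention). The complex scalar curvature is $R=g^{\alpha\bar\beta}R_{\alpha\bar\beta}$, which is half of the Riemannian scalar curvature. Kähler-Einstein means $R_{\alpha\bar\beta}=\frac{R}{m}g_{\alpha\bar\beta}$ (in which case $R$ is constant). The Bochner tensor $B$ has components $$B_{\alpha\bar\beta\gamma\bar\delta}=R_{\alpha\bar\beta\gamma\bar\delta}+\tfrac{1}{m+2}\left(R_{\alpha\bar\beta}g_{\gamma\bar\delta}+R_{\gamma\bar\beta}g_{\alpha\bar\delta}+g_{\alpha\bar\beta}R_{\gamma\bar\delta}+g_{\gamma\bar\beta}R_{\alpha\bar\delta}\right)-\tfrac{R}{(m+1)(m+2)}\left(g_{\alpha\bar\beta}g_{\gamma\bar\delta}+g_{\gamma\bar\beta}g_{\alpha\bar\delta}\right).$$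 Its norm is, at a point, in a frame with $g_{\alpha\bar\beta}=\delta_{\alpha\beta}$, $|B|^2=4\sum_{\alpha,\beta,\gamma,\delta}|B_{\alpha\bar\beta\gamma\bar\delta}|^2$ (the norm of $B$ as a real tensor). "Biholomorphically homothetic to $\mathbb{C}P^m$" means that there is a biholomorphism $M\to\mathbb{C}P^m$ under which the Fubini–Study metric pulls back to a positive constant multiple of $g$. *)

theory Defs
  imports "HOL-Analysis.Analysis"
begin

section \<open>Calculus on open subsets of complex coordinate space\<close>

primrec Ck_on :: "nat \<Rightarrow> 'a::real_normed_vector set \<Rightarrow> ('a \<Rightarrow> 'b::real_normed_vector) \<Rightarrow> bool" where
  "Ck_on 0 S f \<longleftrightarrow> continuous_on S f"
| "Ck_on (Suc k) S f \<longleftrightarrow> (\<forall>x\<in>S. f differentiable (at x)) \<and>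
     (\<forall>v. Ck_on k S (\<lambda>x. frechet_derivative f (at x) v))"

text \<open>Only used for open sets in finite-dimensional spaces, where continuity of all directional
  derivatives is continuity of the derivative.\<close>

definition smooth_on :: "'a::real_normed_vector set \<Rightarrow> ('a \<Rightarrow> 'b::real_normed_vector) \<Rightarrow> bool" where
  "smooth_on S f \<longleftrightarrow> (\<forall>k. Ck_on k S f)"

definition cholomorphic_on :: "(complex^'m \<Rightarrow> complex^'n) \<Rightarrow> (complex^'m) set \<Rightarrow> bool" where
  "cholomorphic_on f S \<longleftrightarrow>
     (\<forall>z\<in>S. \<exists>D. (f has_derivative D) (at z) \<and> (\<forall>c v. D (c *s v) = c *s D v))"

text \<open>The Wirtinger derivatives
  $\partial/\partial z_\alpha = (\partial/\partial x_\alpha - i\,\partial/\partial y_\alpha)/2$ and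
  $\partial/\partial \bar z_\alpha = (\partial/\partial x_\alpha + i\,\partial/\partial y_\alpha)/2$.\<close>

definition dz :: "'m::finite \<Rightarrow> (complex^'m \<Rightarrow> complex) \<Rightarrow> complex^'m \<Rightarrow> complex" where
  "dz \<alpha> f z = (frechet_derivative f (at z) (axis \<alpha> 1)
                - \<i> * frechet_derivative f (at z) (axis \<alpha> \<i>)) / 2"

definition dzbar :: "'m::finite \<Rightarrow> (complex^'m \<Rightarrow> complex) \<Rightarrow> complex^'m \<Rightarrow> complex" where
  "dzbar \<alpha> f z = (frechet_derivative f (at z) (axis \<alpha> 1)
                   + \<i> * frechet_derivative f (at z) (axis \<alpha> \<i>)) / 2"


section \<open>Complex manifolds\<close>

text \<open>A chart is a pair of its domain and its coordinate map; values of the coordinate map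
  outside the domain are irrelevant.\<close>

type_synonym ('a, 'm) chart = "'a set \<times> ('a \<Rightarrow> complex^'m)"

abbreviation dom_of :: "('a, 'm) chart \<Rightarrow> 'a set" where
  "dom_of c \<equiv> fst c"

abbreviation coord :: "('a, 'm) chart \<Rightarrow> 'a \<Rightarrow> complex^'m" where
  "coord c \<equiv> snd c"

abbreviation codom_of :: "('a, 'm) chart \<Rightarrow> (complex^'m) set" where
  "codom_of c \<equiv> coord c ` dom_of c"

definition local_rep :: "('a, 'm) chart \<Rightarrow> ('b, 'n) chart \<Rightarrow> ('a \<Rightarrow> 'b) \<Rightarrow> complex^'m \<Rightarrow> complex^'n" where
  "local_rep c d F = coord d \<circ> F \<circ> inv_into (dom_of c) (coord c)"

definition local_rep_dom :: "('a, 'm) chart \<Rightarrow> ('b, 'n) chart \<Rightarrow> ('a \<Rightarrow> 'b) \<Rightarrow> (complex^'m) set" where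
  "local_rep_dom c d F = coord c ` {p \<in> dom_of c. F p \<in> dom_of d}"

definition holomorphic_atlas :: "'a topology \<Rightarrow> ('a, 'm::finite) chart set \<Rightarrow> bool" where
  "holomorphic_atlas X A \<longleftrightarrow>
     (\<forall>c\<in>A. openin X (dom_of c) \<and> open (codom_of c) \<and>
        homeomorphic_map (subtopology X (dom_of c)) (top_of_set (codom_of c)) (coord c)) \<and>
     (\<Union>c\<in>A. dom_of c) = topspace X \<and>
     (\<forall>c\<in>A. \<forall>d\<in>A. cholomorphic_on (local_rep c d id) (local_rep_dom c d id))"

definition complex_manifold :: "'a topology \<Rightarrow> ('a, 'm::finite) chart set \<Rightarrow> bool" where
  "complex_manifold X A \<longleftrightarrow>
     topspace X \<noteq> {} \<and> connected_space X \<and> Hausdorff_space X \<and> second_countable X \<and>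
     holomorphic_atlas X A"

definition holomorphic_map ::
  "'a topology \<Rightarrow> ('a, 'm::finite) chart set \<Rightarrow> 'b topology \<Rightarrow> ('b, 'n::finite) chart set \<Rightarrow>
   ('a \<Rightarrow> 'b) \<Rightarrow> bool" where
  "holomorphic_map X A Y B F \<longleftrightarrow> continuous_map X Y F \<and>
     (\<forall>c\<in>A. \<forall>d\<in>B. cholomorphic_on (local_rep c d F) (local_rep_dom c d F))"

definition biholomorphic_map ::
  "'a topology \<Rightarrow> ('a, 'm::finite) chart set \<Rightarrow> 'b topology \<Rightarrow> ('b, 'n::finite) chart set \<Rightarrow>
   ('a \<Rightarrow> 'b) \<Rightarrow> bool" where
  "biholomorphic_map X A Y B F \<longleftrightarrow>
     bij_betw F (topspace X) (topspace Y) \<and> holomorphic_map X A Y B F \<and>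
     holomorphic_map Y B X A (inv_into (topspace X) F)"


section \<open>Kaehler metrics\<close>

text \<open>A Hermitian metric is given by its components in the charts of an atlas:
  $g_{\alpha\bar\beta}$ in the chart \<open>c\<close>, at the point with coordinates \<open>z\<close>, is
  \<open>g c z $ \<alpha> $ \<beta>\<close>; in all arrays below the second and fourth indices are the barred ones.\<close>

type_synonym 'm local_metric = "complex^'m \<Rightarrow> complex^'m^'m"

type_synonym ('a, 'm) metric = "('a, 'm) chart \<Rightarrow> 'm local_metric"

text \<open>Pullback, at \<open>z\<close>, of the Hermitian form \<open>h\<close> under a holomorphic map \<open>f\<close> between coordinate
  domains: $\sum_{\mu,\nu} \partial_\alpha f_\mu\, \overline{\partial_\beta f_\nu}\, h_{\mu\bar\nu}\circ f$.\<close>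

definition pullback_form ::
  "(complex^'m::finite \<Rightarrow> complex^'n::finite) \<Rightarrow> 'n local_metric \<Rightarrow> 'm local_metric" where
  "pullback_form f h z = (\<chi> \<alpha> \<beta>. \<Sum>\<mu>\<in>UNIV. \<Sum>\<nu>\<in>UNIV.
     dz \<alpha> (\<lambda>w. f w $ \<mu>) z * cnj (dz \<beta> (\<lambda>w. f w $ \<nu>) z) * h (f z) $ \<mu> $ \<nu>)"

definition hermitian_posdef :: "complex^'m::finite^'m \<Rightarrow> bool" where
  "hermitian_posdef G \<longleftrightarrow>
     (\<forall>\<alpha> \<beta>. G $ \<beta> $ \<alpha> = cnj (G $ \<alpha> $ \<beta>)) \<and>
     (\<forall>v. v \<noteq> 0 \<longrightarrow> 0 < Re (\<Sum>\<alpha>\<in>UNIV. \<Sum>\<beta>\<in>UNIV. G $ \<alpha> $ \<beta> * v $ \<alpha> * cnj (v $ \<beta>)))"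

definition hermitian_metric :: "('a, 'm::finite) chart set \<Rightarrow> ('a, 'm) metric \<Rightarrow> bool" where
  "hermitian_metric A g \<longleftrightarrow>
     (\<forall>c\<in>A. (\<forall>\<alpha> \<beta>. smooth_on (codom_of c) (\<lambda>z. g c z $ \<alpha> $ \<beta>)) \<and>
             (\<forall>z\<in>codom_of c. hermitian_posdef (g c z))) \<and>
     (\<forall>c\<in>A. \<forall>d\<in>A. \<forall>z\<in>local_rep_dom c d id.
        g c z = pullback_form (local_rep c d id) (g d) z)"

text \<open>Closedness of the fundamental form
  $i \sum g_{\alpha\bar\beta}\, dz_\alpha \wedge d\bar z_\beta$, componentwise: the vanishing of the
  (2,1)-part of its differential; the (1,2)-part is the complex conjugate.\<close>

definition fundamental_form_closed :: "('a, 'm::finite) chart set \<Rightarrow> ('a, 'm) metric \<Rightarrow> bool" where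
  "fundamental_form_closed A g \<longleftrightarrow>
     (\<forall>c\<in>A. \<forall>z\<in>codom_of c. \<forall>\<alpha> \<beta> \<gamma>.
        dz \<gamma> (\<lambda>w. g c w $ \<alpha> $ \<beta>) z = dz \<alpha> (\<lambda>w. g c w $ \<gamma> $ \<beta>) z)"

definition kaehler_manifold ::
  "'a topology \<Rightarrow> ('a, 'm::finite) chart set \<Rightarrow> ('a, 'm) metric \<Rightarrow> bool" where
  "kaehler_manifold X A g \<longleftrightarrow>
     complex_manifold X A \<and> hermitian_metric A g \<and> fundamental_form_closed A g"


section \<open>Curvature in local coordinates\<close>

text \<open>\<open>ginv h \<gamma> \<delta> z\<close> is $g^{\gamma\bar\delta}$, normalised by
  $\sum_\gamma g^{\gamma\bar\delta} g_{\gamma\bar\beta} = \delta_{\delta\beta}$; hence the transposed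
  indices.\<close>

definition ginv :: "'m::finite local_metric \<Rightarrow> 'm \<Rightarrow> 'm \<Rightarrow> complex^'m \<Rightarrow> complex" where
  "ginv h \<gamma> \<delta> z = matrix_inv (h z) $ \<delta> $ \<gamma>"

text \<open>\<open>christoffel h \<mu> \<gamma> \<alpha>\<close> is
  $\Gamma^\mu_{\gamma\alpha} = g^{\mu\bar\nu}\partial_\gamma g_{\alpha\bar\nu}$; for a Kaehler metric these
  and their conjugates are the only nonzero components of the Levi-Civita connection.\<close>

definition christoffel :: "'m::finite local_metric \<Rightarrow> 'm \<Rightarrow> 'm \<Rightarrow> 'm \<Rightarrow> complex^'m \<Rightarrow> complex" where
  "christoffel h \<mu> \<gamma> \<alpha> z = (\<Sum>\<nu>\<in>UNIV. ginv h \<mu> \<nu> z * dz \<gamma> (\<lambda>w. h w $ \<alpha> $ \<nu>) z)"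

text \<open>$R_{\alpha\bar\beta\gamma\bar\delta} = g_{\mu\bar\beta}\,\partial_{\bar\delta}\Gamma^\mu_{\gamma\alpha}
  = -\,g([\nabla_\gamma,\nabla_{\bar\delta}]\partial_\alpha, \partial_{\bar\beta})$.  With this sign
  the components are negative multiples of
  $g_{\alpha\bar\beta}g_{\gamma\bar\delta}+g_{\gamma\bar\beta}g_{\alpha\bar\delta}$ on complex projective
  space, and the Ricci tensor, which is minus the trace, is positive there.\<close>

definition curv :: "'m::finite local_metric \<Rightarrow> 'm \<Rightarrow> 'm \<Rightarrow> 'm \<Rightarrow> 'm \<Rightarrow> complex^'m \<Rightarrow> complex" where
  "curv h \<alpha> \<beta> \<gamma> \<delta> z = (\<Sum>\<mu>\<in>UNIV. h z $ \<mu> $ \<beta> * dzbar \<delta> (christoffel h \<mu> \<gamma> \<alpha>) z)"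

definition ricci :: "'m::finite local_metric \<Rightarrow> 'm \<Rightarrow> 'm \<Rightarrow> complex^'m \<Rightarrow> complex" where
  "ricci h \<alpha> \<beta> z = - (\<Sum>\<gamma>\<in>UNIV. \<Sum>\<delta>\<in>UNIV. ginv h \<gamma> \<delta> z * curv h \<alpha> \<beta> \<gamma> \<delta> z)"

text \<open>The complex scalar curvature.  The trace is real for a Kaehler metric, so taking the real part
  only serves to obtain a number of type \<open>real\<close>.\<close>

definition cscal :: "'m::finite local_metric \<Rightarrow> complex^'m \<Rightarrow> real" where
  "cscal h z = Re (\<Sum>\<alpha>\<in>UNIV. \<Sum>\<beta>\<in>UNIV. ginv h \<alpha> \<beta> z * ricci h \<alpha> \<beta> z)"

definition bochner :: "'m::finite local_metric \<Rightarrow> 'm \<Rightarrow> 'm \<Rightarrow> 'm \<Rightarrow> 'm \<Rightarrow> complex^'m \<Rightarrow> complex" where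
  "bochner h \<alpha> \<beta> \<gamma> \<delta> z = (let m = real CARD('m); G = (\<lambda>\<alpha> \<beta>. h z $ \<alpha> $ \<beta>);
       Ric = (\<lambda>\<alpha> \<beta>. ricci h \<alpha> \<beta> z) in
     curv h \<alpha> \<beta> \<gamma> \<delta> z
     + complex_of_real (1 / (m + 2)) *
         (Ric \<alpha> \<beta> * G \<gamma> \<delta> + Ric \<gamma> \<beta> * G \<alpha> \<delta> + G \<alpha> \<beta> * Ric \<gamma> \<delta> + G \<gamma> \<beta> * Ric \<alpha> \<delta>)
     - complex_of_real (cscal h z / ((m + 1) * (m + 2))) *
         (G \<alpha> \<beta> * G \<gamma> \<delta> + G \<gamma> \<beta> * G \<alpha> \<delta>))"

text \<open>The rows of \<open>P\<close> are the coefficients of a frame $e_a = \sum_\alpha P_{a\alpha}\partial_\alpha$;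
  in a unitary frame the metric has components $g_{a\bar b} = \delta_{ab}$.\<close>

definition unitary_frame :: "complex^'m::finite^'m \<Rightarrow> complex^'m^'m \<Rightarrow> bool" where
  "unitary_frame G P \<longleftrightarrow> (\<forall>a b.
     (\<Sum>\<alpha>\<in>UNIV. \<Sum>\<beta>\<in>UNIV. P $ a $ \<alpha> * cnj (P $ b $ \<beta>) * G $ \<alpha> $ \<beta>) = (if a = b then 1 else 0))"

definition frame_components ::
  "complex^'m::finite^'m \<Rightarrow> ('m \<Rightarrow> 'm \<Rightarrow> 'm \<Rightarrow> 'm \<Rightarrow> complex) \<Rightarrow> 'm \<Rightarrow> 'm \<Rightarrow> 'm \<Rightarrow> 'm \<Rightarrow> complex" where
  "frame_components P T a b c d =
     (\<Sum>\<alpha>\<in>UNIV. \<Sum>\<beta>\<in>UNIV. \<Sum>\<gamma>\<in>UNIV. \<Sum>\<delta>\<in>UNIV.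
        P $ a $ \<alpha> * cnj (P $ b $ \<beta>) * P $ c $ \<gamma> * cnj (P $ d $ \<delta>) * T \<alpha> \<beta> \<gamma> \<delta>)"

definition frame_norm ::
  "complex^'m::finite^'m \<Rightarrow> ('m \<Rightarrow> 'm \<Rightarrow> 'm \<Rightarrow> 'm \<Rightarrow> complex) \<Rightarrow> real" where
  "frame_norm P T = sqrt (4 * (\<Sum>a\<in>UNIV. \<Sum>b\<in>UNIV. \<Sum>c\<in>UNIV. \<Sum>d\<in>UNIV.
     (cmod (frame_components P T a b c d))\<^sup>2))"

definition bochner_norm :: "'m::finite local_metric \<Rightarrow> complex^'m \<Rightarrow> real" where
  "bochner_norm h z =
     frame_norm (SOME P. unitary_frame (h z) P) (\<lambda>\<alpha> \<beta> \<gamma> \<delta>. bochner h \<alpha> \<beta> \<gamma> \<delta> z)"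

definition kaehler_einstein :: "('a, 'm::finite) chart set \<Rightarrow> ('a, 'm) metric \<Rightarrow> bool" where
  "kaehler_einstein A g \<longleftrightarrow> (\<forall>c\<in>A. \<forall>z\<in>codom_of c. \<forall>\<alpha> \<beta>.
     ricci (g c) \<alpha> \<beta> z = complex_of_real (cscal (g c) z / real CARD('m)) * g c z $ \<alpha> $ \<beta>)"


section \<open>Independence of the norm of the unitary frame\<close>

lemma unitary_frame_sum:
  fixes P Q :: "complex^'m::finite^'m" and f :: "'m \<Rightarrow> complex"
  assumes "unitary_frame G P" "unitary_frame G Q"
  shows "(\<Sum>a\<in>UNIV. (cmod (\<Sum>\<alpha>\<in>UNIV. P $ a $ \<alpha> * f \<alpha>))\<^sup>2)
       = (\<Sum>a\<in>UNIV. (cmod (\<Sum>\<alpha>\<in>UNIV. Q $ a $ \<alpha> * f \<alpha>))\<^sup>2)"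
proof -
  define adj :: "complex^'m^'m \<Rightarrow> complex^'m^'m" where "adj = (\<lambda>P. \<chi> i j. cnj (P $ j $ i))"
  have gram: "adj P ** P = adj Q ** Q"
  proof -
    have *: "P ** (G ** adj P) = mat 1" if "unitary_frame G P" for P
      using that unfolding unitary_frame_def adj_def matrix_matrix_mult_def mat_def vec_eq_iff
      by (simp add: sum_distrib_left mult_ac)
    have **: "(G ** adj P) ** P = mat 1" if "unitary_frame G P" for P
      using *[OF that] matrix_left_right_inverse by blast
    have "G ** (adj P ** P) = mat 1" "G ** (adj Q ** Q) = mat 1"
      using **[OF assms(1)] **[OF assms(2)] by (simp_all add: matrix_mul_assoc)
    then show ?thesis
      by (metis matrix_left_right_inverse matrix_mul_assoc matrix_mul_lid matrix_mul_rid)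
  qed
  have exp: "complex_of_real (\<Sum>a\<in>UNIV. (cmod (\<Sum>\<alpha>\<in>UNIV. P $ a $ \<alpha> * f \<alpha>))\<^sup>2)
      = (\<Sum>\<beta>\<in>UNIV. \<Sum>\<alpha>\<in>UNIV. cnj (f \<beta>) * (adj P ** P) $ \<beta> $ \<alpha> * f \<alpha>)" for P :: "complex^'m^'m"
  proof -
    have "complex_of_real (\<Sum>a\<in>UNIV. (cmod (\<Sum>\<alpha>\<in>UNIV. P $ a $ \<alpha> * f \<alpha>))\<^sup>2)
        = (\<Sum>a\<in>UNIV. \<Sum>\<beta>\<in>UNIV. \<Sum>\<alpha>\<in>UNIV. cnj (f \<beta>) * (cnj (P $ a $ \<beta>) * P $ a $ \<alpha>) * f \<alpha>)"
      unfolding of_real_sum complex_norm_square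
      by (intro sum.cong refl) (simp add: sum_product mult_ac, rule sum.swap)
    also have "\<dots> = (\<Sum>\<beta>\<in>UNIV. \<Sum>a\<in>UNIV. \<Sum>\<alpha>\<in>UNIV. cnj (f \<beta>) * (cnj (P $ a $ \<beta>) * P $ a $ \<alpha>) * f \<alpha>)"
      by (rule sum.swap)
    also have "\<dots> = (\<Sum>\<beta>\<in>UNIV. \<Sum>\<alpha>\<in>UNIV. \<Sum>a\<in>UNIV. cnj (f \<beta>) * (cnj (P $ a $ \<beta>) * P $ a $ \<alpha>) * f \<alpha>)"
      by (intro sum.cong refl sum.swap)
    also have "\<dots> = (\<Sum>\<beta>\<in>UNIV. \<Sum>\<alpha>\<in>UNIV. cnj (f \<beta>) * (adj P ** P) $ \<beta> $ \<alpha> * f \<alpha>)"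
      by (simp add: adj_def matrix_matrix_mult_def sum_distrib_left sum_distrib_right)
    finally show ?thesis .
  qed
  show ?thesis
    by (rule injD[OF inj_of_real[where ?'a = complex]]) (simp only: exp gram)
qed

lemma unitary_frame_sum_cnj:
  fixes P Q :: "complex^'m::finite^'m" and f :: "'m \<Rightarrow> complex"
  assumes "unitary_frame G P" "unitary_frame G Q"
  shows "(\<Sum>a\<in>UNIV. (cmod (\<Sum>\<alpha>\<in>UNIV. cnj (P $ a $ \<alpha>) * f \<alpha>))\<^sup>2)
       = (\<Sum>a\<in>UNIV. (cmod (\<Sum>\<alpha>\<in>UNIV. cnj (Q $ a $ \<alpha>) * f \<alpha>))\<^sup>2)"
proof -
  have "cmod (\<Sum>\<alpha>\<in>UNIV. cnj (P $ a $ \<alpha>) * f \<alpha>) = cmod (\<Sum>\<alpha>\<in>UNIV. P $ a $ \<alpha> * cnj (f \<alpha>))"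
    for P :: "complex^'m^'m" and a
    by (subst complex_mod_cnj[symmetric]) simp
  then show ?thesis
    using unitary_frame_sum[OF assms, of "\<lambda>\<alpha>. cnj (f \<alpha>)"] by simp
qed

lemma frame_norm_unique:
  fixes P Q :: "complex^'m::finite^'m"
  assumes "unitary_frame G P" "unitary_frame G Q"
  shows "frame_norm P T = frame_norm Q T"
proof -
  let ?cm = "\<lambda>x. (cmod x)\<^sup>2"
  define S where "S = (\<lambda>T :: 'm \<Rightarrow> 'm \<Rightarrow> 'm \<Rightarrow> 'm \<Rightarrow> complex.
    \<Sum>a\<in>UNIV. \<Sum>b\<in>UNIV. \<Sum>c\<in>UNIV. \<Sum>d\<in>UNIV. (cmod (T a b c d))\<^sup>2)"
  define A1 where "A1 = (\<lambda>(R :: complex^'m^'m) (T :: 'm \<Rightarrow> 'm \<Rightarrow> 'm \<Rightarrow> 'm \<Rightarrow> complex) a b c d. \<Sum>\<alpha>\<in>UNIV. R $ a $ \<alpha> * T \<alpha> b c d)"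
  define A2 where "A2 = (\<lambda>(R :: complex^'m^'m) (T :: 'm \<Rightarrow> 'm \<Rightarrow> 'm \<Rightarrow> 'm \<Rightarrow> complex) a b c d. \<Sum>\<beta>\<in>UNIV. cnj (R $ b $ \<beta>) * T a \<beta> c d)"
  define A3 where "A3 = (\<lambda>(R :: complex^'m^'m) (T :: 'm \<Rightarrow> 'm \<Rightarrow> 'm \<Rightarrow> 'm \<Rightarrow> complex) a b c d. \<Sum>\<gamma>\<in>UNIV. R $ c $ \<gamma> * T a b \<gamma> d)"
  define A4 where "A4 = (\<lambda>(R :: complex^'m^'m) (T :: 'm \<Rightarrow> 'm \<Rightarrow> 'm \<Rightarrow> 'm \<Rightarrow> complex) a b c d. \<Sum>\<delta>\<in>UNIV. cnj (R $ d $ \<delta>) * T a b c \<delta>)"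
  note U = unitary_frame_sum[OF assms] and V = unitary_frame_sum_cnj[OF assms]
  have S1: "S (A1 P T) = S (A1 Q T)" for T
  proof -
    have "S T = (\<Sum>b\<in>UNIV. \<Sum>c\<in>UNIV. \<Sum>d\<in>UNIV. \<Sum>a\<in>UNIV. ?cm (T a b c d))" for T
      unfolding S_def
      by (rule trans[OF sum.swap], rule sum.cong[OF refl], rule trans[OF sum.swap],
          rule sum.cong[OF refl], rule sum.swap)
    then show ?thesis by (simp add: A1_def U)
  qed
  have S2: "S (A2 P T) = S (A2 Q T)" for T
  proof -
    have "S T = (\<Sum>a\<in>UNIV. \<Sum>c\<in>UNIV. \<Sum>d\<in>UNIV. \<Sum>b\<in>UNIV. ?cm (T a b c d))" for T
      unfolding S_def
      by (rule sum.cong[OF refl], rule trans[OF sum.swap], rule sum.cong[OF refl], rule sum.swap)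
    then show ?thesis by (simp add: A2_def V)
  qed
  have S3: "S (A3 P T) = S (A3 Q T)" for T
  proof -
    have "S T = (\<Sum>a\<in>UNIV. \<Sum>b\<in>UNIV. \<Sum>d\<in>UNIV. \<Sum>c\<in>UNIV. ?cm (T a b c d))" for T
      unfolding S_def by (rule sum.cong[OF refl], rule sum.cong[OF refl], rule sum.swap)
    then show ?thesis by (simp add: A3_def U)
  qed
  have S4: "S (A4 P T) = S (A4 Q T)" for T
    by (simp add: S_def A4_def V)
  have swc: "(\<Sum>a\<in>UNIV. x a * (\<Sum>b\<in>UNIV. y b * f a b)) = (\<Sum>b\<in>UNIV. y b * (\<Sum>a\<in>UNIV. x a * f a b))"
    for f :: "'m \<Rightarrow> 'm \<Rightarrow> complex" and x y
    by (simp add: sum_distrib_left, subst sum.swap) (simp add: mult_ac)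
  have comm: "A1 R (A2 R' T) = A2 R' (A1 R T)" "A1 R (A3 R' T) = A3 R' (A1 R T)"
    "A1 R (A4 R' T) = A4 R' (A1 R T)" "A2 R (A3 R' T) = A3 R' (A2 R T)"
    "A2 R (A4 R' T) = A4 R' (A2 R T)" "A3 R (A4 R' T) = A4 R' (A3 R T)" for R R' T
    unfolding A1_def A2_def A3_def A4_def by (intro ext swc)+
  have frame: "frame_norm R T = sqrt (4 * S (A1 R (A2 R (A3 R (A4 R T)))))" for R
    unfolding frame_norm_def frame_components_def S_def A1_def A2_def A3_def A4_def
    by (simp add: sum_distrib_left mult.assoc)
  have "S (A1 P (A2 P (A3 P (A4 P T)))) = S (A1 Q (A2 P (A3 P (A4 P T))))"
    by (rule S1)
  also have "\<dots> = S (A2 P (A1 Q (A3 P (A4 P T))))" by (simp only: comm(1))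
  also have "\<dots> = S (A2 Q (A1 Q (A3 P (A4 P T))))" by (rule S2)
  also have "\<dots> = S (A3 P (A2 Q (A1 Q (A4 P T))))" by (simp only: comm(2,4))
  also have "\<dots> = S (A3 Q (A2 Q (A1 Q (A4 P T))))" by (rule S3)
  also have "\<dots> = S (A4 P (A3 Q (A2 Q (A1 Q T))))" by (simp only: comm(3,5,6))
  also have "\<dots> = S (A4 Q (A3 Q (A2 Q (A1 Q T))))" by (rule S4)
  also have "A4 Q (A3 Q (A2 Q (A1 Q T))) = A1 Q (A2 Q (A3 Q (A4 Q T)))" by (simp only: comm)
  finally show ?thesis by (simp add: frame)
qed

section \<open>Complex projective space with the Fubini--Study metric\<close>

text \<open>Homogeneous coordinates are indexed by \<open>'m option\<close>, so the projective space has complex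
  dimension \<open>CARD('m)\<close>; its points are the lines through the origin.\<close>

definition cline :: "complex^'n::finite \<Rightarrow> (complex^'n) set" where
  "cline w = range (\<lambda>c. c *s w)"

definition cproj_space :: "(complex^('m::finite option)) set set" where
  "cproj_space = cline ` (- {0})"

text \<open>The quotient topology with respect to \<open>cline\<close> on the nonzero vectors.\<close>

definition cproj_topology :: "(complex^('m::finite option)) set topology" where
  "cproj_topology = topology (\<lambda>U. U \<subseteq> cproj_space \<and> open {w. w \<noteq> 0 \<and> cline w \<in> U})"

text \<open>The affine chart \<open>w \<mapsto> w / w_i\<close> on the lines with \<open>w_i \<noteq> 0\<close>.  The map \<open>affine_index i\<close> is a
  bijection from \<open>'m\<close> onto the indices different from \<open>i\<close>.\<close>

definition affine_index :: "'m option \<Rightarrow> 'm \<Rightarrow> 'm option" where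
  "affine_index i \<alpha> = (if Some \<alpha> = i then None else Some \<alpha>)"

lemma bij_betw_affine_index: "bij_betw (affine_index i) UNIV (- {i})"
proof -
  have "j \<in> range (affine_index i)" if "j \<noteq> i" for j
  proof (cases j)
    case None
    with that obtain k where "i = Some k" by (cases i) auto
    with None have "j = affine_index i k" by (simp add: affine_index_def)
    then show ?thesis by blast
  next
    case (Some k)
    with that have "j = affine_index i k" by (simp add: affine_index_def)
    then show ?thesis by blast
  qed
  then show ?thesis
    unfolding bij_betw_def inj_on_def by (auto simp: affine_index_def split: if_splits)
qed

definition affine_chart :: "'m option \<Rightarrow> ((complex^('m::finite option)) set, 'm) chart" where
  "affine_chart i =
     ({L \<in> cproj_space. \<exists>w\<in>L. w $ i \<noteq> 0},
      \<lambda>L. \<chi> \<alpha>. (THE w. w \<in> L \<and> w $ i = 1) $ affine_index i \<alpha>)"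

definition cproj_atlas :: "((complex^('m::finite option)) set, 'm) chart set" where
  "cproj_atlas = range affine_chart"

text \<open>In every affine chart the Fubini--Study metric has the Kaehler potential
  $\log(1+|z|^2)$.  Its overall normalisation is immaterial for homotheties.\<close>

definition fubini_study :: "((complex^('m::finite option)) set, 'm) metric" where
  "fubini_study c z =
     (\<chi> \<alpha> \<beta>. dz \<alpha> (dzbar \<beta> (\<lambda>w. complex_of_real (ln (1 + (norm w)\<^sup>2)))) z)"

lemma istopology_cproj:
  "istopology (\<lambda>U. U \<subseteq> cproj_space \<and> open {w :: complex^('m::finite option). w \<noteq> 0 \<and> cline w \<in> U})"
  unfolding istopology_def
proof (intro conjI allI impI)
  fix U V :: "(complex^('m option)) set set"
  assume "U \<subseteq> cproj_space \<and> open {w. w \<noteq> 0 \<and> cline w \<in> U}"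
    and "V \<subseteq> cproj_space \<and> open {w. w \<noteq> 0 \<and> cline w \<in> V}"
  moreover have "{w. w \<noteq> 0 \<and> cline w \<in> U \<inter> V}
      = {w. w \<noteq> 0 \<and> cline w \<in> U} \<inter> {w. w \<noteq> 0 \<and> cline w \<in> V}" by auto
  ultimately show "U \<inter> V \<subseteq> cproj_space" "open {w. w \<noteq> 0 \<and> cline w \<in> U \<inter> V}" by auto
next
  fix \<K> :: "(complex^('m option)) set set set"
  assume *: "\<forall>K\<in>\<K>. K \<subseteq> cproj_space \<and> open {w. w \<noteq> 0 \<and> cline w \<in> K}"
  then show "\<Union>\<K> \<subseteq> cproj_space" by auto
  have "{w. w \<noteq> 0 \<and> cline w \<in> \<Union>\<K>} = (\<Union>K\<in>\<K>. {w. w \<noteq> 0 \<and> cline w \<in> K})" by auto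
  then show "open {w. w \<noteq> 0 \<and> cline w \<in> \<Union>\<K>}" using * by auto
qed

lemma openin_cproj_topology:
  "openin cproj_topology U \<longleftrightarrow>
     U \<subseteq> cproj_space \<and> open {w :: complex^('m::finite option). w \<noteq> 0 \<and> cline w \<in> U}"
  unfolding cproj_topology_def by (simp add: topology_inverse'[OF istopology_cproj])

lemma topspace_cproj_topology:
  "topspace (cproj_topology :: (complex^('m::finite option)) set topology) = cproj_space"
proof -
  have "{w :: complex^('m::finite option). w \<noteq> 0 \<and> cline w \<in> cproj_space} = - {0}"
    by (auto simp: cproj_space_def)
  then have "openin cproj_topology (cproj_space :: (complex^('m option)) set set)"
    by (simp add: openin_cproj_topology open_Compl)
  then show ?thesis
    by (auto simp: topspace_def openin_cproj_topology)
qed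

lemma affine_chart_cline:
  fixes w :: "complex^('m::finite option)"
  assumes "w $ i \<noteq> 0"
  shows "cline w \<in> dom_of (affine_chart i)"
    and "coord (affine_chart i) (cline w) $ \<alpha> = w $ affine_index i \<alpha> / w $ i"
proof -
  have "w \<in> cline w"
    unfolding cline_def by (rule range_eqI[where x = 1]) (simp add: vec_eq_iff)
  moreover have "w \<noteq> 0"
    using assms by (metis zero_index)
  ultimately have "cline w \<in> cproj_space" "\<exists>v\<in>cline w. v $ i \<noteq> 0"
    using assms unfolding cproj_space_def by (blast, blast)
  then show "cline w \<in> dom_of (affine_chart i)"
    by (simp add: affine_chart_def)
  have "(THE v. v \<in> cline w \<and> v $ i = 1) = inverse (w $ i) *s w"
    proof (rule the_equality)
    show "inverse (w $ i) *s w \<in> cline w \<and> (inverse (w $ i) *s w) $ i = 1"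
      using assms unfolding cline_def by (intro conjI range_eqI[OF refl]) simp
    show "v = inverse (w $ i) *s w" if "v \<in> cline w \<and> v $ i = 1" for v
    proof -
      from that obtain c where c: "v = c *s w" unfolding cline_def by blast
      with that have "c * w $ i = 1" by simp
      then have "c = inverse (w $ i)" using assms by (simp add: field_simps)
      with c show ?thesis by simp
    qed
  qed
  then show "coord (affine_chart i) (cline w) $ \<alpha> = w $ affine_index i \<alpha> / w $ i"
    by (simp add: affine_chart_def divide_inverse mult.commute)
qed

section \<open>Homotheties\<close>

definition biholomorphically_homothetic ::
  "'a topology \<Rightarrow> ('a, 'm::finite) chart set \<Rightarrow> ('a, 'm) metric \<Rightarrow>
   'b topology \<Rightarrow> ('b, 'n::finite) chart set \<Rightarrow> ('b, 'n) metric \<Rightarrow> bool" where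
  "biholomorphically_homothetic X A g Y B h \<longleftrightarrow>
     (\<exists>F. biholomorphic_map X A Y B F \<and>
        (\<exists>k::real. k > 0 \<and> (\<forall>c\<in>A. \<forall>d\<in>B. \<forall>z\<in>local_rep_dom c d F. \<forall>\<alpha> \<beta>.
           pullback_form (local_rep c d F) (h d) z $ \<alpha> $ \<beta> = complex_of_real k * g c z $ \<alpha> $ \<beta>)))"

end

theory Submission
  imports Defs "HOL-Complex_Analysis.Complex_Analysis"
begin

text \<open>In normal coordinates the Laplacian of $|B|^2$ is bounded below by a multiple of $R |B|^2$ minus a
cubic contraction of $B$. Reading $B$ as a trace-free Hermitian operator on $V \otimes V$ and on
$V \otimes \bar V$, the cubic term is at most a sharp constant times $|B|^3$, so the pinching and the
maximum principle force $B = 0$: the curvature is $-\kappa(g g + g g)$ with a constant $\kappa > 0$. The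
prolonged equation for sections of the local dual tautological line bundle is then integrable, and
$m + 1$ independent solutions give local holomorphic maps \<open>f\<close> into $\mathbb{C}^{m+1}$ with
$\partial\bar\partial \log |f|^2 = \kappa g$. By Calabi's rigidity two such maps differ by a unitary matrix
and a scalar function, so their local inverses continue analytically, by compactness in steps of
uniform size, to a homogeneous map \<open>F\<close> from $\mathbb{C}^{m+1} - 0$ onto \<open>M\<close>. If $F(w) = F(w')$, then $w'$ is
proportional to $V w$ for a unitary \<open>V\<close> with $F \circ V = F$; as \<open>F\<close> is injective on lines near an
eigenvector of \<open>V\<close>, the matrix \<open>V\<close> is a scalar, and \<open>F\<close> descends to a bijection from projective space.\<close>

text \<open>The constant in the hypothesis is the one at which a single chain of estimates breaks.
  For a trace-free Hermitian n x n matrix |tr A^3| is at most (n-2)/sqrt(n(n-1)) |A|^3; here n =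
  m^2, and three cubic contractions occur. Put N = |B|^2/4 and lam = R/m. In the Laplacian of N the
  terms linear in lam are -2 lam N from the Laplacian of B and +4 lam N from the four raised
  indices. So at a maximum lam N is at most 3 (n-2)/sqrt(n(n-1)) N^(3/2), and B nonzero would force
  |B| to be at least 2 sqrt(m^2-1) R/(3(m^2-2)) there. The obstacle in the second half is that M is
  not known to be simply connected, so its lifts need not fit together on M. The map is therefore
  built in the other direction, from the model to M, where convex half-spaces and the connected
  punctured space replace a monodromy argument. What would be a deck transformation appears only as
  a unitary matrix, and the eigenvector step expresses that a projective unitary map always has a
  fixed point and so cannot act freely.\<close>

no_notation fps_nth (infixl "$" 75)
no_notation suminf (binder \<open>\<Sum>\<close> 10)

abbreviation sum_univ :: "('i => 'a::comm_monoid_add) => 'a"  (binder \<open>\<Sum>\<close> 10) where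
  "sum_univ f == sum f UNIV"

abbreviation cor :: "real => complex" where "cor == complex_of_real"

abbreviation fder :: "('a::real_normed_vector => 'b::real_normed_vector) => 'a filter => 'a => 'b" where
  "fder == frechet_derivative"

section \<open>Functions of class $C^k$\<close>

lemma Ck_on_cong:
 assumes "open S" "!!x. x \<in> S ==> f x = g x"
 shows "Ck_on k S f \<longleftrightarrow> Ck_on k S g"
 using assms(2)
proof (induction k arbitrary: f g)
 case 0
 then show ?case by (simp cong: continuous_on_cong)
next
 case (Suc k)
 have D: "(f has_derivative D) (at x) \<longleftrightarrow> (g has_derivative D) (at x)" if "x \<in> S" for x D
  using has_derivative_transform_within_open[of f D x UNIV S g, OF _ assms(1) that Suc.prems]
   has_derivative_transform_within_open[of g D x UNIV S f, OF _ assms(1) that Suc.prems[symmetric]]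
  by blast
 have *: "f differentiable (at x) \<longleftrightarrow> g differentiable (at x)" if "x \<in> S" for x
  using D[OF that] by (simp add: differentiable_def)
 have **: "fder f (at x) = fder g (at x)" if "x \<in> S" for x
  using D[OF that] by (simp add: frechet_derivative_def)
 show ?case
  using Suc.IH[of "%x. fder f (at x) v" "%x. fder g (at x) v" for v] * **
  by simp
qed

text \<open>Any explicitly given derivative may take the place of \<open>frechet_derivative\<close>,
  by uniqueness of derivatives at interior points; the closure properties of $C^k$ below all go
  through this rule.\<close>

lemma Ck_on_SucI:
 assumes "open S" "!!x. x \<in> S ==> (f has_derivative f' x) (at x)" "!!v. Ck_on k S (%x. f' x v)"
 shows "Ck_on (Suc k) S f"
proof -
 have "Ck_on k S (%x. fder f (at x) v)" for v
  using assms(3)[of v] Ck_on_cong[OF assms(1), of "%x. f' x v" "%x. fder f (at x) v" k]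
   assms(2) frechet_derivative_at by metis
 then show ?thesis using assms(2) by (auto simp: differentiable_def)
qed

lemma Ck_on_Suc_derivative:
 assumes "Ck_on (Suc k) S f" "x \<in> S"
 shows "(f has_derivative fder f (at x)) (at x)"
 using assms by (simp add: frechet_derivative_works[symmetric])

lemma Ck_on_mono: "T \<subseteq> S ==> Ck_on k S f ==> Ck_on k T f"
 by (induction k arbitrary: f) (auto intro: continuous_on_subset)

lemma Ck_on_SucD: "Ck_on (Suc k) S f ==> Ck_on k S f"
proof (induction k arbitrary: f)
 case 0
 then show ?case
  by (auto intro!: continuous_at_imp_continuous_on differentiable_imp_continuous_within)
qed simp

lemma Ck_on_const: "open S ==> Ck_on k S (%x. c)"
proof (induction k arbitrary: c)
 case (Suc k)
 show ?case by (rule Ck_on_SucI[OF Suc.prems, of _ "%x v. 0"]) (use Suc in auto)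
qed simp

lemma Ck_on_linear:
 assumes "open S" "bounded_linear L" shows "Ck_on k S L"
proof (cases k)
 case 0 then show ?thesis using assms by (simp add: linear_continuous_on)
next
 case (Suc j)
 show ?thesis unfolding Suc
  by (rule Ck_on_SucI[OF assms(1), of _ "%x. L"])
   (use assms in \<open>auto simp: bounded_linear_imp_has_derivative Ck_on_const\<close>)
qed

lemma Ck_on_linear_compose:
 assumes "open S" "bounded_linear L" "Ck_on k S f" shows "Ck_on k S (%x. L (f x))"
 using assms(3)
proof (induction k arbitrary: f)
 case 0 then show ?case using assms by (auto simp: bounded_linear.continuous_on)
next
 case (Suc k)
 show ?case
  by (rule Ck_on_SucI[OF assms(1), of _ "%x v. L (fder f (at x) v)"])
   (use Suc in \<open>auto intro!: bounded_linear.has_derivative[OF assms(2)] simp: frechet_derivative_works[symmetric]\<close>)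
qed

lemma Ck_on_add:
 assumes "open S" shows "Ck_on k S f ==> Ck_on k S g ==> Ck_on k S (%x. f x + g x)"
proof (induction k arbitrary: f g)
 case 0 then show ?case by (auto intro: continuous_on_add)
next
 case (Suc k)
 show ?case
  by (rule Ck_on_SucI[OF assms, of _ "%x v. fder f (at x) v + fder g (at x) v"])
   (use Suc in \<open>auto intro!: has_derivative_add simp: frechet_derivative_works[symmetric]\<close>)
qed

lemma Ck_on_bilinear:
 assumes "open S" "bounded_bilinear bb"
 shows "Ck_on k S f ==> Ck_on k S g ==> Ck_on k S (%x. bb (f x) (g x))"
proof (induction k arbitrary: f g)
 case 0 then show ?case using assms by (auto simp: bounded_bilinear.continuous_on)
next
 case (Suc k)
 show ?case
 proof (rule Ck_on_SucI[OF assms(1), of _ "%x v. bb (f x) (fder g (at x) v)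
    + bb (fder f (at x) v) (g x)"])
  show "Ck_on k S (%x. bb (f x) (fder g (at x) v) + bb (fder f (at x) v) (g x))" for v
   using Suc.prems Ck_on_SucD[OF Suc.prems(1)] Ck_on_SucD[OF Suc.prems(2)]
   by (intro Ck_on_add assms(1) Suc.IH) auto
 qed (use Suc.prems in \<open>auto intro!: bounded_bilinear.FDERIV[OF assms(2)] simp: frechet_derivative_works[symmetric]\<close>)
qed

lemma Ck_on_mult:
 fixes f g :: "'a::real_normed_vector => 'b::real_normed_algebra"
 assumes "open S" "Ck_on k S f" "Ck_on k S g" shows "Ck_on k S (%x. f x * g x)"
 by (rule Ck_on_bilinear[OF assms(1) bounded_bilinear_mult assms(2,3)])

lemma Ck_on_sum:
 assumes "open S" "!!i. i \<in> I ==> Ck_on k S (f i)" shows "Ck_on k S (%x. \<Sum>i\<in>I. f i x)"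
 using assms(2) by (induction I rule: infinite_finite_induct) (auto intro!: Ck_on_add Ck_on_const assms(1))

lemma Ck_on_inverse:
 fixes f :: "'a::real_normed_vector => 'b::real_normed_field"
 assumes "open S" "!!x. x \<in> S ==> f x ~= 0"
 shows "Ck_on k S f ==> Ck_on k S (%x. inverse (f x))"
proof (induction k)
 case 0 then show ?case using assms by (auto intro: continuous_on_inverse)
next
 case (Suc k)
 have "Ck_on k S (%x. (-1) * (inverse (f x) * fder f (at x) v * inverse (f x)))" for v
  using Suc Ck_on_SucD[OF Suc.prems] by (intro Ck_on_mult Ck_on_const assms(1)) auto
 then show ?case
  by (intro Ck_on_SucI[OF assms(1), of _ "%x v. - (inverse (f x) * fder f (at x) v * inverse (f x))"])
   (use assms(2) Ck_on_Suc_derivative[OF Suc.prems] in \<open>auto intro: has_derivative_inverse\<close>)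
qed

text \<open>The induction hypothesis speaks of one fixed direction at a time, but the chain rule
  evaluates the derivative of \<open>f\<close> in a direction that varies with \<open>x\<close>.
  Expanding that direction in \<open>Basis\<close> gives a finite sum of products of functions
  already under control; hence the Euclidean intermediate space.\<close>

lemma Ck_on_compose:
 fixes f :: "'b::euclidean_space => 'c::real_normed_vector"
 assumes "open S" "open T" "g ` S \<subseteq> T"
 shows "Ck_on k S g ==> Ck_on k T f ==> Ck_on k S (%x. f (g x))"
proof (induction k arbitrary: f)
 case 0 then show ?case using assms by (auto intro: continuous_on_compose2)
next
 case (Suc k)
 have 1: "((%x. f (g x)) has_derivative
    (%v. \<Sum>b\<in>Basis. (fder g (at x) v \<bullet> b) *\<^sub>R fder f (at (g x)) b)) (at x)"
  if "x \<in> S" for x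
 proof -
  have f: "(f has_derivative fder f (at (g x))) (at (g x))"
   using Ck_on_Suc_derivative[OF Suc.prems(2)] that assms(3) by auto
  have *: "fder f (at (g x)) w = (\<Sum>b\<in>Basis. (w \<bullet> b) *\<^sub>R fder f (at (g x)) b)" for w
  proof -
   have "linear (fder f (at (g x)))" using f has_derivative_linear by blast
   then have "fder f (at (g x)) (\<Sum>b\<in>Basis. (w \<bullet> b) *\<^sub>R b)
     = (\<Sum>b\<in>Basis. (w \<bullet> b) *\<^sub>R fder f (at (g x)) b)"
    by (simp add: linear_sum linear_scale)
   then show ?thesis by (simp add: euclidean_representation)
  qed
  have "((%x. f (g x)) has_derivative (%v. fder f (at (g x)) (fder g (at x) v))) (at x)"
   by (rule has_derivative_compose[OF Ck_on_Suc_derivative[OF Suc.prems(1) that] f])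
  moreover have "(%v. fder f (at (g x)) (fder g (at x) v)) =
   (%v. \<Sum>b\<in>Basis. (fder g (at x) v \<bullet> b) *\<^sub>R fder f (at (g x)) b)"
   by (rule ext, rule *)
  ultimately show ?thesis by simp
 qed
 have 2: "Ck_on k S (%x. fder f (at (g x)) b)" for b
  using Suc.IH[OF Ck_on_SucD[OF Suc.prems(1)], of "%y. fder f (at y) b"] Suc.prems(2) by simp
 have 3: "Ck_on k S (%x. fder g (at x) v \<bullet> b)" for v b
  using Suc.prems(1) by (intro Ck_on_linear_compose[OF assms(1) bounded_linear_inner_left]) simp
 show ?case
  by (rule Ck_on_SucI[OF assms(1) 1])
   (auto intro!: Ck_on_sum assms(1) Ck_on_bilinear[OF assms(1) bounded_bilinear_scaleR] 2 3)
qed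

lemma smooth_onI: "(!!k. Ck_on k S f) ==> smooth_on S f" by (simp add: smooth_on_def)
lemma smooth_onD: "smooth_on S f ==> Ck_on k S f" by (simp add: smooth_on_def)

lemma smooth_on_cong: "open S ==> (!!x. x \<in> S ==> f x = g x) ==> smooth_on S f \<longleftrightarrow> smooth_on S g"
 unfolding smooth_on_def using Ck_on_cong by blast

lemma smooth_on_mono: "smooth_on S f ==> T \<subseteq> S ==> smooth_on T f"
 using Ck_on_mono unfolding smooth_on_def by blast

lemma smooth_on_differentiable: "smooth_on S f ==> x \<in> S ==> f differentiable (at x)"
 using smooth_onD[of S f "Suc 0"] by simp

lemma smooth_on_continuous_on: "smooth_on S f ==> continuous_on S f"
 using smooth_onD[of S f 0] by simp

lemma smooth_on_frechet: "smooth_on S f ==> smooth_on S (%x. fder f (at x) v)"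
 using smooth_onD[of S f "Suc k" for k] by (intro smooth_onI) simp

lemma smooth_on_const: "open S ==> smooth_on S (%x. c)"
 by (simp add: smooth_on_def Ck_on_const)

lemma smooth_on_add: "open S ==> smooth_on S f ==> smooth_on S g ==> smooth_on S (%x. f x + g x)"
 by (simp add: smooth_on_def Ck_on_add)

lemma smooth_on_mult:
 fixes f g :: "'a::real_normed_vector => 'b::real_normed_algebra"
 shows "open S ==> smooth_on S f ==> smooth_on S g ==> smooth_on S (%x. f x * g x)"
 by (simp add: smooth_on_def Ck_on_mult)

lemma smooth_on_linear_compose:
 "open S ==> bounded_linear L ==> smooth_on S f ==> smooth_on S (%x. L (f x))"
 by (simp add: smooth_on_def Ck_on_linear_compose)

lemma smooth_on_minus: "open S ==> smooth_on S f ==> smooth_on S (%x. - f x)"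
 by (rule smooth_on_linear_compose[OF _ bounded_linear_minus[OF bounded_linear_ident]])

lemma smooth_on_diff: "open S ==> smooth_on S f ==> smooth_on S g ==> smooth_on S (%x. f x - g x)"
 using smooth_on_add[of S f "%x. - g x"] smooth_on_minus[of S g] by simp

lemma smooth_on_sum:
 "open S ==> (!!i. i \<in> I ==> smooth_on S (f i)) ==> smooth_on S (%x. \<Sum>i\<in>I. f i x)"
 by (simp add: smooth_on_def Ck_on_sum)

lemma smooth_on_prod:
 fixes f :: "'i => 'a::real_normed_vector => 'b::real_normed_field"
 assumes "open S" "!!i. i \<in> I ==> smooth_on S (f i)" shows "smooth_on S (%x. \<Prod>i\<in>I. f i x)"
 using assms(2)
proof (induction I rule: infinite_finite_induct)
 case (insert i I)
 then show ?case by (simp add: smooth_on_mult[OF assms(1)])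
qed (simp_all add: smooth_on_const[OF assms(1)])

lemma smooth_on_inverse:
 fixes f :: "'a::real_normed_vector => 'b::real_normed_field"
 shows "open S ==> smooth_on S f ==> (!!x. x \<in> S ==> f x ~= 0) ==> smooth_on S (%x. inverse (f x))"
 by (simp add: smooth_on_def Ck_on_inverse)

lemma smooth_on_divide:
 fixes f g :: "'a::real_normed_vector => 'b::real_normed_field"
 shows "open S ==> smooth_on S f ==> smooth_on S g ==> (!!x. x \<in> S ==> g x ~= 0)
  ==> smooth_on S (%x. f x / g x)"
 unfolding divide_inverse by (intro smooth_on_mult smooth_on_inverse)

lemma smooth_on_compose:
 fixes f :: "'b::euclidean_space => 'c::real_normed_vector"
 shows "open S ==> open T ==> g ` S \<subseteq> T ==> smooth_on S g ==> smooth_on T f ==> smooth_on S (%x. f (g x))"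
 by (auto simp: smooth_on_def intro: Ck_on_compose)

lemma smooth_on_cnj: "open S ==> smooth_on S f ==> smooth_on S (%x. cnj (f x))"
 by (rule smooth_on_linear_compose[OF _ bounded_linear_cnj])

lemma smooth_on_vec:
 fixes f :: "'a::real_normed_vector => complex^'n::finite"
 assumes "open S" "!!i. smooth_on S (%x. f x $ i)" shows "smooth_on S f"
proof -
 have bl: "bounded_linear (%c. axis i c :: complex^'n)" for i
  by (auto intro!: linear_conv_bounded_linear[THEN iffD1] linearI simp: vec_eq_iff axis_def)
 have "smooth_on S (%x. \<Sum>i. axis i (f x $ i))"
  by (intro smooth_on_sum assms smooth_on_linear_compose[OF _ bl])
 moreover have "(\<Sum>i. axis i (f x $ i)) = f x" for x
  by (simp add: vec_eq_iff axis_def if_distrib cong: if_cong)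
 ultimately show ?thesis by simp
qed

lemmas smooth_on_intros = smooth_on_const smooth_on_add smooth_on_mult smooth_on_minus smooth_on_diff
 smooth_on_sum smooth_on_cnj

lemma smooth_on_Re_part: "open S ==> smooth_on S f ==> smooth_on S (%x. Re (f x))"
 by (rule smooth_on_linear_compose[OF _ bounded_linear_Re])

text \<open>Mixed second derivatives commute, by the mean value theorem for second differences.\<close>

lemma second_difference_mvt:
 fixes f :: "'a::real_normed_vector => real"
 assumes "Ck_on 2 S f" and h: "0 < h"
  and sub: "!!s t. 0 \<le> s ==> s \<le> h ==> 0 \<le> t ==> t \<le> h ==> z + s *\<^sub>R u + t *\<^sub>R v \<in> S"
 obtains s t where "0 \<le> s" "s \<le> h" "0 \<le> t" "t \<le> h"
  "f (z + h *\<^sub>R u + h *\<^sub>R v) - f (z + h *\<^sub>R u) - f (z + h *\<^sub>R v) + f z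
   = h * h * fder (%x. fder f (at x) u) (at (z + s *\<^sub>R u + t *\<^sub>R v)) v"
proof -
 have C2: "Ck_on (Suc (Suc 0)) S f" using assms(1) by (simp add: eval_nat_numeral)
 define D where "D = (%x. fder f (at x) u)"
 have f': "(f has_derivative fder f (at x)) (at x)" if "x \<in> S" for x
  using Ck_on_Suc_derivative[OF C2 that] .
 have D': "(D has_derivative fder D (at x)) (at x)" if "x \<in> S" for x
  using C2 that unfolding D_def by (simp add: frechet_derivative_works[symmetric])
 \<comment> \<open>The first difference in the direction \<open>v\<close>, as a function of the step
   in the direction \<open>u\<close>: the mean value theorem is applied to it in \<open>s\<close>,
   then to \<open>D\<close> in \<open>t\<close>.\<close>
 define ph where "ph = (%s. f (z + s *\<^sub>R u + h *\<^sub>R v) - f (z + s *\<^sub>R u + 0 *\<^sub>R v))"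
 have der1: "((%s. f (z + s *\<^sub>R u + t *\<^sub>R v)) has_real_derivative D (z + s *\<^sub>R u + t *\<^sub>R v)) (at s)"
  if "0 \<le> s" "s \<le> h" "0 \<le> t" "t \<le> h" for s t
 proof -
  have "((%s. f (z + s *\<^sub>R u + t *\<^sub>R v)) has_derivative
    (%r. fder f (at (z + s *\<^sub>R u + t *\<^sub>R v)) (r *\<^sub>R u))) (at s)"
   by (rule has_derivative_compose[where g = f and f = "%s. z + s *\<^sub>R u + t *\<^sub>R v" and f' = "%r. r *\<^sub>R u", OF _ f'[OF sub[OF that]]]) (auto intro!: derivative_eq_intros)
  moreover have "fder f (at (z + s *\<^sub>R u + t *\<^sub>R v)) (r *\<^sub>R u) = D (z + s *\<^sub>R u + t *\<^sub>R v) * r" for r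
   using linear_scale[OF has_derivative_linear[OF f'[OF sub[OF that]]], of r u] by (simp add: D_def mult.commute)
  ultimately show ?thesis by (simp add: has_field_derivative_def)
 qed
 have "\<exists>s. 0 < s & s < h & ph h - ph 0 = (h - 0) * (D (z + s *\<^sub>R u + h *\<^sub>R v) - D (z + s *\<^sub>R u + 0 *\<^sub>R v))"
  unfolding ph_def using h by (intro MVT2 DERIV_diff der1) auto
 then obtain s where s: "0 < s" "s < h"
  "ph h - ph 0 = h * (D (z + s *\<^sub>R u + h *\<^sub>R v) - D (z + s *\<^sub>R u + 0 *\<^sub>R v))" by auto
 have der2: "((%t. D (z + s *\<^sub>R u + t *\<^sub>R v)) has_real_derivative
   fder D (at (z + s *\<^sub>R u + t *\<^sub>R v)) v) (at t)" if "0 \<le> t" "t \<le> h" for t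
 proof -
  have S: "z + s *\<^sub>R u + t *\<^sub>R v \<in> S" using sub that s by auto
  have "((%t. D (z + s *\<^sub>R u + t *\<^sub>R v)) has_derivative
    (%r. fder D (at (z + s *\<^sub>R u + t *\<^sub>R v)) (r *\<^sub>R v))) (at t)"
   by (rule has_derivative_compose[where g = D and f = "%t. z + s *\<^sub>R u + t *\<^sub>R v" and f' = "%r. r *\<^sub>R v", OF _ D'[OF S]]) (auto intro!: derivative_eq_intros)
  moreover have "fder D (at (z + s *\<^sub>R u + t *\<^sub>R v)) (r *\<^sub>R v)
    = fder D (at (z + s *\<^sub>R u + t *\<^sub>R v)) v * r" for r
   using linear_scale[OF has_derivative_linear[OF D'[OF S]], of r v] by (simp add: mult.commute)
  ultimately show ?thesis by (simp add: has_field_derivative_def)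
 qed
 have "\<exists>t. 0 < t & t < h & D (z + s *\<^sub>R u + h *\<^sub>R v) - D (z + s *\<^sub>R u + 0 *\<^sub>R v)
   = (h - 0) * fder D (at (z + s *\<^sub>R u + t *\<^sub>R v)) v"
  using h by (intro MVT2 der2) auto
 then obtain t where t: "0 < t" "t < h" "D (z + s *\<^sub>R u + h *\<^sub>R v) - D (z + s *\<^sub>R u + 0 *\<^sub>R v)
   = h * fder D (at (z + s *\<^sub>R u + t *\<^sub>R v)) v" by auto
 show ?thesis
  by (rule that[of s t]) (use s t in \<open>auto simp: ph_def D_def algebra_simps\<close>)
qed

text \<open>One second difference, read in the two possible orders, is a multiple of both mixed
  derivatives at nearby points. By continuity these values cannot differ by the full gap between
  \<open>P z\<close> and \<open>Q z\<close>.\<close>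

lemma frechet_derivative_commute_real:
 fixes f :: "'a::real_normed_vector => real"
 assumes "open S" "Ck_on 2 S f" "z \<in> S"
 shows "fder (%x. fder f (at x) u) (at z) v
    = fder (%x. fder f (at x) v) (at z) u"
proof (rule ccontr)
 define P where "P = (%x. fder (%x. fder f (at x) u) (at x) v)"
 define Q where "Q = (%x. fder (%x. fder f (at x) v) (at x) u)"
 assume "\<not> ?thesis"
 then have ne: "P z ~= Q z" by (simp add: P_def Q_def)
 define e where "e = \<bar>P z - Q z\<bar> / 2"
 have e: "e > 0" using ne by (simp add: e_def)
 have cont: "isCont P z" "isCont Q z"
  using assms by (auto simp: P_def Q_def eval_nat_numeral continuous_on_eq_continuous_at)
 obtain d where d: "d > 0" "!!x. dist x z < d ==> x \<in> S & \<bar>P x - P z\<bar> < e & \<bar>Q x - Q z\<bar> < e"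
 proof -
  have "\<forall>\<^sub>F x in nhds z. x \<in> S" using assms by (simp add: eventually_nhds_in_open)
  moreover have "\<forall>\<^sub>F x in nhds z. dist (P x) (P z) < e" "\<forall>\<^sub>F x in nhds z. dist (Q x) (Q z) < e"
   using cont e unfolding isCont_def tendsto_at_iff_tendsto_nhds by (auto intro: tendstoD)
  ultimately have "\<forall>\<^sub>F x in nhds z. x \<in> S & \<bar>P x - P z\<bar> < e & \<bar>Q x - Q z\<bar> < e"
   by eventually_elim (auto simp: dist_real_def)
  then show ?thesis using that unfolding eventually_nhds_metric by blast
 qed
 \<comment> \<open>Small enough that the parallelogram with sides \<open>h *\<^sub>R u\<close> and
   \<open>h *\<^sub>R v\<close> at \<open>z\<close> stays in the ball of radius \<open>d\<close>;
   the summand 1 covers the case of zero directions.\<close>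
 define h where "h = d / (2 * (norm u + norm v + 1))"
 have pos: "norm u + norm v + 1 > 0" by (simp add: add_nonneg_pos)
 have h: "h > 0" using d pos by (simp add: h_def)
 have near: "dist (z + s *\<^sub>R a + t *\<^sub>R b) z < d"
  if "0 \<le> s" "s \<le> h" "0 \<le> t" "t \<le> h" "norm a + norm b = norm u + norm v" for s t a b
 proof -
  have "norm (s *\<^sub>R a + t *\<^sub>R b) \<le> s * norm a + t * norm b"
   using that norm_triangle_ineq[of "s *\<^sub>R a" "t *\<^sub>R b"] by simp
  also have "... \<le> h * norm a + h * norm b" using that by (intro add_mono mult_right_mono) auto
  also have "... = h * (norm u + norm v)" using that by (metis distrib_left)
  also have "... < d" using d pos by (simp add: h_def field_simps add_nonneg_pos)
  finally show ?thesis by (simp add: dist_norm add.assoc)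
 qed
 obtain s t where st: "0 \<le> s" "s \<le> h" "0 \<le> t" "t \<le> h"
  "f (z + h *\<^sub>R u + h *\<^sub>R v) - f (z + h *\<^sub>R u) - f (z + h *\<^sub>R v) + f z = h * h * P (z + s *\<^sub>R u + t *\<^sub>R v)"
  unfolding P_def using second_difference_mvt[OF assms(2) h, of z u v] d(2) near by metis
 obtain s' t' where st': "0 \<le> s'" "s' \<le> h" "0 \<le> t'" "t' \<le> h"
  "f (z + h *\<^sub>R v + h *\<^sub>R u) - f (z + h *\<^sub>R v) - f (z + h *\<^sub>R u) + f z = h * h * Q (z + s' *\<^sub>R v + t' *\<^sub>R u)"
  unfolding Q_def using second_difference_mvt[OF assms(2) h, of z v u] d(2) near
  by (metis add.commute)
 have c: "z + h *\<^sub>R v + h *\<^sub>R u = z + h *\<^sub>R u + h *\<^sub>R v" by simp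
 have "h * h * P (z + s *\<^sub>R u + t *\<^sub>R v) = h * h * Q (z + s' *\<^sub>R v + t' *\<^sub>R u)"
  using st(5) st'(5) unfolding c by linarith
 then have "P (z + s *\<^sub>R u + t *\<^sub>R v) = Q (z + s' *\<^sub>R v + t' *\<^sub>R u)" using h by simp
 moreover have "\<bar>P (z + s *\<^sub>R u + t *\<^sub>R v) - P z\<bar> < e" using d(2) near st by blast
 moreover have "\<bar>Q (z + s' *\<^sub>R v + t' *\<^sub>R u) - Q z\<bar> < e"
  using d(2) near[of s' t' v u] st' by (simp add: add.commute)
 ultimately show False unfolding e_def by argo
qed

lemma frechet_derivative_linear_compose:
 assumes "bounded_linear L" "f differentiable (at x)"
 shows "fder (%x. L (f x)) (at x) v = L (fder f (at x) v)"
 using frechet_derivative_at[OF bounded_linear.has_derivative[OF assms(1)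
   frechet_derivative_works[THEN iffD1, OF assms(2)]]] by metis

lemma frechet_derivative_commute:
 fixes f :: "'a::real_normed_vector => complex"
 assumes "open S" "Ck_on 2 S f" "z \<in> S"
 shows "fder (%x. fder f (at x) u) (at z) v
    = fder (%x. fder f (at x) v) (at z) u"
proof -
 have *: "L (fder (%x. fder f (at x) u) (at z) v)
   = L (fder (%x. fder f (at x) v) (at z) u)"
  if L: "bounded_linear L" for L :: "complex => real"
 proof -
  have D1: "f differentiable (at x)" if "x \<in> S" for x using assms(2) that by (simp add: eval_nat_numeral)
  have D2: "(%x. fder f (at x) w) differentiable (at x)" if "x \<in> S" for x w
   using assms(2) that by (simp add: eval_nat_numeral)
  have "fder (%x. fder (%x. L (f x)) (at x) w) (at z) w'
   = L (fder (%x. fder f (at x) w) (at z) w')" for w w'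
  proof -
   have "((%x. L (fder f (at x) w)) has_derivative
     (%v. L (fder (%x. fder f (at x) w) (at z) v))) (at z)"
    by (rule bounded_linear.has_derivative[OF L]) (use D2[OF assms(3)] frechet_derivative_works in blast)
   then have "((%x. fder (%x. L (f x)) (at x) w) has_derivative
     (%v. L (fder (%x. fder f (at x) w) (at z) v))) (at z)"
    by (rule has_derivative_transform_within_open[OF _ assms(1,3)])
     (simp add: frechet_derivative_linear_compose[OF L D1])
   then show ?thesis by (metis frechet_derivative_at)
  qed
  then show ?thesis
   using frechet_derivative_commute_real[OF assms(1) Ck_on_linear_compose[OF assms(1) L assms(2)] assms(3), of u v]
   by simp
 qed
 show ?thesis
  using *[OF bounded_linear_Re] *[OF bounded_linear_Im] by (simp add: complex_eq_iff)
qed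

section \<open>Wirtinger calculus\<close>

lemma vec_axis_decomp:
 "(\<Sum>al. Re (v $ al) *\<^sub>R axis al 1 + Im (v $ al) *\<^sub>R axis al \<i>) = (v :: complex^'m::finite)"
proof -
 have "(\<Sum>al. Re (v $ al) *\<^sub>R axis al 1 + Im (v $ al) *\<^sub>R axis al \<i> :: complex^'m) $ j = v $ j" for j
 proof -
  have "(Re (v $ al) *\<^sub>R axis al 1 + Im (v $ al) *\<^sub>R axis al \<i> :: complex^'m) $ j
    = (if al = j then v $ j else 0)" for al
   by (auto simp: axis_def complex_eq_iff)
  then show ?thesis by (simp add: sum_component)
 qed
 then show ?thesis by (simp add: vec_eq_iff)
qed

lemma linear_wirtinger:
 fixes D :: "complex^'m::finite => complex"
 assumes "linear D"
 shows "D v = (\<Sum>al. (D (axis al 1) - \<i> * D (axis al \<i>)) / 2 * v $ al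
            + (D (axis al 1) + \<i> * D (axis al \<i>)) / 2 * cnj (v $ al))"
proof -
 have "D v = (\<Sum>al. Re (v $ al) *\<^sub>R D (axis al 1) + Im (v $ al) *\<^sub>R D (axis al \<i>))"
  using linear_sum[OF assms, of "%al. Re (v $ al) *\<^sub>R axis al 1 + Im (v $ al) *\<^sub>R axis al \<i>" UNIV]
  unfolding vec_axis_decomp by (simp add: linear_add[OF assms] linear_scale[OF assms])
 also have "... = (\<Sum>al. (D (axis al 1) - \<i> * D (axis al \<i>)) / 2 * v $ al
            + (D (axis al 1) + \<i> * D (axis al \<i>)) / 2 * cnj (v $ al))"
 proof (rule sum.cong[OF refl])
  fix al
  show "Re (v $ al) *\<^sub>R D (axis al 1) + Im (v $ al) *\<^sub>R D (axis al \<i>)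
    = (D (axis al 1) - \<i> * D (axis al \<i>)) / 2 * v $ al + (D (axis al 1) + \<i> * D (axis al \<i>)) / 2 * cnj (v $ al)"
   by (simp add: complex_eq_iff field_simps)
 qed
 finally show ?thesis .
qed

lemma dz_at:
 assumes "(f has_derivative D) (at z)"
 shows "dz al f z = (D (axis al 1) - \<i> * D (axis al \<i>)) / 2"
  "dzbar al f z = (D (axis al 1) + \<i> * D (axis al \<i>)) / 2"
 unfolding dz_def dzbar_def frechet_derivative_at[OF assms, symmetric] by auto

lemma has_derivative_wirtinger:
 fixes f :: "complex^'m::finite => complex"
 assumes "f differentiable (at z)"
 shows "(f has_derivative (%v. \<Sum>al. dz al f z * v $ al + dzbar al f z * cnj (v $ al))) (at z)"
proof -
 from assms obtain D where D: "(f has_derivative D) (at z)" by (auto simp: differentiable_def)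
 have "D = (%v. \<Sum>al. dz al f z * v $ al + dzbar al f z * cnj (v $ al))"
  unfolding dz_at[OF D] by (rule ext) (rule linear_wirtinger[OF has_derivative_linear[OF D]])
 with D show ?thesis by simp
qed

lemma dz_eqI:
 fixes f :: "complex^'m::finite => complex"
 assumes "(f has_derivative (%v. \<Sum>al. p al * v $ al + q al * cnj (v $ al))) (at z)"
 shows "dz al f z = p al" "dzbar al f z = q al"
proof -
 have 1: "(\<Sum>bt. p bt * axis al c $ bt + q bt * cnj (axis al c $ bt)) = p al * c + q al * cnj c" for c
 proof -
  have "(\<Sum>bt. p bt * axis al c $ bt + q bt * cnj (axis al c $ bt))
   = (\<Sum>bt. if bt = al then p al * c + q al * cnj c else 0)"
   by (intro sum.cong) (auto simp: axis_def)
  then show ?thesis by simp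
 qed
 show "dz al f z = p al" "dzbar al f z = q al"
  unfolding dz_at[OF assms] 1 by (simp_all add: algebra_simps)
qed

lemma dz_cong:
 assumes "open S" "z \<in> S" "!!x. x \<in> S ==> f x = g x"
 shows "dz al f z = dz al g z" "dzbar al f z = dzbar al g z"
proof -
 have "(f has_derivative D) (at z) \<longleftrightarrow> (g has_derivative D) (at z)" for D
  using has_derivative_transform_within_open[of f D z UNIV S g, OF _ assms]
   has_derivative_transform_within_open[of g D z UNIV S f, OF _ assms(1,2) assms(3)[symmetric]]
  by blast
 then have "fder f (at z) = fder g (at z)"
  by (simp add: frechet_derivative_def)
 then show "dz al f z = dz al g z" "dzbar al f z = dzbar al g z"
  by (simp_all add: dz_def dzbar_def)
qed

lemma dz_const [simp]: "dz al (%w. c) z = 0" "dzbar al (%w. c) z = 0"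
 by (simp_all add: dz_at[OF has_derivative_const])

lemma dz_add:
 assumes "f differentiable (at z)" "g differentiable (at z)"
 shows "dz al (%w. f w + g w) z = dz al f z + dz al g z"
  "dzbar al (%w. f w + g w) z = dzbar al f z + dzbar al g z"
proof -
 from assms obtain D E where D: "(f has_derivative D) (at z)" and E: "(g has_derivative E) (at z)"
  by (auto simp: differentiable_def)
 show "dz al (%w. f w + g w) z = dz al f z + dz al g z"
  "dzbar al (%w. f w + g w) z = dzbar al f z + dzbar al g z"
  unfolding dz_at[OF has_derivative_add[OF D E]] dz_at[OF D] dz_at[OF E] by (simp_all add: field_simps)
qed

lemma dz_mult:
 assumes "f differentiable (at z)" "g differentiable (at z)"
 shows "dz al (%w. f w * g w) z = dz al f z * g z + f z * dz al g z"
  "dzbar al (%w. f w * g w) z = dzbar al f z * g z + f z * dzbar al g z"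
proof -
 from assms obtain D E where D: "(f has_derivative D) (at z)" and E: "(g has_derivative E) (at z)"
  by (auto simp: differentiable_def)
 show "dz al (%w. f w * g w) z = dz al f z * g z + f z * dz al g z"
  "dzbar al (%w. f w * g w) z = dzbar al f z * g z + f z * dzbar al g z"
  unfolding dz_at[OF has_derivative_mult[OF D E]] dz_at[OF D] dz_at[OF E] by (simp_all add: field_simps)
qed

lemma dz_cmult:
 assumes "f differentiable (at z)"
 shows "dz al (%w. c * f w) z = c * dz al f z" "dzbar al (%w. c * f w) z = c * dzbar al f z"
 using dz_mult[of "%w. c" z f al] assms by simp_all

lemma dz_minus:
 assumes "f differentiable (at z)"
 shows "dz al (%w. - f w) z = - dz al f z" "dzbar al (%w. - f w) z = - dzbar al f z"
 using dz_cmult[OF assms, of al "-1"] by simp_all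

lemma dz_diff:
 assumes "f differentiable (at z)" "g differentiable (at z)"
 shows "dz al (%w. f w - g w) z = dz al f z - dz al g z"
  "dzbar al (%w. f w - g w) z = dzbar al f z - dzbar al g z"
 using dz_add[of f z "%w. - g w" al] dz_minus[OF assms(2), of al] assms by auto

lemma dz_sum:
 assumes "!!i. i \<in> I ==> f i differentiable (at z)"
 shows "dz al (%w. \<Sum>i\<in>I. f i w) z = (\<Sum>i\<in>I. dz al (f i) z)"
  "dzbar al (%w. \<Sum>i\<in>I. f i w) z = (\<Sum>i\<in>I. dzbar al (f i) z)"
proof -
 have D: "((%w. \<Sum>i\<in>I. f i w) has_derivative (%v. \<Sum>i\<in>I. fder (f i) (at z) v)) (at z)"
  using assms by (intro has_derivative_sum) (simp add: frechet_derivative_works)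
 show "dz al (%w. \<Sum>i\<in>I. f i w) z = (\<Sum>i\<in>I. dz al (f i) z)"
  "dzbar al (%w. \<Sum>i\<in>I. f i w) z = (\<Sum>i\<in>I. dzbar al (f i) z)"
  by (subst dz_at[OF D], simp add: dz_def dzbar_def sum_distrib_left sum_subtractf sum.distrib
    sum_divide_distrib diff_divide_distrib add_divide_distrib)+
qed

lemma differentiable_cnj: "f differentiable (at z) ==> (%w. cnj (f w)) differentiable (at z)"
 using bounded_linear.has_derivative[OF bounded_linear_cnj] by (auto simp: differentiable_def)

lemma dz_cnj:
 assumes "f differentiable (at z)"
 shows "dz al (%w. cnj (f w)) z = cnj (dzbar al f z)" "dzbar al (%w. cnj (f w)) z = cnj (dz al f z)"
proof -
 from assms obtain D where D: "(f has_derivative D) (at z)" by (auto simp: differentiable_def)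
 show "dz al (%w. cnj (f w)) z = cnj (dzbar al f z)" "dzbar al (%w. cnj (f w)) z = cnj (dz al f z)"
  unfolding dz_at[OF bounded_linear.has_derivative[OF bounded_linear_cnj D]] dz_at[OF D] by simp_all
qed

lemma dz_inverse:
 assumes "f differentiable (at z)" "f z ~= 0"
 shows "dz al (%w. inverse (f w)) z = - dz al f z / (f z)\<^sup>2"
  "dzbar al (%w. inverse (f w)) z = - dzbar al f z / (f z)\<^sup>2"
proof -
 from assms obtain D where D: "(f has_derivative D) (at z)" by (auto simp: differentiable_def)
 note I = Deriv.has_derivative_inverse[OF assms(2) D]
 show "dz al (%w. inverse (f w)) z = - dz al f z / (f z)\<^sup>2"
  "dzbar al (%w. inverse (f w)) z = - dzbar al f z / (f z)\<^sup>2"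
  unfolding dz_at[OF I] dz_at[OF D] using assms(2) by (simp_all add: field_simps power2_eq_square)
qed

lemma differentiable_inverse':
 fixes f :: "'a::real_normed_vector => complex"
 shows "f differentiable (at z) ==> f z ~= 0 ==> (%w. inverse (f w)) differentiable (at z)"
 unfolding differentiable_def using Deriv.has_derivative_inverse by blast

lemma dz_coord:
 "dz al (%w. w $ bt) z = (if al = bt then 1 else 0)" "dzbar al (%w. w $ bt) z = 0"
proof -
 have D: "((%w::complex^'a. w $ bt) has_derivative (%v. v $ bt)) (at z)"
  by (rule bounded_linear_imp_has_derivative[OF bounded_linear_vec_nth])
 show "dz al (%w. w $ bt) z = (if al = bt then 1 else 0)" "dzbar al (%w. w $ bt) z = 0"
  unfolding dz_at[OF D] by (auto simp: axis_def)
qed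

lemma differentiable_coord: "(%w::complex^'m::finite. w $ bt) differentiable (at z)"
 using bounded_linear_imp_has_derivative[OF bounded_linear_vec_nth] by (auto simp: differentiable_def)

lemma smooth_on_coord: "open S ==> smooth_on S (%w::complex^'m::finite. w $ bt)"
 using Ck_on_linear[OF _ bounded_linear_vec_nth] by (auto simp: smooth_on_def)

lemma smooth_on_dz:
 assumes "open S" "smooth_on S f" shows "smooth_on S (dz al f)" "smooth_on S (dzbar al f)"
proof -
 have "smooth_on S (%z. 1/2 * (fder f (at z) (axis al 1) - \<i> * fder f (at z) (axis al \<i>)))"
  "smooth_on S (%z. 1/2 * (fder f (at z) (axis al 1) + \<i> * fder f (at z) (axis al \<i>)))"
  by (intro smooth_on_intros assms smooth_on_frechet)+
 then show "smooth_on S (dz al f)" "smooth_on S (dzbar al f)"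
  by (simp_all add: dz_def[abs_def] dzbar_def[abs_def])
qed

lemma smooth_on_dz_differentiable:
 "open S ==> smooth_on S f ==> z \<in> S ==> dz al f differentiable (at z)"
 "open S ==> smooth_on S f ==> z \<in> S ==> dzbar al f differentiable (at z)"
 using smooth_on_dz smooth_on_differentiable by blast+

lemma dz_commute:
 fixes f :: "complex^'m::finite => complex"
 assumes "open S" "smooth_on S f" "z \<in> S"
 shows "dz al (dz bt f) z = dz bt (dz al f) z"
  "dz al (dzbar bt f) z = dzbar bt (dz al f) z"
  "dzbar al (dzbar bt f) z = dzbar bt (dzbar al f) z"
proof -
 define F where "F = (%u v. fder (%x. fder f (at x) u) (at z) v)"
 have comm: "F u v = F v u" for u v
  unfolding F_def by (rule frechet_derivative_commute[OF assms(1) smooth_onD[OF assms(2)] assms(3)])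
 have D: "((%x. fder f (at x) u) has_derivative F u) (at z)" for u
  unfolding F_def frechet_derivative_works[symmetric]
  using smooth_on_differentiable[OF smooth_on_frechet[OF assms(2)] assms(3)] .
 have 1: "(dz bt f has_derivative (%v. (F (axis bt 1) v - \<i> * F (axis bt \<i>) v) / 2)) (at z)" for bt
  unfolding dz_def[abs_def] by (auto intro!: derivative_eq_intros D)
 have 2: "(dzbar bt f has_derivative (%v. (F (axis bt 1) v + \<i> * F (axis bt \<i>) v) / 2)) (at z)" for bt
  unfolding dzbar_def[abs_def] by (auto intro!: derivative_eq_intros D)
 show "dz al (dz bt f) z = dz bt (dz al f) z"
  "dz al (dzbar bt f) z = dzbar bt (dz al f) z"
  "dzbar al (dzbar bt f) z = dzbar bt (dzbar al f) z"
  unfolding dz_at[OF 1] dz_at[OF 2] comm[of "axis bt _"] by (simp_all add: complex_eq_iff field_simps)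
qed

lemma dz_dzbar_cnj:
 fixes f :: "complex^'m::finite => complex"
 assumes "open S" "smooth_on S f" "z \<in> S"
 shows "dz al (dzbar bt (%w. cnj (f w))) z = cnj (dz bt (dzbar al f) z)"
proof -
 have "dz al (dzbar bt (%w. cnj (f w))) z = dz al (%w. cnj (dz bt f w)) z"
  by (rule dz_cong[OF assms(1,3)]) (simp add: dz_cnj smooth_on_differentiable[OF assms(2)])
 also have "... = cnj (dzbar al (dz bt f) z)"
  by (rule dz_cnj) (rule smooth_on_dz_differentiable[OF assms])
 finally show ?thesis by (simp add: dz_commute[OF assms])
qed

section \<open>Holomorphic functions of several variables\<close>

lemma has_derivative_vec:
 fixes f :: "'a::real_normed_vector => complex^'n::finite"
 assumes "!!i. ((%x. f x $ i) has_derivative (%v. D v $ i)) F"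
 shows "(f has_derivative D) F"
proof -
 have bl: "bounded_linear (%c. axis i c :: complex^'n)" for i
  by (auto intro!: linear_conv_bounded_linear[THEN iffD1] linearI simp: vec_eq_iff axis_def)
 have *: "(\<Sum>i. axis i (v $ i)) = v" for v :: "complex^'n"
  by (simp add: vec_eq_iff axis_def if_distrib cong: if_cong)
 have "((%x. \<Sum>i. axis i (f x $ i)) has_derivative (%v. \<Sum>i. axis i (D v $ i))) F"
  by (intro has_derivative_sum bounded_linear.has_derivative[OF bl] assms)
 then show ?thesis by (simp add: *)
qed

text \<open>Scalar holomorphy as real differentiability together with the Cauchy-Riemann equations
  in each variable. Nothing about continuity of derivatives is built in; smoothness on open sets is
  derived from Cauchy's formula.\<close>

definition chol :: "(complex^'m::finite => complex) => (complex^'m) set => bool" where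
 "chol f S \<longleftrightarrow> (\<forall>z\<in>S. f differentiable (at z) & (\<forall>al. dzbar al f z = 0))"

lemma cholD: "chol f S ==> z \<in> S ==> f differentiable (at z)" "chol f S ==> z \<in> S ==> dzbar al f z = 0"
 by (auto simp: chol_def)

lemma chol_mono: "chol f S ==> T \<subseteq> S ==> chol f T" by (auto simp: chol_def)

lemma chol_cong: "open S ==> (!!x. x \<in> S ==> f x = g x) ==> chol f S ==> chol g S"
 unfolding chol_def using dz_cong(2)[of S _ f g] differentiable_transform_within
 by (metis (no_types, lifting) differentiable_def has_derivative_transform_within_open)

lemma chol_has_derivative:
 assumes "chol f S" "z \<in> S"
 shows "(f has_derivative (%v. \<Sum>al. dz al f z * v $ al)) (at z)"
 using has_derivative_wirtinger[of f z] cholD[OF assms] by simp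

lemma cholI_linear:
 assumes "!!z. z \<in> S ==> \<exists>D. (f has_derivative D) (at z) & (\<forall>v. D (\<i> *s v) = \<i> * D v)"
 shows "chol f S"
 unfolding chol_def
proof (intro ballI conjI allI)
 fix z al assume "z \<in> S"
 then obtain D where D: "(f has_derivative D) (at z)" "!!v. D (\<i> *s v) = \<i> * D v" using assms by blast
 show "f differentiable (at z)" using D by (auto simp: differentiable_def)
 have "(axis al \<i> :: complex^'a) = \<i> *s axis al 1" by (simp add: vec_eq_iff axis_def)
 then show "dzbar al f z = 0" unfolding dz_at[OF D(1)] using D(2)[of "axis al 1"] by simp
qed

lemma cholomorphic_on_iff_chol:
 "cholomorphic_on f S \<longleftrightarrow> (\<forall>i. chol (%z. f z $ i) S)"
proof
 assume L: "cholomorphic_on f S"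
 show "\<forall>i. chol (%z. f z $ i) S"
 proof (intro allI cholI_linear)
  fix i z assume "z \<in> S"
  then obtain D where D: "(f has_derivative D) (at z)" "!!c v. D (c *s v) = c *s D v"
   using L unfolding cholomorphic_on_def by blast
  then show "\<exists>D. ((%z. f z $ i) has_derivative D) (at z) & (\<forall>v. D (\<i> *s v) = \<i> * D v)"
   by (intro exI[of _ "%v. D v $ i"]) (auto intro: bounded_linear.has_derivative[OF bounded_linear_vec_nth])
 qed
next
 assume R: "\<forall>i. chol (%z. f z $ i) S"
 show "cholomorphic_on f S"
  unfolding cholomorphic_on_def
 proof
  fix z assume z: "z \<in> S"
  define D where "D = (%v. \<chi> i. \<Sum>al. dz al (%z. f z $ i) z * v $ al)"
  have "((%z. f z $ i) has_derivative (%v. D v $ i)) (at z)" for i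
   using chol_has_derivative[of "%z. f z $ i" S z] R z by (simp add: D_def)
  then have "(f has_derivative D) (at z)" by (rule has_derivative_vec)
  moreover have "\<forall>c v. D (c *s v) = c *s D v"
   by (simp add: D_def vec_eq_iff sum_distrib_left mult_ac)
  ultimately show "\<exists>D. (f has_derivative D) (at z) & (\<forall>c v. D (c *s v) = c *s D v)" by blast
 qed
qed


lemma chol_const: "chol (%w. c) S"
 by (simp add: chol_def)

lemma chol_coord: "chol (%w. w $ i) S"
 by (simp add: chol_def dz_coord differentiable_coord)

lemma chol_add: "chol f S ==> chol g S ==> chol (%w. f w + g w) S"
 by (simp add: chol_def dz_add)

lemma chol_diff: "chol f S ==> chol g S ==> chol (%w. f w - g w) S"
 by (simp add: chol_def dz_diff)

lemma chol_mult: "chol f S ==> chol g S ==> chol (%w. f w * g w) S"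
 by (simp add: chol_def dz_mult)

lemma chol_sum: "(!!i. i \<in> I ==> chol (f i) S) ==> chol (%w. \<Sum>i\<in>I. f i w) S"
 by (cases "finite I") (auto simp: chol_def dz_sum intro!: differentiable_sum)

lemma chol_inverse: "chol f S ==> (!!z. z \<in> S ==> f z ~= 0) ==> chol (%w. inverse (f w)) S"
 by (simp add: chol_def dz_inverse differentiable_inverse')

lemma chol_divide: "chol f S ==> chol g S ==> (!!z. z \<in> S ==> g z ~= 0) ==> chol (%w. f w / g w) S"
 unfolding divide_inverse by (intro chol_mult chol_inverse)

text \<open>Since the inner map satisfies the Cauchy-Riemann equations at the point, the two types
  of derivatives do not mix. The outer function is only real differentiable, so the rule applies to
  components of metrics and connections as well as to holomorphic functions.\<close>

lemma dz_chain_chol: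
 fixes g :: "complex^'m::finite => complex^'n::finite"
 assumes F: "F differentiable (at (g z))"
  and g: "!!i. (%w. g w $ i) differentiable (at z)" "!!i al. dzbar al (%w. g w $ i) z = 0"
 shows "dz al (%w. F (g w)) z = (\<Sum>mu. dz al (%w. g w $ mu) z * dz mu F (g z))"
  "dzbar al (%w. F (g w)) z = (\<Sum>mu. cnj (dz al (%w. g w $ mu) z) * dzbar mu F (g z))"
  "(%w. F (g w)) differentiable (at z)"
proof -
 define D where "D = (%v. \<chi> i. \<Sum>al. dz al (%w. g w $ i) z * v $ al)"
 have "((%w. g w $ i) has_derivative (%v. D v $ i)) (at z)" for i
  using has_derivative_wirtinger[OF g(1)[of i]] g(2)[of _ i] by (simp add: D_def)
 then have g': "(g has_derivative D) (at z)" by (rule has_derivative_vec)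
 have "((%w. F (g w)) has_derivative (%v. \<Sum>mu. dz mu F (g z) * D v $ mu + dzbar mu F (g z) * cnj (D v $ mu))) (at z)"
  by (rule has_derivative_compose[OF g' has_derivative_wirtinger[OF F]])
 moreover have "(%v. \<Sum>mu. dz mu F (g z) * D v $ mu + dzbar mu F (g z) * cnj (D v $ mu))
  = (%v. \<Sum>al. (\<Sum>mu. dz al (%w. g w $ mu) z * dz mu F (g z)) * v $ al
    + (\<Sum>mu. cnj (dz al (%w. g w $ mu) z) * dzbar mu F (g z)) * cnj (v $ al))"
 proof
  fix v
  have 1: "(\<Sum>mu. dz mu F (g z) * D v $ mu)
    = (\<Sum>al. (\<Sum>mu. dz al (%w. g w $ mu) z * dz mu F (g z)) * v $ al)"
   unfolding D_def vec_lambda_beta sum_distrib_left sum_distrib_right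
   by (subst sum.swap) (simp add: mult_ac)
  have 2: "(\<Sum>mu. dzbar mu F (g z) * cnj (D v $ mu))
    = (\<Sum>al. (\<Sum>mu. cnj (dz al (%w. g w $ mu) z) * dzbar mu F (g z)) * cnj (v $ al))"
   unfolding D_def vec_lambda_beta cnj_sum sum_distrib_left sum_distrib_right
   by (subst sum.swap) (simp add: mult_ac)
  show "(\<Sum>mu. dz mu F (g z) * D v $ mu + dzbar mu F (g z) * cnj (D v $ mu))
   = (\<Sum>al. (\<Sum>mu. dz al (%w. g w $ mu) z * dz mu F (g z)) * v $ al
    + (\<Sum>mu. cnj (dz al (%w. g w $ mu) z) * dzbar mu F (g z)) * cnj (v $ al))"
   by (simp add: sum.distrib 1 2)
 qed
 ultimately have R: "((%w. F (g w)) has_derivative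
   (%v. \<Sum>al. (\<Sum>mu. dz al (%w. g w $ mu) z * dz mu F (g z)) * v $ al
    + (\<Sum>mu. cnj (dz al (%w. g w $ mu) z) * dzbar mu F (g z)) * cnj (v $ al))) (at z)" by simp
 show "dz al (%w. F (g w)) z = (\<Sum>mu. dz al (%w. g w $ mu) z * dz mu F (g z))"
  "dzbar al (%w. F (g w)) z = (\<Sum>mu. cnj (dz al (%w. g w $ mu) z) * dzbar mu F (g z))"
  using dz_eqI[OF R, of al] by auto
 show "(%w. F (g w)) differentiable (at z)" using R by (auto simp: differentiable_def)
qed

lemma chol_compose:
 fixes g :: "complex^'m::finite => complex^'n::finite"
 assumes "!!i. chol (%w. g w $ i) S" "chol F T" "g ` S \<subseteq> T"
 shows "chol (%w. F (g w)) S"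
 unfolding chol_def
proof (intro ballI conjI allI)
 fix z al assume z: "z \<in> S"
 then have gz: "g z \<in> T" using assms by auto
 note * = dz_chain_chol[of F g z, OF cholD(1)[OF assms(2) gz] cholD[OF assms(1) z]]
 show "(%w. F (g w)) differentiable (at z)" by (rule *(3))
 show "dzbar al (%w. F (g w)) z = 0" using *(2)[of al] cholD(2)[OF assms(2) gz] by simp
qed

section \<open>Cauchy's integral formula and the smoothness of holomorphic functions\<close>

lemma leibniz_directional:
 fixes F :: "'a::euclidean_space => real => 'b::euclidean_space"
 assumes U: "open U" "convex U" "z \<in> U"
  and der: "!!x t. x \<in> U ==> t \<in> {0..1} ==> ((%x. F x t) has_derivative F' x t) (at x)"
  and cont: "!!v. continuous_on (U \<times> {0..1}) (%(x, t). F' x t v)"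
  and contF: "!!x. x \<in> U ==> continuous_on {0..1} (F x)"
 shows "((%x. integral {0..1} (F x)) has_derivative (%v. integral {0..1} (%t. F' z t v))) (at z)"
proof -
 define G where "G = (%x t. Blinfun (F' x t))"
 have app: "blinfun_apply (G x t) = F' x t" if "x \<in> U" "t \<in> {0..1}" for x t
  unfolding G_def using der[OF that] by (simp add: bounded_linear_Blinfun_apply has_derivative_bounded_linear)
 \<comment> \<open>In finite dimension continuity in the operator norm can be tested on basis
   vectors, so the hypothesis is needed for one direction at a time only.\<close>
 have contG: "continuous_on (U \<times> {0..1}) (%(x, t). G x t)"
 proof (rule continuous_on_blinfun_componentwise)
  fix i :: 'a
  show "continuous_on (U \<times> {0..1}) (%x. blinfun_apply (case x of (x, t) => G x t) i)"
   using cont[of i] by (rule continuous_on_eq) (auto simp: app)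
 qed
 have "((%x. integral (cbox 0 1) (F x)) has_derivative integral (cbox 0 1) (G z)) (at z within U)"
 proof (rule leibniz_rule)
  show "((%x. F x t) has_derivative blinfun_apply (G x t)) (at x within U)" if "x \<in> U" "t \<in> cbox 0 1" for x t
   using der[of x t] that by (simp add: app has_derivative_at_withinI)
  show "F x integrable_on cbox 0 1" if "x \<in> U" for x
   using contF[OF that] integrable_continuous[of 0 1 "F x"] by simp
 qed (use contG U in auto)
 then have *: "((%x. integral {0..1} (F x)) has_derivative integral {0..1} (G z)) (at z)"
  unfolding at_within_open[OF U(3,1)] cbox_interval .
 have "continuous_on {0..1} (%t. G z t)"
 proof -
  have "continuous_on {0..1} (%t. case (z, t) of (x, t) => G x t)"
   by (rule continuous_on_compose2[OF contG]) (use U(3) in \<open>auto intro!: continuous_intros\<close>)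
  then show ?thesis by simp
 qed
 then have int: "G z integrable_on {0..1}" by (rule integrable_continuous_interval)
 have "blinfun_apply (integral {0..1} (G z)) v = integral {0..1} (%t. F' z t v)" for v
 proof -
  have "integral {0..1} ((%A. blinfun_apply A v) \<circ> G z) = blinfun_apply (integral {0..1} (G z)) v"
   by (rule integral_linear[OF int blinfun.bounded_linear_left])
  moreover have "integral {0..1} ((%A. blinfun_apply A v) \<circ> G z) = integral {0..1} (%t. F' z t v)"
   by (rule Henstock_Kurzweil_Integration.integral_cong) (simp add: app U(3))
  ultimately show ?thesis by simp
 qed
 then have "blinfun_apply (integral {0..1} (G z)) = (%v. integral {0..1} (%t. F' z t v))" by (rule ext)
 with * show ?thesis by simp
qed

lemma norm_axis_complex: "norm (axis al c :: complex^'m::finite) = cmod c"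
 by (simp add: norm_vec_def L2_set_def axis_def if_distrib[of norm] if_distrib[of "%x. x\<^sup>2"] cong: if_cong)

lemma has_derivative_axis: "((%c. z + axis al c :: complex^'m::finite) has_derivative axis al) F"
proof -
 have "bounded_linear (%c. axis al c :: complex^'m)"
  by (auto intro!: linear_conv_bounded_linear[THEN iffD1] linearI simp: vec_eq_iff axis_def)
 then show ?thesis
  by (auto intro!: derivative_eq_intros bounded_linear_imp_has_derivative)
qed

lemma chol_axis_deriv:
 fixes f :: "complex^'m::finite => complex"
 assumes "chol f S" "z + axis al ze \<in> S"
 shows "((%ze. f (z + axis al ze)) has_field_derivative dz al f (z + axis al ze)) (at ze)"
proof -
 have "((%ze. f (z + axis al ze)) has_derivative
   (%h. \<Sum>bt. dz bt f (z + axis al ze) * axis al h $ bt)) (at ze)"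
  by (rule has_derivative_compose[where g = f and f = "%ze. z + axis al ze",
     OF has_derivative_axis chol_has_derivative[OF assms]])
 moreover have "(\<Sum>bt. dz bt f (z + axis al ze) * axis al h $ bt) = dz al f (z + axis al ze) * h" for h
  by (simp add: axis_def if_distrib cong: if_cong)
 ultimately show ?thesis by (simp add: has_field_derivative_def)
qed

text \<open>Cauchy's formula in the single variable with index \<open>al\<close>. Written over the
  fixed interval from 0 to 1 it depends on \<open>z\<close> only through values of \<open>f\<close>,
  and so can be differentiated in all variables under the integral.\<close>

lemma chol_cauchy:
 fixes f :: "complex^'m::finite => complex"
 assumes "chol f S" "rh > 0" and sub: "!!ze. cmod ze \<le> rh ==> z + axis al ze \<in> S"
 shows "dz al f z = integral {0..1} (%t. f (z + axis al (rh * exp (2 * of_real pi * \<i> * of_real t)))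
   / (rh * exp (2 * of_real pi * \<i> * of_real t)))"
proof -
 define h where "h = (%ze. f (z + axis al ze))"
 have der: "(h has_field_derivative dz al f (z + axis al ze)) (at ze)" if "cmod ze \<le> rh" for ze
  unfolding h_def by (rule chol_axis_deriv[OF assms(1) sub[OF that]])
 have cont: "continuous_on (cball 0 rh) h"
  using der by (auto intro!: continuous_at_imp_continuous_on DERIV_isCont)
 have hol: "h holomorphic_on ball 0 rh"
  unfolding holomorphic_on_open[OF open_ball] using der less_imp_le by (metis mem_ball_0)
 have "((%u. h u / (u - 0) ^ Suc 1) has_contour_integral (2 * pi * \<i>) / fact 1 * (deriv ^^ 1) h 0) (circlepath 0 rh)"
  by (rule Cauchy_has_contour_integral_higher_derivative_circlepath[OF cont hol]) (use assms in simp)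
 moreover have "deriv h 0 = dz al f z"
  using DERIV_imp_deriv[OF der[of 0]] assms by (simp add: axis_def zero_vec_def[symmetric])
 ultimately have "((%x. h (circlepath 0 rh x) / (circlepath 0 rh x)^2 * vector_derivative (circlepath 0 rh) (at x within {0..1}))
   has_integral (2 * pi * \<i>) * dz al f z) {0..1}"
  by (simp add: has_contour_integral_def power2_eq_square)
 moreover define e where "e = (%x::real. rh * exp (2 * of_real pi * \<i> * of_real x))"
 have e0: "e x ~= 0" for x using assms by (simp add: e_def)
 have "h (circlepath 0 rh x) / (circlepath 0 rh x)^2 * vector_derivative (circlepath 0 rh) (at x within {0..1})
   = 2 * pi * \<i> * (h (e x) / e x)" if "x \<in> {0..1}" for x
 proof -
  have 1: "circlepath 0 rh x = e x" by (simp add: circlepath e_def)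
  have 2: "vector_derivative (circlepath 0 rh) (at x within {0..1}) = 2 * pi * \<i> * e x"
   using that by (simp add: vector_derivative_circlepath01 e_def)
  show ?thesis unfolding 1 2 using e0[of x] by (simp add: field_simps power2_eq_square)
 qed
 ultimately have "((%x. 2 * pi * \<i> * (h (e x) / e x)) has_integral (2 * pi * \<i>) * dz al f z) {0..1}"
  by (rule has_integral_eq[rotated])
 then have "((%x. (1 / (2 * pi * \<i>)) * (2 * pi * \<i> * (h (e x) / e x))) has_integral
   (1 / (2 * pi * \<i>)) * ((2 * pi * \<i>) * dz al f z)) {0..1}"
  by (rule has_integral_mult_right)
 then have "((%x. h (e x) / e x) has_integral dz al f z) {0..1}" by simp
 then show ?thesis by (simp add: integral_unique h_def e_def)
qed

lemma chol_continuous_on: "chol f S ==> continuous_on S f"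
 by (auto simp: chol_def intro!: continuous_at_imp_continuous_on differentiable_imp_continuous_within)

lemma continuous_on_circle_shift:
 fixes f :: "complex^'m::finite => complex"
 assumes "continuous_on S f" "rh > 0" "!!z ze. z \<in> U ==> cmod ze \<le> rh ==> z + axis al ze \<in> S"
 shows "continuous_on (U \<times> {0..1}) (%(z, t::real). f (z + axis al (rh * exp (2 * of_real pi * \<i> * of_real t)))
   / (rh * exp (2 * of_real pi * \<i> * of_real t)))"
proof -
 have ax: "continuous_on T (%x. axis al (g x) :: complex^'m)" if "continuous_on T g" for T :: "((complex^'m) \<times> real) set" and g
 proof -
  have "continuous_on UNIV (%c. 0 + axis al c :: complex^'m)"
   by (intro continuous_at_imp_continuous_on ballI has_derivative_continuous[OF has_derivative_axis])
  then show ?thesis using continuous_on_compose2[OF _ that, of UNIV "axis al"] by simp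
 qed
 have "continuous_on (U \<times> {0..1}) (%x. f (fst x + axis al (rh * exp (2 * of_real pi * \<i> * of_real (snd x)))))"
  by (rule continuous_on_compose2[OF assms(1)]) (use assms in \<open>auto intro!: continuous_intros ax simp: norm_mult\<close>)
 then have "continuous_on (U \<times> {0..1}) (%x. f (fst x + axis al (rh * exp (2 * of_real pi * \<i> * of_real (snd x))))
   / (rh * exp (2 * of_real pi * \<i> * of_real (snd x))))"
  using assms(2) by (intro continuous_intros) auto
 then show ?thesis by (simp add: case_prod_unfold)
qed

lemma chol_dz_continuous:
 fixes f :: "complex^'m::finite => complex"
 assumes "open S" "chol f S"
 shows "continuous_on S (dz al f)"
 unfolding continuous_on_eq_continuous_at[OF assms(1)]
proof
 fix z0 assume "z0 \<in> S"
 then obtain r where r: "r > 0" "ball z0 (2*r) \<subseteq> S"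
  using assms(1) open_contains_ball by (metis field_sum_of_halves half_gt_zero mult_2)
 have sub: "z + axis al ze \<in> S" if "z \<in> ball z0 r" "cmod ze \<le> r" for z ze
 proof -
  have "dist z0 (z + axis al ze) \<le> dist z0 z + dist z (z + axis al ze)" by (rule dist_triangle)
  also have "... < r + r" using that by (intro add_less_le_mono) (auto simp: dist_norm norm_axis_complex)
  finally show ?thesis using r by auto
 qed
 have "continuous_on (ball z0 r) (%z. integral (cbox 0 1) (%t. f (z + axis al (r * exp (2 * of_real pi * \<i> * of_real t)))
   / (r * exp (2 * of_real pi * \<i> * of_real t))))"
  by (rule integral_continuous_on_param)
   (use continuous_on_circle_shift[OF chol_continuous_on[OF assms(2)] r(1) sub, where U = "ball z0 r"] in simp)
 then have "continuous_on (ball z0 r) (dz al f)"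
  by (rule continuous_on_eq) (simp add: chol_cauchy[OF assms(2) r(1) sub])
 then show "isCont (dz al f) z0" using r by (simp add: continuous_on_eq_continuous_at)
qed

text \<open>Differentiate Cauchy's formula under the integral, which is legitimate because the first
  derivatives are already known to be continuous. The integrand has a complex linear derivative, and
  integration preserves this.\<close>

lemma chol_dz:
 fixes f :: "complex^'m::finite => complex"
 assumes "open S" "chol f S"
 shows "chol (dz al f) S"
proof (rule cholI_linear)
 fix z0 assume "z0 \<in> S"
 then obtain r where r: "r > 0" "ball z0 (2*r) \<subseteq> S"
  using assms(1) open_contains_ball by (metis field_sum_of_halves half_gt_zero mult_2)
 have sub: "z + axis al ze \<in> S" if "z \<in> ball z0 r" "cmod ze \<le> r" for z ze
 proof -
  have "dist z0 (z + axis al ze) \<le> dist z0 z + dist z (z + axis al ze)" by (rule dist_triangle)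
  also have "... < r + r" using that by (intro add_less_le_mono) (auto simp: dist_norm norm_axis_complex)
  finally show ?thesis using r by auto
 qed
 define e where "e = (%t::real. r * exp (2 * of_real pi * \<i> * of_real t))"
 define F' where "F' = (%z t v. \<Sum>bt. dz bt f (z + axis al (e t)) / e t * v $ bt)"
 have cmod_e: "cmod (e t) = r" for t using r by (simp add: e_def norm_mult)
 have "((%z. integral {0..1} (%t. f (z + axis al (e t)) / e t)) has_derivative
   (%v. integral {0..1} (%t. F' z0 t v))) (at z0)"
 proof (rule leibniz_directional)
  show "open (ball z0 r)" "convex (ball z0 r)" "z0 \<in> ball z0 r" using r by auto
  show "((%z. f (z + axis al (e t)) / e t) has_derivative F' z t) (at z)" if "z \<in> ball z0 r" "t \<in> {0..1}" for z t
  proof -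
   have "z + axis al (e t) \<in> S" using sub that cmod_e by simp
   note D = chol_has_derivative[OF assms(2) this]
   have "((%z. f (z + axis al (e t))) has_derivative (%v. \<Sum>bt. dz bt f (z + axis al (e t)) * v $ bt)) (at z)"
    by (rule has_derivative_compose[where g = f and f = "%z. z + axis al (e t)" and f' = "%v. v", OF _ D])
     (auto intro!: derivative_eq_intros)
   then have "((%z. f (z + axis al (e t)) * inverse (e t)) has_derivative
     (%v. (\<Sum>bt. dz bt f (z + axis al (e t)) * v $ bt) * inverse (e t))) (at z)"
    by (rule has_derivative_mult_left)
   then show ?thesis by (simp add: F'_def divide_inverse sum_distrib_right sum_distrib_left mult_ac)
  qed
  show "continuous_on (ball z0 r \<times> {0..1}) (%(x, t). F' x t v)" for v
  proof -
   have "continuous_on (ball z0 r \<times> {0..1}) (%x. dz bt f (fst x + axis al (e (snd x))) / e (snd x))" for bt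
    using continuous_on_circle_shift[OF chol_dz_continuous[OF assms, of bt] r(1) sub, where U = "ball z0 r"]
    by (simp add: e_def case_prod_unfold)
   then show ?thesis unfolding F'_def case_prod_unfold by (intro continuous_on_sum continuous_on_mult continuous_on_const)
  qed
  show "continuous_on {0..1} (%t. f (z + axis al (e t)) / e t)" if "z \<in> ball z0 r" for z
  proof -
   have "continuous_on {0..1} (%t. case (z, t) of (z, t) => f (z + axis al (e t)) / e t)"
    unfolding e_def
    by (rule continuous_on_compose2[OF continuous_on_circle_shift[OF chol_continuous_on[OF assms(2)] r(1) sub,
       where U = "ball z0 r"]])
     (use that in \<open>auto intro!: continuous_intros\<close>)
   then show ?thesis by simp
  qed
 qed
 then have D: "(dz al f has_derivative (%v. integral {0..1} (%t. F' z0 t v))) (at z0)"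
  by (rule has_derivative_transform_within_open[of _ _ _ _ "ball z0 r"])
   (use r in \<open>auto simp: chol_cauchy[OF assms(2) r(1) sub] e_def\<close>)
 have "integral {0..1} (%t. F' z0 t (\<i> *s v)) = \<i> * integral {0..1} (%t. F' z0 t v)" for v
 proof -
  have "F' z0 t (\<i> *s v) = \<i> * F' z0 t v" for t
   by (simp add: F'_def sum_distrib_left mult_ac)
  then show ?thesis by simp
 qed
 with D show "\<exists>D. (dz al f has_derivative D) (at z0) & (\<forall>v. D (\<i> *s v) = \<i> * D v)" by blast
qed

lemma chol_Ck_on:
 assumes "open S" shows "chol f S ==> Ck_on k S f"
proof (induction k arbitrary: f)
 case 0 then show ?case by (simp add: chol_continuous_on)
next
 case (Suc k)
 show ?case
  by (rule Ck_on_SucI[OF assms chol_has_derivative[OF Suc.prems]])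
   (assumption, rule Ck_on_sum[OF assms], rule Ck_on_mult[OF assms Suc.IH[OF chol_dz[OF assms Suc.prems]]
    Ck_on_const[OF assms]])
qed

lemma chol_smooth_on: "open S ==> chol f S ==> smooth_on S f"
 by (simp add: smooth_on_def chol_Ck_on)

section \<open>Local Kaehler metrics\<close>

lemma matrix_inv_mat:
 fixes A :: "complex^'n::finite^'n"
 assumes "invertible A"
 shows "matrix_inv A ** A = mat 1" "A ** matrix_inv A = mat 1"
 using assms unfolding matrix_inv_def invertible_def by (rule someI2_ex; simp)+

lemma matrix_inv_unique:
 fixes A :: "complex^'n::finite^'n"
 assumes "B ** A = mat 1" shows "matrix_inv A = B"
proof -
 have "invertible A" using assms invertible_left_inverse by blast
 then have "B = B ** (A ** matrix_inv A)" by (simp add: matrix_inv_mat(2) matrix_mul_rid)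
 also have "... = matrix_inv A" using assms by (simp add: matrix_mul_assoc matrix_mul_lid)
 finally show ?thesis by simp
qed

text \<open>A kernel vector, conjugated, is a null vector of the Hermitian form; the conjugation is
  due to the convention that the second index is the barred one.\<close>

lemma hermitian_posdef_invertible:
 fixes G :: "complex^'m::finite^'m"
 assumes "hermitian_posdef G"
 shows "invertible G"
 unfolding invertible_left_inverse matrix_left_invertible_ker
proof (intro allI impI)
 fix x assume x: "G *v x = 0"
 have "(\<Sum>al bt. G $ al $ bt * cnj (x $ al) * cnj (cnj (x $ bt)))
   = (\<Sum>al. cnj (x $ al) * (G *v x) $ al)"
  by (simp add: matrix_vector_mult_def sum_distrib_left mult_ac)
 then have "\<not> 0 < Re (\<Sum>al bt. G $ al $ bt * (\<chi> i. cnj (x $ i)) $ al * cnj ((\<chi> i. cnj (x $ i)) $ bt))"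
  using x by simp
 then have "(\<chi> i. cnj (x $ i)) = 0"
  using assms unfolding hermitian_posdef_def by blast
 then show "x = 0" by (simp add: vec_eq_iff)
qed

lemma ginv_right:
 assumes "invertible (h z)"
 shows "(\<Sum>dt. h z $ al $ dt * ginv h ga dt z) = (if al = ga then 1 else 0)"
 using matrix_inv_mat(2)[OF assms] by (simp add: vec_eq_iff matrix_matrix_mult_def mat_def ginv_def)

lemma ginv_left:
 assumes "invertible (h z)"
 shows "(\<Sum>ga. ginv h ga dt z * h z $ ga $ bt) = (if dt = bt then 1 else 0)"
 using matrix_inv_mat(1)[OF assms] by (simp add: vec_eq_iff matrix_matrix_mult_def mat_def ginv_def)

lemma smooth_on_det:
 fixes A :: "'a::real_normed_vector => complex^'n::finite^'n"
 assumes "open S" "!!i j. smooth_on S (%z. A z $ i $ j)"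
 shows "smooth_on S (%z. det (A z))"
 unfolding det_def by (intro smooth_on_sum smooth_on_mult smooth_on_const smooth_on_prod assms)

text \<open>By Cramer's rule the entries of the inverse are quotients of determinants, hence
  rational in the entries of the matrix.\<close>

lemma smooth_on_matrix_inv:
 fixes A :: "'a::real_normed_vector => complex^'n::finite^'n"
 assumes S: "open S" and A: "!!i j. smooth_on S (%z. A z $ i $ j)" and inv: "!!z. z \<in> S ==> invertible (A z)"
 shows "smooth_on S (%z. matrix_inv (A z) $ k $ l)"
proof -
 have eq: "matrix_inv (A z) $ k $ l
   = det (\<chi> i j. if j = k then (if i = l then 1 else 0) else A z $ i $ j) / det (A z)" if "z \<in> S" for z
 proof -
  have "A z *v (\<chi> i. matrix_inv (A z) $ i $ l) = (\<chi> i. if i = l then 1 else 0)"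
   using matrix_inv_mat(2)[OF inv[OF that]]
   by (simp add: vec_eq_iff matrix_matrix_mult_def matrix_vector_mult_def mat_def)
  then have "(\<chi> i. matrix_inv (A z) $ i $ l) = (\<chi> k. det (\<chi> i j. if j = k then (\<chi> i. if i = l then 1 else 0) $ i
    else A z $ i $ j) / det (A z))"
   by (subst (asm) cramer) (use inv[OF that] in \<open>auto simp: invertible_det_nz\<close>)
  then have "(\<chi> i. matrix_inv (A z) $ i $ l) $ k = (\<chi> k. det (\<chi> i j. if j = k then (\<chi> i. if i = l then 1 else 0) $ i
    else A z $ i $ j) / det (A z)) $ k" by simp
  then show ?thesis by (simp cong: if_cong)
 qed
 have "smooth_on S (%z. det (\<chi> i j. if j = k then (if i = l then 1 else 0) else A z $ i $ j) / det (A z))"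
 proof (intro smooth_on_divide smooth_on_det A S)
  show "smooth_on S (%z. (\<chi> i j. if j = k then if i = l then 1 else 0 else A z $ i $ j) $ i $ j)" for i j
   by (cases "j = k") (simp_all add: A smooth_on_const[OF S])
 qed (use inv in \<open>simp add: invertible_det_nz\<close>)
 then show ?thesis
  by (rule smooth_on_cong[OF S, THEN iffD2, rotated]) (rule eq)
qed

definition kmetric :: "(complex^'m::finite) set => 'm local_metric => bool" where
 "kmetric U h \<longleftrightarrow> open U & (\<forall>al bt. smooth_on U (%z. h z $ al $ bt)) &
   (\<forall>z\<in>U. hermitian_posdef (h z)) &
   (\<forall>z\<in>U. \<forall>al bt ga. dz ga (%w. h w $ al $ bt) z = dz al (%w. h w $ ga $ bt) z)"

lemma kmetric_mono: "kmetric U h ==> V \<subseteq> U ==> open V ==> kmetric V h"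
 unfolding kmetric_def using smooth_on_mono by blast

locale km =
 fixes U :: "(complex^'m::finite) set" and h :: "'m local_metric"
 assumes km: "kmetric U h"
begin

lemma open_U: "open U" using km by (simp add: kmetric_def)

lemma h_smooth: "smooth_on U (%z. h z $ al $ bt)" using km by (simp add: kmetric_def)

lemma h_posdef: "z \<in> U ==> hermitian_posdef (h z)" using km by (simp add: kmetric_def)

lemma h_closed: "z \<in> U ==> dz ga (%w. h w $ al $ bt) z = dz al (%w. h w $ ga $ bt) z"
 using km by (simp add: kmetric_def)

lemma h_cnj: "z \<in> U ==> cnj (h z $ al $ bt) = h z $ bt $ al"
proof -
 assume "z \<in> U"
 then have "h z $ bt $ al = cnj (h z $ al $ bt)" using h_posdef unfolding hermitian_posdef_def by blast
 then show ?thesis by simp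
qed

lemma h_inv: "z \<in> U ==> invertible (h z)" using h_posdef hermitian_posdef_invertible by blast

lemma h_diff: "z \<in> U ==> (%z. h z $ al $ bt) differentiable (at z)"
 using h_smooth smooth_on_differentiable by blast

lemma dzbar_h: "z \<in> U ==> dzbar ga (%w. h w $ al $ bt) z = cnj (dz ga (%w. h w $ bt $ al) z)"
 using dz_cong(2)[OF open_U, of z "%w. h w $ al $ bt" "%w. cnj (h w $ bt $ al)" ga]
 by (simp add: h_cnj dz_cnj h_diff)

lemma h_closed_bar: "z \<in> U ==> dzbar ga (%w. h w $ al $ bt) z = dzbar bt (%w. h w $ al $ ga) z"
 by (simp add: dzbar_h h_closed[of z ga])

lemma ginv_smooth: "smooth_on U (ginv h ga dt)"
 using smooth_on_matrix_inv[OF open_U h_smooth h_inv] by (simp add: ginv_def[abs_def])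

lemma ginv_cnj:
 assumes "z \<in> U" shows "cnj (ginv h ga dt z) = ginv h dt ga z"
proof -
 define K where "K = (\<chi> i j. cnj (matrix_inv (h z) $ j $ i))"
 have "(K ** h z) $ i $ j = (mat 1 :: complex^'m^'m) $ i $ j" for i j
 proof -
  have "(K ** h z) $ i $ j = cnj (\<Sum>k. h z $ j $ k * matrix_inv (h z) $ k $ i)"
   by (simp add: matrix_matrix_mult_def K_def h_cnj[OF assms] mult.commute)
  also have "... = cnj ((h z ** matrix_inv (h z)) $ j $ i)" by (simp add: matrix_matrix_mult_def)
  also have "... = (mat 1 :: complex^'m^'m) $ i $ j"
   by (simp add: matrix_inv_mat(2)[OF h_inv[OF assms]] mat_def)
  finally show ?thesis .
 qed
 then have "K ** h z = mat 1" by (simp add: vec_eq_iff)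
 then have "matrix_inv (h z) = K" by (rule matrix_inv_unique)
 then have "ginv h dt ga z = K $ ga $ dt" by (simp add: ginv_def)
 then show ?thesis by (simp add: K_def ginv_def)
qed

lemma christoffel_smooth: "smooth_on U (christoffel h mu ga al)"
 unfolding christoffel_def[abs_def]
 by (intro smooth_on_sum smooth_on_mult open_U ginv_smooth smooth_on_dz h_smooth)

lemma christoffel_sym: "z \<in> U ==> christoffel h mu ga al z = christoffel h mu al ga z"
 by (simp add: christoffel_def h_closed[of z ga])

lemma christoffel_lower:
 assumes "z \<in> U"
 shows "(\<Sum>mu. h z $ mu $ bt * christoffel h mu ga al z) = dz ga (%w. h w $ al $ bt) z"
proof -
 have "(\<Sum>mu. h z $ mu $ bt * christoffel h mu ga al z)
   = (\<Sum>mu nu. (ginv h mu nu z * h z $ mu $ bt) * dz ga (%w. h w $ al $ nu) z)"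
  by (simp add: christoffel_def sum_distrib_left mult_ac)
 also have "... = (\<Sum>nu. (\<Sum>mu. ginv h mu nu z * h z $ mu $ bt) * dz ga (%w. h w $ al $ nu) z)"
  unfolding sum_distrib_right by (rule sum.swap)
 also have "... = (\<Sum>nu. (if nu = bt then dz ga (%w. h w $ al $ nu) z else 0))"
  by (intro sum.cong refl) (simp add: ginv_left[where h = h and z = z, OF h_inv[OF assms]])
 finally show ?thesis by simp
qed

text \<open>Differentiating the lowered identity \<open>christoffel_lower\<close> instead of the
  definition of the Christoffel symbols keeps derivatives of the inverse metric out of the
  formula.\<close>

lemma curv_formula:
 assumes "z \<in> U"
 shows "curv h al bt ga dt z = dzbar dt (dz ga (%w. h w $ al $ bt)) z
  - (\<Sum>mu nu. ginv h mu nu z * dz ga (%w. h w $ al $ nu) z * dzbar dt (%w. h w $ mu $ bt) z)"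
proof -
 note d = h_diff[OF assms] smooth_on_differentiable[OF christoffel_smooth assms]
 have "dzbar dt (dz ga (%w. h w $ al $ bt)) z = dzbar dt (%z. \<Sum>mu. h z $ mu $ bt * christoffel h mu ga al z) z"
  by (rule dz_cong[OF open_U assms]) (simp add: christoffel_lower)
 also have "... = (\<Sum>mu. dzbar dt (%w. h w $ mu $ bt) z * christoffel h mu ga al z) + curv h al bt ga dt z"
  using d by (simp add: dz_sum dz_mult curv_def sum.distrib)
 finally show ?thesis
  by (simp add: christoffel_def sum_distrib_left mult_ac)
qed

lemma curv_smooth: "smooth_on U (curv h al bt ga dt)"
 unfolding curv_def[abs_def]
 by (intro smooth_on_sum smooth_on_mult open_U h_smooth smooth_on_dz christoffel_smooth)

lemma curv_sym_unbarred: "z \<in> U ==> curv h al bt ga dt z = curv h ga bt al dt z"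
proof -
 assume z: "z \<in> U"
 have "dzbar dt (christoffel h mu ga al) z = dzbar dt (christoffel h mu al ga) z" for mu
  by (rule dz_cong[OF open_U z]) (rule christoffel_sym)
 then show ?thesis unfolding curv_def by simp
qed

lemma curv_cnj:
 assumes z: "z \<in> U" shows "cnj (curv h al bt ga dt z) = curv h bt al dt ga z"
proof -
 have 1: "cnj (dzbar dt (dz ga (%w. h w $ al $ bt)) z) = dzbar ga (dz dt (%w. h w $ bt $ al)) z"
 proof -
  have "cnj (dzbar dt (dz ga (%w. h w $ al $ bt)) z) = dz dt (%w. cnj (dz ga (%w. h w $ al $ bt) w)) z"
   by (simp add: dz_cnj smooth_on_dz_differentiable[OF open_U h_smooth z])
  also have "... = dz dt (dzbar ga (%w. h w $ bt $ al)) z"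
   by (rule dz_cong[OF open_U z]) (simp add: dzbar_h)
  finally show ?thesis unfolding dz_commute(2)[OF open_U h_smooth z] .
 qed
 show ?thesis
  unfolding curv_formula[OF z] complex_cnj_diff 1
  by (subst sum.swap) (simp add: ginv_cnj[OF z] dzbar_h[OF z] mult_ac)
qed

lemma curv_sym_barred: "z \<in> U ==> curv h al bt ga dt z = curv h al dt ga bt z"
 using curv_cnj[of z bt al dt ga] curv_cnj[of z dt al bt ga] curv_sym_unbarred[of z bt al dt ga] by simp

lemma ricci_smooth: "smooth_on U (ricci h al bt)"
 unfolding ricci_def[abs_def]
 by (intro smooth_on_minus smooth_on_sum smooth_on_mult open_U ginv_smooth curv_smooth)

end

section \<open>Change of frame\<close>

definition adj :: "complex^'n::finite^'m::finite => complex^'m^'n" where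
 "adj A = (\<chi> i j. cnj (A $ j $ i))"

lemma adj_mult: "adj (A ** B) = adj B ** adj A"
 by (simp add: adj_def vec_eq_iff matrix_matrix_mult_def mult.commute)

lemma adj_adj [simp]: "adj (adj A) = A"
 by (simp add: adj_def vec_eq_iff)

lemma adj_mat_1 [simp]: "adj (mat 1 :: complex^'n::finite^'n) = mat 1"
 by (auto simp: adj_def vec_eq_iff mat_def)

text \<open>The two-index building block: \<open>frame_components\<close> is this congruence applied
  to both pairs of indices, so that its functoriality reduces to associativity of matrix
  products.\<close>

definition fc2 :: "complex^'n::finite^'m::finite => ('n => 'n => complex) => 'm => 'm => complex" where
 "fc2 P T a b = (\<Sum>al bt. P $ a $ al * cnj (P $ b $ bt) * T al bt)"

lemma fc2_matrix: "fc2 P T a b = (P ** (\<chi> al bt. T al bt) ** adj P) $ a $ b"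
proof -
 have "(P ** (\<chi> al bt. T al bt) ** adj P) $ a $ b = (\<Sum>bt al. P $ a $ al * cnj (P $ b $ bt) * T al bt)"
  by (simp add: matrix_matrix_mult_def adj_def sum_distrib_right sum_distrib_left mult_ac)
 then show ?thesis unfolding fc2_def by (subst sum.swap) simp
qed

lemma fc2_compose: "fc2 P (fc2 Q T) a b = fc2 (P ** Q) T a b"
proof -
 have "(\<chi> al bt. fc2 Q T al bt) = Q ** (\<chi> al bt. T al bt) ** adj Q"
  by (simp add: fc2_matrix vec_eq_iff)
 then show ?thesis
  unfolding fc2_matrix[of P] fc2_matrix[of "P ** Q"] by (simp add: adj_mult matrix_mul_assoc)
qed

lemma sum_swap22:
 "(\<Sum>a\<in>A. \<Sum>b\<in>B. \<Sum>c\<in>C. \<Sum>d\<in>D. f a b c d) = (\<Sum>c\<in>C. \<Sum>d\<in>D. \<Sum>a\<in>A. \<Sum>b\<in>B. f a b c d)"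
proof -
 have "(\<Sum>a\<in>A. \<Sum>b\<in>B. \<Sum>c\<in>C. \<Sum>d\<in>D. f a b c d) = (\<Sum>a\<in>A. \<Sum>c\<in>C. \<Sum>b\<in>B. \<Sum>d\<in>D. f a b c d)"
  by (intro sum.cong refl sum.swap)
 also have "... = (\<Sum>c\<in>C. \<Sum>a\<in>A. \<Sum>b\<in>B. \<Sum>d\<in>D. f a b c d)"
  by (rule sum.swap)
 also have "... = (\<Sum>c\<in>C. \<Sum>a\<in>A. \<Sum>d\<in>D. \<Sum>b\<in>B. f a b c d)"
  by (intro sum.cong refl sum.swap)
 also have "... = (\<Sum>c\<in>C. \<Sum>d\<in>D. \<Sum>a\<in>A. \<Sum>b\<in>B. f a b c d)"
  by (intro sum.cong refl sum.swap)
 finally show ?thesis .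
qed

lemma fc2_sum: "fc2 P (%al bt. \<Sum>i\<in>I. F i al bt) a b = (\<Sum>i\<in>I. fc2 P (F i) a b)"
proof -
 have "fc2 P (%al bt. \<Sum>i\<in>I. F i al bt) a b
  = (\<Sum>al bt. \<Sum>i\<in>I. P $ a $ al * cnj (P $ b $ bt) * F i al bt)"
  by (simp add: fc2_def sum_distrib_left)
 also have "... = (\<Sum>al. \<Sum>i\<in>I. \<Sum>bt. P $ a $ al * cnj (P $ b $ bt) * F i al bt)"
  by (intro sum.cong refl sum.swap)
 also have "... = (\<Sum>i\<in>I. fc2 P (F i) a b)"
  unfolding fc2_def by (rule sum.swap)
 finally show ?thesis .
qed

lemma fc2_cmult: "fc2 P (%al bt. c * T al bt) a b = c * fc2 P T a b"
 by (simp add: fc2_def sum_distrib_left mult_ac)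

lemma fc2_add: "fc2 P (%al bt. S al bt + T al bt) a b = fc2 P S a b + fc2 P T a b"
 by (simp add: fc2_def distrib_left sum.distrib)

lemma fc2_swap: "fc2 P (%al bt. fc2 Q (%mu nu. X al bt mu nu) c d) a b = fc2 Q (%mu nu. fc2 P (%al bt. X al bt mu nu) a b) c d"
proof -
 have "fc2 P (%al bt. fc2 Q (%mu nu. X al bt mu nu) c d) a b = (\<Sum>al bt mu nu. P $ a $ al * cnj (P $ b $ bt) * (Q $ c $ mu * cnj (Q $ d $ nu)) * X al bt mu nu)"
  by (simp add: fc2_def sum_distrib_left mult_ac)
 also have "... = (\<Sum>mu nu al bt. P $ a $ al * cnj (P $ b $ bt) * (Q $ c $ mu * cnj (Q $ d $ nu)) * X al bt mu nu)"
  by (rule sum_swap22)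
 also have "... = fc2 Q (%mu nu. fc2 P (%al bt. X al bt mu nu) a b) c d"
  by (simp add: fc2_def sum_distrib_left mult_ac)
 finally show ?thesis .
qed

lemma frame_components_fc2:
 "frame_components P T a b c d = fc2 P (%al bt. fc2 P (T al bt) c d) a b"
 by (simp add: frame_components_def fc2_def sum_distrib_left mult_ac)

lemma frame_components_compose:
 "frame_components P (frame_components Q T) a b c d = frame_components (P ** Q) T a b c d"
proof -
 have "frame_components P (frame_components Q T) a b c d
  = fc2 P (%al bt. fc2 P (%ga dt. fc2 Q (%mu nu. fc2 Q (T mu nu) ga dt) al bt) c d) a b"
  by (simp add: frame_components_fc2[abs_def])
 also have "... = fc2 P (fc2 Q (%mu nu. fc2 P (fc2 Q (T mu nu)) c d)) a b"
  by (simp add: fc2_swap[of P Q])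
 also have "... = fc2 (P ** Q) (%mu nu. fc2 (P ** Q) (T mu nu) c d) a b"
  by (simp add: fc2_compose)
 finally show ?thesis by (simp add: frame_components_fc2)
qed

lemma frame_components_add:
 "frame_components P (%al bt ga dt. S al bt ga dt + T al bt ga dt) a b c d
  = frame_components P S a b c d + frame_components P T a b c d"
 by (simp add: frame_components_fc2 fc2_add)

lemma frame_components_cmult:
 "frame_components P (%al bt ga dt. k * T al bt ga dt) a b c d = k * frame_components P T a b c d"
 by (simp add: frame_components_fc2 fc2_cmult)

lemma frame_components_prod:
 "frame_components P (%al bt ga dt. S al bt * T ga dt) a b c d = fc2 P S a b * fc2 P T c d"
proof -
 have "fc2 P (%al bt. S al bt * fc2 P T c d) a b = fc2 P S a b * fc2 P T c d"
  using fc2_cmult[of P "fc2 P T c d" S a b] by (simp add: mult.commute)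
 then show ?thesis by (simp add: frame_components_fc2 fc2_cmult)
qed

lemma frame_components_exchange:
 "frame_components P (%al bt ga dt. T ga bt al dt) a b c d = frame_components P T c b a d"
proof -
 have "frame_components P (%al bt ga dt. T ga bt al dt) a b c d
   = (\<Sum>al ga bt dt. P $ a $ al * cnj (P $ b $ bt) * P $ c $ ga * cnj (P $ d $ dt) * T ga bt al dt)"
  unfolding frame_components_def by (intro sum.cong refl sum.swap)
 also have "... = (\<Sum>ga al bt dt. P $ a $ al * cnj (P $ b $ bt) * P $ c $ ga * cnj (P $ d $ dt) * T ga bt al dt)"
  by (rule sum.swap)
 also have "... = (\<Sum>ga bt al dt. P $ a $ al * cnj (P $ b $ bt) * P $ c $ ga * cnj (P $ d $ dt) * T ga bt al dt)"
  by (intro sum.cong refl sum.swap)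
 also have "... = frame_components P T c b a d"
  unfolding frame_components_def by (simp add: mult_ac)
 finally show ?thesis .
qed

lemma unitary_frame_iff:
 "unitary_frame G P \<longleftrightarrow> P ** G ** adj P = mat 1"
proof -
 have "(\<Sum>al bt. P $ a $ al * cnj (P $ b $ bt) * G $ al $ bt) = (P ** G ** adj P) $ a $ b" for a b
  using fc2_matrix[of P "%al bt. G $ al $ bt" a b] by (simp add: fc2_def)
 then show ?thesis by (simp add: unitary_frame_def vec_eq_iff mat_def)
qed

section \<open>Unitary frames\<close>

definition hform :: "complex^'m::finite^'m => complex^'m => complex^'m => complex" where
 "hform G v w = (\<Sum>al bt. v $ al * cnj (w $ bt) * G $ al $ bt)"

lemma hform_scale: "hform G (c *s v) w = c * hform G v w" "hform G v (c *s w) = cnj c * hform G v w"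
 by (simp_all add: hform_def sum_distrib_left mult_ac)

lemma hform_cnj:
 assumes "hermitian_posdef G" shows "hform G w v = cnj (hform G v w)"
proof -
 have *: "G $ bt $ al = cnj (G $ al $ bt)" for al bt using assms unfolding hermitian_posdef_def by blast
 have "cnj (hform G v w) = (\<Sum>al bt. w $ bt * cnj (v $ al) * G $ bt $ al)"
  unfolding hform_def by (simp add: *[symmetric] mult_ac)
 also have "... = hform G w v" unfolding hform_def by (rule sum.swap)
 finally show ?thesis by simp
qed

lemma hform_pos:
 assumes "hermitian_posdef G" "v ~= 0"
 shows "hform G v v = cor (Re (hform G v v))" "Re (hform G v v) > 0"
proof -
 show "hform G v v = cor (Re (hform G v v))"
  using hform_cnj[OF assms(1), of v v] by (simp add: complex_eq_iff)
 have "hform G v v = (\<Sum>al bt. G $ al $ bt * v $ al * cnj (v $ bt))"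
  by (simp add: hform_def mult_ac)
 moreover have "0 < Re (\<Sum>al bt. G $ al $ bt * v $ al * cnj (v $ bt))"
  using assms unfolding hermitian_posdef_def by blast
 ultimately show "Re (hform G v v) > 0" by simp
qed

text \<open>A maximal orthonormal family is a full frame: a missing index leaves a nonzero vector
 orthogonal to the family.\<close>

lemma unitary_frame_exists:
 fixes G :: "complex^'m::finite^'m"
 assumes G: "hermitian_posdef G"
 shows "\<exists>P. unitary_frame G P"
proof -
 define on where "on = (%(A::'m set) (p :: 'm => complex^'m). \<forall>a\<in>A. \<forall>b\<in>A. hform G (p a) (p b) = (if a = b then 1 else 0))"
 have "\<exists>p. on A p" for A
 proof (induction rule: finite_induct[OF finite[of A]])
  case 1
  then show ?case by (simp add: on_def)
 next
  case (2 c A)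
  then obtain p where p: "on A p" by blast
  \<comment> \<open>For \<open>a\<close> in \<open>A\<close> the row \<open>a\<close> represents
    pairing with \<open>p a\<close>; the other rows vanish. As \<open>c\<close> is not in
    \<open>A\<close>, the matrix is singular, and a kernel vector is orthogonal to the
    family.\<close>
  define M :: "complex^'m^'m" where "M = (\<chi> a al. if a \<in> A then (\<Sum>bt. cnj (p a $ bt) * G $ al $ bt) else 0)"
  have "\<not> invertible M"
  proof
   assume "invertible M"
   then have "M ** matrix_inv M = mat 1" by (rule matrix_inv_mat)
   then have "(M ** matrix_inv M) $ c $ c = 1" by (simp add: mat_def)
   moreover have "(M ** matrix_inv M) $ c $ c = 0"
    using 2(2) by (simp add: matrix_matrix_mult_def M_def)
   ultimately show False by simp
  qed
  then obtain v where v: "M *v v = 0" "v ~= 0"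
   unfolding invertible_left_inverse matrix_left_invertible_ker by blast
  have orth: "hform G v (p a) = 0" if "a \<in> A" for a
  proof -
   have "hform G v (p a) = (M *v v) $ a"
    using that by (simp add: hform_def matrix_vector_mult_def M_def sum_distrib_left sum_distrib_right mult_ac)
   then show ?thesis using v by simp
  qed
  define r where "r = Re (hform G v v)"
  have r: "r > 0" "hform G v v = cor r" using hform_pos[OF G v(2)] by (simp_all add: r_def)
  define q where "q = p(c := cor (1 / sqrt r) *s v)"
  have sq: "cor (sqrt r) * cor (sqrt r) = cor r"
   using r(1) by (metis less_imp_le of_real_mult real_sqrt_mult_self abs_of_pos)
  have "on (insert c A) q"
   unfolding on_def
  proof (intro ballI)
   fix a b assume ab: "a \<in> insert c A" "b \<in> insert c A"
   consider "a = c" "b = c" | "a = c" "b \<in> A" "b ~= c" | "a \<in> A" "a ~= c" "b = c" | "a \<in> A" "b \<in> A" "a ~= c" "b ~= c"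
    using ab by blast
   then show "hform G (q a) (q b) = (if a = b then 1 else 0)"
   proof cases
    case 1
    then show ?thesis using r sq by (simp add: q_def hform_scale)
   next
    case 2
    then show ?thesis using orth by (simp add: q_def hform_scale)
   next
    case 3
    then show ?thesis using orth hform_cnj[OF G, of "p a" v] by (simp add: q_def hform_scale)
   next
    case 4
    then show ?thesis using p by (simp add: q_def on_def)
   qed
  qed
  then show ?case by blast
 qed
 then obtain p where "on UNIV p" by blast
 then have "unitary_frame G (\<chi> a. p a)" by (simp add: unitary_frame_def on_def hform_def)
 then show ?thesis by blast
qed

lemma bochner_norm_eq:
 assumes "unitary_frame (h z) P"
 shows "bochner_norm h z = frame_norm P (%al bt ga dt. bochner h al bt ga dt z)"
 unfolding bochner_norm_def
 by (rule frame_norm_unique) (rule someI[of "unitary_frame (h z)", OF assms], rule assms)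

section \<open>Pullback under holomorphic maps\<close>

definition jac :: "(complex^'m::finite => complex^'m) => complex^'m => complex^'m^'m" where
 "jac f z = (\<chi> al mu. dz al (%w. f w $ mu) z)"

lemma pullback_form_fc2: "pullback_form f h z $ al $ bt = fc2 (jac f z) (%mu nu. h (f z) $ mu $ nu) al bt"
 by (simp add: pullback_form_def fc2_def jac_def)

lemma pullback_form_matrix: "pullback_form f h z = jac f z ** h (f z) ** adj (jac f z)"
 by (simp add: vec_eq_iff pullback_form_fc2 fc2_matrix)

lemma pullback_posdef_invertible:
 fixes f :: "complex^'m::finite => complex^'m"
 assumes "hermitian_posdef (pullback_form f h z)"
 shows "invertible (jac f z)"
proof -
 have "invertible (jac f z ** h (f z) ** adj (jac f z))"
  using hermitian_posdef_invertible[OF assms] by (simp add: pullback_form_matrix)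
 then obtain B where "jac f z ** h (f z) ** adj (jac f z) ** B = mat 1"
  using invertible_right_inverse by blast
 then show ?thesis
  unfolding invertible_right_inverse by (intro exI[of _ "h (f z) ** adj (jac f z) ** B"]) (simp add: matrix_mul_assoc)
qed

lemma pullback_posdef:
 fixes f :: "complex^'m::finite => complex^'m"
 assumes "hermitian_posdef (h (f z))" "invertible (jac f z)"
 shows "hermitian_posdef (pullback_form f h z)"
 unfolding hermitian_posdef_def
proof (intro conjI allI impI)
 let ?J = "jac f z" and ?H = "h (f z)"
 have H: "?H $ bt $ al = cnj (?H $ al $ bt)" for al bt using assms(1) unfolding hermitian_posdef_def by blast
 have "adj ?H = ?H" by (simp add: adj_def vec_eq_iff H[symmetric])
 then have "adj (pullback_form f h z) = pullback_form f h z"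
  by (simp add: pullback_form_matrix adj_mult matrix_mul_assoc)
 then have "adj (pullback_form f h z) $ bt $ al = pullback_form f h z $ bt $ al" for al bt by simp
 then show "pullback_form f h z $ bt $ al = cnj (pullback_form f h z $ al $ bt)" for al bt
  by (simp add: adj_def)
 fix v :: "complex^'m" assume v: "v ~= 0"
 define u where "u = v v* ?J"
 have u0: "u ~= 0"
 proof
  assume "u = 0"
  then have "v v* (?J ** matrix_inv ?J) = 0"
   by (simp add: u_def vector_matrix_mul_assoc[symmetric])
  then show False using v matrix_inv_mat(2)[OF assms(2)] by simp
 qed
 have ui: "u $ mu = (\<Sum>al. v $ al * ?J $ al $ mu)" for mu
  by (simp add: u_def vector_matrix_mult_def mult.commute)
 \<comment> \<open>All rows of the auxiliary matrix equal \<open>v\<close>, so every entry of the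
   congruence is the value of the form at \<open>v\<close>, and the choice \<open>undefined\<close>
   of the entry is harmless.\<close>
 have "(\<Sum>al bt. pullback_form f h z $ al $ bt * v $ al * cnj (v $ bt))
   = fc2 (\<chi> (i::'m). v) (%al bt. fc2 ?J (%mu nu. ?H $ mu $ nu) al bt) undefined undefined"
  by (simp add: fc2_def[of "\<chi> i. v"] pullback_form_fc2 mult_ac)
 also have "... = fc2 ((\<chi> (i::'m). v) ** ?J) (%mu nu. ?H $ mu $ nu) undefined undefined"
  by (rule fc2_compose)
 also have "... = hform ?H u u"
  by (simp add: fc2_def hform_def matrix_matrix_mult_def ui)
 finally show "0 < Re (\<Sum>al bt. pullback_form f h z $ al $ bt * v $ al * cnj (v $ bt))"
  using hform_pos(2)[OF assms(1) u0] by simp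
qed

text \<open>Transport of a Kaehler metric along a holomorphic map with invertible Jacobian. It is
  used twice: for transitions between charts, and for normal coordinates.\<close>

locale pb = tgt: km V h for V :: "(complex^'m::finite) set" and h +
 fixes U :: "(complex^'m) set" and f :: "complex^'m => complex^'m"
 assumes U: "open U" and f: "!!i. chol (%w. f w $ i) U" and fU: "!!z. z \<in> U ==> f z \<in> V"
  and Jinv: "!!z. z \<in> U ==> invertible (jac f z)"
begin

abbreviation g :: "complex^'m => complex^'m^'m" where "g \<equiv> pullback_form f h"

abbreviation J :: "'m => 'm => complex^'m => complex" where "J al mu \<equiv> dz al (%w. f w $ mu)"

lemma J_chol: "chol (J al mu) U" by (rule chol_dz[OF U f])

lemma f_smooth: "smooth_on U f" by (rule smooth_on_vec[OF U]) (rule chol_smooth_on[OF U f])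

lemma comp_smooth: "smooth_on V F ==> smooth_on U (%z. F (f z))"
 by (rule smooth_on_compose[OF U tgt.open_U _ f_smooth]) (use fU in auto)

lemma g_eq: "g z $ al $ bt = (\<Sum>nu. cnj (J bt nu z) * (\<Sum>mu. J al mu z * h (f z) $ mu $ nu))"
 unfolding pullback_form_def by (simp add: sum_distrib_left mult_ac) (rule sum.swap)

lemma g_smooth: "smooth_on U (%z. g z $ al $ bt)"
 unfolding g_eq
 by (intro smooth_on_sum smooth_on_mult smooth_on_cnj U chol_smooth_on J_chol comp_smooth tgt.h_smooth)

lemma dz_comp:
 assumes "z \<in> U" "F differentiable (at (f z))"
 shows "dz ga (%w. F (f w)) z = (\<Sum>sg. J ga sg z * dz sg F (f z))"
  "dzbar ga (%w. F (f w)) z = (\<Sum>sg. cnj (J ga sg z) * dzbar sg F (f z))"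
  "(%w. F (f w)) differentiable (at z)"
 by (rule dz_chain_chol[OF assms(2) cholD[OF f assms(1)]])+

text \<open>The derivative of the pulled-back metric without its antiholomorphic Jacobian factor: an
  unbarred derivative passes through that factor.\<close>

definition E :: "'m => 'm => 'm => complex^'m => complex" where
 "E ga al nu z = (\<Sum>mu. dz ga (J al mu) z * h (f z) $ mu $ nu
   + J al mu z * (\<Sum>sg. J ga sg z * dz sg (%w. h w $ mu $ nu) (f z)))"

lemma dz_g:
 assumes "z \<in> U"
 shows "dz ga (%w. g w $ al $ bt) z = (\<Sum>nu. cnj (J bt nu z) * E ga al nu z)"
proof -
 note d = cholD(1)[OF J_chol assms] differentiable_cnj[OF cholD(1)[OF J_chol assms]]
  dz_comp(3)[OF assms tgt.h_diff[OF fU[OF assms]]]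
 have 1: "dz ga (%w. cnj (J bt nu w)) z = 0" for nu
  by (simp add: dz_cnj cholD[OF J_chol assms])
 have "dz ga (%w. g w $ al $ bt) z
   = dz ga (%z. \<Sum>nu. cnj (J bt nu z) * (\<Sum>mu. J al mu z * h (f z) $ mu $ nu)) z"
  by (simp add: g_eq)
 also have "... = (\<Sum>nu. cnj (J bt nu z) * dz ga (%z. \<Sum>mu. J al mu z * h (f z) $ mu $ nu) z)"
  using d by (simp add: dz_sum dz_mult 1)
 also have "... = (\<Sum>nu. cnj (J bt nu z) * E ga al nu z)"
  using d by (simp add: dz_sum dz_mult E_def dz_comp(1)[OF assms tgt.h_diff[OF fU[OF assms]]])
 finally show ?thesis .
qed

text \<open>Closedness of the target metric handles the quadratic Jacobian term, commuting second
  derivatives of \<open>f\<close> the other one; together they give closedness of the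
  pullback.\<close>

lemma E_sym:
 assumes "z \<in> U" shows "E ga al nu z = E al ga nu z"
proof -
 have 1: "dz ga (J al mu) z = dz al (J ga mu) z" for mu
  by (rule dz_commute(1)[OF U chol_smooth_on[OF U f] assms])
 have "(\<Sum>mu sg. J al mu z * (J ga sg z * dz sg (%w. h w $ mu $ nu) (f z)))
   = (\<Sum>sg mu. J ga sg z * (J al mu z * dz mu (%w. h w $ sg $ nu) (f z)))"
  by (subst sum.swap) (simp add: mult_ac tgt.h_closed[OF fU[OF assms], of _ _ nu] cong: sum.cong)
 then show ?thesis by (simp add: E_def sum.distrib sum_distrib_left 1)
qed

lemma kmetric_g: "kmetric U g"
 unfolding kmetric_def
 using U g_smooth pullback_posdef[of h f, OF tgt.h_posdef[OF fU] Jinv] dz_g E_sym by simp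

sublocale src: km U g by (rule km.intro) (rule kmetric_g)

end

lemma frame_components_fc2':
 "frame_components P T a b c d = fc2 P (%ga dt. fc2 P (%al bt. T al bt ga dt) a b) c d"
 unfolding frame_components_fc2 by (rule fc2_swap)

lemma fc2_minus: "fc2 P (%al bt. - T al bt) a b = - fc2 P T a b"
 using fc2_cmult[of P "-1" T a b] by simp

context pb
begin

lemma jac_invD:
 assumes "z \<in> U" "!!bt. (\<Sum>nu. cnj (J bt nu z) * y nu) = 0"
 shows "y nu = 0"
proof -
 let ?K = "\<chi> bt nu. cnj (J bt nu z)"
 have K: "?K = adj (transpose (jac f z))" by (simp add: adj_def transpose_def jac_def vec_eq_iff)
 have "invertible ?K"
 proof -
  have "jac f z ** matrix_inv (jac f z) = mat 1" using matrix_inv_mat(2)[OF Jinv[OF assms(1)]] .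
  then have "adj (transpose (jac f z)) ** adj (transpose (matrix_inv (jac f z))) = mat 1"
   by (metis adj_mat_1 adj_mult matrix_transpose_mul transpose_mat)
  then show ?thesis unfolding K invertible_right_inverse by blast
 qed
 moreover have "?K *v (\<chi> nu. y nu) = 0"
  using assms(2) by (simp add: matrix_vector_mult_def vec_eq_iff)
 ultimately have "(\<chi> nu. y nu) = 0"
  unfolding invertible_left_inverse matrix_left_invertible_ker by blast
 then show ?thesis by (simp add: vec_eq_iff)
qed

lemma h_invD:
 assumes "z \<in> V" "!!nu. (\<Sum>rh. x rh * h z $ rh $ nu) = 0"
 shows "x rh = 0"
proof -
 have "0 = (\<Sum>nu. (\<Sum>rh'. x rh' * h z $ rh' $ nu) * ginv h rh nu z)" using assms(2) by simp
 also have "... = (\<Sum>nu rh'. x rh' * (h z $ rh' $ nu * ginv h rh nu z))"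
  by (simp add: sum_distrib_left sum_distrib_right mult_ac)
 also have "... = (\<Sum>rh'. x rh' * (\<Sum>nu. h z $ rh' $ nu * ginv h rh nu z))"
  unfolding sum_distrib_left by (rule sum.swap)
 also have "... = (\<Sum>rh'. if rh' = rh then x rh' else 0)"
  by (intro sum.cong refl) (simp add: ginv_right[where h = h and z = z, OF tgt.h_inv[OF assms(1)]])
 finally show ?thesis by simp
qed

text \<open>Lowered with \<open>h\<close> and contracted with the conjugate Jacobian, both sides
  become the derivative of the pulled-back metric. Invertibility of the Jacobian and of
  \<open>h\<close> then allows cancellation.\<close>

lemma christoffel_pullback:
 assumes z: "z \<in> U"
 shows "(\<Sum>mu. christoffel g mu ga al z * J mu rh z)
  = dz ga (J al rh) z + (\<Sum>mu sg. J al mu z * J ga sg z * christoffel h rh sg mu (f z))"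
proof -
 define L where "L = (%rh. \<Sum>mu. christoffel g mu ga al z * J mu rh z)"
 define R where "R = (%rh. dz ga (J al rh) z + (\<Sum>mu sg. J al mu z * J ga sg z * christoffel h rh sg mu (f z)))"
 have R: "(\<Sum>rh. R rh * h (f z) $ rh $ nu) = E ga al nu z" for nu
 proof -
  have "(\<Sum>rh. (\<Sum>mu sg. J al mu z * J ga sg z * christoffel h rh sg mu (f z)) * h (f z) $ rh $ nu)
   = (\<Sum>rh mu sg. J al mu z * J ga sg z * (h (f z) $ rh $ nu * christoffel h rh sg mu (f z)))"
   by (simp add: sum_distrib_left sum_distrib_right mult_ac)
  also have "... = (\<Sum>mu rh sg. J al mu z * J ga sg z * (h (f z) $ rh $ nu * christoffel h rh sg mu (f z)))"
   by (rule sum.swap)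
  also have "... = (\<Sum>mu sg. J al mu z * J ga sg z * (\<Sum>rh. h (f z) $ rh $ nu * christoffel h rh sg mu (f z)))"
   unfolding sum_distrib_left by (intro sum.cong refl sum.swap)
  also have "... = (\<Sum>mu sg. J al mu z * J ga sg z * dz sg (%w. h w $ mu $ nu) (f z))"
   by (simp add: tgt.christoffel_lower[OF fU[OF z]])
  finally have *: "(\<Sum>rh. (\<Sum>mu sg. J al mu z * J ga sg z * christoffel h rh sg mu (f z)) * h (f z) $ rh $ nu)
   = (\<Sum>mu sg. J al mu z * J ga sg z * dz sg (%w. h w $ mu $ nu) (f z))" .
  show ?thesis
   unfolding R_def E_def distrib_right sum.distrib * by (simp add: sum_distrib_left mult_ac)
 qed
 have L: "(\<Sum>nu. cnj (J bt nu z) * (\<Sum>rh. L rh * h (f z) $ rh $ nu)) = dz ga (%w. g w $ al $ bt) z" for bt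
 proof -
  have "(\<Sum>rh. L rh * h (f z) $ rh $ nu) = (\<Sum>mu. christoffel g mu ga al z * (\<Sum>rh. J mu rh z * h (f z) $ rh $ nu))" for nu
   unfolding L_def sum_distrib_left sum_distrib_right by (subst sum.swap) (simp add: mult_ac)
  then have "(\<Sum>nu. cnj (J bt nu z) * (\<Sum>rh. L rh * h (f z) $ rh $ nu))
   = (\<Sum>nu mu. christoffel g mu ga al z * (cnj (J bt nu z) * (\<Sum>rh. J mu rh z * h (f z) $ rh $ nu)))"
   by (simp add: sum_distrib_left sum_distrib_right mult_ac)
  also have "... = (\<Sum>mu. christoffel g mu ga al z * g z $ mu $ bt)"
   unfolding g_eq by (subst sum.swap) (simp add: sum_distrib_left[of "christoffel _ _ _ _ _"])
  finally show ?thesis using src.christoffel_lower[OF z, of bt ga al] by (simp add: mult.commute)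
 qed
 have "(\<Sum>rh. (L rh - R rh) * h (f z) $ rh $ nu) = 0" for nu
 proof (rule jac_invD[OF z])
  show "(\<Sum>nu. cnj (J bt nu z) * (\<Sum>rh. (L rh - R rh) * h (f z) $ rh $ nu)) = 0" for bt
   using L[of bt] dz_g[OF z, of ga al bt]
   by (simp add: left_diff_distrib sum_subtractf R right_diff_distrib)
 qed
 then have "L rh - R rh = 0"
  by (rule h_invD[OF fU[OF z]])
 then show ?thesis by (simp add: L_def R_def)
qed

text \<open>A barred derivative of the transformation law of the Christoffel symbols kills its
  inhomogeneous term, which is holomorphic. Tensoriality of the curvature is what remains.\<close>

lemma curv_pullback:
 assumes z: "z \<in> U"
 shows "curv g al bt ga dt z = frame_components (jac f z) (%mu nu sg ta. curv h mu nu sg ta (f z)) al bt ga dt"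
proof -
 note d = cholD(1)[OF J_chol z] smooth_on_differentiable[OF src.christoffel_smooth z]
  dz_comp(3)[OF z smooth_on_differentiable[OF tgt.christoffel_smooth fU[OF z]]]
  cholD(1)[OF chol_dz[OF U J_chol] z]
 have 0: "dzbar dt (J mu rh) z = 0" "dzbar dt (dz ga (J mu rh)) z = 0" for mu rh
  using cholD(2)[OF J_chol z] cholD(2)[OF chol_dz[OF U J_chol] z] by auto
 have D: "(\<Sum>mu. J mu rh z * dzbar dt (christoffel g mu ga al) z)
  = (\<Sum>mu sg. J al mu z * J ga sg z * (\<Sum>ta. cnj (J dt ta z) * dzbar ta (christoffel h rh sg mu) (f z)))" for rh
 proof -
  have "dzbar dt (%z. \<Sum>mu. christoffel g mu ga al z * J mu rh z) z
   = dzbar dt (%z. dz ga (J al rh) z + (\<Sum>mu sg. J al mu z * J ga sg z * christoffel h rh sg mu (f z))) z"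
   by (rule dz_cong[OF U z]) (rule christoffel_pullback)
  then show ?thesis
   using d by (simp add: dz_sum dz_mult dz_add 0 mult.commute
     dz_comp(2)[OF z smooth_on_differentiable[OF tgt.christoffel_smooth fU[OF z]]])
 qed
 have "curv g al bt ga dt z
  = (\<Sum>mu nu rh. cnj (J bt nu z) * h (f z) $ rh $ nu * (J mu rh z * dzbar dt (christoffel g mu ga al) z))"
  by (simp add: curv_def g_eq sum_distrib_left sum_distrib_right mult_ac)
 also have "... = (\<Sum>nu rh. cnj (J bt nu z) * h (f z) $ rh $ nu * (\<Sum>mu. J mu rh z * dzbar dt (christoffel g mu ga al) z))"
  unfolding sum_distrib_left by (subst sum.swap) (intro sum.cong refl sum.swap)
 also have "... = (\<Sum>nu rh mu sg. J al mu z * cnj (J bt nu z) * J ga sg z *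
   (h (f z) $ rh $ nu * (\<Sum>ta. cnj (J dt ta z) * dzbar ta (christoffel h rh sg mu) (f z))))"
  unfolding D by (simp add: sum_distrib_left sum_distrib_right mult_ac)
 also have "... = (\<Sum>mu nu sg rh. J al mu z * cnj (J bt nu z) * J ga sg z *
   (h (f z) $ rh $ nu * (\<Sum>ta. cnj (J dt ta z) * dzbar ta (christoffel h rh sg mu) (f z))))"
 proof -
  have "(\<Sum>nu rh mu sg. X nu rh mu sg)
   = (\<Sum>mu nu sg rh. X nu rh mu sg)" for X :: "'m => 'm => 'm => 'm => complex"
  proof -
   have "(\<Sum>nu rh mu sg. X nu rh mu sg)
    = (\<Sum>mu sg nu rh. X nu rh mu sg)" by (rule sum_swap22)
   also have "... = (\<Sum>mu nu sg rh. X nu rh mu sg)"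
    by (intro sum.cong refl sum.swap)
   finally show ?thesis .
  qed
  then show ?thesis .
 qed
 also have "... = (\<Sum>mu nu sg ta. J al mu z * cnj (J bt nu z) * J ga sg z * cnj (J dt ta z) *
   curv h mu nu sg ta (f z))"
 proof -
  have *: "(\<Sum>rh. J al mu z * cnj (J bt nu z) * J ga sg z *
    (h (f z) $ rh $ nu * (\<Sum>ta. cnj (J dt ta z) * dzbar ta (christoffel h rh sg mu) (f z))))
   = (\<Sum>ta. J al mu z * cnj (J bt nu z) * J ga sg z * cnj (J dt ta z) * curv h mu nu sg ta (f z))" for mu nu sg
  proof -
  have "(\<Sum>rh. J al mu z * cnj (J bt nu z) * J ga sg z *
    (h (f z) $ rh $ nu * (\<Sum>ta. cnj (J dt ta z) * dzbar ta (christoffel h rh sg mu) (f z))))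
   = (\<Sum>rh ta. J al mu z * cnj (J bt nu z) * J ga sg z * cnj (J dt ta z) *
    (h (f z) $ rh $ nu * dzbar ta (christoffel h rh sg mu) (f z)))"
   by (simp add: sum_distrib_left mult_ac)
  also have "... = (\<Sum>ta. J al mu z * cnj (J bt nu z) * J ga sg z * cnj (J dt ta z) * curv h mu nu sg ta (f z))"
   unfolding curv_def sum_distrib_left by (rule sum.swap)
  finally show ?thesis .
  qed
  show ?thesis by (simp only: *)
 qed
 finally show ?thesis by (simp add: frame_components_def jac_def)
qed

text \<open>The inverse metric transforms contragrediently, so in a full contraction the Jacobians
  cancel; this is how traces of pulled-back tensors are computed.\<close>

lemma ginv_pullback:
 assumes z: "z \<in> U"
 shows "(\<Sum>ga dt. ginv g ga dt z * fc2 (jac f z) T ga dt) = (\<Sum>sg ta. ginv h sg ta (f z) * T sg ta)"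
proof -
 let ?J = "jac f z" and ?H = "h (f z)"
 have J: "invertible ?J" by (rule Jinv[OF z])
 have K: "adj (matrix_inv ?J) ** adj ?J = mat 1" "adj ?J ** adj (matrix_inv ?J) = mat 1"
  using matrix_inv_mat[OF J] by (metis adj_mat_1 adj_mult)+
 have "matrix_inv (g z) ** g z = mat 1" by (rule matrix_inv_mat(1)[OF src.h_inv[OF z]])
 then have "adj ?J ** (matrix_inv (g z) ** (?J ** ?H ** adj ?J)) ** adj (matrix_inv ?J) = mat 1"
  by (simp add: pullback_form_matrix K)
 then have "adj ?J ** matrix_inv (g z) ** ?J ** ?H ** (adj ?J ** adj (matrix_inv ?J)) = mat 1"
  by (simp add: matrix_mul_assoc)
 then have "adj ?J ** matrix_inv (g z) ** ?J ** ?H = mat 1" by (simp add: K)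
 then have inv: "matrix_inv ?H = adj ?J ** matrix_inv (g z) ** ?J" by (rule matrix_inv_unique)
 have g: "ginv h sg ta (f z) = (\<Sum>ga dt. ginv g ga dt z * (?J $ ga $ sg * cnj (?J $ dt $ ta)))" for sg ta
  unfolding ginv_def inv by (simp add: matrix_matrix_mult_def adj_def sum_distrib_left sum_distrib_right mult_ac)
 have "(\<Sum>ga dt. ginv g ga dt z * fc2 ?J T ga dt)
  = (\<Sum>ga dt sg ta. ginv g ga dt z * (?J $ ga $ sg * cnj (?J $ dt $ ta)) * T sg ta)"
  by (simp add: fc2_def sum_distrib_left mult_ac)
 also have "... = (\<Sum>sg ta ga dt. ginv g ga dt z * (?J $ ga $ sg * cnj (?J $ dt $ ta)) * T sg ta)"
  by (rule sum_swap22)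
 also have "... = (\<Sum>sg ta. ginv h sg ta (f z) * T sg ta)"
  unfolding g sum_distrib_right ..
 finally show ?thesis .
qed

lemma ricci_pullback:
 assumes z: "z \<in> U"
 shows "ricci g al bt z = fc2 (jac f z) (%mu nu. ricci h mu nu (f z)) al bt"
proof -
 have "ricci g al bt z = - (\<Sum>ga dt. ginv g ga dt z *
   fc2 (jac f z) (%sg ta. fc2 (jac f z) (%mu nu. curv h mu nu sg ta (f z)) al bt) ga dt)"
  unfolding ricci_def curv_pullback[OF z] frame_components_fc2' ..
 also have "... = - (\<Sum>sg ta. ginv h sg ta (f z) * fc2 (jac f z) (%mu nu. curv h mu nu sg ta (f z)) al bt)"
  unfolding ginv_pullback[OF z] ..
 also have "... = fc2 (jac f z) (%mu nu. ricci h mu nu (f z)) al bt"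
  unfolding ricci_def by (simp add: fc2_minus fc2_sum fc2_cmult)
 finally show ?thesis .
qed

lemma cscal_pullback: "z \<in> U ==> cscal g z = cscal h (f z)"
 unfolding cscal_def by (simp add: ricci_pullback ginv_pullback)

lemma bochner_pullback:
 assumes z: "z \<in> U"
 shows "bochner g al bt ga dt z = frame_components (jac f z) (%mu nu sg ta. bochner h mu nu sg ta (f z)) al bt ga dt"
proof -
 let ?J = "jac f z" and ?fc = "frame_components (jac f z)"
 let ?R = "%mu nu. ricci h mu nu (f z)" and ?H = "%mu nu. h (f z) $ mu $ nu"
 define k1 k2 where "k1 = cor (1 / (real CARD('m) + 2))"
  and "k2 = - cor (cscal h (f z) / ((real CARD('m) + 1) * (real CARD('m) + 2)))"
 have B: "bochner h mu nu sg ta (f z) = curv h mu nu sg ta (f z) + (k1 * (?R mu nu * ?H sg ta + (?R sg nu * ?H mu ta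
   + (?H mu nu * ?R sg ta + ?H sg nu * ?R mu ta))) + k2 * (?H mu nu * ?H sg ta + ?H sg nu * ?H mu ta))" for mu nu sg ta
  by (simp add: bochner_def Let_def k1_def k2_def algebra_simps add_divide_distrib)
 have ex: "?fc (%mu nu sg ta. S sg nu * T mu ta) al bt ga dt = fc2 ?J S ga bt * fc2 ?J T al dt" for S T
  using frame_components_exchange[of ?J "%mu nu sg ta. S mu nu * T sg ta"] by (simp add: frame_components_prod)
 show ?thesis
  unfolding B frame_components_add frame_components_cmult frame_components_prod ex
   curv_pullback[OF z, symmetric] ricci_pullback[OF z, symmetric] pullback_form_fc2[symmetric]
  by (simp add: bochner_def Let_def k1_def k2_def cscal_pullback[OF z] algebra_simps add_divide_distrib)
qed

text \<open>A unitary frame of the pullback, multiplied by the Jacobian, is a unitary frame of the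
  target with the same Bochner components; the value of the norm does not depend on the
  frame.\<close>

lemma bochner_norm_pullback:
 assumes z: "z \<in> U"
 shows "bochner_norm g z = bochner_norm h (f z)"
proof -
 obtain P where P: "unitary_frame (g z) P"
  using unitary_frame_exists[OF src.h_posdef[OF z]] by blast
 then have Q: "unitary_frame (h (f z)) (P ** jac f z)"
  unfolding unitary_frame_iff by (simp add: pullback_form_matrix adj_mult matrix_mul_assoc)
 have "frame_components P (%al bt ga dt. bochner g al bt ga dt z)
   = frame_components (P ** jac f z) (%al bt ga dt. bochner h al bt ga dt (f z))"
  unfolding bochner_pullback[OF z] by (intro ext) (rule frame_components_compose)
 then show ?thesis
  unfolding bochner_norm_eq[of g z, OF P] bochner_norm_eq[of h "f z", OF Q] frame_norm_def by simp
qed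

end

section \<open>Normal coordinates\<close>

text \<open>A quadratic holomorphic change of variables suffices: its linear part makes the metric
  the identity, its quadratic part removes the first derivatives.\<close>

lemma normal_coordinates:
 fixes h :: "'m::finite local_metric"
 assumes "kmetric V h" "p \<in> V"
 obtains U f where "pb V h U f" "0 \<in> U" "f 0 = p" "pullback_form f h 0 = mat 1"
  "!!al bt ga. dz ga (%w. pullback_form f h w $ al $ bt) 0 = 0"
proof -
 interpret t: km V h using assms by unfold_locales
 obtain P where P: "unitary_frame (h p) P" using unitary_frame_exists[OF t.h_posdef[OF assms(2)]] by blast
 \<comment> \<open>The Christoffel symbols at \<open>p\<close>, with both lower indices expressed in
   the frame \<open>P\<close>.\<close>
 define C where "C = (%ga al rh. \<Sum>mu sg. P $ al $ mu * P $ ga $ sg * christoffel h rh sg mu p)"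
 have Csym: "C ga al rh = C al ga rh" for ga al rh
  unfolding C_def by (subst sum.swap) (simp add: t.christoffel_sym[OF assms(2), of rh] mult_ac)
 \<comment> \<open>The coefficient -1/2 compensates for the factor 2 that a symmetric quadratic form
   acquires under differentiation: the second derivatives of \<open>f\<close> are then exactly
   \<open>- C\<close>.\<close>
 define f :: "complex^'m => complex^'m" where
  "f = (%w. \<chi> mu. p $ mu + ((\<Sum>a. w $ a * P $ a $ mu) + (-1/2) * (\<Sum>a b. w $ a * (w $ b * C a b mu))))"
 have f_chol: "chol (%w. f w $ mu) S" for mu S
  unfolding f_def vec_lambda_beta by (intro chol_add chol_const chol_sum chol_mult chol_coord)
 have d: "(%w. w $ a) differentiable (at z)" "(%w. w $ a * c) differentiable (at z)"
  "(%w. w $ a * (w $ b * c)) differentiable (at z)" for a b c and z :: "complex^'m"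
  using cholD(1)[OF chol_coord, of z UNIV] cholD(1)[OF chol_mult[OF chol_coord chol_const], of z UNIV]
   cholD(1)[OF chol_mult[OF chol_coord chol_mult[OF chol_coord chol_const]], of z UNIV] by auto
 have dJ: "dz al (%w. f w $ mu) z = P $ al $ mu - (\<Sum>b. z $ b * C al b mu)" for al mu z
 proof -
  have 1: "dz al (%w. \<Sum>a. w $ a * P $ a $ mu) z = P $ al $ mu"
   using d by (simp add: dz_sum dz_mult dz_coord if_distrib if_distribR cong: if_cong)
  have "dz al (%w. \<Sum>a b. w $ a * (w $ b * C a b mu)) z
    = (\<Sum>a b. (if al = a then z $ b * C a b mu else 0) + (if al = b then z $ a * C a b mu else 0))"
   using d by (auto simp: dz_sum dz_mult dz_coord intro!: sum.cong)
  also have "... = (\<Sum>b. z $ b * C al b mu) + (\<Sum>a. z $ a * C a al mu)"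
   unfolding sum.distrib by (subst sum.swap) simp
  also have "... = 2 * (\<Sum>b. z $ b * C al b mu)"
   by (simp add: Csym[of _ al])
  finally have 2: "dz al (%w. \<Sum>a b. w $ a * (w $ b * C a b mu)) z = 2 * (\<Sum>b. z $ b * C al b mu)" .
  have D: "(%w. \<Sum>a. w $ a * P $ a $ mu) differentiable (at z)"
   "(%w. \<Sum>a b. w $ a * (w $ b * C a b mu)) differentiable (at z)"
   by (rule cholD(1)[where S = UNIV], intro chol_sum chol_mult chol_const chol_coord, simp)+
  have D': "(%w. (-1/2) * (\<Sum>a b. w $ a * (w $ b * C a b mu))) differentiable (at z)"
   using D(2) by simp
  show ?thesis
   unfolding f_def vec_lambda_beta
   by (subst dz_add, simp, rule differentiable_add[OF D(1) D'], subst dz_add[OF D(1) D'], subst dz_cmult[OF D(2)])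
    (simp add: 1 2)
 qed
 have J: "jac f z $ al $ mu = P $ al $ mu - (\<Sum>b. z $ b * C al b mu)" for z al mu
  by (simp add: jac_def dJ)
 have ddJ: "dz ga (%z. dz al (%w. f w $ mu) z) z = - C ga al mu" for ga al mu z
 proof -
  have D: "(%z. \<Sum>b. z $ b * C al b mu) differentiable (at z)"
   by (rule cholD(1)[where S = UNIV], intro chol_sum chol_mult chol_const chol_coord) simp
  show ?thesis unfolding dJ
   using d by (subst dz_diff[OF _ D], simp)
    (simp add: dz_sum dz_mult dz_coord if_distrib if_distribR Csym[of ga] cong: if_cong)
 qed
 \<comment> \<open>The polynomial map is defined everywhere; it is restricted to the open set on
   which it lands in \<open>V\<close> and its Jacobian stays invertible.\<close>
 define U where "U = f -` V \<inter> (%z. det (jac f z)) -` (- {0})"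
 have contf: "isCont f z" for z
 proof -
  have "smooth_on UNIV f" by (rule smooth_on_vec[OF open_UNIV]) (rule chol_smooth_on[OF open_UNIV f_chol])
  then show ?thesis using smooth_on_continuous_on continuous_on_eq_continuous_at[OF open_UNIV] by blast
 qed
 have contd: "isCont (%z. det (jac f z)) z" for z
 proof -
  have "smooth_on UNIV (%z. det (jac f z))"
   by (rule smooth_on_det[OF open_UNIV], unfold jac_def vec_lambda_beta)
    (rule chol_smooth_on[OF open_UNIV chol_dz[OF open_UNIV f_chol]])
  then show ?thesis using smooth_on_continuous_on continuous_on_eq_continuous_at[OF open_UNIV] by blast
 qed
 have U: "open U"
  unfolding U_def by (intro open_Int continuous_open_vimage contf contd t.open_U open_Compl closed_singleton)
 have f0: "f 0 = p" by (simp add: f_def vec_eq_iff)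
 have J0: "jac f 0 = P" by (simp add: vec_eq_iff J)
 have P1: "P ** h p ** adj P = mat 1" using P by (simp add: unitary_frame_iff)
 then have "invertible P" unfolding invertible_right_inverse by (metis matrix_mul_assoc)
 then have U0: "0 \<in> U" using assms(2) by (simp add: U_def f0 J0 invertible_det_nz)
 interpret pb V h U f
  by unfold_locales (use U f_chol in \<open>auto simp: U_def invertible_det_nz\<close>)
 have "dz ga (%w. pullback_form f h w $ al $ bt) 0 = 0" for al bt ga
 proof -
  have "E ga al nu 0 = 0" for nu
  proof -
   have "(\<Sum>mu. dz al (%w. f w $ mu) 0 * (\<Sum>sg. dz ga (%w. f w $ sg) 0 * dz sg (%w. h w $ mu $ nu) p))
    = (\<Sum>mu sg rh. h p $ rh $ nu * (P $ al $ mu * P $ ga $ sg * christoffel h rh sg mu p))"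
    by (simp add: dJ t.christoffel_lower[OF assms(2), symmetric] sum_distrib_left mult_ac)
   also have "... = (\<Sum>mu rh sg. h p $ rh $ nu * (P $ al $ mu * P $ ga $ sg * christoffel h rh sg mu p))"
    by (intro sum.cong refl sum.swap)
   also have "... = (\<Sum>rh. h p $ rh $ nu * C ga al rh)"
    unfolding C_def sum_distrib_left by (rule sum.swap)
   finally show ?thesis
    by (simp add: E_def sum.distrib f0 ddJ mult.commute sum_subtractf)
  qed
  then show ?thesis by (simp add: dz_g[OF U0])
 qed
 moreover have "pullback_form f h 0 = mat 1" by (simp add: pullback_form_matrix f0 J0 P1)
 ultimately show ?thesis using that[of U f] pb_axioms U0 f0 by blast
qed

section \<open>Second derivatives and curvature at the centre of normal coordinates\<close>

lemma dz_dzbar_mult: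
 fixes F G :: "complex^'m::finite => complex"
 assumes "open S" "smooth_on S F" "smooth_on S G" "z \<in> S"
 shows "dz e (dzbar f (%w. F w * G w)) z = dz e (dzbar f F) z * G z + dzbar f F z * dz e G z
   + dz e F z * dzbar f G z + F z * dz e (dzbar f G) z"
proof -
 note dF = smooth_on_differentiable[OF assms(2)] smooth_on_dz_differentiable[OF assms(1,2)]
 note dG = smooth_on_differentiable[OF assms(3)] smooth_on_dz_differentiable[OF assms(1,3)]
 have "dz e (dzbar f (%w. F w * G w)) z = dz e (%w. dzbar f F w * G w + F w * dzbar f G w) z"
  by (rule dz_cong[OF assms(1,4)]) (simp add: dz_mult dF dG)
 also have "... = dz e (dzbar f F) z * G z + dzbar f F z * dz e G z + (dz e F z * dzbar f G z + F z * dz e (dzbar f G) z)"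
  using assms(4) by (simp add: dz_add dz_mult dF dG)
 finally show ?thesis by simp
qed

lemma dz_dzbar_sum:
 fixes F :: "'i => complex^'m::finite => complex"
 assumes "open S" "!!i. i \<in> I ==> smooth_on S (F i)" "z \<in> S"
 shows "dz e (dzbar f (%w. \<Sum>i\<in>I. F i w)) z = (\<Sum>i\<in>I. dz e (dzbar f (F i)) z)"
proof -
 have "dz e (dzbar f (%w. \<Sum>i\<in>I. F i w)) z = dz e (%w. \<Sum>i\<in>I. dzbar f (F i) w) z"
  by (rule dz_cong[OF assms(1,3)]) (simp add: dz_sum smooth_on_differentiable[OF assms(2)])
 also have "... = (\<Sum>i\<in>I. dz e (dzbar f (F i)) z)"
  by (rule dz_sum) (rule smooth_on_dz_differentiable[OF assms(1) assms(2) assms(3)])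
 finally show ?thesis .
qed

lemma dz_dzbar_cong:
 assumes "open S" "z \<in> S" "!!x. x \<in> S ==> F x = G x"
 shows "dz e (dzbar f F) z = dz e (dzbar f G) z"
 by (rule dz_cong[OF assms(1,2)]) (rule dz_cong[OF assms(1) _ assms(3)])

text \<open>At the origin the Christoffel symbols vanish. Hence the curvature there is the mixed
  second derivative of the metric, and the inverse metric has no first-order part.\<close>

locale nk = km U h for U :: "(complex^'m::finite) set" and h :: "'m local_metric" +
 assumes U0: "0 \<in> U" and h0: "h 0 = mat 1"
  and dh0: "!!al bt ga. dz ga (%w. h w $ al $ bt) 0 = 0"
begin

abbreviation R :: "'m => 'm => 'm => 'm => complex" where "R a b c d \<equiv> curv h a b c d 0"

lemma h00: "h 0 $ a $ b = (if a = b then 1 else 0)" by (simp add: h0 mat_def)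

lemma dbh0: "dzbar ga (%w. h w $ al $ bt) 0 = 0" by (simp add: dzbar_h U0 dh0)

lemma ginv0: "ginv h a b 0 = (if a = b then 1 else 0)"
proof -
 have "matrix_inv (h 0) = mat 1" by (rule matrix_inv_unique) (simp add: h0)
 then show ?thesis by (auto simp: ginv_def mat_def)
qed

lemma ginv_h: "z \<in> U ==> (\<Sum>ga. ginv h ga dt z * h z $ ga $ bt) = (if dt = bt then 1 else 0)"
 by (rule ginv_left[where h = h and z = z, OF h_inv])

lemma dginv0: "dz e (ginv h a b) 0 = 0" "dzbar e (ginv h a b) 0 = 0"
proof -
 note d = smooth_on_differentiable[OF ginv_smooth U0] h_diff[OF U0]
 have "dz e (%z. \<Sum>ga. ginv h ga b z * h z $ ga $ a) 0 = dz e (%z. if b = a then 1 else 0) 0"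
  "dzbar e (%z. \<Sum>ga. ginv h ga b z * h z $ ga $ a) 0 = dzbar e (%z. if b = a then 1 else 0) 0"
  by (rule dz_cong[OF open_U U0], erule ginv_h)+
 then show "dz e (ginv h a b) 0 = 0" "dzbar e (ginv h a b) 0 = 0"
  using d by (simp_all add: dz_sum dz_mult dh0 dbh0 h00 mult_delta_left mult_delta_right)
qed

lemma curv0: "R a b c d = dzbar d (dz c (%w. h w $ a $ b)) 0"
 by (simp add: curv_formula[OF U0] dh0)

lemma curv0': "dz c (dzbar d (%w. h w $ a $ b)) 0 = R a b c d"
 by (simp add: curv0 dz_commute(2)[OF open_U h_smooth U0])

lemma ddginv0: "dz e (dzbar f (ginv h a b)) 0 = - R b a e f"
proof -
 have "dz e (dzbar f (%z. \<Sum>ga. ginv h ga b z * h z $ ga $ a)) 0 = dz e (dzbar f (%z. if b = a then 1 else 0)) 0"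
  by (rule dz_dzbar_cong[OF open_U U0]) (rule ginv_h)
 also have "... = 0" by (simp add: dz_const[abs_def])
 also have "dz e (dzbar f (%z. \<Sum>ga. ginv h ga b z * h z $ ga $ a)) 0
  = (\<Sum>ga. dz e (dzbar f (ginv h ga b)) 0 * h 0 $ ga $ a + ginv h ga b 0 * dz e (dzbar f (%w. h w $ ga $ a)) 0)"
  by (simp add: dz_dzbar_sum[OF open_U _ U0] dz_dzbar_mult[OF open_U ginv_smooth h_smooth U0] dh0 dbh0
    smooth_on_mult[OF open_U ginv_smooth h_smooth])
 also have "... = dz e (dzbar f (ginv h a b)) 0 + R b a e f"
  by (simp add: h00 ginv0 sum.distrib curv0' mult_delta_left mult_delta_right)
 finally show ?thesis by (simp add: add_eq_0_iff)
qed

end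

context nk
begin

lemma sm_dz: "smooth_on U F ==> smooth_on U (dz e F)" "smooth_on U F ==> smooth_on U (dzbar e F)"
 using smooth_on_dz[OF open_U] by auto

lemma dz_congU:
 assumes "!!x. x \<in> U ==> F x = G x" "z \<in> U"
 shows "dz e F z = dz e G z" "dzbar e F z = dzbar e G z"
 using dz_cong[OF open_U assms(2,1)] by auto

lemma dz_closed: "dz e (dz c (%w. h w $ a $ b)) 0 = dz c (dz e (%w. h w $ a $ b)) 0"
 by (rule dz_commute(1)[OF open_U h_smooth U0])

lemma curv_eq: "z \<in> U ==> curv h a b c d z = dzbar d (dz c (%w. h w $ a $ b)) z
  - (\<Sum>mu nu. (ginv h mu nu z * dz c (%w. h w $ a $ nu) z) * dzbar d (%w. h w $ mu $ b) z)"
 by (rule curv_formula)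

lemma smX: "smooth_on U (%z. ginv h mu nu z * dz c (%w. h w $ a $ nu) z)"
 by (intro smooth_on_mult open_U ginv_smooth sm_dz h_smooth)

lemma dcurv0: "dz e (curv h a b c d) 0 = dz e (dzbar d (dz c (%w. h w $ a $ b))) 0"
proof -
 note sm = smooth_on_differentiable[OF _ U0]
 have d1: "(%z. (ginv h mu nu z * dz c (%w. h w $ a $ nu) z) * dzbar d (%w. h w $ mu $ b) z) differentiable (at 0)" for mu nu
  by (rule sm) (intro smooth_on_mult open_U ginv_smooth sm_dz h_smooth)
 have d2: "dzbar d (dz c (%w. h w $ a $ b)) differentiable (at 0)" by (rule sm) (intro sm_dz h_smooth)
 have d3: "(%z. \<Sum>mu nu. (ginv h mu nu z * dz c (%w. h w $ a $ nu) z) * dzbar d (%w. h w $ mu $ b) z) differentiable (at 0)"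
  by (rule sm) (intro smooth_on_sum smooth_on_mult open_U ginv_smooth sm_dz h_smooth)
 have d4: "(%z. \<Sum>nu. (ginv h mu nu z * dz c (%w. h w $ a $ nu) z) * dzbar d (%w. h w $ mu $ b) z) differentiable (at 0)" for mu
  by (rule sm) (intro smooth_on_sum smooth_on_mult open_U ginv_smooth sm_dz h_smooth)
 have 0: "dz e (%z. (ginv h mu nu z * dz c (%w. h w $ a $ nu) z) * dzbar d (%w. h w $ mu $ b) z) 0 = 0" for mu nu
  by (subst dz_mult) (auto intro!: sm smX sm_dz h_smooth simp: dbh0 dh0)
 have "dz e (curv h a b c d) 0 = dz e (%z. dzbar d (dz c (%w. h w $ a $ b)) z
  - (\<Sum>mu nu. (ginv h mu nu z * dz c (%w. h w $ a $ nu) z) * dzbar d (%w. h w $ mu $ b) z)) 0"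
  by (rule dz_congU[OF curv_eq U0])
 also have "... = dz e (dzbar d (dz c (%w. h w $ a $ b))) 0"
  by (subst dz_diff[OF d2 d3], subst dz_sum[OF d4], subst dz_sum[OF d1]) (simp add: 0)
 finally show ?thesis .
qed

text \<open>Of the quadratic term only products of two second derivatives survive. The product of
  two pure second derivatives is not a tensor, but it is symmetric under exchanging the pairs (c,d)
  and (e,f), and so it drops out of \<open>ddcurv_exchange\<close>.\<close>

lemma ddcurv0:
 "dz e (dzbar f (curv h a b c d)) 0 = dz e (dzbar f (dzbar d (dz c (%w. h w $ a $ b)))) 0
  - (\<Sum>nu. R a nu c f * R nu b e d
    + dz e (dz c (%w. h w $ a $ nu)) 0 * dzbar f (dzbar d (%w. h w $ nu $ b)) 0)"
proof -
 let ?P = "%mu nu z. (ginv h mu nu z * dz c (%w. h w $ a $ nu) z) * dzbar d (%w. h w $ mu $ b) z"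
 note sm = smooth_on_differentiable[OF _ U0]
 have sP: "smooth_on U (?P mu nu)" for mu nu by (intro smooth_on_mult open_U ginv_smooth sm_dz h_smooth)
 have sP1: "smooth_on U (%z. \<Sum>nu. ?P mu nu z)" for mu by (intro smooth_on_sum open_U sP)
 have sP2: "smooth_on U (%z. \<Sum>mu nu. ?P mu nu z)" by (intro smooth_on_sum open_U sP1)
 have sH: "smooth_on U (dzbar d (dz c (%w. h w $ a $ b)))" by (intro sm_dz h_smooth)
 have dX: "dz e (%z. ginv h mu nu z * dz c (%w. h w $ a $ nu) z) 0 = ginv h mu nu 0 * dz e (dz c (%w. h w $ a $ nu)) 0"
  "dzbar f (%z. ginv h mu nu z * dz c (%w. h w $ a $ nu) z) 0 = ginv h mu nu 0 * R a nu c f" for mu nu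
  by (subst dz_mult; auto intro!: sm ginv_smooth sm_dz h_smooth simp: dh0 dginv0 curv0)+
 have 1: "dz e (dzbar f (?P mu nu)) 0 = ginv h mu nu 0 * (R a nu c f * R mu b e d
   + dz e (dz c (%w. h w $ a $ nu)) 0 * dzbar f (dzbar d (%w. h w $ mu $ b)) 0)" for mu nu
  by (subst dz_dzbar_mult[OF open_U smX sm_dz(2)[OF h_smooth] U0])
   (simp add: dX dh0 dbh0 curv0' algebra_simps)
 have "dz e (dzbar f (curv h a b c d)) 0
   = dz e (dzbar f (%z. dzbar d (dz c (%w. h w $ a $ b)) z - (\<Sum>mu nu. ?P mu nu z))) 0"
  by (rule dz_dzbar_cong[OF open_U U0 curv_eq])
 also have "... = dz e (%z. dzbar f (dzbar d (dz c (%w. h w $ a $ b))) z - dzbar f (%z. \<Sum>mu nu. ?P mu nu z) z) 0"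
  by (rule dz_congU[OF dz_diff(2) U0]; rule smooth_on_differentiable[OF sH] smooth_on_differentiable[OF sP2])
 also have "... = dz e (dzbar f (dzbar d (dz c (%w. h w $ a $ b)))) 0 - dz e (dzbar f (%z. \<Sum>mu nu. ?P mu nu z)) 0"
  by (rule dz_diff) (rule sm, rule sm_dz(2), rule sH sP2)+
 also have "dz e (dzbar f (%z. \<Sum>mu nu. ?P mu nu z)) 0 = (\<Sum>mu nu. dz e (dzbar f (?P mu nu)) 0)"
  by (simp only: dz_dzbar_sum[OF open_U sP1 U0] dz_dzbar_sum[OF open_U sP U0])
 also have "... = (\<Sum>nu. R a nu c f * R nu b e d
    + dz e (dz c (%w. h w $ a $ nu)) 0 * dzbar f (dzbar d (%w. h w $ nu $ b)) 0)"
  by (simp add: 1 ginv0 mult_delta_left)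
 finally show ?thesis .
qed

text \<open>The combination of the second Bianchi identity and the Ricci identity that is needed; in
 normal coordinates it only expresses that derivatives of the metric commute.\<close>

lemma ddcurv_exchange:
 "dz e (dzbar f (curv h a b c d)) 0 + (\<Sum>nu. R a nu c f * R nu b e d)
  = dz c (dzbar d (curv h a b e f)) 0 + (\<Sum>nu. R a nu e d * R nu b c f)"
proof -
 let ?H = "%w. h w $ a $ b"
 note c = dz_commute[OF open_U]
 note s = h_smooth sm_dz
 have "dz e (dzbar f (dzbar d (dz c ?H))) 0 = dz e (dzbar d (dzbar f (dz c ?H))) 0"
  by (rule dz_congU[OF c(3) U0]) (intro s)
 also have "... = dz e (dzbar d (dz c (dzbar f ?H))) 0"
  by (rule dz_congU[OF dz_congU(2)[OF c(2)[symmetric]] U0]) (intro s)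
 also have "... = dz e (dz c (dzbar d (dzbar f ?H))) 0"
  by (rule dz_congU[OF c(2)[symmetric] U0]) (intro s)
 also have "... = dz c (dz e (dzbar d (dzbar f ?H))) 0"
  by (rule c(1)[OF _ U0]) (intro s)
 also have "... = dz c (dzbar d (dz e (dzbar f ?H))) 0"
  by (rule dz_congU[OF c(2) U0]) (intro s)
 also have "... = dz c (dzbar d (dzbar f (dz e ?H))) 0"
  by (rule dz_congU[OF dz_congU(2)[OF c(2)] U0]) (intro s)
 finally have 1: "dz e (dzbar f (dzbar d (dz c ?H))) 0 = dz c (dzbar d (dzbar f (dz e ?H))) 0" .
 have 2: "dzbar f (dzbar d (%w. h w $ nu $ b)) 0 = dzbar d (dzbar f (%w. h w $ nu $ b)) 0" for nu
  by (rule c(3)[OF h_smooth U0])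
 show ?thesis
  unfolding ddcurv0[of e f] ddcurv0[of c d] 1 sum.distrib
  by (simp add: dz_closed[of e c] 2)
qed

lemma einstein_trace:
 assumes "!!z. z \<in> U ==> ricci h a b z = L z * h z $ a $ b" "z \<in> U"
 shows "(\<Sum>ga dt. ginv h ga dt z * curv h a b ga dt z) = - L z * h z $ a $ b"
 using assms(1)[OF assms(2)] unfolding ricci_def by (simp add: minus_equation_iff)

text \<open>The derivative of the curvature at the origin is symmetric in \<open>e\<close> and
  \<open>a\<close>. Taking the trace, it is the derivative of \<open>L\<close> times the metric,
  which is not symmetric in this way unless it vanishes.\<close>

lemma schur_nk:
 assumes E: "!!a b z. z \<in> U ==> ricci h a b z = L z * h z $ a $ b" and L: "smooth_on U L"
  and m: "CARD('m) \<ge> 2"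
 shows "dz e L 0 = 0"
proof -
 note sm = smooth_on_differentiable[OF _ U0]
 have tr: "(\<Sum>ga. dz e (curv h a b ga ga) 0) = - dz e L 0 * (if a = b then 1 else 0)" for a b e
 proof -
  have d1: "(%z. ginv h ga dt z * curv h a b ga dt z) differentiable (at 0)" for ga dt
   by (rule sm) (intro smooth_on_mult open_U ginv_smooth curv_smooth)
  have d2: "(%z. \<Sum>dt. ginv h ga dt z * curv h a b ga dt z) differentiable (at 0)" for ga
   by (rule sm) (intro smooth_on_sum smooth_on_mult open_U ginv_smooth curv_smooth)
  have 1: "dz e (%z. ginv h ga dt z * curv h a b ga dt z) 0 = ginv h ga dt 0 * dz e (curv h a b ga dt) 0" for ga dt
   by (subst dz_mult) (auto intro!: sm ginv_smooth curv_smooth simp: dginv0)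
  have "dz e (%z. \<Sum>ga dt. ginv h ga dt z * curv h a b ga dt z) 0 = dz e (%z. - (L z * h z $ a $ b)) 0"
   by (rule dz_congU[OF _ U0]) (simp add: einstein_trace[OF E])
  also have "... = - dz e L 0 * (if a = b then 1 else 0)"
   using sm[OF L] h_diff[OF U0] by (subst dz_minus) (auto simp: dz_mult dh0 h00)
  finally show ?thesis
   by (simp add: dz_sum d1 d2 1 ginv0 mult_delta_left)
 qed
 have sym: "dz e (curv h a b ga ga) 0 = dz a (curv h e b ga ga) 0" for a b ga e
 proof -
  note c = dz_commute[OF open_U]
  note s = h_smooth sm_dz
  have *: "dz e (dzbar ga (dz ga (%w. h w $ a $ b))) 0 = dzbar ga (dz ga (dz e (%w. h w $ a $ b))) 0" for e a
  proof -
   have "dz e (dzbar ga (dz ga (%w. h w $ a $ b))) 0 = dzbar ga (dz e (dz ga (%w. h w $ a $ b))) 0"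
    by (rule c(2)[OF _ U0]) (intro s)
   also have "... = dzbar ga (dz ga (dz e (%w. h w $ a $ b))) 0"
    by (rule dz_congU[OF c(1) U0]) (intro s)
   finally show ?thesis .
  qed
  have "dzbar ga (dz ga (dz e (%w. h w $ a $ b))) 0 = dzbar ga (dz ga (dz a (%w. h w $ e $ b))) 0"
   by (rule dz_congU[OF dz_congU(1)[OF h_closed] U0])
  then show ?thesis by (simp add: dcurv0 *)
 qed
 have "\<exists>a. a ~= e"
 proof (rule ccontr)
  assume "\<not> ?thesis"
  then have "(UNIV :: 'm set) = {e}" by auto
  then have "card (UNIV :: 'm set) = card {e}" by (rule arg_cong)
  then show False using m by simp
 qed
 then obtain a where "a ~= e" by blast
 \<comment> \<open>With \<open>a\<close> different from \<open>e\<close>, the diagonal entry yields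
   the derivative of \<open>L\<close> in the direction \<open>e\<close>, whereas the entry it is
   equal to by symmetry is off-diagonal and zero. This is where dimension at least 2 enters.\<close>
 then show ?thesis using tr[of e a a] tr[of a e a] sym[of e a a] by simp
qed

end

lemma (in km) cscal_smooth: "smooth_on U (%z. cor (cscal h z))"
 unfolding cscal_def
 by (intro smooth_on_linear_compose[OF open_U bounded_linear_of_real] smooth_on_Re_part open_U
   smooth_on_sum smooth_on_mult ginv_smooth ricci_smooth)

lemma (in pb) einstein_pullback:
 assumes "!!a b z. z \<in> V ==> ricci h a b z = L z * h z $ a $ b" "z \<in> U"
 shows "ricci g a b z = L (f z) * g z $ a $ b"
 unfolding ricci_pullback[OF assms(2)] pullback_form_fc2 using assms(1)[OF fU[OF assms(2)]] by (simp add: fc2_cmult)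

text \<open>The Jacobian of the normal coordinates carries the vanishing at their centre back to
  \<open>p\<close>. The barred derivatives vanish as well because the scalar curvature is
  real.\<close>

lemma schur:
 fixes h :: "'m::finite local_metric"
 assumes k: "kmetric V h" and E: "!!a b z. z \<in> V ==> ricci h a b z = cor (cscal h z / real CARD('m)) * h z $ a $ b"
  and m: "CARD('m) \<ge> 2" and p: "p \<in> V"
 shows "((%z. cor (cscal h z)) has_derivative (%v. 0)) (at p)"
proof -
 interpret t: km V h using k by unfold_locales
 define L where "L = (%z. cor (1 / real CARD('m)) * cor (cscal h z))"
 have E': "ricci h a b z = L z * h z $ a $ b" if "z \<in> V" for a b z
  using E[OF that] by (simp add: L_def)
 have sL: "smooth_on V L" unfolding L_def by (intro smooth_on_mult smooth_on_const t.open_U t.cscal_smooth)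
 obtain U f where n: "pb V h U f" "0 \<in> U" "f 0 = p" "pullback_form f h 0 = mat 1"
  "!!al bt ga. dz ga (%w. pullback_form f h w $ al $ bt) 0 = 0"
  using normal_coordinates[OF k p] by blast
 interpret pb V h U f by (rule n(1))
 interpret nk U g by unfold_locales (use n in auto)
 have dL: "L differentiable (at (f 0))" using smooth_on_differentiable[OF sL] n(3) p by simp
 have 0: "dz e (%w. L (f w)) 0 = 0" for e
  by (rule schur_nk[OF einstein_pullback[OF E'] comp_smooth[OF sL] m])
 have "dz sg L p = 0" for sg
 proof -
  have "jac f 0 *v (\<chi> sg. dz sg L p) = 0"
   using 0 n(3) by (simp add: dz_comp(1)[OF n(2) dL] matrix_vector_mult_def jac_def vec_eq_iff)
  then have "(\<chi> sg. dz sg L p) = 0"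
   using Jinv[OF n(2)] unfolding invertible_left_inverse matrix_left_invertible_ker by blast
  then show ?thesis by (simp add: vec_eq_iff)
 qed
 moreover have dC: "(%z. cor (cscal h z)) differentiable (at p)"
  using smooth_on_differentiable[OF t.cscal_smooth p] .
 ultimately have 1: "dz sg (%z. cor (cscal h z)) p = 0" for sg
  using dz_cmult(1)[OF dC, of sg "cor (1 / real CARD('m))"] m unfolding L_def by auto
 have 2: "dzbar sg (%z. cor (cscal h z)) p = 0" for sg
  using dz_cnj(2)[OF dC, of sg] 1 by simp
 show ?thesis using has_derivative_wirtinger[OF dC] by (simp add: 1 2)
qed

section \<open>The cubic inequality\<close>

lemma sum_if_const:
 "(\<Sum>j\<in>A. if P then f j else 0) = (if P then (\<Sum>j\<in>A. f j) else (0::'a::comm_monoid_add))"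
 by simp

text \<open>A bound on the largest eigenvalue without diagonalisation: because \<open>A\<close> is
  trace-free, pairing it with the rank-one matrix of \<open>v\<close> is the same as pairing it with
  the trace-free part \<open>W\<close>, whose norm is smaller by the factor sqrt((n-1)/n).
  Cauchy-Schwarz does the rest.\<close>

lemma hermitian_form_bound:
 fixes A :: "'n::finite => 'n => complex"
 assumes tr: "(\<Sum>i. A i i) = 0"
 shows "Re (\<Sum>i j. cnj (v i) * A i j * v j)
  \<le> sqrt ((real CARD('n) - 1) / real CARD('n) * (\<Sum>i j. (cmod (A i j))\<^sup>2)) * (\<Sum>i. (cmod (v i))\<^sup>2)"
proof -
 define n where "n = real CARD('n)"
 have n: "n > 0" by (simp add: n_def)
 define V where "V = (\<Sum>i. (cmod (v i))\<^sup>2)"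
 define S where "S = (\<Sum>i j. (cmod (A i j))\<^sup>2)"
 define W where "W = (%i j. cnj (v i) * v j - (if i = j then cor (V / n) else 0))"
 have V0: "V \<ge> 0" by (simp add: V_def sum_nonneg)
 have W2: "(\<Sum>i j. (cmod (W i j))\<^sup>2) = V\<^sup>2 * ((n - 1) / n)"
 proof -
  have "(cmod (W i j))\<^sup>2 = (cmod (v i))\<^sup>2 * (cmod (v j))\<^sup>2
    + (if i = j then (V / n)\<^sup>2 - 2 * (V / n) * (cmod (v i))\<^sup>2 else 0)" for i j
  proof (cases "i = j")
   case True
   have "W i j = cor ((cmod (v i))\<^sup>2 - V / n)"
    using True unfolding of_real_diff complex_norm_square by (simp add: W_def mult.commute)
   then have "(cmod (W i j))\<^sup>2 = ((cmod (v i))\<^sup>2 - V / n)\<^sup>2" by (simp only: norm_of_real power2_abs)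
   then show ?thesis using True by (simp add: power2_eq_square algebra_simps)
  qed (simp add: W_def norm_mult power_mult_distrib)
  then have "(\<Sum>i j. (cmod (W i j))\<^sup>2)
   = (\<Sum>i j. (cmod (v i))\<^sup>2 * (cmod (v j))\<^sup>2) + (\<Sum>i. (V / n)\<^sup>2 - 2 * (V / n) * (cmod (v i))\<^sup>2)"
   by (simp add: sum.distrib)
  also have "... = V * V + (n * (V / n)\<^sup>2 - 2 * (V / n) * V)"
   unfolding V_def sum_product by (simp add: sum_subtractf sum_distrib_left n_def)
  also have "... = V\<^sup>2 * ((n - 1) / n)" using n by (simp add: field_simps power2_eq_square)
  finally show ?thesis .
 qed
 have eq: "(\<Sum>i j. cnj (v i) * A i j * v j) = (\<Sum>i j. A i j * W i j)"
 proof -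
  have "(\<Sum>i j. A i j * W i j) = (\<Sum>i j. cnj (v i) * A i j * v j)
    - (\<Sum>i. A i i * cor (V / n))"
   by (simp add: W_def algebra_simps sum_subtractf mult_delta_right)
  then show ?thesis using tr unfolding sum_distrib_right[symmetric] by simp
 qed
 have "Re (\<Sum>i j. A i j * W i j) \<le> cmod (\<Sum>i j. A i j * W i j)"
  by (rule complex_Re_le_cmod)
 also have "... \<le> (\<Sum>i j. cmod (A i j) * cmod (W i j))"
  by (rule order_trans[OF norm_sum], rule sum_mono, rule order_trans[OF norm_sum]) (simp add: norm_mult)
 also have "... = (\<Sum>p. cmod (A (fst p) (snd p)) * cmod (W (fst p) (snd p)))"
  unfolding sum.cartesian_product UNIV_Times_UNIV by (simp add: case_prod_unfold)
 also have "... \<le> sqrt (S * (V\<^sup>2 * ((n - 1) / n)))"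
 proof (rule real_le_rsqrt)
  have "(\<Sum>p. cmod (A (fst p) (snd p)) * cmod (W (fst p) (snd p)))\<^sup>2
   \<le> (\<Sum>p. (cmod (A (fst p) (snd p)))\<^sup>2) * (\<Sum>p. (cmod (W (fst p) (snd p)))\<^sup>2)"
   by (rule Cauchy_Schwarz_ineq_sum)
  moreover have "(\<Sum>p. (cmod (A (fst p) (snd p)))\<^sup>2) = S"
   unfolding S_def sum.cartesian_product UNIV_Times_UNIV by (simp add: case_prod_unfold)
  moreover have "(\<Sum>p. (cmod (W (fst p) (snd p)))\<^sup>2) = V\<^sup>2 * ((n - 1) / n)"
   unfolding W2[symmetric] sum.cartesian_product UNIV_Times_UNIV by (simp add: case_prod_unfold)
  ultimately show "(\<Sum>p. cmod (A (fst p) (snd p)) * cmod (W (fst p) (snd p)))\<^sup>2 \<le> S * (V\<^sup>2 * ((n - 1) / n))"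
   by simp
 qed
 also have "... = sqrt ((n - 1) / n * S) * V"
 proof -
  have "S * (V\<^sup>2 * ((n - 1) / n)) = ((n - 1) / n * S) * V\<^sup>2" by simp
  then show ?thesis using V0 by (simp only: real_sqrt_mult real_sqrt_abs abs_of_nonneg)
 qed
 finally show ?thesis unfolding eq[symmetric] n_def V_def S_def .
qed

text \<open>If \<open>A\<close> is Hermitian and \<open>A \<le> s\<close>, then \<open>(A + t) (s - A) (A + t)\<close> is positive; its trace, for
 the optimal \<open>t\<close>, gives the sharp bound.\<close>

lemma trace_cube_bound:
 fixes A :: "'n::finite => 'n => complex"
 assumes herm: "!!i j. cnj (A i j) = A j i" and tr: "(\<Sum>i. A i i) = 0" and n2: "CARD('n) \<ge> 2"
 defines "S \<equiv> (\<Sum>i j. (cmod (A i j))\<^sup>2)"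
 shows "Re (\<Sum>i j k. A i j * A j k * A k i)
  \<le> (real CARD('n) - 2) / sqrt (real CARD('n) * (real CARD('n) - 1)) * (S * sqrt S)"
proof -
 define n where "n = real CARD('n)"
 have n: "n \<ge> 2" using n2 by (simp add: n_def)
 have S0: "S \<ge> 0" by (simp add: S_def sum_nonneg)
 \<comment> \<open>The extremal matrix has the eigenvalue \<open>s\<close> once and
   \<open>- t\<close> otherwise: trace zero gives \<open>t = s / (n - 1)\<close>, and the prescribed
   norm gives this value of \<open>s\<close>.\<close>
 define s where "s = sqrt ((n - 1) / n * S)"
 define t where "t = s / (n - 1)"
 define T where "T = (\<Sum>i j k. A i j * A j k * A k i)"
 \<comment> \<open>The column \<open>k\<close> of A + t; summing over \<open>k\<close> the bound of
   the form by \<open>s\<close> at these vectors is the trace inequality for (A + t) (s - A) (A +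
   t).\<close>
 define v where "v = (%k i. A i k + (if i = k then cor t else 0))"
 have cS: "cor S = (\<Sum>i j. A i j * A j i)"
  unfolding S_def of_real_sum complex_norm_square herm ..
 have cT: "(\<Sum>k i j. cnj (v k i) * A i j * v k j) = T + 2 * cor (t * S)"
 proof -
  have "(\<Sum>k i j. cnj (v k i) * A i j * v k j)
   = (\<Sum>k i j. A k i * A i j * A j k)
    + t * (\<Sum>k i. A k i * A i k)
    + t * (\<Sum>k j. A k j * A j k) + t * (t * (\<Sum>k. A k k))"
  proof -
   have "cnj (v k i) * A i j * v k j = A k i * A i j * A j k + (if j = k then t * (A k i * A i k) else 0)
     + (if i = k then t * (A k j * A j k) else 0) + (if i = k then if j = k then t * (t * A k k) else 0 else 0)" for i j k
    by (auto simp: v_def herm algebra_simps)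
   then show ?thesis by (simp add: sum.distrib sum_distrib_left sum_if_const cong: if_cong)
  qed
  also have "(\<Sum>k i j. A k i * A i j * A j k) = T" by (simp add: T_def)
  finally show ?thesis using tr by (simp add: cS)
 qed
 have vS: "(\<Sum>k i. (cmod (v k i))\<^sup>2) = S + n * t\<^sup>2"
 proof -
  have "cor (\<Sum>k i. (cmod (v k i))\<^sup>2)
   = (\<Sum>k i. A i k * A k i + (if i = k then t * A k k + t * A k k + t\<^sup>2 else 0))"
   unfolding of_real_sum complex_norm_square
   by (intro sum.cong refl) (auto simp: v_def herm algebra_simps power2_eq_square)
  also have "... = (\<Sum>k i. A k i * A i k) + (t * (\<Sum>k. A k k) + t * (\<Sum>k. A k k) + n * t\<^sup>2)"
   by (simp add: sum.distrib sum_distrib_left n_def mult.commute)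
  also have "... = cor (S + n * t\<^sup>2)" by (simp add: tr cS)
  finally show ?thesis using of_real_eq_iff by blast
 qed
 have "Re (\<Sum>i j. cnj (v k i) * A i j * v k j) \<le> s * (\<Sum>i. (cmod (v k i))\<^sup>2)" for k
  using hermitian_form_bound[of A "v k", OF tr] unfolding s_def n_def S_def .
 then have "(\<Sum>k. Re (\<Sum>i j. cnj (v k i) * A i j * v k j))
   \<le> (\<Sum>k. s * (\<Sum>i. (cmod (v k i))\<^sup>2))"
  by (rule sum_mono)
 then have "Re (T + 2 * cor (t * S)) \<le> (\<Sum>k. s * (\<Sum>i. (cmod (v k i))\<^sup>2))"
  unfolding Re_sum[of _ UNIV, symmetric] cT .
 also have "... = s * (S + n * t\<^sup>2)" by (simp only: sum_distrib_left[symmetric] vS)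
 finally have "Re T \<le> s * (S + n * t\<^sup>2) - 2 * t * S" by simp
 also have "... = (n - 2) / sqrt (n * (n - 1)) * (S * sqrt S)"
 proof -
  have s2: "s * s = (n - 1) / n * S" using n S0 by (simp add: s_def)
  have "n * t\<^sup>2 = S / (n - 1)"
  proof -
   have "n * t\<^sup>2 = n * (s * s) / ((n - 1) * (n - 1))" by (simp add: t_def power2_eq_square)
   also have "... = S / (n - 1)"
   proof -
    have "n * (d / n * S) / (d * d) = S / d" if "d ~= 0" for d using n that by simp
    then show ?thesis unfolding s2 using n by simp
   qed
   finally show ?thesis .
  qed
  then have "s * (S + n * t\<^sup>2) - 2 * t * S = (n - 2) * S * (s / (n - 1))"
  proof -
   have "s * (S + S / d) - 2 * (s / d) * S = (d - 1) * S * (s / d)" if "d ~= 0" for d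
    using that by (simp add: field_simps)
   from this[of "n - 1"] show ?thesis using n \<open>n * t\<^sup>2 = S / (n - 1)\<close> by (simp add: t_def)
  qed
  also have "s / (n - 1) = sqrt S / sqrt (n * (n - 1))"
  proof -
   have "n - 1 = sqrt (n - 1) * sqrt (n - 1)" using n by simp
   then have "s / (n - 1) = (sqrt (n - 1) * sqrt S / sqrt n) / (sqrt (n - 1) * sqrt (n - 1))"
    by (simp add: s_def real_sqrt_mult real_sqrt_divide)
   also have "... = sqrt S / sqrt (n * (n - 1))"
   proof -
    have "(x * q / y) / (x * x) = q / (y * x)" if "x ~= 0" "y ~= 0" for x y q :: real
     using that by (simp add: field_simps)
    note * = this
    show ?thesis unfolding real_sqrt_mult by (rule *) (use n in auto)
   qed
   finally show ?thesis .
  qed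
  finally show ?thesis by (simp add: mult_ac)
 qed
 finally show ?thesis by (simp add: T_def n_def)
qed

lemma trace_cube_bound_below:
 fixes A :: "'n::finite => 'n => complex"
 assumes herm: "!!i j. cnj (A i j) = A j i" and tr: "(\<Sum>i. A i i) = 0" and n2: "CARD('n) \<ge> 2"
 defines "S \<equiv> (\<Sum>i j. (cmod (A i j))\<^sup>2)"
 shows "- (Re (\<Sum>i j k. A i j * A j k * A k i))
  \<le> (real CARD('n) - 2) / sqrt (real CARD('n) * (real CARD('n) - 1)) * (S * sqrt S)"
 using trace_cube_bound[of "%i j. - A i j"] herm tr n2 by (simp add: S_def sum_negf)

text \<open>\<open>k\<close> is the constant for which \<open>R\<close> is the sum of the curvature of constant holomorphic
 sectional curvature and the trace-free part \<open>B\<close>; the terms linear in \<open>B\<close> cancel.\<close>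

lemma cubic_contraction:
 fixes B :: "'m::finite => 'm => 'm => 'm => complex" and k :: complex
 assumes su: "!!a b c d. B a b c d = B c b a d" and sb: "!!a b c d. B a b c d = B a d c b"
  and herm: "!!a b c d. cnj (B a b c d) = B b a d c" and tr: "!!a b. (\<Sum>c. B a b c c) = 0"
 defines "R \<equiv> %a b c d. B a b c d - k * ((if a = b then if c = d then 1 else 0 else 0) + (if c = b then if a = d then 1 else 0 else 0))"
 shows "(\<Sum>a b c d. cnj (B a b c d) *
   (\<Sum>e nu. R a nu e d * R nu b c e - R a nu c e * R nu b e d + R a b e nu * R nu e c d))
  = (\<Sum>a b c d. cnj (B a b c d) *
   (\<Sum>e nu. B a nu e d * B nu b c e - B a nu c e * B nu b e d + B a b e nu * B nu e c d))"
proof -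
 have tr': "(\<Sum>c. k * B a c c b) = 0" "(\<Sum>c. k * B c b a c) = 0" "(\<Sum>c. k * B c c a b) = 0"
  "(\<Sum>c. k * B a b c c) = 0" for a b
 proof -
  have "(\<Sum>c. B a c c b) = (\<Sum>c. B a b c c)" by (intro sum.cong refl sb)
  moreover have "(\<Sum>c. B c b a c) = (\<Sum>c. B a b c c)" by (intro sum.cong refl su)
  moreover have "(\<Sum>c. B c c a b) = (\<Sum>c. B a b c c)"
   by (intro sum.cong refl trans[OF su sb])
  ultimately show "(\<Sum>c. k * B a c c b) = 0" "(\<Sum>c. k * B c b a c) = 0"
   "(\<Sum>c. k * B c c a b) = 0" "(\<Sum>c. k * B a b c c) = 0"
   using tr[of a b] by (simp_all add: sum_distrib_left[symmetric])
 qed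
 let ?x = "%a b c d. if a = b then if c = d then 1 else 0 else 0 :: complex"
 let ?y = "%a b c d. if c = b then if a = d then 1 else 0 else 0 :: complex"
 let ?m = "of_nat CARD('m) :: complex"
 note ex = sum_if_const algebra_simps sum.distrib sum_subtractf mult_delta_left mult_delta_right tr' power2_eq_square
 have 1: "(\<Sum>e nu. R a nu e d * R nu b c e) = (\<Sum>e nu. B a nu e d * B nu b c e) - 2 * k * B a b c d
    + k\<^sup>2 * (?x a b c d + (?m + 2) * ?y a b c d)" for a b c d
  unfolding R_def by (simp add: ex cong: if_cong)
 have 2: "(\<Sum>e nu. R a nu c e * R nu b e d) = (\<Sum>e nu. B a nu c e * B nu b e d) - 4 * k * B a b c d
    + k\<^sup>2 * (2 * ?x a b c d + 2 * ?y a b c d)" for a b c d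
  unfolding R_def by (simp add: ex su[of c b a d] sb[of a d c b] cong: if_cong)
 have 3: "(\<Sum>e nu. R a b e nu * R nu e c d) = (\<Sum>e nu. B a b e nu * B nu e c d) - 2 * k * B a b c d
    + k\<^sup>2 * ((?m + 2) * ?x a b c d + ?y a b c d)" for a b c d
  unfolding R_def by (simp add: ex cong: if_cong)
 define u where "u = k\<^sup>2 * (?m + 1)"
 have eq: "(\<Sum>e nu. R a nu e d * R nu b c e - R a nu c e * R nu b e d + R a b e nu * R nu e c d)
   = (\<Sum>e nu. B a nu e d * B nu b c e - B a nu c e * B nu b e d + B a b e nu * B nu e c d)
    + u * (?x a b c d + ?y a b c d)" for a b c d
  unfolding sum.distrib sum_subtractf 1 2 3 u_def by (simp add: algebra_simps)
 \<comment> \<open>The linear coefficients -2, +4, -2 have cancelled. The constant part is a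
   multiple of the curvature of the model, and the trace-free \<open>B\<close> is orthogonal to
   it.\<close>
 have z: "(\<Sum>a b c d. cnj (B a b c d) * (u * (?x a b c d + ?y a b c d))) = 0"
 proof -
  have t1: "(\<Sum>c. cnj (B a a c c) * u) = 0" "(\<Sum>c. cnj (B a c c a) * u) = 0" for a
  proof -
   have "(\<Sum>c. B a c c a) = (\<Sum>c. B a a c c)" by (intro sum.cong refl sb)
   then show "(\<Sum>c. cnj (B a a c c) * u) = 0" "(\<Sum>c. cnj (B a c c a) * u) = 0"
    using tr[of a a] by (simp_all add: sum_distrib_right[symmetric] cnj_sum[symmetric])
  qed
  have "(\<Sum>a b c d. cnj (B a b c d) * (u * (?x a b c d + ?y a b c d)))
   = (\<Sum>a c. cnj (B a a c c) * u) + (\<Sum>a c. cnj (B a c c a) * u)"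
   by (simp add: distrib_left sum.distrib mult_delta_left mult_delta_right sum_if_const cong: if_cong)
  then show ?thesis by (simp add: t1)
 qed
 show ?thesis
  unfolding eq unfolding distrib_left[of "cnj _" _ "u * _"] sum.distrib z by simp
qed

lemma sum_product_UNIV:
 "(\<Sum>p\<in>(UNIV :: ('a::finite \<times> 'b::finite) set). f p) = (\<Sum>a b. f (a, b))"
 unfolding sum.cartesian_product UNIV_Times_UNIV by (simp add: case_prod_unfold)

text \<open>Two ways of reading a curvature-like tensor as a Hermitian matrix, on $V \otimes V$ and on
 $V \otimes \bar V$, turn the three cubic contractions into traces of cubes.\<close>

lemma cubic_bound:
 fixes B :: "'m::finite => 'm => 'm => 'm => complex"
 assumes su: "!!a b c d. B a b c d = B c b a d" and sb: "!!a b c d. B a b c d = B a d c b"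
  and herm: "!!a b c d. cnj (B a b c d) = B b a d c" and tr: "!!a b. (\<Sum>c. B a b c c) = 0"
  and m2: "CARD('m) \<ge> 2"
 defines "N \<equiv> (\<Sum>a b c d. (cmod (B a b c d))\<^sup>2)"
 defines "n \<equiv> (real CARD('m))\<^sup>2"
 shows "- Re (\<Sum>a b c d. cnj (B a b c d) *
   (\<Sum>e nu. B a nu e d * B nu b c e - B a nu c e * B nu b e d + B a b e nu * B nu e c d))
  \<le> 3 * ((n - 2) / sqrt (n * (n - 1))) * (N * sqrt N)"
proof -
 \<comment> \<open>\<open>K\<close> has rows indexed by one unbarred and one barred slot,
   \<open>H\<close> by the two unbarred slots. The first and third contractions are both traces of
   the cube of \<open>K\<close>, the second that of \<open>H\<close>.\<close>
 define K :: "'m \<times> 'm => 'm \<times> 'm => complex" where "K = (%p q. B (fst p) (fst q) (snd q) (snd p))"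
 define H :: "'m \<times> 'm => 'm \<times> 'm => complex" where "H = (%p q. B (fst p) (fst q) (snd p) (snd q))"
 have card: "CARD('m \<times> 'm) \<ge> 2" "real CARD('m \<times> 'm) = n"
  using m2 mult_le_mono[OF m2 m2] by (simp_all add: n_def power2_eq_square)
 have hK: "cnj (K p q) = K q p" for p q
  by (simp add: K_def herm)
 have hH: "cnj (H p q) = H q p" for p q by (simp add: H_def herm)
 have tK: "(\<Sum>p. K p p) = 0" by (simp add: K_def sum_product_UNIV tr)
 have tH: "(\<Sum>p. H p p) = 0" by (simp add: H_def sum_product_UNIV tr)
 have NH: "(\<Sum>p q. (cmod (H p q))\<^sup>2) = N"
 proof -
  have "(\<Sum>p q. (cmod (H p q))\<^sup>2) = (\<Sum>a c b d. (cmod (B a b c d))\<^sup>2)"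
   by (simp add: H_def sum_product_UNIV)
  also have "... = N" unfolding N_def by (intro sum.cong refl sum.swap)
  finally show ?thesis .
 qed
 have NK: "(\<Sum>p q. (cmod (K p q))\<^sup>2) = N"
 proof -
  have "(\<Sum>p q. (cmod (K p q))\<^sup>2) = (\<Sum>a d b c. (cmod (B a b c d))\<^sup>2)"
   by (simp add: K_def sum_product_UNIV)
  also have "... = (\<Sum>a b d c. (cmod (B a b c d))\<^sup>2)"
   by (intro sum.cong refl sum.swap)
  also have "... = N" unfolding N_def by (rule sum.cong[OF refl], rule sum.cong[OF refl], rule sum.swap)
  finally show ?thesis .
 qed
 let ?C = "%f :: 'm => 'm => 'm => 'm => 'm => 'm => complex. \<Sum>a b c d e nu. f a b c d e nu"
 have T1: "?C (%a b c d e nu. cnj (B a b c d) * (B a nu e d * B nu b c e)) = (\<Sum>p q r. K p q * K q r * K r p)"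
 proof -
  have P: "?C f = (\<Sum>a d nu e b c. f a b c d e nu)" for f :: "'m => 'm => 'm => 'm => 'm => 'm => complex"
  proof -
   have "?C f = (\<Sum>x. (%(a,b,c,d,e,nu). f a b c d e nu) x)" by (simp add: sum_product_UNIV)
   also have "... = (\<Sum>x. (%(a,d,nu,e,b,c). f a b c d e nu) x)"
    by (rule sum.reindex_bij_witness[where i = "%(a,d,nu,e,b,c). (a,b,c,d,e,nu)" and j = "%(a,b,c,d,e,nu). (a,d,nu,e,b,c)"]) auto
   finally show ?thesis by (simp add: sum_product_UNIV)
  qed
  have pt: "cnj (B a b c d) * (B a nu e d * B nu b c e) = B a nu e d * B nu b c e * B b a d c" for a b c d e nu
   using herm[of a b c d] by (simp add: mult_ac)
  show ?thesis unfolding pt K_def sum_product_UNIV fst_conv snd_conv by (rule P)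
 qed
 have T3: "?C (%a b c d e nu. cnj (B a b c d) * (B a b e nu * B nu e c d)) = (\<Sum>p q r. K p q * K q r * K r p)"
 proof -
  have P: "?C f = (\<Sum>a b nu e d c. f a b c d e nu)" for f :: "'m => 'm => 'm => 'm => 'm => 'm => complex"
  proof -
   have "?C f = (\<Sum>x. (%(a,b,c,d,e,nu). f a b c d e nu) x)" by (simp add: sum_product_UNIV)
   also have "... = (\<Sum>x. (%(a,b,nu,e,d,c). f a b c d e nu) x)"
    by (rule sum.reindex_bij_witness[where i = "%(a,b,nu,e,d,c). (a,b,c,d,e,nu)" and j = "%(a,b,c,d,e,nu). (a,b,nu,e,d,c)"]) auto
   finally show ?thesis by (simp add: sum_product_UNIV)
  qed
  have pt: "cnj (B a b c d) * (B a b e nu * B nu e c d) = B a nu e b * B nu d c e * B d a b c" for a b c d e nu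
   using herm[of a b c d] sb[of a b e nu] sb[of nu e c d] su[of b a d c] by (simp add: mult_ac)
  show ?thesis unfolding pt K_def sum_product_UNIV fst_conv snd_conv by (rule P)
 qed
 have T2: "?C (%a b c d e nu. cnj (B a b c d) * (B a nu c e * B nu b e d)) = (\<Sum>p q r. H p q * H q r * H r p)"
 proof -
  have P: "?C f = (\<Sum>a c nu e b d. f a b c d e nu)" for f :: "'m => 'm => 'm => 'm => 'm => 'm => complex"
  proof -
   have "?C f = (\<Sum>x. (%(a,b,c,d,e,nu). f a b c d e nu) x)" by (simp add: sum_product_UNIV)
   also have "... = (\<Sum>x. (%(a,c,nu,e,b,d). f a b c d e nu) x)"
    by (rule sum.reindex_bij_witness[where i = "%(a,c,nu,e,b,d). (a,b,c,d,e,nu)" and j = "%(a,b,c,d,e,nu). (a,c,nu,e,b,d)"]) auto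
   finally show ?thesis by (simp add: sum_product_UNIV)
  qed
  have pt: "cnj (B a b c d) * (B a nu c e * B nu b e d) = B a nu c e * B nu b e d * B b a d c" for a b c d e nu
   using herm[of a b c d] by (simp add: mult_ac)
  show ?thesis unfolding pt H_def sum_product_UNIV fst_conv snd_conv by (rule P)
 qed
 have "(\<Sum>a b c d. cnj (B a b c d) *
   (\<Sum>e nu. B a nu e d * B nu b c e - B a nu c e * B nu b e d + B a b e nu * B nu e c d))
  = ?C (%a b c d e nu. cnj (B a b c d) * (B a nu e d * B nu b c e)) - ?C (%a b c d e nu. cnj (B a b c d) * (B a nu c e * B nu b e d))
   + ?C (%a b c d e nu. cnj (B a b c d) * (B a b e nu * B nu e c d))"
  by (simp add: sum_distrib_left distrib_left right_diff_distrib sum.distrib sum_subtractf)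
 note eq = this
 \<comment> \<open>\<open>K\<close> occurs twice and needs the lower bound, \<open>H\<close> occurs
   once with the opposite sign and needs the upper one; together they give the factor 3.\<close>
 have fin: "- Re (x - y + x) \<le> 3 * c * w" if "- Re x \<le> c * w" "Re y \<le> c * w" for x y :: complex and c w :: real
  using that by simp
 show ?thesis
  unfolding eq T1 T2 T3
  using trace_cube_bound_below[of K, OF hK tK card(1)] trace_cube_bound[of H, OF hH tH card(1)]
  unfolding NK NH card(2) by (rule fin)
qed

section \<open>The Laplacian of the Bochner tensor\<close>

lemma second_derivative_max:
 fixes f :: "'a::real_normed_vector => complex"
 assumes "open U" "smooth_on U f" "0 \<in> U" and max: "!!z. z \<in> U ==> Re (f z) \<le> Re (f 0)"
 shows "Re (fder (%x. fder f (at x) u) (at 0) u) \<le> 0"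
proof (rule ccontr)
 define D where "D = (%x. fder f (at x) u)"
 assume "\<not> ?thesis"
 then have pos: "Re (fder D (at 0) u) > 0" by (simp add: D_def)
 have sD: "smooth_on U D" unfolding D_def by (rule smooth_on_frechet[OF assms(2)])
 have opn: "open ((%t::real. t *\<^sub>R u) -` U)"
  by (rule open_vimage[OF assms(1)]) (intro continuous_intros)
 have "0 \<in> (%t::real. t *\<^sub>R u) -` U" using assms(3) by simp
 then obtain d where d: "d > 0" "ball 0 d \<subseteq> (%t::real. t *\<^sub>R u) -` U"
  using opn open_contains_ball by blast
 then have inU: "t *\<^sub>R u \<in> U" if "\<bar>t\<bar> < d" for t using that by (auto simp: subset_iff)
 have der: "((%t. Re (F (t *\<^sub>R u))) has_real_derivative Re (fder F (at (t *\<^sub>R u)) u)) (at t)"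
  if "smooth_on U F" "\<bar>t\<bar> < d" for F :: "'a => complex" and t
 proof -
  have F: "(F has_derivative fder F (at (t *\<^sub>R u))) (at (t *\<^sub>R u))"
   using smooth_on_differentiable[OF that(1) inU[OF that(2)]] by (simp add: frechet_derivative_works)
  have "((%t. F (t *\<^sub>R u)) has_derivative (%r. fder F (at (t *\<^sub>R u)) (r *\<^sub>R u))) (at t)"
   by (rule has_derivative_compose[where g = F and f = "%t. t *\<^sub>R u" and f' = "%r. r *\<^sub>R u", OF _ F])
    (auto intro!: derivative_eq_intros)
  then have "((%t. Re (F (t *\<^sub>R u))) has_derivative (%r. Re (fder F (at (t *\<^sub>R u)) (r *\<^sub>R u)))) (at t)"
   by (rule bounded_linear.has_derivative[OF bounded_linear_Re])
  moreover have "Re (fder F (at (t *\<^sub>R u)) (r *\<^sub>R u)) = Re (fder F (at (t *\<^sub>R u)) u) * r" for r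
   using linear_scale[OF has_derivative_linear[OF F], of r u] by simp
  ultimately show ?thesis by (simp add: has_field_derivative_def)
 qed
 have g1: "((%t. Re (f (t *\<^sub>R u))) has_real_derivative Re (D (t *\<^sub>R u))) (at t)" if "\<bar>t\<bar> < d" for t
  using der[OF assms(2) that] by (simp add: D_def)
 have g2: "((%t. Re (D (t *\<^sub>R u))) has_real_derivative Re (fder D (at 0) u)) (at 0)"
  using der[OF sD, of 0] d by simp
 have z: "Re (D 0) = 0"
 proof -
  have "((%t. Re (f (t *\<^sub>R u))) has_real_derivative Re (D 0)) (at 0)" using g1[of 0] d by simp
  moreover have "\<forall>y. \<bar>0 - y\<bar> < d \<longrightarrow> Re (f (y *\<^sub>R u)) \<le> Re (f (0 *\<^sub>R u))" using max inU by simp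
  ultimately show ?thesis using DERIV_local_max[OF _ d(1)] by blast
 qed
 obtain e where e: "e > 0" "!!t. 0 < t ==> t < e ==> 0 < Re (D (t *\<^sub>R u))"
  using DERIV_pos_inc_right[OF g2 pos] z by auto
 define t where "t = min e d / 2"
 have t: "0 < t" "t < e" "t < d" using e d by (auto simp: t_def)
 have "\<exists>s. 0 < s & s < t & Re (f (t *\<^sub>R u)) - Re (f (0 *\<^sub>R u)) = (t - 0) * Re (D (s *\<^sub>R u))"
  using t by (intro MVT2 g1) auto
 then obtain s where s: "0 < s" "s < t" "Re (f (t *\<^sub>R u)) - Re (f 0) = t * Re (D (s *\<^sub>R u))" by auto
 have "0 < t * Re (D (s *\<^sub>R u))" using e(2)[of s] s t by (intro mult_pos_pos) auto
 then have "Re (f (t *\<^sub>R u)) > Re (f 0)" using s(3) by linarith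
 then show False using max[OF inU[of t]] t by simp
qed

text \<open>The operator is a quarter of the sum of the second derivatives in the real and imaginary
  coordinate directions, each of which is nonpositive at a maximum.\<close>

lemma dz_dzbar_max:
 fixes f :: "complex^'m::finite => complex"
 assumes "open U" "smooth_on U f" "0 \<in> U" "!!z. z \<in> U ==> Re (f z) \<le> Re (f 0)"
 shows "Re (dz e (dzbar e f) 0) \<le> 0"
proof -
 define F where "F = (%u v. fder (%x. fder f (at x) u) (at 0) v)"
 have comm: "F u v = F v u" for u v
  unfolding F_def by (rule frechet_derivative_commute[OF assms(1) smooth_onD[OF assms(2)] assms(3)])
 have D: "((%x. fder f (at x) u) has_derivative F u) (at 0)" for u
  unfolding F_def frechet_derivative_works[symmetric]
  using smooth_on_differentiable[OF smooth_on_frechet[OF assms(2)] assms(3)] .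
 have 2: "(dzbar e f has_derivative (%v. (F (axis e 1) v + \<i> * F (axis e \<i>) v) / 2)) (at 0)"
  unfolding dzbar_def[abs_def] by (auto intro!: derivative_eq_intros D)
 have "dz e (dzbar e f) 0 = (F (axis e 1) (axis e 1) + F (axis e \<i>) (axis e \<i>)) / 4"
  unfolding dz_at[OF 2] comm[of "axis e \<i>" "axis e 1"] by (simp add: field_simps)
 moreover have "Re ((x + y) / 4) = (Re x + Re y) / 4" for x y by simp
 ultimately have "Re (dz e (dzbar e f) 0) = (Re (F (axis e 1) (axis e 1)) + Re (F (axis e \<i>) (axis e \<i>))) / 4"
  by (simp only:)
 then show ?thesis
  using second_derivative_max[OF assms, of "axis e 1"] second_derivative_max[OF assms, of "axis e \<i>"]
  by (simp add: F_def)
qed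

locale nke = nk U h for U :: "(complex^'m::finite) set" and h :: "'m local_metric" +
 fixes lam :: real
 assumes ein: "!!z a b. z \<in> U ==> ricci h a b z = cor lam * h z $ a $ b"
  and m2: "CARD('m) \<ge> 2"
begin

text \<open>A quarter of the Euclidean Laplacian, evaluated at the origin only. Normal coordinates
  make this enough for the maximum principle; no Laplace operator on the manifold is used.\<close>

definition lap :: "(complex^'m => complex) => complex" where
 "lap F = (\<Sum>e. dz e (dzbar e F) 0)"

lemma ric0: "(\<Sum>c. R a b c c) = - cor lam * (if a = b then 1 else 0)"
 using einstein_trace[OF ein, of 0 a b] by (simp add: U0 ginv0 h00 mult_delta_left)

text \<open>The Einstein equation, differentiated twice. The quadratic term comes from the second
  derivative of the inverse metric used in taking the trace.\<close>

lemma trace_dd: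
 "(\<Sum>e. dz c (dzbar d (curv h a b e e)) 0) = (\<Sum>e nu. R a b e nu * R nu e c d) - lam * R a b c d"
proof -
 have s: "smooth_on U (%z. ginv h ga dt z * curv h a b ga dt z)" for ga dt
  by (intro smooth_on_mult open_U ginv_smooth curv_smooth)
 have s2: "smooth_on U (%z. \<Sum>dt. ginv h ga dt z * curv h a b ga dt z)" for ga
  by (intro smooth_on_sum open_U s)
 have "dz c (dzbar d (%z. \<Sum>ga dt. ginv h ga dt z * curv h a b ga dt z)) 0
  = dz c (dzbar d (%z. (- cor lam) * h z $ a $ b)) 0"
  by (rule dz_dzbar_cong[OF open_U U0]) (rule einstein_trace[OF ein])
 also have "... = - lam * R a b c d"
  by (subst dz_dzbar_mult[OF open_U smooth_on_const[OF open_U] h_smooth U0]) (simp add: curv0' dz_const[abs_def])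
 also have "dz c (dzbar d (%z. \<Sum>ga dt. ginv h ga dt z * curv h a b ga dt z)) 0
  = (\<Sum>ga dt. - R dt ga c d * R a b ga dt + ginv h ga dt 0 * dz c (dzbar d (curv h a b ga dt)) 0)"
  by (simp add: dz_dzbar_sum[OF open_U s2 U0] dz_dzbar_sum[OF open_U s U0]
    dz_dzbar_mult[OF open_U ginv_smooth curv_smooth U0] dginv0 ddginv0)
 also have "... = - (\<Sum>ga dt. R a b ga dt * R dt ga c d) + (\<Sum>ga. dz c (dzbar d (curv h a b ga ga)) 0)"
  by (simp add: sum.distrib sum_subtractf ginv0 mult_delta_left mult.commute)
 finally show ?thesis by (simp add: algebra_simps add_eq_0_iff)
qed

text \<open>With e = f in \<open>ddcurv_exchange\<close>, the Laplacian of the curvature is traded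
  for second derivatives of its trace, which \<open>trace_dd\<close> evaluates, at the price of
  quadratic curvature terms.\<close>

lemma lap_curv:
 "lap (curv h a b c d) = (\<Sum>e nu. R a nu e d * R nu b c e - R a nu c e * R nu b e d + R a b e nu * R nu e c d)
   - lam * R a b c d"
proof -
 have "dz e (dzbar e (curv h a b c d)) 0 = dz c (dzbar d (curv h a b e e)) 0
   + ((\<Sum>nu. R a nu e d * R nu b c e) - (\<Sum>nu. R a nu c e * R nu b e d))" for e
  using ddcurv_exchange[of e e a b c d] by (simp add: algebra_simps)
 then have "lap (curv h a b c d) = (\<Sum>e. dz c (dzbar d (curv h a b e e)) 0)
   + (\<Sum>e. (\<Sum>nu. R a nu e d * R nu b c e) - (\<Sum>nu. R a nu c e * R nu b e d))"
  by (simp add: lap_def sum.distrib)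
 then show ?thesis by (simp add: trace_dd sum.distrib sum_subtractf)
qed

lemma lap_sum: "(!!i. i \<in> I ==> smooth_on U (F i)) ==> lap (%z. \<Sum>i\<in>I. F i z) = (\<Sum>i\<in>I. lap (F i))"
 unfolding lap_def by (simp add: dz_dzbar_sum[OF open_U _ U0]) (rule sum.swap)

lemma lap_mult:
 assumes "smooth_on U F" "smooth_on U G"
 shows "lap (%z. F z * G z) = lap F * G 0 + F 0 * lap G
  + (\<Sum>e. dzbar e F 0 * dz e G 0 + dz e F 0 * dzbar e G 0)"
 unfolding lap_def dz_dzbar_mult[OF open_U assms U0]
 by (simp add: sum.distrib sum_distrib_left sum_distrib_right)

lemma lap_cnj: "smooth_on U F ==> lap (%z. cnj (F z)) = cnj (lap F)"
 unfolding lap_def by (simp add: dz_dzbar_cnj[OF open_U _ U0])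

lemma lap_h: "lap (%w. h w $ a $ b) = - cor lam * (if a = b then 1 else 0)"
 unfolding lap_def curv0' by (rule ric0)

lemma lap_ginv: "lap (ginv h a b) = cor lam * (if a = b then 1 else 0)"
 unfolding lap_def ddginv0 using ric0[of b a] by (simp add: sum_negf)

text \<open>What is needed of a matrix function in order to raise an index at the origin. It is
  stated abstractly because unbarred and barred slots require the inverse metric and its
  transpose.\<close>

definition sl :: "('m => 'm => complex^'m => complex) => bool" where
 "sl G \<longleftrightarrow> (\<forall>i j. smooth_on U (G i j) & G i j 0 = (if i = j then 1 else 0) &
   (\<forall>e. dz e (G i j) 0 = 0 & dzbar e (G i j) 0 = 0) & lap (G i j) = cor lam * (if i = j then 1 else 0))"

lemma sl_ginv: "sl (ginv h)" "sl (%i j. ginv h j i)"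
 unfolding sl_def by (auto simp: ginv_smooth ginv0 dginv0 lap_ginv)

text \<open>Raising an index leaves the 1-jet at the origin unchanged and adds \<open>lam\<close>
  times the value to the Laplacian, because the inverse metric is the identity to first order and
  has Laplacian \<open>lam\<close> times the identity.\<close>

lemma slot:
 fixes X :: "'m => complex^'m => complex"
 assumes X: "!!i. smooth_on U (X i)" and G: "sl G"
 defines "Y \<equiv> %j z. \<Sum>i. G i j z * X i z"
 shows "smooth_on U (Y j)" "Y j 0 = X j 0" "dz e (Y j) 0 = dz e (X j) 0" "dzbar e (Y j) 0 = dzbar e (X j) 0"
  "lap (Y j) = lap (X j) + lam * X j 0"
proof -
 have sG: "smooth_on U (G i j)" and G0: "G i j 0 = (if i = j then 1 else 0)"
  and dG: "dz e (G i j) 0 = 0" "dzbar e (G i j) 0 = 0" and lG: "lap (G i j) = cor lam * (if i = j then 1 else 0)" for i j e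
  using G unfolding sl_def by auto
 note d = smooth_on_differentiable[OF _ U0]
 have s: "smooth_on U (%z. G i j z * X i z)" for i j by (intro smooth_on_mult open_U sG X)
 show "smooth_on U (Y j)" unfolding Y_def by (intro smooth_on_sum open_U s)
 show "Y j 0 = X j 0" by (simp add: Y_def G0 mult_delta_left)
 show "dz e (Y j) 0 = dz e (X j) 0" "dzbar e (Y j) 0 = dzbar e (X j) 0"
  unfolding Y_def using d[OF s] d[OF sG] d[OF X]
  by (simp_all add: dz_sum dz_mult G0 dG mult_delta_left)
 show "lap (Y j) = lap (X j) + lam * X j 0"
  unfolding Y_def lap_sum[OF s] lap_mult[OF sG X] by (simp add: G0 dG lG sum.distrib mult_delta_left mult_delta_right)
qed

text \<open>The Bochner tensor when the Ricci tensor is \<open>lam\<close> times the metric. The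
  Ricci and scalar terms then combine with coefficient 2 lam/(m+2) - m lam/((m+1)(m+2)) =
  lam/(m+1).\<close>

definition Bf :: "'m => 'm => 'm => 'm => complex^'m => complex" where
 "Bf a b c d z = curv h a b c d z
   + cor (lam / (real CARD('m) + 1)) * (h z $ a $ b * h z $ c $ d + h z $ c $ b * h z $ a $ d)"

lemma cscal_eq:
 assumes "z \<in> U" shows "cscal h z = lam * real CARD('m)"
proof -
 have "(\<Sum>al bt. ginv h al bt z * ricci h al bt z)
   = lam * (\<Sum>al bt. ginv h al bt z * h z $ al $ bt)"
  by (simp add: ein[OF assms] sum_distrib_left mult_ac)
 also have "(\<Sum>al bt. ginv h al bt z * h z $ al $ bt) = (\<Sum>bt al. ginv h al bt z * h z $ al $ bt)"
  by (rule sum.swap)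
 also have "... = of_nat CARD('m)" by (simp add: ginv_h[OF assms])
 finally show ?thesis by (simp add: cscal_def)
qed

lemma bochner_eq:
 assumes "z \<in> U" shows "bochner h a b c d z = Bf a b c d z"
proof -
 define m where "m = real CARD('m)"
 have m: "m > 0" by (simp add: m_def)
 have coef: "lam / (m + 1) = 2 * lam / (m + 2) - lam * m / ((m + 1) * (m + 2))"
  using m by (simp add: divide_simps) (simp add: algebra_simps)
 have "bochner h a b c d z = curv h a b c d z
   + cor (2 * lam / (m + 2) - lam * m / ((m + 1) * (m + 2))) * (h z $ a $ b * h z $ c $ d + h z $ c $ b * h z $ a $ d)"
  unfolding bochner_def Let_def m_def ein[OF assms] cscal_eq[OF assms]
  by (simp add: algebra_simps add_divide_distrib)
 then show ?thesis unfolding Bf_def coef[symmetric, unfolded m_def] m_def[symmetric] coef[symmetric] .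
qed

lemma Bf_smooth: "smooth_on U (Bf a b c d)"
 unfolding Bf_def[abs_def] by (intro smooth_on_add smooth_on_mult smooth_on_const open_U curv_smooth h_smooth)

abbreviation B0 :: "'m => 'm => 'm => 'm => complex" where "B0 a b c d \<equiv> Bf a b c d 0"

lemma B0_eq: "B0 a b c d = R a b c d + cor (lam / (real CARD('m) + 1)) *
  ((if a = b then if c = d then 1 else 0 else 0) + (if c = b then if a = d then 1 else 0 else 0))"
 by (simp add: Bf_def h00)

lemma B0_sym: "B0 a b c d = B0 c b a d" "B0 a b c d = B0 a d c b" "cnj (B0 a b c d) = B0 b a d c"
proof -
 show "B0 a b c d = B0 c b a d" by (simp add: Bf_def curv_sym_unbarred[OF U0, of a b] add.commute mult.commute)
 show "B0 a b c d = B0 a d c b" by (simp add: Bf_def curv_sym_barred[OF U0, of a b] add.commute mult.commute)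
 show "cnj (B0 a b c d) = B0 b a d c" by (simp add: Bf_def curv_cnj[OF U0] h_cnj[OF U0] mult.commute)
qed

lemma B0_trace: "(\<Sum>c. B0 a b c c) = 0"
proof -
 have k: "cor (lam / (real CARD('m) + 1)) * (of_nat CARD('m) + 1) = lam"
 proof -
  have "lam / (real CARD('m) + 1) * (real CARD('m) + 1) = lam" by (simp add: add_nonneg_pos less_imp_neq[symmetric])
  then show ?thesis by (metis of_real_1 of_real_add of_real_mult of_real_of_nat_eq)
 qed
 have "(\<Sum>c. B0 a b c c) = - cor lam * (if a = b then 1 else 0)
   + cor (lam / (real CARD('m) + 1)) * ((if a = b then of_nat CARD('m) else 0) + (if a = b then 1 else 0))"
  unfolding B0_eq sum.distrib ric0 sum_distrib_left[symmetric] by (simp add: sum.distrib sum_if_const cong: if_cong)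
 then show ?thesis using k by (cases "a = b") (simp_all add: algebra_simps)
qed

lemma lap_Bf:
 "lap (Bf a b c d) = lap (curv h a b c d) - 2 * lam * cor (lam / (real CARD('m) + 1)) *
  ((if a = b then if c = d then 1 else 0 else 0) + (if c = b then if a = d then 1 else 0 else 0))"
proof -
 have s: "smooth_on U (%z. h z $ a $ b * h z $ c $ d + h z $ c $ b * h z $ a $ d)"
  by (intro smooth_on_add smooth_on_mult open_U h_smooth)
 have s1: "smooth_on U (%z. h z $ a $ b * h z $ c $ d)" for a b c d by (intro smooth_on_mult open_U h_smooth)
 have la: "lap (%z. F z + G z) = lap F + lap G" if "smooth_on U F" "smooth_on U G" for F G
  using lap_sum[of UNIV "%i::bool. if i then F else G"] that by (simp add: UNIV_bool add.commute)
 have lc: "lap (%z. k * F z) = k * lap F" if "smooth_on U F" for F k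
  using lap_mult[OF smooth_on_const[OF open_U] that, of k] by (simp add: lap_def dz_const[abs_def])
 have l1: "lap (%z. h z $ a $ b * h z $ c $ d) = - 2 * lam * (if a = b then if c = d then 1 else 0 else 0)" for a b c d
  unfolding lap_mult[OF h_smooth h_smooth] lap_h h00 dh0 dbh0 by simp
 show ?thesis
  unfolding Bf_def[abs_def]
  by (subst la[OF curv_smooth smooth_on_mult[OF open_U smooth_on_const[OF open_U] s]], subst lc[OF s], subst la[OF s1 s1])
   (simp add: l1 algebra_simps)
qed

end

text \<open>Contraction of a single slot of a four-index array; the norm of a tensor is obtained by raising
 its indices one after the other.\<close>

definition O1 :: "('m => 'm => complex) => ('m::finite => 'm => 'm => 'm => complex) => 'm => 'm => 'm => 'm => complex" where
 "O1 M T a b c d = (\<Sum>i. M i a * T i b c d)"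
definition O2 :: "('m => 'm => complex) => ('m::finite => 'm => 'm => 'm => complex) => 'm => 'm => 'm => 'm => complex" where
 "O2 M T a b c d = (\<Sum>i. M i b * T a i c d)"
definition O3 :: "('m => 'm => complex) => ('m::finite => 'm => 'm => 'm => complex) => 'm => 'm => 'm => 'm => complex" where
 "O3 M T a b c d = (\<Sum>i. M i c * T a b i d)"
definition O4 :: "('m => 'm => complex) => ('m::finite => 'm => 'm => 'm => complex) => 'm => 'm => 'm => 'm => complex" where
 "O4 M T a b c d = (\<Sum>i. M i d * T a b c i)"

definition ip4 :: "('m::finite => 'm => 'm => 'm => complex) => ('m => 'm => 'm => 'm => complex) => complex" where
 "ip4 X Y = (\<Sum>a b c d. X a b c d * cnj (Y a b c d))"

lemma slot_commute:
 fixes x y :: "'m::finite => complex"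
 shows "(\<Sum>a. x a * (\<Sum>b. y b * f a b)) = (\<Sum>b. y b * (\<Sum>a. x a * f a b))"
 by (simp add: sum_distrib_left, subst sum.swap) (simp add: mult_ac)

lemma O_commute:
 "O1 M (O2 N T) = O2 N (O1 M T)" "O1 M (O3 N T) = O3 N (O1 M T)" "O1 M (O4 N T) = O4 N (O1 M T)"
 "O2 M (O3 N T) = O3 N (O2 M T)" "O2 M (O4 N T) = O4 N (O2 M T)" "O3 M (O4 N T) = O4 N (O3 M T)"
 unfolding O1_def O2_def O3_def O4_def by (intro ext slot_commute)+

lemma slot_adjoint:
 fixes M :: "'m::finite => 'm => complex"
 shows "(\<Sum>a. (\<Sum>i. M i a * x i) * cnj (\<Sum>j. M j a * y j))
  = (\<Sum>j. (\<Sum>i. (\<Sum>a. M i a * cnj (M j a)) * x i) * cnj (y j))"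
proof -
 have "(\<Sum>a. (\<Sum>i. M i a * x i) * cnj (\<Sum>j. M j a * y j))
  = (\<Sum>a j i. M i a * cnj (M j a) * x i * cnj (y j))"
  by (simp add: sum_distrib_left sum_distrib_right mult_ac)
 also have "... = (\<Sum>j a i. M i a * cnj (M j a) * x i * cnj (y j))"
  by (rule sum.swap)
 also have "... = (\<Sum>j i a. M i a * cnj (M j a) * x i * cnj (y j))"
  by (intro sum.cong refl sum.swap)
 finally show ?thesis by (simp add: sum_distrib_left sum_distrib_right mult_ac)
qed

lemma O_adjoint:
 fixes M :: "'m::finite => 'm => complex"
 defines "G \<equiv> %i j. \<Sum>a. M i a * cnj (M j a)"
 shows "ip4 (O1 M X) (O1 M Y) = ip4 (O1 G X) Y" "ip4 (O2 M X) (O2 M Y) = ip4 (O2 G X) Y"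
  "ip4 (O3 M X) (O3 M Y) = ip4 (O3 G X) Y" "ip4 (O4 M X) (O4 M Y) = ip4 (O4 G X) Y"
proof -
 have 1: "ip4 X Y = (\<Sum>b c d a. X a b c d * cnj (Y a b c d))" for X Y :: "'m => 'm => 'm => 'm => complex"
  unfolding ip4_def
  by (rule trans[OF sum.swap], rule sum.cong[OF refl], rule trans[OF sum.swap],
    rule sum.cong[OF refl], rule sum.swap)
 have 2: "ip4 X Y = (\<Sum>a c d b. X a b c d * cnj (Y a b c d))" for X Y :: "'m => 'm => 'm => 'm => complex"
  unfolding ip4_def
  by (rule sum.cong[OF refl], rule trans[OF sum.swap], rule sum.cong[OF refl], rule sum.swap)
 have 3: "ip4 X Y = (\<Sum>a b d c. X a b c d * cnj (Y a b c d))" for X Y :: "'m => 'm => 'm => 'm => complex"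
  unfolding ip4_def by (rule sum.cong[OF refl], rule sum.cong[OF refl], rule sum.swap)
 show "ip4 (O1 M X) (O1 M Y) = ip4 (O1 G X) Y" unfolding 1 O1_def G_def slot_adjoint ..
 show "ip4 (O2 M X) (O2 M Y) = ip4 (O2 G X) Y" unfolding 2 O2_def G_def slot_adjoint ..
 show "ip4 (O3 M X) (O3 M Y) = ip4 (O3 G X) Y" unfolding 3 O3_def G_def slot_adjoint ..
 show "ip4 (O4 M X) (O4 M Y) = ip4 (O4 G X) Y" unfolding ip4_def O4_def G_def slot_adjoint ..
qed

lemma frame_components_O:
 "frame_components P T = O1 (%i a. P $ a $ i) (O2 (%i a. cnj (P $ a $ i)) (O3 (%i a. P $ a $ i) (O4 (%i a. cnj (P $ a $ i)) T)))"
 by (intro ext) (simp add: frame_components_def O1_def O2_def O3_def O4_def sum_distrib_left mult_ac)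

text \<open>Removes the chosen frame from the norm: moved across the inner product slot by slot, the
  frame turns into the inverse metric. The resulting expression is visibly smooth in
  \<open>z\<close> and can be differentiated twice.\<close>

lemma (in km) bochner_norm_raise:
 assumes z: "z \<in> U"
 defines "G \<equiv> %i j. ginv h i j z" and "G' \<equiv> %i j. ginv h j i z" and "T \<equiv> %a b c d. bochner h a b c d z"
 shows "cor ((bochner_norm h z)\<^sup>2 / 4) = ip4 (O4 G' (O3 G (O2 G' (O1 G T)))) T"
proof -
 obtain P where P: "unitary_frame (h z) P" using unitary_frame_exists[OF h_posdef[OF z]] by blast
 define A where "A = (%i a. P $ a $ i)"
 define A' where "A' = (%i a. cnj (P $ a $ i))"
 have inv: "matrix_inv (h z) = adj P ** P"
 proof (rule matrix_inv_unique)
  have "(P ** h z) ** adj P = mat 1" using P by (simp add: unitary_frame_iff)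
  then have "adj P ** (P ** h z) = mat 1" using matrix_left_right_inverse by blast
  then show "adj P ** P ** h z = mat 1" by (simp add: matrix_mul_assoc)
 qed
 have G: "(%i j. \<Sum>a. A i a * cnj (A j a)) = G"
  by (intro ext) (simp add: G_def ginv_def inv A_def adj_def matrix_matrix_mult_def mult.commute)
 have G': "(%i j. \<Sum>a. A' i a * cnj (A' j a)) = G'"
  by (intro ext) (simp add: G'_def ginv_def inv A'_def adj_def matrix_matrix_mult_def mult.commute)
 note adj = O_adjoint[of A, unfolded G] and adj' = O_adjoint[of A', unfolded G']
 have fc: "frame_components P T = O1 A (O2 A' (O3 A (O4 A' T)))"
  by (simp add: frame_components_O A_def A'_def)
 have nn: "(bochner_norm h z)\<^sup>2 / 4 = (\<Sum>a b c d. (cmod (frame_components P T a b c d))\<^sup>2)"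
 proof -
  have "0 \<le> (\<Sum>a b c d. (cmod (frame_components P T a b c d))\<^sup>2)"
   by (intro sum_nonneg) simp
  then show ?thesis
   unfolding bochner_norm_eq[of h z, OF P] frame_norm_def T_def[symmetric] by simp
 qed
 have "cor ((bochner_norm h z)\<^sup>2 / 4) = ip4 (O1 A (O2 A' (O3 A (O4 A' T)))) (O1 A (O2 A' (O3 A (O4 A' T))))"
  unfolding nn of_real_sum complex_norm_square fc ip4_def ..
 also have "... = ip4 (O1 G (O2 A' (O3 A (O4 A' T)))) (O2 A' (O3 A (O4 A' T)))" by (rule adj)
 also have "... = ip4 (O2 A' (O1 G (O3 A (O4 A' T)))) (O2 A' (O3 A (O4 A' T)))" by (simp only: O_commute)
 also have "... = ip4 (O2 G' (O1 G (O3 A (O4 A' T)))) (O3 A (O4 A' T))" by (rule adj')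
 also have "... = ip4 (O3 A (O2 G' (O1 G (O4 A' T)))) (O3 A (O4 A' T))" by (simp only: O_commute)
 also have "... = ip4 (O3 G (O2 G' (O1 G (O4 A' T)))) (O4 A' T)" by (rule adj)
 also have "... = ip4 (O4 A' (O3 G (O2 G' (O1 G T)))) (O4 A' T)" by (simp only: O_commute)
 also have "... = ip4 (O4 G' (O3 G (O2 G' (O1 G T)))) T" by (rule adj')
 finally show ?thesis .
qed

lemma (in km) bochner_smooth: "smooth_on U (bochner h a b c d)"
proof -
 have eq: "bochner h a b c d = (%z. curv h a b c d z + cor (1 / (real CARD('m) + 2)) *
   (ricci h a b z * h z $ c $ d + ricci h c b z * h z $ a $ d + h z $ a $ b * ricci h c d z + h z $ c $ b * ricci h a d z)
   - cor (1 / ((real CARD('m) + 1) * (real CARD('m) + 2))) * cor (cscal h z) * (h z $ a $ b * h z $ c $ d + h z $ c $ b * h z $ a $ d))"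
  by (intro ext) (simp add: bochner_def Let_def divide_inverse mult_ac)
 show ?thesis
  unfolding eq by (intro smooth_on_diff smooth_on_add smooth_on_mult smooth_on_const open_U curv_smooth ricci_smooth h_smooth cscal_smooth)
qed

lemma (in km) bochner_norm_sq_smooth: "smooth_on U (%z. cor ((bochner_norm h z)\<^sup>2))"
proof -
 have "smooth_on U (%z. 4 * ip4 (O4 (%i j. ginv h j i z) (O3 (%i j. ginv h i j z) (O2 (%i j. ginv h j i z)
   (O1 (%i j. ginv h i j z) (%a b c d. bochner h a b c d z))))) (%a b c d. bochner h a b c d z))"
  unfolding ip4_def O1_def O2_def O3_def O4_def
  by (intro smooth_on_mult smooth_on_sum smooth_on_const smooth_on_cnj open_U ginv_smooth bochner_smooth)
 then show ?thesis
  by (rule smooth_on_cong[OF open_U, THEN iffD2, rotated]) (simp add: bochner_norm_raise[symmetric])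
qed

lemma bochner_norm_nonneg: "0 \<le> bochner_norm h z"
 unfolding bochner_norm_def frame_norm_def by (simp add: sum_nonneg)

context nke
begin

text \<open>At the maximum the Laplacian of |B|^2/4 is nonpositive. It equals twice the real part of
  the pairing of B with its Laplacian, plus 4 lam N, plus squared gradients. The pairing is the
  cubic term minus lam N, so lam N is at most minus the real part of the cubic term.\<close>

lemma bochner_max:
 assumes max: "!!z. z \<in> U ==> bochner_norm h z \<le> bochner_norm h 0"
  and pinch: "bochner_norm h 0 < 2 * sqrt ((real CARD('m))\<^sup>2 - 1) * (lam * real CARD('m)) / (3 * ((real CARD('m))\<^sup>2 - 2))"
 shows "bochner_norm h 0 = 0"
proof -
 define N where "N = (bochner_norm h 0)\<^sup>2 / 4"
 \<comment> \<open>The four indices of the tensor are raised one at a time; by \<open>slot\<close>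
   each step adds \<open>cor lam\<close> times the value to the Laplacian and changes neither value
   nor first derivatives at the origin.\<close>
 define Y1 where "Y1 = (%a b c d z. \<Sum>i. ginv h i a z * Bf i b c d z)"
 define Y2 where "Y2 = (%a b c d z. \<Sum>i. ginv h b i z * Y1 a i c d z)"
 define Y3 where "Y3 = (%a b c d z. \<Sum>i. ginv h i c z * Y2 a b i d z)"
 define Y4 where "Y4 = (%a b c d z. \<Sum>i. ginv h d i z * Y3 a b c i z)"
 have s1: "smooth_on U (Y1 a b c d)" for a b c d
  unfolding Y1_def by (rule slot(1)[OF Bf_smooth sl_ginv(1)])
 have s2: "smooth_on U (Y2 a b c d)" for a b c d
  unfolding Y2_def by (rule slot(1)[OF s1 sl_ginv(2)])
 have s3: "smooth_on U (Y3 a b c d)" for a b c d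
  unfolding Y3_def by (rule slot(1)[OF s2 sl_ginv(1)])
 have s4: "smooth_on U (Y4 a b c d)" for a b c d
  unfolding Y4_def by (rule slot(1)[OF s3 sl_ginv(2)])
 have Y1: "Y1 a b c d 0 = B0 a b c d" "dz e (Y1 a b c d) 0 = dz e (Bf a b c d) 0" "dzbar e (Y1 a b c d) 0 = dzbar e (Bf a b c d) 0"
  "lap (Y1 a b c d) = lap (Bf a b c d) + cor lam * B0 a b c d" for a b c d e
  unfolding Y1_def by (rule slot[OF Bf_smooth sl_ginv(1)])+
 have Y2: "Y2 a b c d 0 = Y1 a b c d 0" "dz e (Y2 a b c d) 0 = dz e (Y1 a b c d) 0" "dzbar e (Y2 a b c d) 0 = dzbar e (Y1 a b c d) 0"
  "lap (Y2 a b c d) = lap (Y1 a b c d) + cor lam * Y1 a b c d 0" for a b c d e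
  unfolding Y2_def by (rule slot[OF s1 sl_ginv(2)])+
 have Y3: "Y3 a b c d 0 = Y2 a b c d 0" "dz e (Y3 a b c d) 0 = dz e (Y2 a b c d) 0" "dzbar e (Y3 a b c d) 0 = dzbar e (Y2 a b c d) 0"
  "lap (Y3 a b c d) = lap (Y2 a b c d) + cor lam * Y2 a b c d 0" for a b c d e
  unfolding Y3_def by (rule slot[OF s2 sl_ginv(1)])+
 have Y4: "Y4 a b c d 0 = Y3 a b c d 0" "dz e (Y4 a b c d) 0 = dz e (Y3 a b c d) 0" "dzbar e (Y4 a b c d) 0 = dzbar e (Y3 a b c d) 0"
  "lap (Y4 a b c d) = lap (Y3 a b c d) + cor lam * Y3 a b c d 0" for a b c d e
  unfolding Y4_def by (rule slot[OF s3 sl_ginv(2)])+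
 have Y0: "Y4 a b c d 0 = B0 a b c d" for a b c d
  by (simp only: Y4 Y3 Y2 Y1)
 have dY: "dz e (Y4 a b c d) 0 = dz e (Bf a b c d) 0" "dzbar e (Y4 a b c d) 0 = dzbar e (Bf a b c d) 0" for a b c d e
  by (simp_all only: Y4 Y3 Y2 Y1)
 have lY: "lap (Y4 a b c d) = lap (Bf a b c d) + 4 * cor lam * B0 a b c d" for a b c d
  by (simp add: Y4 Y3 Y2 Y1)
 define F where "F = (%z. \<Sum>a b c d. cnj (Bf a b c d z) * Y4 a b c d z)"
 have F: "F z = cor ((bochner_norm h z)\<^sup>2 / 4)" if "z \<in> U" for z
  unfolding bochner_norm_raise[OF that] ip4_def O1_def O2_def O3_def O4_def bochner_eq[OF that]
  by (simp add: F_def Y4_def Y3_def Y2_def Y1_def mult.commute)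
 have sc: "smooth_on U (%z. cnj (Bf a b c d z))" for a b c d by (intro smooth_on_cnj open_U Bf_smooth)
 have sP: "smooth_on U (%z. cnj (Bf a b c d z) * Y4 a b c d z)" for a b c d
  by (intro smooth_on_mult open_U sc s4)
 have sF: "smooth_on U F" unfolding F_def by (intro smooth_on_sum open_U sP)
 have "Re (lap F) \<le> 0"
  unfolding lap_def Re_sum
 proof (rule sum_nonpos)
  fix e show "Re (dz e (dzbar e F) 0) \<le> 0"
  proof (rule dz_dzbar_max[OF open_U sF U0])
   fix z assume z: "z \<in> U"
   have "(bochner_norm h z)\<^sup>2 \<le> (bochner_norm h 0)\<^sup>2"
    using max[OF z] by (simp add: bochner_norm_nonneg power_mono)
   then show "Re (F z) \<le> Re (F 0)" by (simp add: F[OF z] F[OF U0])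
  qed
 qed
 define dt where "dt = (%a b c d::'m. (if a = b then if c = d then 1 else 0 else 0) + (if c = b then if a = d then 1 else 0 else 0) :: complex)"
 define k where "k = cor (lam / (real CARD('m) + 1))"
 define S where "S = (%f :: 'm => 'm => 'm => 'm => complex. \<Sum>a b c d. cnj (B0 a b c d) * f a b c d)"
 have S_lin: "S (%a b c d. f a b c d + g a b c d) = S f + S g" "S (%a b c d. f a b c d - g a b c d) = S f - S g"
  "S (%a b c d. x * f a b c d) = x * S f" for f g x
  by (simp_all add: S_def distrib_left right_diff_distrib sum.distrib sum_subtractf sum_distrib_left mult_ac)
 have Sdt: "S dt = 0"
 proof -
  have t: "(\<Sum>c. cnj (B0 a a c c)) = 0" "(\<Sum>c. cnj (B0 a c c a)) = 0" for a
  proof -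
   have "(\<Sum>c. B0 a c c a) = (\<Sum>c. B0 a a c c)" by (intro sum.cong refl B0_sym(2))
   then show "(\<Sum>c. cnj (B0 a a c c)) = 0" "(\<Sum>c. cnj (B0 a c c a)) = 0"
    using B0_trace[of a a] by (simp_all only: cnj_sum[symmetric] complex_cnj_zero)
  qed
  have "S dt = (\<Sum>a c. cnj (B0 a a c c)) + (\<Sum>a c. cnj (B0 a c c a))"
   by (simp add: S_def dt_def distrib_left sum.distrib mult_delta_left mult_delta_right sum_if_const cong: if_cong)
  then show ?thesis by (simp add: t)
 qed
 have NS: "S B0 = cor N"
 proof -
  have "S B0 = F 0" by (simp add: S_def F_def Y0)
  then show ?thesis using F[OF U0] by (simp add: N_def)
 qed
 define C where "C = S (%a b c d. \<Sum>e nu. B0 a nu e d * B0 nu b c e - B0 a nu c e * B0 nu b e d + B0 a b e nu * B0 nu e c d)"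
 have Rk: "R a b c d = B0 a b c d - k * dt a b c d" for a b c d
  by (simp add: B0_eq k_def dt_def)
 have C_eq: "S (%a b c d. \<Sum>e nu. R a nu e d * R nu b c e - R a nu c e * R nu b e d + R a b e nu * R nu e c d) = C"
  using cubic_contraction[of B0 k, OF B0_sym B0_trace] unfolding C_def S_def Rk dt_def .
 have lapB: "S (%a b c d. lap (Bf a b c d)) = C - cor lam * N"
 proof -
  have l: "lap (Bf a b c d) = ((\<Sum>e nu. R a nu e d * R nu b c e - R a nu c e * R nu b e d + R a b e nu * R nu e c d)
    - cor lam * (B0 a b c d - k * dt a b c d)) - 2 * cor lam * k * dt a b c d" for a b c d
   by (simp only: lap_Bf lap_curv Rk k_def dt_def of_real_mult of_real_numeral)
  have "S (%a b c d. lap (Bf a b c d)) = S (%a b c d. ((\<Sum>e nu. R a nu e d * R nu b c e - R a nu c e * R nu b e d + R a b e nu * R nu e c d)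
    - cor lam * (B0 a b c d - k * dt a b c d)) - 2 * cor lam * k * dt a b c d)"
   unfolding l ..
  also have "... = C - cor lam * N"
   unfolding S_lin C_eq Sdt NS by simp
  finally show ?thesis .
 qed
 have Bbound: "- Re C \<le> 3 * (((real CARD('m))\<^sup>2 - 2) / sqrt ((real CARD('m))\<^sup>2 * ((real CARD('m))\<^sup>2 - 1))) * (N * sqrt N)"
 proof -
  have "cor N = cor (\<Sum>a b c d. (cmod (B0 a b c d))\<^sup>2)"
   unfolding NS[symmetric] S_def of_real_sum complex_norm_square by (simp add: mult.commute)
  then have N: "N = (\<Sum>a b c d. (cmod (B0 a b c d))\<^sup>2)"
   by (simp only: of_real_eq_iff)
  show ?thesis
   using cubic_bound[of B0, OF B0_sym B0_trace m2] unfolding N C_def S_def .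
 qed
 \<comment> \<open>Equality holds with the squared norm \<open>E\<close> of the first derivatives as
   an extra term, which is nonnegative and is discarded.\<close>
 have "Re (lap F) \<ge> 2 * Re (S (%a b c d. lap (Bf a b c d))) + 4 * lam * N"
 proof -
  define E where "E = (%a b c d. \<Sum>e. (cmod (dz e (Bf a b c d) 0))\<^sup>2 + (cmod (dzbar e (Bf a b c d) 0))\<^sup>2)"
  have l: "lap (%z. cnj (Bf a b c d z) * Y4 a b c d z) = cnj (lap (Bf a b c d)) * B0 a b c d
    + cnj (B0 a b c d) * lap (Bf a b c d) + 4 * cor lam * (cnj (B0 a b c d) * B0 a b c d)
    + cor (E a b c d)" for a b c d
  proof -
   have dc: "dz e (%z. cnj (Bf a b c d z)) 0 = cnj (dzbar e (Bf a b c d) 0)"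
    "dzbar e (%z. cnj (Bf a b c d z)) 0 = cnj (dz e (Bf a b c d) 0)" for e
    by (simp_all add: dz_cnj smooth_on_differentiable[OF Bf_smooth U0])
   have "cor (E a b c d) = (\<Sum>e. cnj (dz e (Bf a b c d) 0) * dz e (Bf a b c d) 0
     + cnj (dzbar e (Bf a b c d) 0) * dzbar e (Bf a b c d) 0)"
    unfolding E_def of_real_sum of_real_add complex_norm_square by (simp only: mult.commute)
   then show ?thesis
    unfolding lap_mult[OF sc s4] lap_cnj[OF Bf_smooth] dc dY Y0 lY by (simp add: algebra_simps)
  qed
  have "lap F = (\<Sum>a b c d. lap (%z. cnj (Bf a b c d z) * Y4 a b c d z))"
   unfolding F_def by (subst lap_sum, intro smooth_on_sum open_U sP, (rule sum.cong[OF refl])?)+ (rule refl)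
  also have "... = cnj (S (%a b c d. lap (Bf a b c d))) + S (%a b c d. lap (Bf a b c d)) + 4 * cor lam * S B0
    + cor (\<Sum>a b c d. E a b c d)"
   unfolding l S_def by (simp add: sum.distrib sum_distrib_left mult_ac)
  finally have "Re (lap F) = 2 * Re (S (%a b c d. lap (Bf a b c d))) + 4 * lam * N
    + (\<Sum>a b c d. E a b c d)"
   unfolding NS by simp
  moreover have "0 \<le> (\<Sum>a b c d. E a b c d)"
   unfolding E_def by (intro sum_nonneg) simp
  ultimately show ?thesis by linarith
 qed
 with \<open>Re (lap F) \<le> 0\<close> have "2 * Re C - 2 * lam * N + 4 * lam * N \<le> 0"
  unfolding lapB by simp
 then have ineq: "lam * N \<le> - Re C" by (simp add: mult.commute)
 show ?thesis
 proof (rule ccontr)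
  define m where "m = real CARD('m)"
  define bt where "bt = bochner_norm h 0"
  assume "\<not> ?thesis"
  then have bt: "bt > 0" using bochner_norm_nonneg[of h 0] by (simp add: bt_def)
  have m: "m \<ge> 2" using m2 by (simp add: m_def)
  have mm: "m\<^sup>2 - 2 > 0" using mult_mono[OF m m] m by (simp add: power2_eq_square)
  define q where "q = sqrt (m\<^sup>2 - 1)"
  have q: "q > 0" using mm by (simp add: q_def)
  have sq: "sqrt (m\<^sup>2 * (m\<^sup>2 - 1)) = m * q" using m by (simp add: q_def real_sqrt_mult)
  have N: "N = bt\<^sup>2 / 4" "N > 0" "sqrt N = bt / 2"
   using bt by (simp_all add: N_def bt_def[symmetric] real_sqrt_divide)
  \<comment> \<open>Here sqrt N = |B|/2. Division by N and multiplication by 2 q m, where q =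
    sqrt(m^2-1), turns this into the reverse of the pinching inequality, as lam m is the scalar
    curvature.\<close>
  have "lam * N \<le> 3 * ((m\<^sup>2 - 2) / (m * q)) * (N * (bt / 2))"
   using ineq Bbound unfolding m_def[symmetric] sq N(3) by linarith
  then have "lam * N \<le> (3 * ((m\<^sup>2 - 2) / (m * q)) * (bt / 2)) * N" by (simp add: mult_ac)
  then have 1: "lam \<le> 3 * ((m\<^sup>2 - 2) / (m * q)) * (bt / 2)" using N(2) by (rule mult_right_le_imp_le)
  have e: "2 * q * ((3 * (x / (m * q)) * (bt / 2)) * m) = bt * (3 * x)" for x
   using q m by (simp add: field_simps)
  have "bt * (3 * (m\<^sup>2 - 2)) < 2 * q * (lam * m)"
   using pinch mm unfolding m_def[symmetric] bt_def[symmetric] q_def[symmetric] by (simp add: pos_less_divide_eq)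
  moreover have "2 * q * (lam * m) \<le> 2 * q * ((3 * ((m\<^sup>2 - 2) / (m * q)) * (bt / 2)) * m)"
   using 1 q m by (intro mult_left_mono mult_right_mono) auto
  ultimately show False unfolding e by linarith
 qed
qed

end

section \<open>Linear total differential equations\<close>

text \<open>The system dS(v) = Th(v) S near the origin. The assumption \<open>int\<close> is
  Frobenius integrability, and \<open>C * rh \<le> 1/4\<close> makes the iteration contract on the
  whole ball, independently of the initial value.\<close>

context
 fixes Th :: "'a::euclidean_space => 'a \<Rightarrow>\<^sub>L ('e::euclidean_space \<Rightarrow>\<^sub>L 'e)"
  and Th' :: "'a => 'a \<Rightarrow>\<^sub>L ('a \<Rightarrow>\<^sub>L ('e \<Rightarrow>\<^sub>L 'e))" and rh C :: real
 assumes rh: "rh > 0" and C: "C \<ge> 0" "C * rh \<le> 1/4"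
  and der: "!!z. z \<in> ball 0 rh ==> (Th has_derivative blinfun_apply (Th' z)) (at z)"
  and cont: "continuous_on (ball 0 rh) Th'"
  and bound: "!!z. z \<in> ball 0 rh ==> norm (Th z) \<le> C"
  and int: "!!z u v s. z \<in> ball 0 rh ==> Th' z u v s + Th z v (Th z u s) = Th' z v u s + Th z u (Th z v s)"
begin

text \<open>Integrates the equation along the ray from 0 to \<open>z\<close> only. A fixed point
  solves it in radial directions by construction; the other directions need integrability.\<close>

definition pic :: "'e => ('a => 'e) => 'a => 'e" where
 "pic s0 S z = s0 + integral {0..1} (%t. Th (t *\<^sub>R z) z (S (t *\<^sub>R z)))"

definition C1 :: "('a => 'e) => ('a => 'a \<Rightarrow>\<^sub>L 'e) => bool" where
 "C1 S S' \<longleftrightarrow> (\<forall>z\<in>ball 0 rh. (S has_derivative blinfun_apply (S' z)) (at z)) & continuous_on (ball 0 rh) S'"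

lemma scale_ball: "z \<in> ball 0 rh ==> t \<in> {0..1} ==> t *\<^sub>R z \<in> ball (0::'a) rh"
 using mult_left_le_one_le[of "norm z" t] by (auto simp: abs_of_nonneg)

lemma contTh: "continuous_on (ball 0 rh) Th"
 using der by (auto intro!: continuous_at_imp_continuous_on has_derivative_continuous)

lemma C1_cont: "C1 S S' ==> continuous_on (ball 0 rh) S"
 unfolding C1_def by (auto intro!: continuous_at_imp_continuous_on has_derivative_continuous)

lemma cont_scale:
 assumes "continuous_on (ball 0 rh) f"
 shows "continuous_on (ball 0 rh \<times> {0..1}) (%x. f (snd x *\<^sub>R fst x :: 'a))"
 by (rule continuous_on_compose2[OF assms]) (auto intro!: continuous_intros scale_ball)

lemma cont_scale1:
 assumes "continuous_on (ball 0 rh) f" "z \<in> ball 0 rh"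
 shows "continuous_on {0..1} (%t. f (t *\<^sub>R z :: 'a))"
 by (rule continuous_on_compose2[OF assms(1)]) (auto intro!: continuous_intros scale_ball assms(2))

definition pd :: "('a => 'e) => ('a => 'a \<Rightarrow>\<^sub>L 'e) => 'a => real => 'a => 'e" where
 "pd S S' z t v = t *\<^sub>R Th' (t *\<^sub>R z) v z (S (t *\<^sub>R z)) + Th (t *\<^sub>R z) v (S (t *\<^sub>R z)) + t *\<^sub>R Th (t *\<^sub>R z) z (S' (t *\<^sub>R z) v)"

lemma pd_cont:
 assumes "C1 S S'"
 shows "continuous_on (ball 0 rh \<times> {0..1}) (%(z, t). pd S S' z t v)"
 unfolding pd_def case_prod_unfold
 using assms unfolding C1_def
 by (intro continuous_intros cont_scale cont contTh C1_cont[OF assms]) auto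

lemma pic_der:
 assumes S: "C1 S S'" and z: "z \<in> ball 0 rh"
 shows "(pic s0 S has_derivative (%v. integral {0..1} (%t. pd S S' z t v))) (at z)"
proof -
 have "((%z. integral {0..1} (%t. Th (t *\<^sub>R z) z (S (t *\<^sub>R z)))) has_derivative (%v. integral {0..1} (%t. pd S S' z t v))) (at z)"
 proof (rule leibniz_directional[OF open_ball convex_ball z])
  fix x t assume x: "x \<in> ball (0::'a) rh" and t: "t \<in> {0..1::real}"
  have tx: "t *\<^sub>R x \<in> ball 0 rh" using x t by (rule scale_ball)
  have sc: "((%x::'a. t *\<^sub>R x) has_derivative (%v. t *\<^sub>R v)) (at x)" by (auto intro!: derivative_eq_intros)
  have 1: "((%x. Th (t *\<^sub>R x)) has_derivative (%v. Th' (t *\<^sub>R x) (t *\<^sub>R v))) (at x)"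
   by (rule has_derivative_compose[where g = Th, OF sc der[OF tx]])
  have 2: "((%x. S (t *\<^sub>R x)) has_derivative (%v. S' (t *\<^sub>R x) (t *\<^sub>R v))) (at x)"
   using S tx unfolding C1_def by (intro has_derivative_compose[where g = S, OF sc]) auto
  have 3: "((%x. Th (t *\<^sub>R x) x) has_derivative (%v. Th (t *\<^sub>R x) v + Th' (t *\<^sub>R x) (t *\<^sub>R v) x)) (at x)"
   by (rule blinfun.FDERIV[OF 1 has_derivative_ident])
  have "((%x. Th (t *\<^sub>R x) x (S (t *\<^sub>R x))) has_derivative
    (%v. Th (t *\<^sub>R x) x (S' (t *\<^sub>R x) (t *\<^sub>R v)) + (Th (t *\<^sub>R x) v + Th' (t *\<^sub>R x) (t *\<^sub>R v) x) (S (t *\<^sub>R x)))) (at x)"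
   by (rule blinfun.FDERIV[OF 3 2])
  then show "((%x. Th (t *\<^sub>R x) x (S (t *\<^sub>R x))) has_derivative pd S S' x t) (at x)"
   by (rule has_derivative_eq_rhs)
    (auto simp: pd_def[abs_def] blinfun.bilinear_simps algebra_simps)
 next
  show "continuous_on (ball 0 rh \<times> {0..1}) (%(x, t). pd S S' x t v)" for v by (rule pd_cont[OF S])
  show "continuous_on {0..1} (%t. Th (t *\<^sub>R x) x (S (t *\<^sub>R x)))" if "x \<in> ball 0 rh" for x
   by (intro continuous_intros cont_scale1[OF _ that] contTh C1_cont[OF S])
 qed
 then show ?thesis unfolding pic_def[abs_def] by (auto intro!: derivative_eq_intros)
qed

lemma pic_C1:
 assumes S: "C1 S S'" shows "\<exists>D. C1 (pic s0 S) D"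
proof -
 define D where "D = (%z. Blinfun (%v. integral {0..1} (%t. pd S S' z t v)))"
 have app: "blinfun_apply (D z) = (%v. integral {0..1} (%t. pd S S' z t v))" if "z \<in> ball 0 rh" for z
  unfolding D_def by (rule bounded_linear_Blinfun_apply[OF has_derivative_bounded_linear[OF pic_der[OF S that]]])
 have "continuous_on (ball 0 rh) D"
 proof (rule continuous_on_blinfun_componentwise)
  fix i :: 'a
  have "continuous_on (ball 0 rh) (%z. integral (cbox 0 1) (%t. pd S S' z t i))"
   by (rule integral_continuous_on_param) (use pd_cont[OF S, of i] in simp)
  then show "continuous_on (ball 0 rh) (%z. blinfun_apply (D z) i)"
   by (rule continuous_on_eq) (simp add: app)
 qed
 then show ?thesis unfolding C1_def using pic_der[OF S] app by (intro exI[of _ D]) auto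
qed

text \<open>Up to the defect of \<open>S\<close> from being a solution, the derivative of the Picard iterate is
 what it should be; this is where integrability enters.\<close>

lemma pic_defect:
 assumes S: "C1 S S'" and z: "z \<in> ball 0 rh"
 shows "integral {0..1} (%t. pd S S' z t v) - Th z v (S z)
  = integral {0..1} (%t. t *\<^sub>R (Th (t *\<^sub>R z) z (S' (t *\<^sub>R z) v - Th (t *\<^sub>R z) v (S (t *\<^sub>R z)))
    - Th (t *\<^sub>R z) v (S' (t *\<^sub>R z) z - Th (t *\<^sub>R z) z (S (t *\<^sub>R z)))))"
proof -
 \<comment> \<open>The derivative in \<open>t\<close> of
   \<open>t *\<^sub>R Th (t *\<^sub>R z) v (S (t *\<^sub>R z))\<close>, so its integral is the value
   the derivative of the iterate ought to have.\<close>
 define q where "q = (%t. Th (t *\<^sub>R z) v (S (t *\<^sub>R z)) + t *\<^sub>R (Th' (t *\<^sub>R z) z v (S (t *\<^sub>R z)) + Th (t *\<^sub>R z) v (S' (t *\<^sub>R z) z)))"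
 have "(q has_integral (1 *\<^sub>R Th (1 *\<^sub>R z) v (S (1 *\<^sub>R z)) - 0 *\<^sub>R Th (0 *\<^sub>R z) v (S (0 *\<^sub>R z)))) {0..1}"
 proof (rule fundamental_theorem_of_calculus)
  fix t :: real assume t: "t \<in> {0..1}"
  have tz: "t *\<^sub>R z \<in> ball 0 rh" using z t by (rule scale_ball)
  have sc: "((%t. t *\<^sub>R z) has_derivative (%r. r *\<^sub>R z)) (at t)" by (auto intro!: derivative_eq_intros)
  have 1: "((%t. Th (t *\<^sub>R z)) has_derivative (%r. Th' (t *\<^sub>R z) (r *\<^sub>R z))) (at t)"
   by (rule has_derivative_compose[where g = Th, OF sc der[OF tz]])
  have 2: "((%t. S (t *\<^sub>R z)) has_derivative (%r. S' (t *\<^sub>R z) (r *\<^sub>R z))) (at t)"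
   using S tz unfolding C1_def by (intro has_derivative_compose[where g = S, OF sc]) auto
  have 3: "((%t. Th (t *\<^sub>R z) v) has_derivative (%r. Th' (t *\<^sub>R z) (r *\<^sub>R z) v)) (at t)"
   using blinfun.FDERIV[OF 1 has_derivative_const[of v]] by simp
  have 4: "((%t. Th (t *\<^sub>R z) v (S (t *\<^sub>R z))) has_derivative
    (%r. Th (t *\<^sub>R z) v (S' (t *\<^sub>R z) (r *\<^sub>R z)) + Th' (t *\<^sub>R z) (r *\<^sub>R z) v (S (t *\<^sub>R z)))) (at t)"
   by (rule blinfun.FDERIV[OF 3 2])
  have "((%t. t *\<^sub>R Th (t *\<^sub>R z) v (S (t *\<^sub>R z))) has_derivative (%r. r *\<^sub>R q t)) (at t)"
   by (rule has_derivative_eq_rhs[OF has_derivative_scaleR[OF has_derivative_ident 4]])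
    (auto simp: q_def blinfun.bilinear_simps algebra_simps)
  then show "((%t. t *\<^sub>R Th (t *\<^sub>R z) v (S (t *\<^sub>R z))) has_vector_derivative q t) (at t within {0..1})"
   unfolding has_vector_derivative_def by (rule has_derivative_at_withinI)
 qed simp
 then have q: "(q has_integral Th z v (S z)) {0..1}" by simp
 have "continuous_on {0..1} (%t. case (z, t) of (z, t) => pd S S' z t v)"
  by (rule continuous_on_compose2[OF pd_cont[OF S]]) (use z in \<open>auto intro!: continuous_intros\<close>)
 then have "((%t. pd S S' z t v) has_integral integral {0..1} (%t. pd S S' z t v)) {0..1}"
  by (intro integrable_integral integrable_continuous_interval) simp
 from has_integral_diff[OF this q]
 have "((%t. pd S S' z t v - q t) has_integral (integral {0..1} (%t. pd S S' z t v) - Th z v (S z))) {0..1}" .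
 moreover have "pd S S' z t v - q t = t *\<^sub>R (Th (t *\<^sub>R z) z (S' (t *\<^sub>R z) v - Th (t *\<^sub>R z) v (S (t *\<^sub>R z)))
    - Th (t *\<^sub>R z) v (S' (t *\<^sub>R z) z - Th (t *\<^sub>R z) z (S (t *\<^sub>R z))))" if t: "t \<in> {0..1}" for t
 proof -
  have tz: "t *\<^sub>R z \<in> ball 0 rh" using z t by (rule scale_ball)
  have i: "Th' (t *\<^sub>R z) v z (S (t *\<^sub>R z)) = Th' (t *\<^sub>R z) z v (S (t *\<^sub>R z))
    + Th (t *\<^sub>R z) v (Th (t *\<^sub>R z) z (S (t *\<^sub>R z))) - Th (t *\<^sub>R z) z (Th (t *\<^sub>R z) v (S (t *\<^sub>R z)))"
   using int[OF tz, of v z "S (t *\<^sub>R z)"] by (simp add: algebra_simps)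
  show ?thesis unfolding pd_def q_def i by (simp add: blinfun.bilinear_simps algebra_simps)
 qed
 ultimately have "((%t. t *\<^sub>R (Th (t *\<^sub>R z) z (S' (t *\<^sub>R z) v - Th (t *\<^sub>R z) v (S (t *\<^sub>R z)))
    - Th (t *\<^sub>R z) v (S' (t *\<^sub>R z) z - Th (t *\<^sub>R z) z (S (t *\<^sub>R z))))) has_integral
   (integral {0..1} (%t. pd S S' z t v) - Th z v (S z))) {0..1}"
  by (rule has_integral_eq[rotated])
 then show ?thesis by (rule integral_unique[symmetric])
qed

lemma Th_bound:
 assumes "w \<in> ball 0 rh" shows "norm (Th w u s) \<le> C * norm u * norm s"
proof -
 have "norm (Th w u s) \<le> norm (Th w u) * norm s" by (rule norm_blinfun)
 also have "... \<le> (norm (Th w) * norm u) * norm s" by (intro mult_right_mono norm_blinfun) simp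
 also have "... \<le> (C * norm u) * norm s" using bound[OF assms] by (intro mult_right_mono) auto
 finally show ?thesis .
qed

lemma Th_bound_small:
 assumes "w \<in> ball 0 rh" "z \<in> ball 0 rh" shows "norm (Th w z s) \<le> 1/4 * norm s"
proof -
 have "C * norm z \<le> C * rh" using assms C by (intro mult_left_mono) auto
 then have "C * norm z \<le> 1/4" using C by simp
 then show ?thesis using order_trans[OF Th_bound[OF assms(1)] mult_right_mono[of "C * norm z" "1/4" "norm s"]] by simp
qed

text \<open>The two terms of the defect formula each contribute at most a quarter of the old defect,
  by the smallness of \<open>C * rh\<close>.\<close>

lemma pic_defect_bound:
 assumes S: "C1 S S'" and z: "z \<in> ball 0 rh"
  and e: "!!z v. z \<in> ball 0 rh ==> norm (S' z v - Th z v (S z)) \<le> ep * norm v" and e0: "ep \<ge> 0"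
 shows "norm (integral {0..1} (%t. pd S S' z t v) - Th z v (S z)) \<le> 1/2 * ep * norm v"
 unfolding pic_defect[OF S z]
proof -
 let ?g = "%t. t *\<^sub>R (Th (t *\<^sub>R z) z (S' (t *\<^sub>R z) v - Th (t *\<^sub>R z) v (S (t *\<^sub>R z)))
    - Th (t *\<^sub>R z) v (S' (t *\<^sub>R z) z - Th (t *\<^sub>R z) z (S (t *\<^sub>R z))))"
 have c: "continuous_on (ball 0 rh) S'" using S by (simp add: C1_def)
 have "continuous_on {0..1} ?g"
  by (intro continuous_intros cont_scale1[OF _ z] contTh c C1_cont[OF S])
 then have "?g integrable_on {0..1}" by (rule integrable_continuous_interval)
 moreover have "norm (?g t) \<le> 1/2 * ep * norm v" if t: "t \<in> {0..1}" for t
 proof -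
  have tz: "t *\<^sub>R z \<in> ball 0 rh" using z t by (rule scale_ball)
  have 1: "norm (Th (t *\<^sub>R z) z (S' (t *\<^sub>R z) v - Th (t *\<^sub>R z) v (S (t *\<^sub>R z)))) \<le> 1/4 * (ep * norm v)"
   using order_trans[OF Th_bound_small[OF tz z] mult_left_mono[OF e[OF tz, of v], of "1/4"]] by simp
  have "norm (Th (t *\<^sub>R z) v (S' (t *\<^sub>R z) z - Th (t *\<^sub>R z) z (S (t *\<^sub>R z)))) \<le> C * norm v * (ep * norm z)"
   using C by (intro order_trans[OF Th_bound[OF tz]] mult_left_mono e[OF tz]) auto
  also have "... = (C * norm z) * (ep * norm v)" by simp
  also have "... \<le> 1/4 * (ep * norm v)"
  proof (intro mult_right_mono)
   have "C * norm z \<le> C * rh" using z C by (intro mult_left_mono) auto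
   then show "C * norm z \<le> 1/4" using C by simp
  qed (use e0 in auto)
  finally have 2: "norm (Th (t *\<^sub>R z) v (S' (t *\<^sub>R z) z - Th (t *\<^sub>R z) z (S (t *\<^sub>R z)))) \<le> 1/4 * (ep * norm v)" .
  have "norm (?g t) \<le> \<bar>t\<bar> * (1/4 * (ep * norm v) + 1/4 * (ep * norm v))"
   unfolding norm_scaleR by (intro mult_left_mono order_trans[OF norm_triangle_ineq4] add_mono 1 2) simp
  also have "... \<le> 1 * (1/4 * (ep * norm v) + 1/4 * (ep * norm v))" using t e0 by (intro mult_right_mono) auto
  finally show ?thesis by simp
 qed
 ultimately have "norm (integral {0..1} ?g) \<le> integral {0..1} (%t::real. 1/2 * ep * norm v)"
  by (intro integral_norm_bound_integral) auto
 then show "norm (integral {0..1} ?g) \<le> 1/2 * ep * norm v" by simp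
qed

lemma pic_diff_bound:
 assumes c: "continuous_on (ball 0 rh) S" "continuous_on (ball 0 rh) T" and z: "z \<in> ball 0 rh"
  and d: "!!z. z \<in> ball 0 rh ==> norm (S z - T z) \<le> d"
 shows "norm (pic s0 S z - pic s0 T z) \<le> 1/4 * d"
proof -
 have i: "(%t. Th (t *\<^sub>R z) z (S (t *\<^sub>R z))) integrable_on {0..1}" if "continuous_on (ball 0 rh) S" for S
  by (intro integrable_continuous_interval continuous_intros cont_scale1[OF _ z] contTh that)
 have "pic s0 S z - pic s0 T z = integral {0..1} (%t. Th (t *\<^sub>R z) z (S (t *\<^sub>R z) - T (t *\<^sub>R z)))"
  unfolding pic_def using Henstock_Kurzweil_Integration.integral_diff[OF i[OF c(1)] i[OF c(2)]]
  by (simp add: blinfun.bilinear_simps)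
 also have "norm ... \<le> integral {0..1} (%t::real. 1/4 * d)"
 proof (rule integral_norm_bound_integral)
  show "(%t. Th (t *\<^sub>R z) z (S (t *\<^sub>R z) - T (t *\<^sub>R z))) integrable_on {0..1}"
   by (intro integrable_continuous_interval continuous_intros cont_scale1[OF _ z] contTh c)
  show "norm (Th (t *\<^sub>R z) z (S (t *\<^sub>R z) - T (t *\<^sub>R z))) \<le> 1/4 * d" if "t \<in> {0..1}" for t
   using Th_bound_small[OF scale_ball[OF z that] z, of "S (t *\<^sub>R z) - T (t *\<^sub>R z)"] d[OF scale_ball[OF z that]] by linarith
 qed (intro integrable_continuous_interval continuous_intros)
 finally show ?thesis by simp
qed

text \<open>The iterates converge with ratio 1/4. The defect of the derivative satisfies a recursion
  with factor 1/2 from the old defect plus at most 1/4 from the change of the iterate, hence decays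
  like (3/4)^k. So the derivatives converge to the desired right-hand side.\<close>

lemma picard_solution:
 "\<exists>S. S 0 = s0 & (\<forall>z\<in>ball 0 rh. (S has_derivative (%v. Th z v (S z))) (at z))"
proof -
 define S where "S = (%k. (pic s0 ^^ k) (%z. s0))"
 have S0: "S 0 = (%z. s0)" and SS: "S (Suc k) = pic s0 (S k)" for k by (simp_all add: S_def)
 have ex: "\<exists>D. C1 (S k) D" for k
 proof (induction k)
  case 0
  have "C1 (S 0) (%z. 0)" unfolding S0 C1_def by (auto intro!: derivative_eq_intros)
  then show ?case by blast
 next
  case (Suc k)
  then show ?case using pic_C1 SS by metis
 qed
 then obtain D where D: "!!k. C1 (S k) (D k)" by metis
 note cS = C1_cont[OF D]
 define d where "d = norm s0"
 have d: "norm (S (Suc k) z - S k z) \<le> d * (1/4) ^ k" if "z \<in> ball 0 rh" for k z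
  using that
 proof (induction k arbitrary: z)
  case 0
  have "norm (integral {0..1} (%t. Th (t *\<^sub>R z) z s0)) \<le> integral {0..1} (%t::real. 1/4 * norm s0)"
  proof (rule integral_norm_bound_integral)
   show "(%t. Th (t *\<^sub>R z) z s0) integrable_on {0..1}"
    by (intro integrable_continuous_interval continuous_intros cont_scale1[OF _ 0] contTh)
   show "norm (Th (t *\<^sub>R z) z s0) \<le> 1/4 * norm s0" if "t \<in> {0..1}" for t
    by (rule Th_bound_small[OF scale_ball[OF 0 that] 0])
  qed (intro integrable_continuous_interval continuous_intros)
  also have "... \<le> d" by (simp add: d_def)
  finally have "norm (integral {0..1} (%t. Th (t *\<^sub>R z) z s0)) \<le> d" .
  moreover have "S (Suc 0) z - S 0 z = integral {0..1} (%t. Th (t *\<^sub>R z) z s0)"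
   by (simp add: SS S0 pic_def)
  ultimately show ?case by simp
 next
  case (Suc k)
  have "norm (S (Suc (Suc k)) z - S (Suc k) z) \<le> 1/4 * (d * (1/4) ^ k)"
   unfolding SS[of "Suc k"] SS[of k]
   by (rule pic_diff_bound[OF cS[of "Suc k", unfolded SS] cS Suc.prems]) (use Suc.IH in \<open>simp add: SS\<close>)
  then show ?case by simp
 qed
 \<comment> \<open>The value for which the change of the iterate, of size at most
   \<open>C * d * (1/4) ^ k\<close>, is absorbed into a quarter of the bound
   \<open>K * (3/4) ^ k\<close>.\<close>
 define K where "K = 4 * C * d"
 have K: "K \<ge> 0" using C by (simp add: K_def d_def)
 have e: "norm (D k z v - Th z v (S k z)) \<le> K * (3/4) ^ k * norm v" if "z \<in> ball 0 rh" for k z v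
  using that
 proof (induction k arbitrary: z v)
  case 0
  have "(S 0 has_derivative blinfun_apply (D 0 z)) (at z)" using D[of 0] 0 by (simp add: C1_def)
  moreover have "(S 0 has_derivative (%v. 0)) (at z)" unfolding S0 by simp
  ultimately have "blinfun_apply (D 0 z) = (%v. 0)" by (rule has_derivative_unique)
  then have "norm (D 0 z v - Th z v (S 0 z)) = norm (Th z v s0)" by (simp add: S0)
  also have "... \<le> C * norm v * norm s0" by (rule Th_bound[OF 0])
  also have "... \<le> K * norm v" using C by (simp add: K_def d_def mult_right_mono mult_ac)
  finally show ?case by simp
 next
  case (Suc k)
  have "(S (Suc k) has_derivative blinfun_apply (D (Suc k) z)) (at z)" using D[of "Suc k"] Suc.prems by (simp add: C1_def)
  moreover have "(S (Suc k) has_derivative (%v. integral {0..1} (%t. pd (S k) (D k) z t v))) (at z)"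
   unfolding SS by (rule pic_der[OF D Suc.prems])
  ultimately have eq: "blinfun_apply (D (Suc k) z) = (%v. integral {0..1} (%t. pd (S k) (D k) z t v))"
   by (rule has_derivative_unique)
  have 1: "norm (D (Suc k) z v - Th z v (S k z)) \<le> 1/2 * (K * (3/4) ^ k) * norm v"
   unfolding eq using K by (intro pic_defect_bound[OF D Suc.prems Suc.IH]) auto
  have "norm (Th z v (S (Suc k) z - S k z)) \<le> C * norm v * (d * (1/4) ^ k)"
   using C by (intro order_trans[OF Th_bound[OF Suc.prems]] mult_left_mono d[OF Suc.prems]) auto
  also have "... \<le> C * norm v * (d * (3/4) ^ k)"
   using C by (intro mult_left_mono power_mono) (auto simp: d_def)
  also have "... = 1/4 * (K * (3/4) ^ k) * norm v" by (simp add: K_def)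
  finally have 2: "norm (Th z v (S (Suc k) z - S k z)) \<le> 1/4 * (K * (3/4) ^ k) * norm v" .
  have "D (Suc k) z v - Th z v (S (Suc k) z) = (D (Suc k) z v - Th z v (S k z)) - Th z v (S (Suc k) z - S k z)"
   by (simp add: blinfun.bilinear_simps)
  then have "norm (D (Suc k) z v - Th z v (S (Suc k) z)) \<le> 1/2 * (K * (3/4) ^ k) * norm v + 1/4 * (K * (3/4) ^ k) * norm v"
   by (simp only:) (rule order_trans[OF norm_triangle_ineq4 add_mono[OF 1 2]])
  then show ?case by (simp add: mult_ac)
 qed
 define L where "L = (%z. s0 + suminf (%i. S (Suc i) z - S i z))"
 have ul0: "uniform_limit (ball 0 rh) (%n z. \<Sum>i<n. S (Suc i) z - S i z) (%z. suminf (%i. S (Suc i) z - S i z)) sequentially"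
  by (rule Weierstrass_m_test[where M = "%k. d * (1/4) ^ k"]) (use d in \<open>auto intro!: summable_mult\<close>)
 have tele: "(\<Sum>i<n. S (Suc i) z - S i z) = S n z - s0" for n z
  using sum_lessThan_telescope[of "%i. S i z" n] by (simp add: S0)
 have ul: "uniform_limit (ball 0 rh) S L sequentially"
 proof (rule uniform_limitI)
  fix e :: real assume "e > 0"
  from uniform_limitD[OF ul0 this]
  show "\<forall>\<^sub>F n in sequentially. \<forall>x\<in>ball 0 rh. dist (S n x) (L x) < e"
   unfolding tele by eventually_elim (auto simp: L_def dist_norm algebra_simps)
 qed
 have S00: "S n 0 = s0" for n by (induction n) (simp_all add: S0 SS pic_def)
 have L0: "L 0 = s0" by (simp add: L_def S00)
 \<comment> \<open>The limit of the iterates is differentiable with the limit derivative, because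
   the derivatives converge uniformly on the ball to \<open>Th x h (L x)\<close>.\<close>
 have "\<exists>g. \<forall>x\<in>ball 0 rh. (%n. S n x) \<longlonglongrightarrow> g x & (g has_derivative (%v. Th x v (L x))) (at x within ball 0 rh)"
 proof (rule has_derivative_sequence)
  show "convex (ball (0::'a) rh)" by simp
  show "(S n has_derivative blinfun_apply (D n x)) (at x within ball 0 rh)" if "x \<in> ball 0 rh" for n x
   using D[of n] that by (auto simp: C1_def has_derivative_at_withinI)
  show "(0::'a) \<in> ball 0 rh" using rh by simp
  show "(%n. S n 0) \<longlonglongrightarrow> s0" by (simp add: S00)
  fix e :: real assume e0: "e > 0"
  have c1: "\<forall>\<^sub>F n in sequentially. \<forall>x\<in>ball 0 rh. dist (S n x) (L x) < e / (2 * (C + 1))"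
   using uniform_limitD[OF ul, of "e / (2 * (C + 1))"] e0 C by simp
  have "(%n. K * (3/4::real) ^ n) \<longlonglongrightarrow> K * 0"
   by (intro tendsto_mult_left LIMSEQ_power_zero) simp
  then have c2: "\<forall>\<^sub>F n in sequentially. K * (3/4) ^ n < e / 2"
   using e0 by (intro order_tendstoD) auto
  from c1 c2 show "\<forall>\<^sub>F n in sequentially. \<forall>x\<in>ball 0 rh. \<forall>h. norm (blinfun_apply (D n x) h - Th x h (L x)) \<le> e * norm h"
  proof eventually_elim
   case (elim n)
   show ?case
   proof (intro ballI allI)
    fix x h assume x: "x \<in> ball (0::'a) rh"
    have "norm (Th x h (S n x - L x)) \<le> C * norm h * (e / (2 * (C + 1)))"
     using C elim(1) x by (intro order_trans[OF Th_bound[OF x]] mult_left_mono) (auto simp: dist_norm less_imp_le)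
    also have "... = norm h * (e / 2) * (C / (C + 1))" using C by (simp add: field_simps)
    also have "... \<le> norm h * (e / 2) * 1" using C e0 by (intro mult_left_mono) auto
    finally have 1: "norm (Th x h (S n x - L x)) \<le> norm h * (e / 2)" by simp
    have 2: "norm (D n x h - Th x h (S n x)) \<le> e / 2 * norm h"
     using elim(2) by (intro order_trans[OF e[OF x]] mult_right_mono) auto
    have "D n x h - Th x h (L x) = (D n x h - Th x h (S n x)) + Th x h (S n x - L x)"
     by (simp add: blinfun.bilinear_simps)
    then have "norm (D n x h - Th x h (L x)) \<le> e / 2 * norm h + norm h * (e / 2)"
     by (simp only:) (rule order_trans[OF norm_triangle_ineq add_mono[OF 2 1]])
    then show "norm (D n x h - Th x h (L x)) \<le> e * norm h" by (simp add: algebra_simps)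
   qed
  qed
 qed
 then obtain g where g: "!!x. x \<in> ball 0 rh ==> (%n. S n x) \<longlonglongrightarrow> g x"
  "!!x. x \<in> ball 0 rh ==> (g has_derivative (%v. Th x v (L x))) (at x within ball 0 rh)" by blast
 have gL: "g x = L x" if "x \<in> ball 0 rh" for x
  using g(1)[OF that] tendsto_uniform_limitI[OF ul that] LIMSEQ_unique by blast
 have "(L has_derivative (%v. Th x v (L x))) (at x)" if "x \<in> ball 0 rh" for x
 proof -
  have "(g has_derivative (%v. Th x v (L x))) (at x)"
   using g(2)[OF that] at_within_open[OF that open_ball] by simp
  then show ?thesis
   by (rule has_derivative_transform_within_open[OF _ open_ball that]) (rule gL)
 qed
 then show ?thesis using L0 by blast
qed

end

section \<open>Consequences of the maximum principle\<close>

text \<open>The estimate of \<open>bochner_max\<close> uses a numerical Einstein constant, so the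
  metric is first restricted to a ball on which Schur's lemma makes the scalar curvature constant,
  and then pulled back to normal coordinates at \<open>p\<close>.\<close>

lemma bochner_vanish_at_max:
 fixes h :: "'m::finite local_metric"
 assumes k: "kmetric V h" and m: "CARD('m) \<ge> 2"
  and E: "!!a b z. z \<in> V ==> ricci h a b z = cor (cscal h z / real CARD('m)) * h z $ a $ b"
  and p: "p \<in> V" and max: "!!z. z \<in> V ==> bochner_norm h z \<le> bochner_norm h p"
  and pinch: "bochner_norm h p < 2 * sqrt ((real CARD('m))\<^sup>2 - 1) * cscal h p / (3 * ((real CARD('m))\<^sup>2 - 2))"
 shows "bochner_norm h p = 0"
proof -
 have "open V" using k by (simp add: kmetric_def)
 then obtain r where r: "r > 0" "ball p r \<subseteq> V" using p openE by blast
 have c: "cor (cscal h z) = cor (cscal h p)" if z: "z \<in> ball p r" for z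
 proof (rule has_derivative_zero_unique[OF convex_ball _ z])
  show "p \<in> ball p r" using r by simp
  show "((%z. cor (cscal h z)) has_derivative (%v. 0)) (at x within ball p r)" if "x \<in> ball p r" for x
   by (rule has_derivative_at_withinI, rule schur[OF k E m]) (use that r(2) in auto)
 qed
 define lam where "lam = cscal h p / real CARD('m)"
 have kB: "kmetric (ball p r) h" by (rule kmetric_mono[OF k r(2) open_ball])
 have pB: "p \<in> ball p r" using r by simp
 obtain U f where n: "pb (ball p r) h U f" "0 \<in> U" "f 0 = p" "pullback_form f h 0 = mat 1"
  "!!al bt ga. dz ga (%w. pullback_form f h w $ al $ bt) 0 = 0"
  using normal_coordinates[OF kB pB] by blast
 interpret pb "ball p r" h U f by (rule n(1))
 have E': "ricci h a b z = cor lam * h z $ a $ b" if "z \<in> ball p r" for a b z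
  using E[of z a b] that r(2) c[OF that] by (auto simp: lam_def)
 interpret nke U g lam
  by unfold_locales (use n m einstein_pullback[where L = "%_. cor lam", OF E'] in auto)
 have "bochner_norm g 0 = 0"
 proof (rule bochner_max)
  show "bochner_norm g z \<le> bochner_norm g 0" if "z \<in> U" for z
   using max[of "f z"] fU[OF that] r(2) bochner_norm_pullback[OF that] bochner_norm_pullback[OF n(2)] n(3) by auto
  show "bochner_norm g 0 < 2 * sqrt ((real CARD('m))\<^sup>2 - 1) * (lam * real CARD('m)) / (3 * ((real CARD('m))\<^sup>2 - 2))"
   using pinch m by (simp add: bochner_norm_pullback[OF n(2)] n(3) lam_def)
 qed
 then show ?thesis by (simp add: bochner_norm_pullback[OF n(2)] n(3))
qed

lemma frame_components_mat_1: "frame_components (mat 1) T a b c d = T a b c d"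
 unfolding frame_components_fc2
 by (simp add: fc2_def mat_def mult_delta_left mult_delta_right sum_if_const if_distrib[of cnj] cong: if_cong)

lemma bochner_norm_zero:
 assumes "kmetric V h" "z \<in> V" "bochner_norm h z = 0"
 shows "bochner h al bt ga dt z = 0"
proof -
 obtain P where P: "unitary_frame (h z) P"
  using unitary_frame_exists assms unfolding kmetric_def by blast
 let ?T = "%al bt ga dt. bochner h al bt ga dt z"
 have "(\<Sum>a b c d. (cmod (frame_components P ?T a b c d))\<^sup>2) = 0"
  using assms(3) unfolding bochner_norm_eq[of h z, OF P] frame_norm_def by simp
 then have 0: "frame_components P ?T = (%a b c d. 0)"
  by (intro ext) (simp add: sum_nonneg_eq_0_iff sum_nonneg)
 obtain Q where Q: "Q ** P = mat 1"
  using P unfolding unitary_frame_iff by (metis matrix_left_right_inverse matrix_mul_assoc)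
 have "?T al bt ga dt = frame_components Q (frame_components P ?T) al bt ga dt"
  unfolding frame_components_compose Q frame_components_mat_1 ..
 also have "... = 0" unfolding 0 by (simp add: frame_components_def)
 finally show ?thesis .
qed

lemma constant_holomorphic_curvature:
 fixes h :: "'m::finite local_metric"
 assumes "!!a b. ricci h a b z = cor (cscal h z / real CARD('m)) * h z $ a $ b"
  and "!!al bt ga dt. bochner h al bt ga dt z = 0"
 shows "curv h al bt ga dt z = - cor (cscal h z / (real CARD('m) * (real CARD('m) + 1))) *
  (h z $ al $ bt * h z $ ga $ dt + h z $ ga $ bt * h z $ al $ dt)"
proof -
 define m where "m = real CARD('m)"
 define X where "X = h z $ al $ bt * h z $ ga $ dt + h z $ ga $ bt * h z $ al $ dt"
 have m: "m > 0" by (simp add: m_def)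
 have "curv h al bt ga dt z + cor (1 / (m + 2)) * (cor (cscal h z / m) * (2 * X))
   - cor (cscal h z / ((m + 1) * (m + 2))) * X = 0"
  using assms(2)[of al bt ga dt] unfolding bochner_def Let_def assms(1) X_def m_def
  by (simp add: algebra_simps)
 then have "curv h al bt ga dt z = cor (cscal h z / ((m + 1) * (m + 2)) - 1 / (m + 2) * (cscal h z / m) * 2) * X"
  by (simp add: algebra_simps)
 also have "cscal h z / ((m + 1) * (m + 2)) - 1 / (m + 2) * (cscal h z / m) * 2 = - (cscal h z / (m * (m + 1)))"
  using m by (simp add: divide_simps) algebra
 finally show ?thesis unfolding X_def m_def by simp
qed

text \<open>To treat $\partial_\gamma$ and $\partial_{\bar\gamma}$ uniformly, the directions are indexed by
 pairs whose first component is true for the unbarred ones.\<close>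

definition wdz :: "bool \<times> 'm::finite => (complex^'m => complex) => complex^'m => complex" where
 "wdz a f z = (if fst a then dz (snd a) f z else dzbar (snd a) f z)"

definition wco :: "bool \<times> 'm::finite => complex^'m => complex" where
 "wco a v = (if fst a then v $ snd a else cnj (v $ snd a))"

lemma sum_wdir: "(\<Sum>a. F a) = (\<Sum>ga. F (True, ga)) + (\<Sum>ga. F (False, ga :: 'm::finite) :: complex)"
proof -
 have "(\<Sum>a. F a) = (\<Sum>b ga. F (b, ga))"
  unfolding sum.cartesian_product UNIV_Times_UNIV by simp
 then show ?thesis by (simp add: UNIV_bool add.commute)
qed

lemma has_derivative_wdz:
 "f differentiable (at z) ==> (f has_derivative (%v. \<Sum>a. wco a v * wdz a f z)) (at z)"
 by (rule has_derivative_eq_rhs[OF has_derivative_wirtinger])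
  (simp_all add: sum_wdir wco_def wdz_def sum.distrib mult_ac fun_eq_iff)

lemma wco_linear: "linear (wco a)"
 by (rule linearI) (simp_all add: wco_def scaleR_conv_of_real[where 'a = complex])

text \<open>Linear systems with complex coefficients in all unbarred and barred directions. The
  radius is found before the initial value is given, so that several solutions can be taken on one
  common ball.\<close>

lemma frobenius:
 fixes N :: "bool \<times> 'm::finite => 'i::finite => 'i => complex^'m => complex"
 assumes U: "open U" "p \<in> U" and sm: "!!a i j. smooth_on U (N a i j)"
  and int: "!!z a b i j. z \<in> U ==> wdz b (N a i j) z + (\<Sum>k. N a i k z * N b k j z)
    = wdz a (N b i j) z + (\<Sum>k. N b i k z * N a k j z)"
 shows "\<exists>r>0. ball p r \<subseteq> U & (\<forall>s0. \<exists>S. S p = s0 & (\<forall>z\<in>ball p r.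
   (S has_derivative (%v. \<Sum>a. wco a v *s (\<chi> i. \<Sum>j. N a i j z * S z $ j))) (at z)))"
proof -
 \<comment> \<open>The elementary operator that sends a direction \<open>v\<close> and a vector
   \<open>s\<close> to a multiple of the basis vector \<open>i\<close>; the coefficient form
   \<open>Th\<close> is a sum of these, so its derivative is computed entry by entry.\<close>
 define L :: "bool \<times> 'm => 'i => 'i => complex => (complex^'m) \<Rightarrow>\<^sub>L ((complex^'i) \<Rightarrow>\<^sub>L (complex^'i))"
  where "L = (%a i j c. Blinfun (%v. Blinfun (%s. axis i (c * wco a v * s $ j))))"
 have L1: "blinfun_apply (Blinfun (%s. axis i (c * wco a v * s $ j) :: complex^'i)) = (%s. axis i (c * wco a v * s $ j))" for a i j c and v :: "complex^'m"
  by (rule bounded_linear_Blinfun_apply, rule linear_conv_bounded_linear[THEN iffD1], rule linearI)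
   (simp_all add: vec_eq_iff axis_def algebra_simps)
 have L: "blinfun_apply (blinfun_apply (L a i j c) v) s = axis i (c * wco a v * s $ j)" for a i j c v s
 proof -
  have "blinfun_apply (L a i j c) = (%v. Blinfun (%s. axis i (c * wco a v * s $ j)))"
   unfolding L_def
   by (rule bounded_linear_Blinfun_apply, rule linear_conv_bounded_linear[THEN iffD1], rule linearI; rule blinfun_eqI, unfold blinfun.bilinear_simps L1)
    (simp_all add: linear_add[OF wco_linear] linear_scale[OF wco_linear] vec_eq_iff axis_def algebra_simps)
  then show ?thesis by (simp add: L1)
 qed
 have bl: "bounded_linear (L a i j)" for a i j
  by (rule linear_conv_bounded_linear[THEN iffD1], rule linearI; (rule blinfun_eqI)+, unfold blinfun.bilinear_simps L)
   (simp_all add: vec_eq_iff axis_def algebra_simps)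
 define Th where "Th = (%z. \<Sum>a j i. L a i j (N a i j (p + z)))"
 define Th' where "Th' = (%z. Blinfun (%u. \<Sum>a j i. L a i j (fder (N a i j) (at (p + z)) u)))"
 have app: "blinfun_apply (blinfun_apply (\<Sum>a j i. L a i j (F a i j)) v) s $ i
   = (\<Sum>a. wco a v * (\<Sum>j. F a i j * s $ j))" for F v s i
  by (simp add: blinfun.sum_left L sum_component axis_def sum_distrib_left mult_ac if_distrib cong: if_cong)
 have appTh: "blinfun_apply (blinfun_apply (Th z) v) s = (\<Sum>a. wco a v *s (\<chi> i. \<Sum>j. N a i j (p + z) * s $ j))" for z v s
  unfolding Th_def by (simp add: vec_eq_iff app)
 obtain r0 where r0: "r0 > 0" "cball p r0 \<subseteq> U" using U open_contains_cball by blast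
 have der0: "(Th has_derivative (%u. \<Sum>a j i. L a i j (fder (N a i j) (at (p + z)) u))) (at z)"
  if "p + z \<in> U" for z
  unfolding Th_def
 proof (intro has_derivative_sum bounded_linear.has_derivative[OF bl])
  fix a i j
  have 1: "((%z. p + z) has_derivative (%u. u)) (at z)" by (auto intro!: derivative_eq_intros)
  have 2: "(N a i j has_derivative fder (N a i j) (at (p + z))) (at (p + z))"
   using smooth_on_differentiable[OF sm that] frechet_derivative_works by blast
  show "((%z. N a i j (p + z)) has_derivative fder (N a i j) (at (p + z))) (at z)"
   by (rule has_derivative_compose[where g = "N a i j", OF 1 2])
 qed
 have appTh': "blinfun_apply (Th' z) = (%u. \<Sum>a j i. L a i j (fder (N a i j) (at (p + z)) u))"
  if "p + z \<in> U" for z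
  unfolding Th'_def by (rule bounded_linear_Blinfun_apply[OF has_derivative_bounded_linear[OF der0[OF that]]])
 have inU: "p + z \<in> U" if "norm z \<le> r0" for z using that r0 by (auto simp: subset_iff dist_norm)
 have contTh: "continuous_on (cball 0 r0) Th"
  by (intro continuous_at_imp_continuous_on ballI has_derivative_continuous[OF der0] inU) simp
 have "bounded (Th ` cball 0 r0)" by (intro compact_imp_bounded compact_continuous_image contTh compact_cball)
 then obtain C where C: "!!z. norm z \<le> r0 ==> norm (Th z) \<le> C"
  unfolding bounded_iff by (metis imageI mem_cball_0)
 have C0: "C \<ge> 0" using order_trans[OF norm_ge_zero C[of 0]] r0 by simp
 \<comment> \<open>Makes \<open>C * r\<close> at most 1/4; the denominator uses \<open>C + 1\<close>
   because \<open>C\<close> may be zero.\<close>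
 define r where "r = min r0 (1 / (4 * (C + 1)))"
 have r: "r > 0" "r \<le> r0" using r0 C0 by (simp_all add: r_def)
 have sub: "ball p r \<subseteq> U" using r(2) r0(2) by (meson ball_subset_cball order_trans subset_ball)
 have "C * r \<le> C * (1 / (4 * (C + 1)))" unfolding r_def using C0 by (intro mult_left_mono) auto
 also have "... \<le> 1/4" using C0 by (simp add: field_simps)
 finally have Cr: "C * r \<le> 1/4" .
 have small: "norm z \<le> r0" if "z \<in> ball 0 r" for z :: "complex^'m" using that r by simp
 have sol: "\<exists>S. S 0 = s0 & (\<forall>z\<in>ball 0 r. (S has_derivative (%v. Th z v (S z))) (at z))" for s0
 proof (rule picard_solution[OF r(1) C0 Cr])
  fix z :: "complex^'m" assume z: "z \<in> ball 0 r"
  show "(Th has_derivative blinfun_apply (Th' z)) (at z)"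
   using der0 appTh' inU[OF small[OF z]] by simp
  show "norm (Th z) \<le> C" by (rule C[OF small[OF z]])
  fix u v s
  have zU: "p + z \<in> U" by (rule inU[OF small[OF z]])
  have fd: "fder (N a i j) (at (p + z)) u = (\<Sum>b. wco b u * wdz b (N a i j) (p + z))" for a i j u
   by (rule fun_cong[OF frechet_derivative_at[OF has_derivative_wdz[OF smooth_on_differentiable[OF sm zU]]], symmetric])
  \<comment> \<open>The integrability hypothesis says that this array is symmetric in
    \<open>a\<close> and \<open>b\<close>; in terms of blinfuns that is the symmetry of the second
    derivative in \<open>u\<close> and \<open>v\<close>.\<close>
  define X where "X = (%i a b j. wdz b (N a i j) (p + z) + (\<Sum>k. N a i k (p + z) * N b k j (p + z)))"
  have Xs: "X i a b j = X i b a j" for i a b j unfolding X_def by (rule int[OF zU])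
  have e: "(Th' z u v s + Th z v (Th z u s)) $ i = (\<Sum>a b. wco a v * wco b u * (\<Sum>j. X i a b j * s $ j))" for u v i
  proof -
   have "(\<Sum>a. wco a v * (\<Sum>j. (\<Sum>b. wco b u * wdz b (N a i j) (p + z)) * s $ j))
    = (\<Sum>a b. wco a v * wco b u * (\<Sum>j. wdz b (N a i j) (p + z) * s $ j))"
    by (intro sum.cong[OF refl]) (simp add: sum_distrib_left sum_distrib_right mult_ac, rule sum.swap)
   moreover have "(\<Sum>a. wco a v * (\<Sum>k. N a i k (p + z) * (\<Sum>b. wco b u * (\<Sum>j. N b k j (p + z) * s $ j))))
    = (\<Sum>a b. wco a v * wco b u * (\<Sum>j. (\<Sum>k. N a i k (p + z) * N b k j (p + z)) * s $ j))"
   proof (rule sum.cong[OF refl])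
    fix a
    have "wco a v * (\<Sum>k. N a i k (p + z) * (\<Sum>b. wco b u * (\<Sum>j. N b k j (p + z) * s $ j)))
     = (\<Sum>k b. wco a v * wco b u * (\<Sum>j. N a i k (p + z) * N b k j (p + z) * s $ j))"
     by (simp add: sum_distrib_left mult_ac)
    also have "... = (\<Sum>b k. wco a v * wco b u * (\<Sum>j. N a i k (p + z) * N b k j (p + z) * s $ j))"
     by (rule sum.swap)
    also have "... = (\<Sum>b. wco a v * wco b u * (\<Sum>j. (\<Sum>k. N a i k (p + z) * N b k j (p + z)) * s $ j))"
    proof (rule sum.cong[OF refl])
     fix b
     have "(\<Sum>k j. N a i k (p + z) * N b k j (p + z) * s $ j) = (\<Sum>j. (\<Sum>k. N a i k (p + z) * N b k j (p + z)) * s $ j)"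
      by (subst sum.swap) (simp add: sum_distrib_right)
     then show "(\<Sum>k. wco a v * wco b u * (\<Sum>j. N a i k (p + z) * N b k j (p + z) * s $ j))
      = wco a v * wco b u * (\<Sum>j. (\<Sum>k. N a i k (p + z) * N b k j (p + z)) * s $ j)"
      unfolding sum_distrib_left[symmetric] by simp
    qed
    finally show "wco a v * (\<Sum>k. N a i k (p + z) * (\<Sum>b. wco b u * (\<Sum>j. N b k j (p + z) * s $ j)))
     = (\<Sum>b. wco a v * wco b u * (\<Sum>j. (\<Sum>k. N a i k (p + z) * N b k j (p + z)) * s $ j))" .
   qed
   ultimately show ?thesis
    unfolding X_def by (simp add: appTh'[OF zU] app fd appTh distrib_left distrib_right sum.distrib)
  qed
  have "(Th' z u v s + Th z v (Th z u s)) $ i = (Th' z v u s + Th z u (Th z v s)) $ i" for i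
  proof -
   have "(\<Sum>a b. wco a v * wco b u * (\<Sum>j. X i a b j * s $ j))
    = (\<Sum>b a. wco a v * wco b u * (\<Sum>j. X i a b j * s $ j))" by (rule sum.swap)
   also have "... = (\<Sum>b a. wco b u * wco a v * (\<Sum>j. X i b a j * s $ j))"
    by (intro sum.cong[OF refl]) (simp only: Xs[of i] mult.commute)
   finally show ?thesis unfolding e .
  qed
  then show "Th' z u v s + Th z v (Th z u s) = Th' z v u s + Th z u (Th z v s)" by (simp add: vec_eq_iff)
 next
  show "continuous_on (ball 0 r) Th'"
  proof (rule continuous_on_blinfun_componentwise)
   fix e :: "complex^'m"
   have "continuous_on (ball 0 r) (%z. \<Sum>a j i. L a i j (fder (N a i j) (at (p + z)) e))"
   proof (intro continuous_on_sum bounded_linear.continuous_on[OF bl])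
    fix a i j
    show "continuous_on (ball 0 r) (%z. fder (N a i j) (at (p + z)) e)"
     by (rule continuous_on_compose2[OF smooth_on_continuous_on[OF smooth_on_frechet[OF sm]]])
      (use sub in \<open>auto intro!: continuous_intros\<close>)
   qed
   then show "continuous_on (ball 0 r) (%z. blinfun_apply (Th' z) e)"
    by (rule continuous_on_eq) (simp add: appTh' inU[OF small])
  qed
 qed
 show ?thesis
 proof (intro exI[of _ r] conjI allI)
  show "ball p r \<subseteq> U" by (rule sub)
  fix s0
  obtain S where S: "S 0 = s0" "!!z. z \<in> ball 0 r ==> (S has_derivative (%v. Th z v (S z))) (at z)" using sol by blast
  have "((%z. S (z - p)) has_derivative (%v. \<Sum>a. wco a v *s (\<chi> i. \<Sum>j. N a i j z * S (z - p) $ j))) (at z)" if "z \<in> ball p r" for z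
  proof -
   have 0: "z - p \<in> ball 0 r" using that by (simp add: dist_norm norm_minus_commute)
   have 1: "((%z. z - p) has_derivative (%u. u)) (at z)" by (auto intro!: derivative_eq_intros)
   have "((%z. S (z - p)) has_derivative (%v. Th (z - p) v (S (z - p)))) (at z)"
    by (rule has_derivative_compose[where g = S, OF 1 S(2)[OF 0]])
   then show ?thesis unfolding appTh by simp
  qed
  then show "\<exists>S. S p = s0 & (\<forall>z\<in>ball p r. (S has_derivative (%v. \<Sum>a. wco a v *s (\<chi> i. \<Sum>j. N a i j z * S z $ j))) (at z))"
   using S(1) by (intro exI[of _ "%z. S (z - p)"]) simp
 qed (rule r(1))
qed

section \<open>Local lifts to the sphere model\<close>

lemma sum_option: "(\<Sum>A. F A) = F None + (\<Sum>al. F (Some (al :: 'm::finite)) :: 'b::comm_monoid_add)"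
proof -
 have "(\<Sum>A\<in>range Some. F A) = (\<Sum>al. F (Some al))"
  by (subst sum.reindex) (auto intro: inj_onI)
 then show ?thesis unfolding UNIV_option_conv by (subst sum.insert) auto
qed

text \<open>The pullback of the Fubini-Study form under the map [f] to projective space, through its
  potential log |f|^2 on homogeneous coordinates.\<close>

definition fsform :: "(complex^'m::finite => complex^'n::finite) => complex^'m => complex^'m^'m" where
 "fsform f z = (\<chi> al bt. dz al (dzbar bt (%w. cor (ln ((norm (f w))\<^sup>2)))) z)"

text \<open>A map \<open>f\<close> lifts a local isometry to projective space if, up to the factor \<open>ka\<close>, the metric
 is the pullback of the Fubini--Study form under $[f]$.\<close>

definition lift :: "real => 'm::finite local_metric => (complex^'m) set => (complex^'m => complex^'n::finite) => bool" where
 "lift ka h U f \<longleftrightarrow> open U & (\<forall>i. chol (%z. f z $ i) U) & (\<forall>z\<in>U. f z ~= 0) &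
   (\<forall>z\<in>U. \<forall>al bt. fsform f z $ al $ bt = cor ka * h z $ al $ bt)"

lemma norm_vec_sq: "cor ((norm (v :: complex^'n::finite))\<^sup>2) = (\<Sum>i. v $ i * cnj (v $ i))"
 by (simp add: norm_vec_def L2_set_def sum_nonneg complex_norm_square[symmetric] flip: of_real_power)

lemma dz_ln:
 fixes q :: "complex^'m::finite => real"
 assumes d: "(%z. cor (q z)) differentiable (at z)" and q: "q z > 0"
 shows "dz al (%z. cor (ln (q z))) z = dz al (%z. cor (q z)) z / cor (q z)"
  "dzbar al (%z. cor (ln (q z))) z = dzbar al (%z. cor (q z)) z / cor (q z)"
proof -
 obtain D where D: "((%z. cor (q z)) has_derivative D) (at z)" using d by (auto simp: differentiable_def)
 have 1: "(q has_derivative (%v. Re (D v))) (at z)"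
  using bounded_linear.has_derivative[OF bounded_linear_Re D] by simp
 have 2: "D = (%v. cor (Re (D v)))"
  by (rule has_derivative_unique[OF D bounded_linear.has_derivative[OF bounded_linear_of_real 1]])
 have "((%z. ln (q z)) has_derivative (%v. Re (D v) / q z)) (at z)"
  using 1 q by (auto intro!: derivative_eq_intros simp: divide_inverse)
 then have "((%z. cor (ln (q z))) has_derivative (%v. cor (Re (D v)) / cor (q z))) (at z)"
  by (intro has_derivative_eq_rhs[OF bounded_linear.has_derivative[OF bounded_linear_of_real]]) auto
 then have 3: "((%z. cor (ln (q z))) has_derivative (%v. D v / cor (q z))) (at z)"
  by (rule has_derivative_eq_rhs) (rule ext, simp only: fun_cong[OF 2, symmetric])
 show "dz al (%z. cor (ln (q z))) z = dz al (%z. cor (q z)) z / cor (q z)"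
  "dzbar al (%z. cor (ln (q z))) z = dzbar al (%z. cor (q z)) z / cor (q z)"
  unfolding dz_at[OF D] dz_at[OF 3] by (simp_all add: diff_divide_distrib add_divide_distrib mult.commute)
qed

lemma hermitian_posdef_matrix_inv:
 fixes G :: "complex^'m::finite^'m"
 assumes G: "hermitian_posdef G"
 shows "hermitian_posdef (\<chi> al bt. matrix_inv G $ bt $ al)"
proof -
 \<comment> \<open>The matrix is regarded as a constant Kaehler metric, which makes the facts about
   \<open>ginv\<close> available for a single matrix.\<close>
 interpret k: km UNIV "%z. G"
  by unfold_locales (simp add: kmetric_def smooth_on_const G)
 define K where "K = (%al bt. matrix_inv G $ bt $ al)"
 have gi: "ginv (%z. G) al bt z = K al bt" for al bt z by (simp add: ginv_def K_def)
 have Kc: "cnj (K al bt) = K bt al" for al bt using k.ginv_cnj[of undefined al bt] by (simp add: gi)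
 have KG: "(\<Sum>ga. K ga dt * G $ ga $ bt) = (if dt = bt then 1 else 0)" for dt bt
  using ginv_left[of "%z. G" undefined dt bt] hermitian_posdef_invertible[OF G] by (simp add: gi)
 have GK: "(\<Sum>dt. G $ al $ dt * K ga dt) = (if al = ga then 1 else 0)" for al ga
  using ginv_right[of "%z. G" undefined al ga] hermitian_posdef_invertible[OF G] by (simp add: gi)
 show ?thesis
  unfolding hermitian_posdef_def vec_lambda_beta
 proof (intro conjI allI impI)
  show "matrix_inv G $ al $ bt = cnj (matrix_inv G $ bt $ al)" for al bt using Kc[of al bt] by (simp add: K_def)
  fix v :: "complex^'m" assume v: "v ~= 0"
  define u where "u = (\<chi> dt. \<Sum>ga. K ga dt * v $ ga)"
  have vG: "v $ al = (\<Sum>dt. G $ al $ dt * u $ dt)" for al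
  proof -
   have "(\<Sum>dt. G $ al $ dt * u $ dt) = (\<Sum>dt ga. (G $ al $ dt * K ga dt) * v $ ga)"
    by (simp add: u_def sum_distrib_left mult_ac)
   also have "... = (\<Sum>ga. (\<Sum>dt. G $ al $ dt * K ga dt) * v $ ga)"
    by (subst sum.swap) (simp add: sum_distrib_right)
   finally show ?thesis unfolding GK by (simp add: mult_delta_left)
  qed
  define w where "w = (\<chi> dt. cnj (u $ dt))"
  have "w ~= 0"
  proof
   assume "w = 0"
   then have "u $ dt = 0" for dt by (simp add: w_def vec_eq_iff)
   then show False using v by (simp add: vec_eq_iff vG)
  qed
  then have p: "0 < Re (\<Sum>al bt. G $ al $ bt * w $ al * cnj (w $ bt))"
   using G unfolding hermitian_posdef_def by blast
  have "(\<Sum>al bt. G $ al $ bt * w $ al * cnj (w $ bt)) = (\<Sum>al. cnj (u $ al) * v $ al)"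
   by (simp add: w_def vG sum_distrib_left mult_ac)
  also have "... = (\<Sum>al bt. K al bt * cnj (v $ bt) * v $ al)"
   by (simp add: u_def sum_distrib_left sum_distrib_right mult_ac Kc)
  finally show "0 < Re (\<Sum>al bt. matrix_inv G $ bt $ al * v $ al * cnj (v $ bt))"
   using p by (simp add: K_def mult_ac)
 qed
qed

text \<open>Constant holomorphic sectional curvature, normalised so that \<open>ka\<close> times the
  metric has the curvature of the form with potential log(1+|z|^2).\<close>

locale chc = km V h for V :: "(complex^'m::finite) set" and h :: "'m local_metric" +
 fixes ka :: real
 assumes ka: "ka > 0" and curv: "!!z al bt ga dt. z \<in> V ==> curv h al bt ga dt z =
  - cor ka * (h z $ al $ bt * h z $ ga $ dt + h z $ ga $ bt * h z $ al $ dt)"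
begin

abbreviation Ga where "Ga \<equiv> christoffel h"

text \<open>Connection coefficient of the (m+1)-st root of the anticanonical bundle: the covariant
  derivative of a section s is ds - a s in unbarred directions. On the model this root is the dual
  of the tautological bundle.\<close>

definition a :: "'m => complex^'m => complex" where
 "a ga z = - cor (1 / (real CARD('m) + 1)) * (\<Sum>mu. Ga mu ga mu z)"

lemma a_smooth: "smooth_on V (a ga)"
 unfolding a_def[abs_def] by (intro smooth_on_mult smooth_on_const smooth_on_sum christoffel_smooth open_U)

lemma h_cancel:
 assumes "z \<in> V" "!!bt. (\<Sum>mu. h z $ mu $ bt * x mu) = (\<Sum>mu. h z $ mu $ bt * y mu)"
 shows "x mu = y mu"
proof -
 have *: "(\<Sum>bt. ginv h mu bt z * (\<Sum>nu. h z $ nu $ bt * x nu)) = x mu" for x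
 proof -
  have "(\<Sum>bt. ginv h mu bt z * (\<Sum>nu. h z $ nu $ bt * x nu))
    = (\<Sum>nu. (\<Sum>bt. h z $ nu $ bt * ginv h mu bt z) * x nu)"
   by (simp add: sum_distrib_left sum_distrib_right mult_ac) (rule sum.swap)
  then show ?thesis by (simp add: ginv_right[of h z, OF h_inv[OF assms(1)]] mult_delta_left)
 qed
 show ?thesis using *[of x] *[of y] assms(2) by simp
qed

lemma dzbar_christoffel:
 assumes z: "z \<in> V"
 shows "dzbar dt (Ga mu ga al) z
  = - cor ka * ((if al = mu then h z $ ga $ dt else 0) + (if ga = mu then h z $ al $ dt else 0))"
proof (rule h_cancel[where mu = mu and x = "%mu. dzbar dt (Ga mu ga al) z", OF z])
 show "(\<Sum>mu. h z $ mu $ bt * dzbar dt (Ga mu ga al) z) = (\<Sum>mu. h z $ mu $ bt *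
   (- cor ka * ((if al = mu then h z $ ga $ dt else 0) + (if ga = mu then h z $ al $ dt else 0))))" for bt
  using curv[OF z, of al bt ga dt] unfolding curv_def
  by (simp add: distrib_left sum.distrib sum_negf mult_delta_right mult_ac)
qed

lemma dzbar_a:
 assumes z: "z \<in> V" shows "dzbar dt (a ga) z = cor ka * h z $ ga $ dt"
proof -
 have "dzbar dt (a ga) z = - cor (1 / (real CARD('m) + 1)) * (\<Sum>mu. dzbar dt (Ga mu ga mu) z)"
  unfolding a_def[abs_def]
  by (subst dz_cmult(2)) (simp_all add: dz_sum smooth_on_differentiable[OF christoffel_smooth z] differentiable_sum)
 also have "(\<Sum>mu. dzbar dt (Ga mu ga mu) z) = - cor ka * ((of_nat CARD('m) + 1) * h z $ ga $ dt)"
  unfolding dzbar_christoffel[OF z] sum_distrib_left[symmetric] sum.distrib by (simp add: distrib_right)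
 also have "- cor (1 / (real CARD('m) + 1)) * (- cor ka * ((of_nat CARD('m) + 1) * h z $ ga $ dt))
  = cor ka * h z $ ga $ dt"
 proof -
  have "(of_nat CARD('m) + 1 :: complex) ~= 0"
   by (metis Suc_eq_plus1 of_nat_Suc of_nat_neq_0 add.commute)
  then show ?thesis by (simp add: field_simps)
 qed
 finally show ?thesis .
qed

text \<open>The pure unbarred part of the curvature vanishes: both sides, lowered with the metric,
  are the same second derivative of the metric in different orders.\<close>

lemma dz_christoffel_flat:
 assumes z: "z \<in> V"
 shows "dz dt (Ga mu ga al) z + (\<Sum>nu. Ga nu ga al z * Ga mu dt nu z)
  = dz ga (Ga mu dt al) z + (\<Sum>nu. Ga nu dt al z * Ga mu ga nu z)"
proof -
 have *: "(\<Sum>mu. h z $ mu $ bt * (dz dt (Ga mu ga al) z + (\<Sum>nu. Ga nu ga al z * Ga mu dt nu z)))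
  = dz dt (dz ga (%w. h w $ al $ bt)) z" for dt ga bt
 proof -
  have "dz dt (dz ga (%w. h w $ al $ bt)) z = dz dt (%z. \<Sum>mu. h z $ mu $ bt * Ga mu ga al z) z"
   by (rule dz_cong[OF open_U z]) (simp add: christoffel_lower)
  also have "... = (\<Sum>mu. dz dt (%w. h w $ mu $ bt) z * Ga mu ga al z) + (\<Sum>mu. h z $ mu $ bt * dz dt (Ga mu ga al) z)"
   by (simp add: dz_sum dz_mult h_diff[OF z] smooth_on_differentiable[OF christoffel_smooth z] sum.distrib)
  also have "(\<Sum>mu. dz dt (%w. h w $ mu $ bt) z * Ga mu ga al z)
   = (\<Sum>nu mu. h z $ mu $ bt * (Ga nu ga al z * Ga mu dt nu z))"
   by (simp add: christoffel_lower[OF z, symmetric] sum_distrib_left sum_distrib_right mult_ac)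
  also have "... = (\<Sum>mu nu. h z $ mu $ bt * (Ga nu ga al z * Ga mu dt nu z))"
   by (rule sum.swap)
  finally show ?thesis by (simp add: distrib_left sum.distrib sum_distrib_left)
 qed
 show ?thesis
  by (rule h_cancel[where mu = mu and x = "%mu. dz dt (Ga mu ga al) z + (\<Sum>nu. Ga nu ga al z * Ga mu dt nu z)", OF z])
   (unfold *, rule dz_commute(1)[OF open_U h_smooth z])
qed

lemma dz_a_sym:
 assumes z: "z \<in> V" shows "dz dt (a ga) z = dz ga (a dt) z"
proof -
 have *: "dz dt (a ga) z = - cor (1 / (real CARD('m) + 1)) * (\<Sum>mu. dz dt (Ga mu ga mu) z)" for dt ga
  unfolding a_def[abs_def]
  by (subst dz_cmult(1)) (simp_all add: dz_sum smooth_on_differentiable[OF christoffel_smooth z] differentiable_sum)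
 have "(\<Sum>mu. dz dt (Ga mu ga mu) z + (\<Sum>nu. Ga nu ga mu z * Ga mu dt nu z))
  = (\<Sum>mu. dz ga (Ga mu dt mu) z + (\<Sum>nu. Ga nu dt mu z * Ga mu ga nu z))"
  by (intro sum.cong refl dz_christoffel_flat[OF z])
 moreover have "(\<Sum>mu nu. Ga nu ga mu z * Ga mu dt nu z) = (\<Sum>mu nu. Ga nu dt mu z * Ga mu ga nu z)"
  by (subst sum.swap) (simp add: mult.commute)
 ultimately show ?thesis unfolding * by (simp add: sum.distrib)
qed

lemma dz_ginv:
 assumes z: "z \<in> V"
 shows "dz ga (ginv h al bt) z = - (\<Sum>mu. ginv h mu bt z * Ga al ga mu z)"
proof -
 note d = h_diff[OF z] smooth_on_differentiable[OF ginv_smooth z]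
 have 0: "(\<Sum>nu. dz ga (ginv h nu bt) z * h z $ nu $ dt + ginv h nu bt z * dz ga (%w. h w $ nu $ dt) z) = 0" for dt
 proof -
  have "dz ga (%z. \<Sum>nu. ginv h nu bt z * h z $ nu $ dt) z = dz ga (%z. if bt = dt then 1 else 0) z"
   by (rule dz_cong[OF open_U z]) (rule ginv_left, rule h_inv)
  then show ?thesis by (simp add: dz_sum dz_mult d add.commute)
 qed
 show ?thesis
 proof (rule h_cancel[where mu = al and x = "%al. dz ga (ginv h al bt) z", OF z])
  fix dt
  have "(\<Sum>mu. h z $ mu $ dt * dz ga (ginv h mu bt) z) = - (\<Sum>nu. ginv h nu bt z * dz ga (%w. h w $ nu $ dt) z)"
   using 0[of dt] by (simp add: sum.distrib mult.commute add_eq_0_iff)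
  also have "... = - (\<Sum>nu mu. h z $ mu $ dt * (ginv h nu bt z * Ga mu ga nu z))"
   by (simp add: christoffel_lower[OF z, symmetric] sum_distrib_left mult_ac)
  also have "... = - (\<Sum>mu nu. h z $ mu $ dt * (ginv h nu bt z * Ga mu ga nu z))"
   unfolding neg_equal_iff_equal by (rule sum.swap)
  finally show "(\<Sum>mu. h z $ mu $ dt * dz ga (ginv h mu bt) z)
   = (\<Sum>mu. h z $ mu $ dt * - (\<Sum>nu. ginv h nu bt z * Ga mu ga nu z))"
   by (simp add: sum_distrib_left sum_negf)
 qed
qed

end

context chc
begin

text \<open>The prolonged system for a section $\sigma$ of the dual tautological line bundle: the components
 of a solution are $\sigma$ (index \<open>None\<close>) and $\tau_\alpha = \nabla_\alpha\sigma$ (index \<open>Some al\<close>).\<close>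

definition N :: "bool \<times> 'm => 'm option => 'm option => complex^'m => complex" where
 "N d A B z = (case (A, B) of
   (None, None) => if fst d then a (snd d) z else 0
  | (None, Some bt) => if fst d then (if snd d = bt then 1 else 0) else 0
  | (Some al, None) => if fst d then 0 else - cor ka * h z $ al $ snd d
  | (Some al, Some bt) => if fst d then (if al = bt then a (snd d) z else 0) + Ga bt (snd d) al z else 0)"

lemma N_simps [simp]:
 "N (True, ga) None None = a ga" "N (True, ga) None (Some bt) = (%z. if ga = bt then 1 else 0)"
 "N (True, ga) (Some al) None = (%z. 0)"
 "N (True, ga) (Some al) (Some bt) = (%z. (if al = bt then a ga z else 0) + Ga bt ga al z)"
 "N (False, ga) None B = (%z. 0)" "N (False, ga) (Some al) (Some bt) = (%z. 0)"
 "N (False, ga) (Some al) None = (%z. - cor ka * h z $ al $ ga)"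
 by (auto simp: N_def fun_eq_iff split: option.split)

lemma N_smooth: "smooth_on V (N d A B)"
proof -
 obtain b ga where d: "d = (b, ga)" by fastforce
 have i: "smooth_on V (%z. if P then f z else 0)" if "smooth_on V f" for P and f :: "complex^'m => complex"
  using that by (cases P) (simp_all add: smooth_on_const open_U)
 show ?thesis unfolding d
  by (cases b; cases A; cases B) (auto intro!: smooth_on_const smooth_on_mult smooth_on_minus smooth_on_add i a_smooth h_smooth christoffel_smooth open_U)
qed

text \<open>Pure unbarred pairs need the flatness of the connection in these directions, pure barred
  pairs the closedness of the metric. The mixed pairs are the only ones that use constant curvature:
  the curvature of the tangent part is exactly compensated by the coupling of the two
  components.\<close>

lemma N_integrable:
 assumes z: "z \<in> V"
 shows "wdz e (N d i j) z + (\<Sum>k. N d i k z * N e k j z) = wdz d (N e i j) z + (\<Sum>k. N e i k z * N d k j z)"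
proof -
 note dif = smooth_on_differentiable[OF a_smooth z] smooth_on_differentiable[OF christoffel_smooth z] h_diff[OF z]
 have di: "(%z. if P then a ga z else 0) differentiable (at z)" for P ga using dif by (cases P) auto
 have dzi: "dz dt (%z. if P then a ga z else 0) z = (if P then dz dt (a ga) z else 0)"
  "dzbar dt (%z. if P then a ga z else 0) z = (if P then dzbar dt (a ga) z else 0)" for P ga dt by auto
 have dm: "dz dt (%z. - (c * h z $ al $ ga)) z = - (c * dz dt (%z. h z $ al $ ga) z)"
  "dzbar dt (%z. - (c * h z $ al $ ga)) z = - (c * dzbar dt (%z. h z $ al $ ga) z)" for c al ga dt
  using dz_cmult[OF h_diff[OF z], of dt "- c" al ga] by simp_all
 have TT: "wdz (True, dt) (N (True, ga) i j) z + (\<Sum>k. N (True, ga) i k z * N (True, dt) k j z)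
   = wdz (True, ga) (N (True, dt) i j) z + (\<Sum>k. N (True, dt) i k z * N (True, ga) k j z)" for ga dt i j
 proof (cases i)
  case None
  show ?thesis
  proof (cases j)
   case N: None
   show ?thesis unfolding None N by (simp add: wdz_def sum_option dz_a_sym[OF z, of ga dt])
  next
   case (Some bt)
   show ?thesis unfolding None Some
    by (simp add: wdz_def sum_option distrib_left sum.distrib mult_delta_left mult_delta_right christoffel_sym[OF z, of bt ga dt])
  qed
 next
  case (Some al)
  note i = this
  show ?thesis
  proof (cases j)
   case None
   show ?thesis unfolding i None by (simp add: wdz_def sum_option)
  next
   case (Some mu)
   show ?thesis unfolding i Some
    using dz_christoffel_flat[OF z, of dt mu ga al] dz_a_sym[OF z, of ga dt]
    by (cases "al = mu") (simp_all add: wdz_def sum_option dz_add di dif dzi distrib_left distrib_right sum.distrib mult_delta_left mult_delta_right algebra_simps)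
  qed
 qed
 have TF: "wdz (False, dt) (N (True, ga) i j) z + (\<Sum>k. N (True, ga) i k z * N (False, dt) k j z)
   = wdz (True, ga) (N (False, dt) i j) z + (\<Sum>k. N (False, dt) i k z * N (True, ga) k j z)" for ga dt i j
 proof (cases i)
  case None
  show ?thesis unfolding None
   by (cases j) (simp_all add: wdz_def sum_option mult_delta_left dzbar_a[OF z] sum_negf)
 next
  case (Some al)
  note i = this
  show ?thesis
  proof (cases j)
   case None
   show ?thesis unfolding i None
    by (simp add: wdz_def sum_option distrib_left distrib_right sum.distrib mult_delta_left mult_delta_right dm christoffel_lower[OF z, symmetric] sum_distrib_left sum_negf sum_subtractf mult_ac)
  next
   case (Some mu)
   show ?thesis unfolding i Some
    by (simp add: wdz_def sum_option dz_add di dif dzi dzbar_a[OF z] dzbar_christoffel[OF z] algebra_simps)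
  qed
 qed
 have FF: "wdz (False, dt) (N (False, ga) i j) z + (\<Sum>k. N (False, ga) i k z * N (False, dt) k j z)
   = wdz (False, ga) (N (False, dt) i j) z + (\<Sum>k. N (False, dt) i k z * N (False, ga) k j z)" for ga dt i j
  by (cases i; cases j) (simp_all add: wdz_def sum_option dm h_closed_bar[OF z, of dt _ ga])
 obtain b ga b' dt where de: "d = (b, ga)" "e = (b', dt)" by fastforce
 show ?thesis
  unfolding de by (cases b; cases b'; simp only:; (rule TT | rule TF | rule TF[symmetric] | rule FF))
qed

end

lemma dz_sum_wdir:
 fixes f :: "complex^'m::finite => complex"
 assumes "(f has_derivative (%v. \<Sum>d. wco d v * F d)) (at z)"
 shows "dz ga f z = F (True, ga)" "dzbar ga f z = F (False, ga)" "f differentiable (at z)"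
proof -
 have "(f has_derivative (%v. \<Sum>ga. F (True, ga) * v $ ga + F (False, ga) * cnj (v $ ga))) (at z)"
  by (rule has_derivative_eq_rhs[OF assms]) (simp add: sum_wdir wco_def sum.distrib mult.commute)
 from dz_eqI[OF this] show "dz ga f z = F (True, ga)" "dzbar ga f z = F (False, ga)" by auto
qed (use assms in \<open>auto simp: differentiable_def\<close>)

context chc
begin

text \<open>The Hermitian form |s|^2 + |t|^2/ka on the prolonged system. Along solutions it is
  parallel up to the factor given by the connection coefficient \<open>a\<close>, which is what
  makes \<open>lift_exists\<close> work.\<close>

definition H :: "complex^'m => complex^('m option)^('m option)" where
 "H z = (\<chi> A B. case (A, B) of (None, None) => 1 | (Some al, Some bt) => cor (1 / ka) * ginv h al bt z | _ => 0)"

lemma H_simps [simp]: "H z $ None $ None = 1" "H z $ None $ Some bt = 0" "H z $ Some al $ None = 0"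
 "H z $ Some al $ Some bt = cor (1 / ka) * ginv h al bt z"
 by (simp_all add: H_def)

lemma H_cnj: "z \<in> V ==> cnj (H z $ A $ B) = H z $ B $ A"
 by (cases A; cases B) (simp_all add: ginv_cnj)

lemma H_posdef:
 assumes z: "z \<in> V" shows "hermitian_posdef (H z)"
 unfolding hermitian_posdef_def
proof (intro conjI allI impI)
 show "H z $ B $ A = cnj (H z $ A $ B)" for A B by (rule H_cnj[OF z, symmetric])
 fix v :: "complex^('m option)" assume v: "v ~= 0"
 define w where "w = (\<chi> al. v $ Some al)"
 define q where "q = (\<Sum>al bt. matrix_inv (h z) $ bt $ al * w $ al * cnj (w $ bt))"
 have e: "(\<Sum>A B. H z $ A $ B * v $ A * cnj (v $ B)) = v $ None * cnj (v $ None) + cor (1 / ka) * q"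
  by (simp add: sum_option q_def w_def ginv_def sum_distrib_left mult_ac)
 have n: "Re (v $ None * cnj (v $ None)) = (cmod (v $ None))\<^sup>2" by (simp add: complex_norm_square[symmetric])
 have q: "w ~= 0 ==> Re q > 0"
  using conjunct2[OF hermitian_posdef_matrix_inv[OF h_posdef[OF z], unfolded hermitian_posdef_def]] by (simp add: q_def)
 show "0 < Re (\<Sum>A B. H z $ A $ B * v $ A * cnj (v $ B))"
 proof (cases "w = 0")
  case True
  then have q0: "q = 0" by (simp add: q_def)
  have "v $ None ~= 0"
  proof
   assume 0: "v $ None = 0"
   have "v $ Some al = 0" for al using True by (simp add: w_def vec_eq_iff)
   then have "v $ A = 0" for A using 0 by (cases A) auto
   then show False using v by (simp add: vec_eq_iff)
  qed
  then show ?thesis unfolding e plus_complex.sel n using q0 by simp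
 next
  case False
  then have "Re (cor (1 / ka) * q) > 0" using q ka by simp
  then show ?thesis unfolding e plus_complex.sel n by (simp add: add_nonneg_pos)
 qed
qed

text \<open>The solutions start orthonormal at \<open>p\<close>, and their pairings all satisfy one
  and the same scalar equation, so they stay orthonormal up to a common factor \<open>q\<close>. The
  squared norm of the vector of their first components is then \<open>q\<close>, and log q has the
  required mixed derivatives.\<close>

theorem lift_exists:
 assumes p: "p \<in> V"
 shows "\<exists>U (f :: complex^'m => complex^('m option)). p \<in> U & U \<subseteq> V & lift ka h U f"
proof -
 obtain r where r: "r > 0" "ball p r \<subseteq> V"
  and ex: "!!s0. \<exists>S. S p = s0 & (\<forall>z\<in>ball p r. (S has_derivative (%v. \<Sum>d. wco d v *s (\<chi> A. \<Sum>B. N d A B z * S z $ B))) (at z))"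
  using frobenius[OF open_U p N_smooth N_integrable] by blast
 \<comment> \<open>The initial values are the rows of a unitary frame for the form
   \<open>H p\<close>, so that the pairings \<open>Q\<close> start as the identity matrix.\<close>
 obtain M where M: "unitary_frame (H p) M" using unitary_frame_exists[OF H_posdef[OF p]] by blast
 have "\<exists>S. \<forall>i. S i p = M $ i & (\<forall>z\<in>ball p r. (S i has_derivative (%v. \<Sum>d. wco d v *s (\<chi> A. \<Sum>B. N d A B z * S i z $ B))) (at z))"
  using ex by (intro choice allI)
 then obtain S where Sp: "!!i. S i p = M $ i"
  and S: "!!i z. z \<in> ball p r ==> (S i has_derivative (%v. \<Sum>d. wco d v *s (\<chi> A. \<Sum>B. N d A B z * S i z $ B))) (at z)"
  by blast
 have SA: "((%z. S i z $ A) has_derivative (%v. \<Sum>d. wco d v * (\<Sum>B. N d A B z * S i z $ B))) (at z)"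
  if "z \<in> ball p r" for i A z
  by (rule has_derivative_eq_rhs[OF bounded_linear.has_derivative[OF bounded_linear_vec_nth S[OF that]]])
   (simp add: sum_component)
 have dS: "dz ga (%z. S i z $ A) z = (\<Sum>B. N (True, ga) A B z * S i z $ B)"
  "dzbar ga (%z. S i z $ A) z = (\<Sum>B. N (False, ga) A B z * S i z $ B)"
  "(%z. S i z $ A) differentiable (at z)" if "z \<in> ball p r" for ga i A z
  by (fact dz_sum_wdir[OF SA[OF that]])+
 define ta where "ta = (%i al z. S i z $ Some al)"
 define sg where "sg = (%i z. S i z $ None)"
 have dsg: "dz ga (sg i) z = a ga z * sg i z + ta i ga z" "dzbar ga (sg i) z = 0" "sg i differentiable (at z)"
  if "z \<in> ball p r" for i ga z
  using dS(1,2)[OF that, of ga i None] dS(3)[OF that, of i None] by (auto simp: sg_def ta_def sum_option mult_delta_left)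
 have dta: "dz ga (ta i al) z = a ga z * ta i al z + (\<Sum>mu. Ga mu ga al z * ta i mu z)"
  "dzbar ga (ta i al) z = - cor ka * h z $ al $ ga * sg i z" "ta i al differentiable (at z)"
  if "z \<in> ball p r" for i ga al z
  using dS(1,2)[OF that, of ga i "Some al"] dS(3)[OF that, of i "Some al"]
  by (auto simp: sg_def ta_def sum_option mult_delta_left distrib_right sum.distrib)
 define c where "c = cor (1 / ka)"
 have cka: "c * cor ka = 1" using ka by (simp add: c_def)
 define Q where "Q = (%i j z. sg i z * cnj (sg j z) + c * (\<Sum>al bt. ginv h al bt z * (ta i al z * cnj (ta j bt z))))"
 have QH: "Q i j z = (\<Sum>A B. S i z $ A * cnj (S j z $ B) * H z $ A $ B)" for i j z
  by (simp add: sum_option Q_def sg_def ta_def c_def sum_distrib_left mult_ac)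
 have Qc: "Q i j z = cnj (Q j i z)" if "z \<in> V" for i j z
  unfolding QH by (subst sum.swap) (simp add: H_cnj[OF that] mult_ac)
 have Qd: "Q i j differentiable (at z)" and dQ: "dz ga (Q i j) z = a ga z * Q i j z" if z: "z \<in> ball p r" for i j z ga
 proof -
  have zV: "z \<in> V" using z r by blast
  note di = dsg(3)[OF z] dta(3)[OF z] differentiable_cnj[OF dsg(3)[OF z]] differentiable_cnj[OF dta(3)[OF z]]
   smooth_on_differentiable[OF ginv_smooth zV]
  show "Q i j differentiable (at z)" unfolding Q_def by (intro differentiable_add differentiable_mult differentiable_sum ballI di differentiable_const finite)
  define T1 where "T1 = (\<Sum>al bt. dz ga (ginv h al bt) z * (ta i al z * cnj (ta j bt z)))"
  define T2 where "T2 = (\<Sum>al bt. ginv h al bt z * ((\<Sum>mu. Ga mu ga al z * ta i mu z) * cnj (ta j bt z)))"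
  define T3 where "T3 = (\<Sum>al bt. ginv h al bt z * (ta i al z * cnj (- cor ka * h z $ bt $ ga * sg j z)))"
  define T0 where "T0 = (\<Sum>al bt. ginv h al bt z * (ta i al z * cnj (ta j bt z)))"
  have "dz ga (%z. ginv h al bt z * (ta i al z * cnj (ta j bt z))) z =
    dz ga (ginv h al bt) z * (ta i al z * cnj (ta j bt z))
   + ginv h al bt z * ((a ga z * ta i al z + (\<Sum>mu. Ga mu ga al z * ta i mu z)) * cnj (ta j bt z)
    + ta i al z * cnj (- cor ka * h z $ bt $ ga * sg j z))" for al bt
   by (simp only: dz_mult(1) dz_cnj(1) di differentiable_mult dta(1,2)[OF z])
  note X = this
  have "dz ga (Q i j) z = dz ga (%z. sg i z * cnj (sg j z)) z
    + c * (\<Sum>al bt. dz ga (%z. ginv h al bt z * (ta i al z * cnj (ta j bt z))) z)"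
   unfolding Q_def by (simp add: dz_add dz_cmult dz_sum di differentiable_mult differentiable_sum)
  also have "dz ga (%z. sg i z * cnj (sg j z)) z = (a ga z * sg i z + ta i ga z) * cnj (sg j z)"
   by (simp add: dz_mult di dz_cnj dsg[OF z])
  also have "(\<Sum>al bt. dz ga (%z. ginv h al bt z * (ta i al z * cnj (ta j bt z))) z)
    = T1 + (a ga z * T0 + T2 + T3)"
   unfolding X T0_def T1_def T2_def T3_def sum_distrib_left[of "a ga z"] sum.distrib[symmetric]
   by (intro sum.cong[OF refl]) (simp add: algebra_simps)
  finally have "dz ga (Q i j) z = (a ga z * sg i z + ta i ga z) * cnj (sg j z) + c * (T1 + (a ga z * T0 + T2 + T3))" .
  \<comment> \<open>The derivative of the inverse metric cancels the Christoffel terms of the second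
    components; \<open>T3\<close> below cancels the coupling of first and second components.\<close>
  moreover have "T1 + T2 = 0"
  proof -
   have "T1 = - (\<Sum>al bt mu. ginv h mu bt z * (Ga al ga mu z * ta i al z * cnj (ta j bt z)))"
    unfolding T1_def dz_ginv[OF zV] by (simp add: sum_negf sum_distrib_left sum_distrib_right mult_ac)
   also have "(\<Sum>al bt mu. ginv h mu bt z * (Ga al ga mu z * ta i al z * cnj (ta j bt z)))
    = (\<Sum>bt mu al. ginv h mu bt z * (Ga al ga mu z * ta i al z * cnj (ta j bt z)))"
    by (subst sum.swap) (intro sum.cong[OF refl] sum.swap)
   also have "... = (\<Sum>mu bt al. ginv h mu bt z * (Ga al ga mu z * ta i al z * cnj (ta j bt z)))"
    by (rule sum.swap)
   also have "... = T2" unfolding T2_def by (simp add: sum_distrib_left sum_distrib_right mult_ac)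
   finally show ?thesis by simp
  qed
  moreover have "c * T3 = - (ta i ga z * cnj (sg j z))"
  proof -
   have "c * T3 = (c * cor ka) * - (\<Sum>al. ta i al z * cnj (sg j z) * (\<Sum>bt. h z $ ga $ bt * ginv h al bt z))"
    unfolding T3_def by (simp add: sum_distrib_left sum_negf h_cnj[OF zV] mult_ac)
   also have "... = - (ta i ga z * cnj (sg j z))"
    unfolding ginv_right[of h z, OF h_inv[OF zV]] cka by (simp add: mult_delta_right)
   finally show ?thesis .
  qed
  ultimately show "dz ga (Q i j) z = a ga z * Q i j z"
   unfolding Q_def T0_def[symmetric] by (simp add: algebra_simps add_eq_0_iff2)
 qed
 have dQ': "dzbar ga (Q i j) z = cnj (a ga z) * Q i j z" if z: "z \<in> ball p r" for i j z ga
 proof -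
  have zV: "z \<in> V" using z r by blast
  have "dzbar ga (Q i j) z = dzbar ga (%z. cnj (Q j i z)) z" by (rule dz_cong[OF open_U zV]) (rule Qc)
  then show ?thesis unfolding dz_cnj(2)[OF Qd[OF z]] dQ[OF z] using Qc[OF zV, of i j] by simp
 qed
 define q where "q = Q None None"
 have Qp: "Q i j p = (if i = j then 1 else 0)" for i j
  using M unfolding unitary_frame_def QH Sp by blast
 have pr: "p \<in> ball p r" using r by simp
 have "continuous (at p) q" unfolding q_def by (rule differentiable_imp_continuous_within[OF Qd[OF pr]])
 moreover have "q p ~= 0" by (simp add: q_def Qp)
 ultimately obtain r1 where r1: "r1 > 0" "!!z. dist p z < r1 ==> q z ~= 0"
  using continuous_at_avoid by blast
 define B where "B = ball p (min r r1)"
 have B: "open B" "p \<in> B" "B \<subseteq> V" "B \<subseteq> ball p r" "convex B" and q0: "!!z. z \<in> B ==> q z ~= 0"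
  using r r1 by (auto simp: B_def)
 \<comment> \<open>All the \<open>Q i j\<close> satisfy the same first-order equations, so each
   quotient by \<open>q\<close> is constant on the ball.\<close>
 have Qq: "Q i j z = (if i = j then q z else 0)" if "z \<in> B" for i j z
 proof -
  have "Q i j z * inverse (q z) = Q i j p * inverse (q p)"
  proof (rule has_derivative_zero_unique[OF B(5) _ that B(2)])
   fix x assume x: "x \<in> B"
   then have xr: "x \<in> ball p r" and x0: "q x ~= 0" using B q0 by auto
   have iq: "(%z. inverse (q z)) differentiable (at x)"
    using differentiable_inverse' Qd[OF xr] x0 unfolding q_def by blast
   have "dz ga (%z. Q i j z * inverse (q z)) x = 0" "dzbar ga (%z. Q i j z * inverse (q z)) x = 0" for ga
    unfolding dz_mult[OF Qd[OF xr] iq] dz_inverse[OF Qd[OF xr, of None None, folded q_def] x0]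
    using x0 unfolding q_def dQ[OF xr] dQ'[OF xr] by (simp_all add: field_simps power2_eq_square)
   then have "((%z. Q i j z * inverse (q z)) has_derivative (%v. 0)) (at x)"
    using has_derivative_wirtinger[OF differentiable_mult[OF Qd[OF xr, of i j] iq]] by simp
   then show "((%z. Q i j z * inverse (q z)) has_derivative (%v. 0)) (at x within B)" by (rule has_derivative_at_withinI)
  qed
  then show ?thesis using q0[OF that] Qp[of None None] by (auto simp: Qp q_def field_simps split: if_splits)
 qed
 define f where "f = (%z. \<chi> i. sg i z)"
 \<comment> \<open>The pairing relation says that a multiple of the matrix of solutions has a
   one-sided inverse. It is then two-sided, and its entry at \<open>None\<close>,
   \<open>None\<close>, read in the other order, is the sum of the |s_i|^2 divided by
   \<open>q\<close>.\<close>
 have fq: "cor ((norm (f z))\<^sup>2) = q z" if z: "z \<in> B" for z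
 proof -
  define P where "P = (\<chi> i. S i z)"
  define X where "X = H z ** adj P"
  have 1: "(P ** X) $ i $ j = (if i = j then q z else 0)" for i j
  proof -
   have "(P ** X) $ i $ j = Q i j z"
    using fc2_matrix[of P "%A B. H z $ A $ B" i j] by (simp add: X_def fc2_def QH P_def matrix_mul_assoc)
   then show ?thesis using Qq[OF z] by simp
  qed
  define Y where "Y = (\<chi> i j. inverse (q z) * X $ i $ j)"
  have "P ** Y = mat 1"
  proof -
   have "(P ** Y) $ i $ j = inverse (q z) * (P ** X) $ i $ j" for i j
    by (simp add: Y_def matrix_matrix_mult_def sum_distrib_left mult_ac)
   then show ?thesis unfolding 1 using q0[OF z] by (simp add: vec_eq_iff mat_def)
  qed
  then have "Y ** P = mat 1" using matrix_left_right_inverse by blast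
  then have "(Y ** P) $ None $ None = 1" by (simp add: mat_def)
  moreover have "(Y ** P) $ None $ None = inverse (q z) * (\<Sum>i. sg i z * cnj (sg i z))"
   by (simp add: Y_def X_def P_def matrix_matrix_mult_def sum_distrib_left distrib_left adj_def sg_def sum_option mult_ac)
  ultimately have "(\<Sum>i. sg i z * cnj (sg i z)) = q z" using q0[OF z] by (simp add: field_simps)
  then show ?thesis unfolding norm_vec_sq f_def by simp
 qed
 have chol: "chol (%z. f z $ i) B" for i
  unfolding chol_def f_def using dsg B(4) by (auto simp: subset_iff)
 have nz: "f z ~= 0" if "z \<in> B" for z using fq[OF that] q0[OF that] by auto
 have "fsform f z $ al $ bt = cor ka * h z $ al $ bt" if z: "z \<in> B" for z al bt
 proof -
  have 1: "dzbar bt (%w. cor (ln ((norm (f w))\<^sup>2))) w = cnj (a bt w)" if w: "w \<in> B" for w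
  proof -
   have wr: "w \<in> ball p r" using w B by blast
   have dd: "(%w. cor ((norm (f w))\<^sup>2)) differentiable (at w)"
    using Qd[OF wr] has_derivative_transform_within_open[OF _ B(1) w, of q _ UNIV "%w. cor ((norm (f w))\<^sup>2)"] fq
    unfolding differentiable_def q_def by metis
   have "dzbar bt (%w. cor (ln ((norm (f w))\<^sup>2))) w = dzbar bt (%w. cor ((norm (f w))\<^sup>2)) w / q w"
    using dz_ln(2)[OF dd, of bt] nz[OF w] fq[OF w] by simp
   also have "dzbar bt (%w. cor ((norm (f w))\<^sup>2)) w = dzbar bt q w"
    by (rule dz_cong[OF B(1) w]) (rule fq)
   finally show ?thesis using q0[OF w] by (simp add: q_def dQ'[OF wr])
  qed
  have zV: "z \<in> V" using z B by blast
  have "fsform f z $ al $ bt = dz al (%w. cnj (a bt w)) z"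
   unfolding fsform_def vec_lambda_beta by (rule dz_cong[OF B(1) z]) (rule 1)
  also have "... = cor ka * h z $ al $ bt"
   by (simp add: dz_cnj smooth_on_differentiable[OF a_smooth zV] dzbar_a[OF zV] h_cnj[OF zV])
  finally show ?thesis .
 qed
 then have "lift ka h B f" unfolding lift_def using B(1) chol nz by blast
 then show ?thesis using B by blast
qed

end

section \<open>The Fubini-Study form of a holomorphic map\<close>

lemma ddbar_chain:
 fixes ph :: "complex^'m::finite => complex^'n::finite"
 assumes S: "open S" "z \<in> S" and T: "open T" "smooth_on T u" and ph: "!!i. chol (%w. ph w $ i) S" "ph ` S \<subseteq> T"
 shows "dz al (dzbar bt (%w. u (ph w))) z = (\<Sum>mu nu. dz al (%w. ph w $ mu) z * cnj (dz bt (%w. ph w $ nu) z) * dz mu (dzbar nu u) (ph z))"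
proof -
 have c: "(%w. ph w $ i) differentiable (at w)" "dzbar al (%w. ph w $ i) w = 0" "ph w \<in> T" if "w \<in> S" for w i al
  using that cholD[OF ph(1)] ph(2) by auto
 have "dz al (dzbar bt (%w. u (ph w))) z = dz al (%w. \<Sum>nu. cnj (dz bt (%w. ph w $ nu) w) * dzbar nu u (ph w)) z"
  by (rule dz_cong[OF S]) (rule dz_chain_chol(2)[OF smooth_on_differentiable[OF T(2) c(3)] c(1,2)])
 also have "... = (\<Sum>nu. cnj (dz bt (%w. ph w $ nu) z) * (\<Sum>mu. dz al (%w. ph w $ mu) z * dz mu (dzbar nu u) (ph z)))"
 proof -
  note e = cholD[OF chol_dz[OF S(1) ph(1)] S(2)]
  note d = smooth_on_dz_differentiable(2)[OF T c(3)[OF S(2)]]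
  note k = dz_chain_chol(1,3)[OF d c(1,2)[OF S(2)]]
  show ?thesis by (simp add: dz_sum dz_mult differentiable_cnj e dz_cnj k differentiable_mult)
 qed
 also have "... = (\<Sum>nu mu. dz al (%w. ph w $ mu) z * cnj (dz bt (%w. ph w $ nu) z) * dz mu (dzbar nu u) (ph z))"
  by (simp add: sum_distrib_left mult_ac)
 also have "... = (\<Sum>mu nu. dz al (%w. ph w $ mu) z * cnj (dz bt (%w. ph w $ nu) z) * dz mu (dzbar nu u) (ph z))"
  by (rule sum.swap)
 finally show ?thesis .
qed

lemma smooth_on_ln:
 fixes q :: "'a::euclidean_space => real"
 assumes S: "open S" and q: "smooth_on S q" "!!z. z \<in> S ==> q z > 0"
 shows "smooth_on S (%z. ln (q z))"
proof (rule smooth_onI)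
 fix k show "Ck_on k S (%z. ln (q z))"
 proof (cases k)
  case 0
  show ?thesis unfolding 0 Ck_on.simps
   by (intro continuous_on_ln smooth_on_continuous_on q(1)) (use q(2) in \<open>auto simp: less_imp_neq[symmetric]\<close>)
 next
  case (Suc j)
  show ?thesis unfolding Suc
  proof (rule Ck_on_SucI[OF S])
   fix x assume x: "x \<in> S"
   have "(q has_derivative fder q (at x)) (at x)"
    using smooth_on_differentiable[OF q(1) x] frechet_derivative_works by blast
   then show "((%z. ln (q z)) has_derivative (%v. fder q (at x) v / q x)) (at x)"
    using q(2)[OF x] by (auto intro!: derivative_eq_intros simp: divide_inverse)
  next
   show "Ck_on j S (%x. fder q (at x) v / q x)" for v
    by (rule smooth_onD, rule smooth_on_divide[OF S smooth_on_frechet[OF q(1)] q(1)]) (use q(2) in force)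
  qed
 qed
qed

lemma smooth_on_norm_sq:
 fixes f :: "complex^'m::finite => complex^'n::finite"
 assumes S: "open S" "!!i. smooth_on S (%z. f z $ i)"
 shows "smooth_on S (%z. (norm (f z))\<^sup>2)"
proof -
 have "smooth_on S (%z. \<Sum>i. f z $ i * cnj (f z $ i))"
  by (intro smooth_on_sum smooth_on_mult smooth_on_cnj S)
 then have "smooth_on S (%z. Re (\<Sum>i. f z $ i * cnj (f z $ i)))"
  by (rule smooth_on_linear_compose[OF S(1) bounded_linear_Re])
 then show ?thesis unfolding norm_vec_sq[symmetric] by simp
qed

lemma smooth_on_ln_norm:
 fixes f :: "complex^'m::finite => complex^'n::finite"
 assumes S: "open S" "!!i. smooth_on S (%z. f z $ i)" and nz: "!!z. z \<in> S ==> f z ~= 0"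
 shows "smooth_on S (%z. cor (ln ((norm (f z))\<^sup>2)))"
 by (intro smooth_on_linear_compose[OF S(1) bounded_linear_of_real] smooth_on_ln[OF S(1)] smooth_on_norm_sq[OF S])
  (use nz in simp)

context
 fixes f :: "complex^'m::finite => complex^'n::finite" and S :: "(complex^'m) set"
 assumes S: "open S" and f: "!!i. chol (%z. f z $ i) S" and nz: "!!z. z \<in> S ==> f z ~= 0"
begin

lemma dz_ln_norm:
 assumes z: "z \<in> S"
 shows "dz al (%z. cor (ln ((norm (f z))\<^sup>2))) z
   = (\<Sum>i. dz al (%w. f w $ i) z * cnj (f z $ i)) / cor ((norm (f z))\<^sup>2)"
  "dzbar al (%z. cor (ln ((norm (f z))\<^sup>2))) z
   = (\<Sum>i. f z $ i * cnj (dz al (%w. f w $ i) z)) / cor ((norm (f z))\<^sup>2)"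
proof -
 note c = cholD[OF f z]
 have d: "(%z. cor ((norm (f z))\<^sup>2)) differentiable (at z)"
  unfolding norm_vec_sq by (intro differentiable_sum ballI finite differentiable_mult c differentiable_cnj)
 have q: "(norm (f z))\<^sup>2 > 0" using nz[OF z] by simp
 show "dz al (%z. cor (ln ((norm (f z))\<^sup>2))) z
   = (\<Sum>i. dz al (%w. f w $ i) z * cnj (f z $ i)) / cor ((norm (f z))\<^sup>2)"
  unfolding dz_ln(1)[OF d q] unfolding norm_vec_sq
  by (simp add: dz_sum dz_mult c differentiable_cnj dz_cnj differentiable_mult)
 show "dzbar al (%z. cor (ln ((norm (f z))\<^sup>2))) z
   = (\<Sum>i. f z $ i * cnj (dz al (%w. f w $ i) z)) / cor ((norm (f z))\<^sup>2)"
  unfolding dz_ln(2)[OF d q] unfolding norm_vec_sq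
  by (simp add: dz_sum dz_mult c differentiable_cnj dz_cnj differentiable_mult)
qed

lemma fsform_formula:
 assumes z: "z \<in> S"
 shows "fsform f z $ al $ bt = (\<Sum>i. dz al (%w. f w $ i) z * cnj (dz bt (%w. f w $ i) z)) / cor ((norm (f z))\<^sup>2)
  - (\<Sum>i. dz al (%w. f w $ i) z * cnj (f z $ i)) * (\<Sum>i. f z $ i * cnj (dz bt (%w. f w $ i) z))
    / (cor ((norm (f z))\<^sup>2))\<^sup>2"
proof -
 define q where "q = (%z. \<Sum>i. f z $ i * cnj (f z $ i))"
 define r where "r = (%z. \<Sum>i. f z $ i * cnj (dz bt (%w. f w $ i) z))"
 note c = cholD[OF f z] and e = cholD[OF chol_dz[OF S f] z]
 have qn: "cor ((norm (f z))\<^sup>2) = q z" for z unfolding q_def norm_vec_sq ..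
 have q0: "q z ~= 0" using nz[OF z] qn[of z, symmetric] by simp
 have dq: "q differentiable (at z)" unfolding q_def
  by (intro differentiable_sum ballI finite differentiable_mult c differentiable_cnj)
 have dr: "r differentiable (at z)" unfolding r_def
  by (intro differentiable_sum ballI finite differentiable_mult c differentiable_cnj e)
 have dzq: "dz al q z = (\<Sum>i. dz al (%w. f w $ i) z * cnj (f z $ i))"
  unfolding q_def by (simp add: dz_sum dz_mult c differentiable_cnj dz_cnj differentiable_mult)
 have dzr: "dz al r z = (\<Sum>i. dz al (%w. f w $ i) z * cnj (dz bt (%w. f w $ i) z))"
  unfolding r_def by (simp add: dz_sum dz_mult c e differentiable_cnj dz_cnj differentiable_mult)
 have "fsform f z $ al $ bt = dz al (%z. r z * inverse (q z)) z"
  unfolding fsform_def vec_lambda_beta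
  by (rule dz_cong[OF S z]) (simp only: dz_ln_norm(2) qn r_def divide_inverse)
 also have "... = dz al r z / q z - dz al q z * r z / (q z)\<^sup>2"
  unfolding dz_mult[OF dr differentiable_inverse'[OF dq q0]] dz_inverse[OF dq q0] by (simp add: divide_inverse)
 finally show ?thesis unfolding dzq dzr qn unfolding r_def .
qed

text \<open>The potential changes by log |s|^2, whose barred derivatives are conjugates of
  holomorphic functions and are therefore annihilated by unbarred ones. Hence the form depends only
  on the map to projective space.\<close>

lemma fsform_scale:
 assumes s: "chol s S" "!!z. z \<in> S ==> s z ~= 0" and z: "z \<in> S"
 shows "fsform (%z. s z *s f z) z = fsform f z"
proof -
 have "fsform (%z. s z *s f z) z $ al $ bt = fsform f z $ al $ bt" for al bt
 proof -
  let ?l = "%z. cor (ln ((norm (f z))\<^sup>2))"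
  have l: "smooth_on S ?l" by (rule smooth_on_ln_norm[OF S chol_smooth_on[OF S f] nz])
  have "dzbar bt (%z. cor (ln ((norm (s z *s f z))\<^sup>2))) w
   = cnj (dz bt s w * inverse (s w)) + dzbar bt ?l w" if w: "w \<in> S" for w
  proof -
   have ds: "(%z. cor ((cmod (s z))\<^sup>2)) differentiable (at w)"
    unfolding complex_norm_square by (intro differentiable_mult cholD(1)[OF s(1) w] differentiable_cnj)
   have s0: "(cmod (s w))\<^sup>2 > 0" using s(2)[OF w] by simp
   have dl: "(%z. cor (ln ((cmod (s z))\<^sup>2))) differentiable (at w)"
   proof (rule smooth_on_differentiable[OF smooth_on_linear_compose[OF S bounded_linear_of_real smooth_on_ln[OF S]] w])
    have "smooth_on S (%z. Re (s z * cnj (s z)))"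
     by (intro smooth_on_linear_compose[OF S bounded_linear_Re] smooth_on_mult smooth_on_cnj S chol_smooth_on[OF S s(1)])
    then show "smooth_on S (%z. (cmod (s z))\<^sup>2)" unfolding complex_norm_square[symmetric] by simp
   qed (use s(2) in simp)
   have "dzbar bt (%z. cor (ln ((norm (s z *s f z))\<^sup>2))) w
    = dzbar bt (%z. cor (ln ((cmod (s z))\<^sup>2)) + ?l z) w"
   proof (rule dz_cong[OF S w])
    fix z assume z: "z \<in> S"
    have "norm (s z *s f z) = cmod (s z) * norm (f z)"
     by (simp add: norm_vec_def L2_set_def norm_mult power_mult_distrib sum_distrib_left[symmetric] real_sqrt_mult)
    then show "cor (ln ((norm (s z *s f z))\<^sup>2)) = cor (ln ((cmod (s z))\<^sup>2)) + ?l z"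
     using s(2)[OF z] nz[OF z] by (simp add: power_mult_distrib ln_mult)
   qed
   also have "... = dzbar bt (%z. cor (ln ((cmod (s z))\<^sup>2))) w + dzbar bt ?l w"
    by (rule dz_add(2)[OF dl smooth_on_differentiable[OF l w]])
   also have "dzbar bt (%z. cor (ln ((cmod (s z))\<^sup>2))) w = cnj (dz bt s w * inverse (s w))"
    unfolding dz_ln(2)[OF ds s0] unfolding complex_norm_square
    using s(2)[OF w] by (simp add: dz_mult cholD[OF s(1) w] differentiable_cnj dz_cnj field_simps)
   finally show ?thesis .
  qed
  then have "fsform (%z. s z *s f z) z $ al $ bt = dz al (%w. cnj (dz bt s w * inverse (s w)) + dzbar bt ?l w) z"
   unfolding fsform_def vec_lambda_beta by (intro dz_cong[OF S z])
  also have "... = fsform f z $ al $ bt"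
  proof -
   have "chol (%w. dz bt s w * inverse (s w)) S"
    by (intro chol_mult chol_dz[OF S s(1)] chol_inverse s)
   then have c: "(%w. dz bt s w * inverse (s w)) differentiable (at z)"
    "dzbar al (%w. dz bt s w * inverse (s w)) z = 0"
    using z by (rule cholD)+
   have "dz al (%w. cnj (dz bt s w * inverse (s w)) + dzbar bt ?l w) z
     = dz al (%w. cnj (dz bt s w * inverse (s w))) z + dz al (dzbar bt ?l) z"
    by (rule dz_add(1)[OF differentiable_cnj[OF c(1)] smooth_on_dz_differentiable(2)[OF S l z]])
   also have "dz al (%w. cnj (dz bt s w * inverse (s w))) z = 0"
    by (rule trans[OF dz_cnj(1)[OF c(1)]]) (simp only: c(2) complex_cnj_zero)
   finally show ?thesis by (simp add: fsform_def)
  qed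
  finally show ?thesis .
 qed
 then show ?thesis by (simp add: vec_eq_iff)
qed

lemma fsform_compose:
 fixes ta :: "complex^'k::finite => complex^'m"
 assumes T: "open T" "z \<in> T" and ta: "!!i. chol (%z. ta z $ i) T" "ta ` T \<subseteq> S"
 shows "fsform (%z. f (ta z)) z = pullback_form ta (fsform f) z"
 unfolding vec_eq_iff fsform_def pullback_form_def vec_lambda_beta
 by (intro allI ddbar_chain[OF T S smooth_on_ln_norm[OF S chol_smooth_on[OF S f] nz] ta])

end

section \<open>Rigidity of lifts\<close>

definition unitary :: "complex^'n::finite^'n => bool" where
 "unitary V \<longleftrightarrow> adj V ** V = mat 1"

definition par :: "complex^'n => complex^'n => bool" where
 "par u w \<longleftrightarrow> (\<exists>c. c ~= 0 & u = c *s w)"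

lemma par_refl [simp]: "par u u"
 unfolding par_def by (intro exI[of _ 1]) simp

lemma par_sym: "par u w ==> par w u"
proof -
 assume "par u w"
 then obtain c where c: "c ~= 0" "u = c *s w" unfolding par_def by blast
 then have "w = inverse c *s u" by (simp add: vec_eq_iff)
 then show ?thesis unfolding par_def using c(1) by (intro exI[of _ "inverse c"]) simp
qed

lemma par_trans: "par u v ==> par v w ==> par u w"
 unfolding par_def by (metis mult_eq_0_iff vector_smult_assoc)

lemma par_scale: "c ~= 0 ==> par (c *s w) w"
 unfolding par_def by blast

lemma matrix_vector_smult: "A *v (c *s x) = c *s (A *v (x :: complex^'n::finite))"
 by (simp add: vec_eq_iff matrix_vector_mult_def sum_distrib_left mult_ac)

lemma par_matrix: "par u w ==> par (V *v u) (V *v (w :: complex^'n::finite))"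
 unfolding par_def using matrix_vector_smult by blast

lemma unitary_right: "unitary V ==> V ** adj V = mat 1"
 unfolding unitary_def using matrix_left_right_inverse by blast

lemma unitary_adj: "unitary V ==> unitary (adj V)"
 using unitary_right[of V] by (simp add: unitary_def)

lemma unitary_mult: "unitary V ==> unitary W ==> unitary (V ** W)"
 unfolding unitary_def adj_mult by (metis matrix_mul_assoc matrix_mul_lid)

lemma unitary_mat_1: "unitary (mat 1)" by (simp add: unitary_def matrix_mul_lid)

lemma unitary_cancel: "unitary V ==> adj V *v (V *v x) = x" "unitary V ==> V *v (adj V *v x) = x"
 using unitary_right[of V] by (simp_all add: unitary_def matrix_vector_mul_assoc)

lemma unitary_norm: assumes "unitary V" shows "norm (V *v x) = norm x"
proof -
 have "cor ((norm (V *v x))\<^sup>2) = (\<Sum>i k. cnj (V $ i $ k) * cnj (x $ k) * (V *v x) $ i)"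
  unfolding norm_vec_sq by (simp add: matrix_vector_mult_def[of V] sum_distrib_left mult_ac)
 also have "... = (\<Sum>k. cnj (x $ k) * (adj V *v (V *v x)) $ k)"
 proof -
  have "(adj V *v y) $ k = (\<Sum>i. cnj (V $ i $ k) * y $ i)" for k y
   by (simp add: matrix_vector_mult_def adj_def)
  then show ?thesis by (subst sum.swap) (simp add: sum_distrib_left mult_ac)
 qed
 also have "... = cor ((norm x)\<^sup>2)"
  unfolding unitary_cancel[OF assms] norm_vec_sq by (simp add: mult.commute)
 finally have "(norm (V *v x))\<^sup>2 = (norm x)\<^sup>2" unfolding of_real_eq_iff .
 then show ?thesis by simp
qed

text \<open>A Householder reflection exchanges two unit vectors whose inner product is real. So the
  phase \<open>c\<close> is first chosen to make the inner product of \<open>u\<close> with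
  \<open>c *s v\<close> nonnegative, and is removed again at the end.\<close>

lemma unitary_transitive:
 fixes u v :: "complex^'n::finite"
 assumes "norm u = 1" "norm v = 1"
 shows "\<exists>V. unitary V & V *v u = v"
proof -
 define a where "a = (\<Sum>i. u $ i * cnj (v $ i))"
 define c where "c = (if a = 0 then 1 else a / cor (cmod a))"
 have c1: "cmod c = 1" by (simp add: c_def norm_divide)
 have cc: "c * cnj c = 1" by (metis c1 complex_norm_square of_real_1 one_power2)
 have ca: "cnj c * a = cor (cmod a)"
  using complex_norm_square[of a] by (auto simp: c_def power2_eq_square mult.commute[of "cnj a"] nonzero_divide_eq_eq)
 define w where "w = u - c *s v"
 have W: "cor ((norm w)\<^sup>2) = 2 - 2 * cor (cmod a)"
 proof -
  have "cor ((norm w)\<^sup>2) = (\<Sum>i. u $ i * cnj (u $ i)) - cnj c * (\<Sum>i. u $ i * cnj (v $ i))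
    - c * (\<Sum>i. cnj (u $ i) * v $ i) + (c * cnj c) * (\<Sum>i. v $ i * cnj (v $ i))"
   unfolding norm_vec_sq w_def by (simp add: algebra_simps sum.distrib sum_subtractf sum_distrib_left)
  also have "(\<Sum>i. cnj (u $ i) * v $ i) = cnj a" by (simp add: a_def)
  also have "c * cnj a = cor (cmod a)" using arg_cong[OF ca, of cnj] by simp
  finally show ?thesis using assms unfolding a_def[symmetric] ca cc norm_vec_sq[symmetric] by simp
 qed
 obtain R where R: "unitary R" "R *v u = c *s v"
 proof (cases "w = 0")
  case True
  then have "mat 1 *v u = c *s v" by (simp add: w_def matrix_vector_mul_lid)
  then show ?thesis using that unitary_mat_1 by blast
 next
  case False
  define k where "k = 2 / cor ((norm w)\<^sup>2)"
  have k0: "k * cor ((norm w)\<^sup>2) = 2" using False by (simp add: k_def)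
  have kc: "cnj k = k" by (simp add: k_def)
  define R where "R = (\<chi> i j. (if i = j then 1 else 0) - k * w $ i * cnj (w $ j))"
  have a: "adj R = R" by (simp add: adj_def R_def vec_eq_iff kc mult_ac)
  have "(R ** R) $ i $ j = (mat 1 :: complex^'n^'n) $ i $ j" for i j
  proof -
   have "(R ** R) $ i $ j = (\<Sum>l. (if i = l then (if l = j then 1 else 0) else 0) - (if i = l then k * w $ l * cnj (w $ j) else 0)
     - (if l = j then k * w $ i * cnj (w $ l) else 0) + k * w $ i * cnj (w $ j) * k * (w $ l * cnj (w $ l)))"
    unfolding matrix_matrix_mult_def R_def vec_lambda_beta by (intro sum.cong[OF refl]) (auto simp: algebra_simps)
   also have "... = (if i = j then 1 else 0) - 2 * (k * w $ i * cnj (w $ j)) + w $ i * cnj (w $ j) * k * (k * cor ((norm w)\<^sup>2))"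
    unfolding norm_vec_sq by (simp add: sum.distrib sum_subtractf sum_distrib_left mult_ac)
   also have "... = (mat 1 :: complex^'n^'n) $ i $ j" unfolding k0 by (simp add: mat_def)
   finally show ?thesis .
  qed
  then have "R ** R = mat 1" unfolding vec_eq_iff by blast
  then have "unitary R" unfolding unitary_def a .
  moreover have "R *v u = c *s v"
  proof -
   have "(\<Sum>j. cnj (w $ j) * u $ j) = cor ((norm u)\<^sup>2) - cnj c * a"
    unfolding norm_vec_sq w_def a_def by (simp add: algebra_simps sum_subtractf sum_distrib_left)
   moreover have "2 * (k * (1 - cor (cmod a))) = 2 * 1"
    using k0 unfolding W by (simp add: algebra_simps)
   ultimately have "k * (\<Sum>j. cnj (w $ j) * u $ j) = 1"
    unfolding mult_left_cancel[OF zero_neq_numeral[symmetric]] using ca assms by simp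
   moreover have "(R *v u) $ i = u $ i - k * (\<Sum>j. cnj (w $ j) * u $ j) * w $ i" for i
    unfolding matrix_vector_mult_def R_def vec_lambda_beta
    by (simp add: left_diff_distrib right_diff_distrib sum_subtractf mult_delta_left mult_delta_right sum_distrib_left sum_distrib_right mult_ac)
   ultimately show ?thesis by (simp add: vec_eq_iff w_def)
  qed
  ultimately show ?thesis using that by blast
 qed
 define V where "V = (\<chi> i j. cnj c * R $ i $ j)"
 have "(adj V ** V) $ i $ j = (c * cnj c) * (adj R ** R) $ i $ j" for i j
  by (simp add: V_def adj_def matrix_matrix_mult_def sum_distrib_left mult_ac)
 then have "adj V ** V = adj R ** R" unfolding cc by (simp add: vec_eq_iff)
 then have "unitary V" using R(1) by (simp add: unitary_def)
 moreover have "V *v u = v"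
 proof -
  have "V *v u = cnj c *s (R *v u)" by (simp add: V_def matrix_vector_mult_def vec_eq_iff sum_distrib_left mult_ac)
  then show ?thesis using cc by (simp add: R(2) vec_eq_iff mult.assoc[symmetric] mult.commute[of "cnj c"])
 qed
 ultimately show ?thesis by blast
qed

lemma fsform_unitary:
 assumes "unitary V" shows "fsform (%z. V *v f z) z = fsform f z"
 unfolding fsform_def unitary_norm[OF assms] ..

lemma chol_matrix: "(!!i. chol (%z. f z $ i) S) ==> chol (%z. (V *v f z) $ j) S"
 unfolding matrix_vector_mult_def vec_lambda_beta by (intro chol_sum chol_mult chol_const)

text \<open>Closing the family under directional derivatives replaces multi-indices: restricted to a
  complex line through \<open>p\<close>, each member has all its Taylor coefficients equal to values
  at \<open>p\<close> of other members, hence zero.\<close>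

lemma chol_zero:
 fixes \<A> :: "(complex^'m::finite => complex) set"
 assumes ch: "!!F. F \<in> \<A> ==> chol F (ball p r)" and zero: "!!F. F \<in> \<A> ==> F p = 0"
  and cl: "!!F v. F \<in> \<A> ==> (%z. \<Sum>ga. v $ ga * dz ga F z) \<in> \<A>"
  and F: "F \<in> \<A>" and z: "z \<in> ball p r"
 shows "F z = 0"
proof -
 define v where "v = z - p"
 have vr: "norm v < r" using z by (simp add: v_def dist_norm norm_minus_commute)
 \<comment> \<open>Larger than 1, so that the parameter 1, which corresponds to \<open>z\<close>,
   lies in the disc on which the line stays in the ball.\<close>
 define rh where "rh = (if v = 0 then 2 else r / norm v)"
 have rh: "rh > 1" using vr by (simp add: rh_def)
 have sv: "norm (ze *s v) = cmod ze * norm v" for ze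
  by (simp add: norm_vec_def L2_set_def norm_mult power_mult_distrib sum_distrib_left[symmetric] real_sqrt_mult)
 have inb: "p + ze *s v \<in> ball p r" if "ze \<in> ball 0 rh" for ze
 proof (cases "v = 0")
  case True then show ?thesis using vr by simp
 next
  case False then show ?thesis using that by (simp add: rh_def dist_norm sv field_simps)
 qed
 define L where "L = (%F (ze::complex). F (p + ze *s v) :: complex)"
 have der: "(L F has_field_derivative L (%z. \<Sum>ga. v $ ga * dz ga F z) ze) (at ze)" if "F \<in> \<A>" "ze \<in> ball 0 rh" for F ze
 proof -
  have 1: "((%ze. p + ze *s v) has_derivative (%t. t *s v)) (at ze)"
   by (rule has_derivative_vec) (auto intro!: derivative_eq_intros)
  have "(L F has_derivative (%t. \<Sum>ga. dz ga F (p + ze *s v) * (t *s v) $ ga)) (at ze)"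
   unfolding L_def by (rule has_derivative_compose[where g = F, OF 1 chol_has_derivative[OF ch[OF that(1)] inb[OF that(2)]]])
  then show ?thesis unfolding has_field_derivative_def
   by (rule has_derivative_eq_rhs) (simp add: L_def fun_eq_iff sum_distrib_left sum_distrib_right mult_ac)
 qed
 have hol: "L F holomorphic_on ball 0 rh" if "F \<in> \<A>" for F
  unfolding holomorphic_on_open[OF open_ball] using der[OF that] by blast
 have 0: "(deriv ^^ n) (L F) 0 = 0" if "F \<in> \<A>" for n F
  using that
 proof (induction n arbitrary: F)
  case 0 then show ?case using zero by (simp add: L_def)
 next
  case (Suc n)
  have "(deriv ^^ Suc n) (L F) 0 = (deriv ^^ n) (deriv (L F)) 0" by (simp add: funpow_Suc_right del: funpow.simps)
  also have "... = (deriv ^^ n) (L (%z. \<Sum>ga. v $ ga * dz ga F z)) 0"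
  proof (rule higher_deriv_transform_within_open[OF _ hol[OF cl[OF Suc.prems]] open_ball])
   show "deriv (L F) holomorphic_on ball 0 rh" by (rule holomorphic_deriv[OF hol[OF Suc.prems] open_ball])
   show "deriv (L F) ze = L (%z. \<Sum>ga. v $ ga * dz ga F z) ze" if "ze \<in> ball 0 rh" for ze
    using der[OF Suc.prems that] by (rule DERIV_imp_deriv)
  qed (use rh in simp)
  also have "... = 0" by (rule Suc.IH[OF cl[OF Suc.prems]])
  finally show ?case .
 qed
 have "L F 1 = 0" by (rule holomorphic_fun_eq_0_on_ball[OF hol[OF F] _ 0[OF F]]) (use rh in simp)
 then show ?thesis by (simp add: L_def v_def vec_eq_iff vector_smult_lid)
qed

lemma chol_const_on_ball:
 fixes F :: "complex^'m::finite => complex"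
 assumes "!!z. z \<in> ball p r ==> F differentiable (at z)"
  and "!!z ga. z \<in> ball p r ==> dz ga F z = 0" "!!z ga. z \<in> ball p r ==> dzbar ga F z = 0" and z: "z \<in> ball p r"
 shows "F z = F p"
proof (rule has_derivative_zero_unique[OF convex_ball _ z])
 show "p \<in> ball p r" using le_less_trans[OF zero_le_dist, of p z r] z by simp
 show "(F has_derivative (%h. 0)) (at x within ball p r)" if "x \<in> ball p r" for x
  by (rule has_derivative_at_withinI, rule has_derivative_eq_rhs[OF has_derivative_wirtinger[OF assms(1)[OF that]]])
   (simp add: assms(2,3)[OF that])
qed

lemma invertible_ker: "invertible (A :: complex^'n::finite^'n) ==> A *v x = 0 ==> x = 0"
 unfolding invertible_left_inverse matrix_left_invertible_ker by blast

text \<open>For maps $(1, \varphi)$ and $(1, \varphi')$ with $\varphi(p) = \varphi'(p) = 0$, the difference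
 of the potentials is pluriharmonic; its holomorphic derivatives lie in the ideal generated by
 $\bar\varphi_\mu$ and $\bar\varphi'_\mu$, hence vanish to all orders at \<open>p\<close>.\<close>

lemma rigidity_normalised:
 fixes f f' :: "complex^'m::finite => complex^('m option)"
 assumes U: "open U" "p \<in> U" and f: "!!i. chol (%z. f z $ i) U" and f': "!!i. chol (%z. f' z $ i) U"
  and N: "!!z. z \<in> U ==> f z $ None = 1" and N': "!!z. z \<in> U ==> f' z $ None = 1"
  and P: "!!al. f p $ Some al = 0" and P': "!!al. f' p $ Some al = 0"
  and eq: "!!z. z \<in> U ==> fsform f z = fsform f' z" and pd: "hermitian_posdef (fsform f p)"
 shows "\<exists>W V. open W & p \<in> W & W \<subseteq> U & unitary V & (\<forall>z\<in>W. f' z = V *v f z)"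
proof -
 obtain r where r: "r > 0" "ball p r \<subseteq> U" using U openE by blast
 define B where "B = ball p r"
 have B: "open B" "p \<in> B" "B \<subseteq> U" using r by (auto simp: B_def)
 have nz: "f z ~= 0" "f' z ~= 0" if "z \<in> B" for z
  using N[of z] N'[of z] that B(3) by (auto simp: vec_eq_iff intro!: exI[of _ None])
 note fB = chol_mono[OF f B(3)] and f'B = chol_mono[OF f' B(3)]
 have dN: "dz al (%w. f w $ None) z = 0" "dz al (%w. f' w $ None) z = 0" if "z \<in> B" for al z
  using dz_cong(1)[OF B(1) that, of "%w. f w $ None" "%w. 1" al] dz_cong(1)[OF B(1) that, of "%w. f' w $ None" "%w. 1" al]
   N N' B(3) by auto
 define ph where "ph = (%mu z. f z $ Some mu)"
 define ph' where "ph' = (%mu z. f' z $ Some mu)"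
 have phB: "chol (ph mu) B" and ph'B: "chol (ph' mu) B" for mu unfolding ph_def ph'_def by (rule fB f'B)+
 define q where "q = (%z. cor ((norm (f z))\<^sup>2))"
 define q' where "q' = (%z. cor ((norm (f' z))\<^sup>2))"
 have q0: "q z ~= 0" "q' z ~= 0" if "z \<in> B" for z using nz[OF that] by (simp_all add: q_def q'_def)
 have sq: "smooth_on B q" "smooth_on B q'" unfolding q_def q'_def
  by (intro smooth_on_linear_compose[OF B(1) bounded_linear_of_real] smooth_on_norm_sq B(1) chol_smooth_on[OF B(1)] fB f'B)+
 define l where "l = (%z. cor (ln ((norm (f z))\<^sup>2)))"
 define l' where "l' = (%z. cor (ln ((norm (f' z))\<^sup>2)))"
 have sl: "smooth_on B l" "smooth_on B l'" unfolding l_def l'_def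
  by (intro smooth_on_ln_norm B(1) chol_smooth_on[OF B(1)] fB f'B nz; assumption)+
 define E where "E = (%z. l z - l' z)"
 have sE: "smooth_on B E" unfolding E_def by (intro smooth_on_diff B(1) sl)
 define rh where "rh = (%al z. \<Sum>mu. dz al (ph mu) z * cnj (ph mu z))"
 define rh' where "rh' = (%al z. \<Sum>mu. dz al (ph' mu) z * cnj (ph' mu z))"
 have dl: "dz al l z = rh al z / q z" "dz al l' z = rh' al z / q' z" if "z \<in> B" for al z
 proof -
  show "dz al l z = rh al z / q z" unfolding l_def
   by (rule trans[OF dz_ln_norm(1)[OF B(1) fB nz(1) that]]) (simp_all add: sum_option dN[OF that] rh_def ph_def q_def)
  show "dz al l' z = rh' al z / q' z" unfolding l'_def
   by (rule trans[OF dz_ln_norm(1)[OF B(1) f'B nz(2) that]]) (simp_all add: sum_option dN[OF that] rh'_def ph'_def q'_def)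
 qed
 have dE: "dz al E z = rh al z / q z - rh' al z / q' z" if "z \<in> B" for al z
  unfolding E_def by (simp add: dz_diff smooth_on_differentiable[OF sl(1) that] smooth_on_differentiable[OF sl(2) that] dl[OF that])
 have fs: "fsform f z $ al $ bt = dz al (dzbar bt l) z" "fsform f' z $ al $ bt = dz al (dzbar bt l') z" for z al bt
  by (simp_all add: fsform_def l_def l'_def)
 have kch: "chol (dz al E) B" for al
  unfolding chol_def
 proof (intro ballI conjI allI)
  fix z bt assume z: "z \<in> B"
  show "dz al E differentiable (at z)" by (rule smooth_on_dz_differentiable(1)[OF B(1) sE z])
  have "dzbar bt (dz al E) z = dz al (dzbar bt E) z" by (rule dz_commute(2)[OF B(1) sE z, symmetric])
  also have "... = dz al (%z. dzbar bt l z - dzbar bt l' z) z"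
   by (rule dz_cong[OF B(1) z]) (simp add: E_def dz_diff smooth_on_differentiable[OF sl(1)] smooth_on_differentiable[OF sl(2)])
  also have "... = 0"
   unfolding dz_diff(1)[OF smooth_on_dz_differentiable(2)[OF B(1) sl(1) z] smooth_on_dz_differentiable(2)[OF B(1) sl(2) z]]
   unfolding fs[symmetric] eq[OF subsetD[OF B(3) z]] by simp
  finally show "dzbar bt (dz al E) z = 0" .
 qed
 \<comment> \<open>An unbarred derivative differentiates only the smooth coefficients and not the
   conjugate generators, so the ideal condition is inherited by directional derivatives, as
   \<open>chol_zero\<close> requires.\<close>
 define \<A> where "\<A> = {F. chol F B & (\<exists>A A'. (\<forall>mu. smooth_on B (A mu)) & (\<forall>mu. smooth_on B (A' mu)) &
   (\<forall>z\<in>B. F z = (\<Sum>mu. cnj (ph mu z) * A mu z + cnj (ph' mu z) * A' mu z)))}"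
 have AI: "F \<in> \<A>" if "chol F B" "\<forall>mu. smooth_on B (A mu)" "\<forall>mu. smooth_on B (A' mu)"
   "\<forall>z\<in>B. F z = (\<Sum>mu. cnj (ph mu z) * A mu z + cnj (ph' mu z) * A' mu z)" for F A A'
  using that unfolding \<A>_def by blast
 have kA: "dz al E \<in> \<A>" for al
 proof -
  have "\<forall>mu. smooth_on B (%z. dz al (ph mu) z * inverse (q z))" "\<forall>mu. smooth_on B (%z. - (dz al (ph' mu) z * inverse (q' z)))"
   by (intro allI smooth_on_minus smooth_on_mult smooth_on_inverse B(1) sq smooth_on_dz chol_smooth_on[OF B(1)] phB ph'B q0; assumption)+
  moreover have "\<forall>z\<in>B. dz al E z = (\<Sum>mu. cnj (ph mu z) * (dz al (ph mu) z * inverse (q z)) + cnj (ph' mu z) * (- (dz al (ph' mu) z * inverse (q' z))))"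
   by (simp add: dE rh_def rh'_def divide_inverse sum_distrib_left sum_distrib_right sum_subtractf mult_ac)
  ultimately show ?thesis by (rule AI[OF kch])
 qed
 have k0: "dz al E z = 0" if "z \<in> B" for al z
 proof (rule chol_zero[where \<A> = \<A> and p = p and r = r, OF _ _ _ kA that[unfolded B_def]])
  show "chol F (ball p r)" if "F \<in> \<A>" for F using that by (simp add: \<A>_def B_def)
  show "F p = 0" if "F \<in> \<A>" for F using that B(2) P P' by (auto simp: \<A>_def ph_def ph'_def)
  show "(%z. \<Sum>ga. v $ ga * dz ga F z) \<in> \<A>" if F: "F \<in> \<A>" for F v
  proof -
   obtain A A' where A: "!!mu. smooth_on B (A mu)" "!!mu. smooth_on B (A' mu)"
    and e: "!!z. z \<in> B ==> F z = (\<Sum>mu. cnj (ph mu z) * A mu z + cnj (ph' mu z) * A' mu z)" and c: "chol F B"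
    using F unfolding \<A>_def by blast
   have d: "dz ga F z = (\<Sum>mu. cnj (ph mu z) * dz ga (A mu) z + cnj (ph' mu z) * dz ga (A' mu) z)" if z: "z \<in> B" for ga z
   proof -
    note di = cholD[OF phB z] cholD[OF ph'B z] smooth_on_differentiable[OF A(1) z] smooth_on_differentiable[OF A(2) z]
    have "dz ga F z = dz ga (%z. \<Sum>mu. cnj (ph mu z) * A mu z + cnj (ph' mu z) * A' mu z) z"
     by (rule dz_cong[OF B(1) z]) (rule e)
    then show ?thesis by (simp add: dz_sum dz_add dz_mult differentiable_cnj dz_cnj di differentiable_mult differentiable_add)
   qed
   have "chol (%z. \<Sum>ga. v $ ga * dz ga F z) B" by (intro chol_sum chol_mult chol_const chol_dz B(1) c)
   moreover have "\<forall>mu. smooth_on B (%z. \<Sum>ga. v $ ga * dz ga (A mu) z)" "\<forall>mu. smooth_on B (%z. \<Sum>ga. v $ ga * dz ga (A' mu) z)"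
    by (intro allI smooth_on_sum smooth_on_mult smooth_on_const smooth_on_dz B(1) A)+
   moreover have "(\<Sum>ga. v $ ga * dz ga F z) = (\<Sum>mu. cnj (ph mu z) * (\<Sum>ga. v $ ga * dz ga (A mu) z)
     + cnj (ph' mu z) * (\<Sum>ga. v $ ga * dz ga (A' mu) z))" if "z \<in> B" for z
    unfolding d[OF that] sum_distrib_left sum.distrib[symmetric] by (subst sum.swap) (simp add: algebra_simps)
   ultimately show ?thesis by (rule AI[OF _ _ _ ballI])
  qed
 qed
 \<comment> \<open>The difference of potentials is real, so the barred derivatives vanish together
   with the unbarred ones and it is constant; at \<open>p\<close> the two maps coincide.\<close>
 have E0: "E z = 0" if z: "z \<in> B" for z
 proof -
  have "E z = E p"
  proof (rule chol_const_on_ball[where r = r])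
   fix x ga assume x: "x \<in> ball p r"
   then show "E differentiable (at x)" "dz ga E x = 0" using k0 smooth_on_differentiable[OF sE] by (auto simp: B_def)
   have "E = (%z. cnj (E z))" by (simp add: E_def l_def l'_def fun_eq_iff)
   then have "dzbar ga E x = dzbar ga (%z. cnj (E z)) x" by simp
   then show "dzbar ga E x = 0"
    using k0[of x ga] x smooth_on_differentiable[OF sE, of x] by (simp add: dz_cnj(2) B_def)
  qed (use z in \<open>simp add: B_def\<close>)
  also have "E p = 0"
  proof -
   have "f p = f' p"
    using N[OF U(2)] N'[OF U(2)] P P' unfolding vec_eq_iff by (metis option.exhaust)
   then show ?thesis by (simp add: E_def l_def l'_def)
  qed
  finally show ?thesis .
 qed
 have qq: "q z = q' z" if z: "z \<in> B" for z
  using E0[OF z] nz[OF z] by (simp add: E_def l_def l'_def q_def q'_def)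
 have rhrh: "rh al z = rh' al z" if "z \<in> B" for z al
  using k0[OF that, of al] dE[OF that, of al] qq[OF that] q0[OF that] by (simp add: field_simps)
 \<comment> \<open>Equal potentials and equal forms leave equal Gram matrices of the two Jacobians,
   so the Jacobians differ by a unitary matrix at each point.\<close>
 define J where "J = (%z. \<chi> al mu. dz al (ph mu) z)"
 define J' where "J' = (%z. \<chi> al mu. dz al (ph' mu) z)"
 have JJ: "(J z ** adj (J z)) $ al $ bt = (\<Sum>mu. dz al (ph mu) z * cnj (dz bt (ph mu) z))"
  "(J' z ** adj (J' z)) $ al $ bt = (\<Sum>mu. dz al (ph' mu) z * cnj (dz bt (ph' mu) z))" for z al bt
  by (simp_all add: matrix_matrix_mult_def adj_def J_def J'_def)
 have crh: "(\<Sum>mu. ph mu z * cnj (dz bt (ph mu) z)) = cnj (rh bt z)" "(\<Sum>mu. ph' mu z * cnj (dz bt (ph' mu) z)) = cnj (rh' bt z)" for bt z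
  by (simp_all add: rh_def rh'_def mult.commute)
 have ff: "fsform f z $ al $ bt = (J z ** adj (J z)) $ al $ bt / q z - rh al z * cnj (rh bt z) / (q z)\<^sup>2"
  "fsform f' z $ al $ bt = (J' z ** adj (J' z)) $ al $ bt / q' z - rh' al z * cnj (rh' bt z) / (q' z)\<^sup>2" if "z \<in> B" for z al bt
 proof -
  show "fsform f z $ al $ bt = (J z ** adj (J z)) $ al $ bt / q z - rh al z * cnj (rh bt z) / (q z)\<^sup>2"
   by (rule trans[OF fsform_formula[OF B(1) fB nz(1) that]])
    (simp_all add: sum_option dN[OF that] JJ crh(1)[symmetric], simp_all add: rh_def q_def ph_def)
  show "fsform f' z $ al $ bt = (J' z ** adj (J' z)) $ al $ bt / q' z - rh' al z * cnj (rh' bt z) / (q' z)\<^sup>2"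
   by (rule trans[OF fsform_formula[OF B(1) f'B nz(2) that]])
    (simp_all add: sum_option dN[OF that] JJ crh(2)[symmetric], simp_all add: rh'_def q'_def ph'_def)
 qed
 have JJJ: "J z ** adj (J z) = J' z ** adj (J' z)" if z: "z \<in> B" for z
 proof -
  have "fsform f z $ al $ bt = fsform f' z $ al $ bt" for al bt using eq[of z] z B(3) by auto
  then have "(J z ** adj (J z)) $ al $ bt / q z = (J' z ** adj (J' z)) $ al $ bt / q z" for al bt
   unfolding ff[OF z] qq[OF z] rhrh[OF z] by (metis diff_add_cancel)
  then show ?thesis using q0[OF z] by (simp add: vec_eq_iff)
 qed
 have sJ: "smooth_on B (%z. J z $ i $ j)" "smooth_on B (%z. J' z $ i $ j)" for i j
  unfolding J_def J'_def vec_lambda_beta by (intro smooth_on_dz B(1) chol_smooth_on[OF B(1)] phB ph'B)+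
 have "fsform f p = J p ** adj (J p)"
 proof -
  have "q p = 1" using N[OF U(2)] P by (simp add: q_def norm_vec_sq sum_option del: of_real_power)
  moreover have "rh al p = 0" for al by (simp add: rh_def ph_def P)
  ultimately show ?thesis by (simp add: vec_eq_iff ff[OF B(2)])
 qed
 then have "invertible (J p ** adj (J p))" using hermitian_posdef_invertible[OF pd] by simp
 then have "invertible (J p)" unfolding invertible_right_inverse by (metis matrix_mul_assoc)
 then have d0: "det (J p) ~= 0" by (simp add: invertible_det_nz)
 have "continuous (at p) (%z. det (J z))"
  using smooth_on_continuous_on[OF smooth_on_det[OF B(1) sJ(1)]] B(1,2) continuous_on_eq_continuous_at by blast
 then obtain r1 where r1: "r1 > 0" "!!z. dist p z < r1 ==> det (J z) ~= 0" using continuous_at_avoid[where f = "%z. det (J z)" and x = p and a = 0] d0 by blast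
 define R where "R = min r r1"
 define W where "W = ball p R"
 have R: "R > 0" using r r1 by (simp add: R_def)
 have W: "open W" "p \<in> W" "W \<subseteq> B" using r r1 by (auto simp: W_def B_def R_def)
 have Ji: "invertible (J z)" if "z \<in> W" for z using r1(2)[of z] that by (simp add: W_def R_def invertible_det_nz)
 \<comment> \<open>This matrix depends holomorphically on \<open>z\<close> because both Jacobians
   do, and it is unitary at every point; together this forces it to be constant.\<close>
 define V where "V = (%z. matrix_inv (J z) ** J' z)"
 have JV: "J z ** V z = J' z" if "z \<in> W" for z
  using matrix_inv_mat(2)[OF Ji[OF that]] by (simp add: V_def matrix_mul_assoc matrix_mul_lid)
 have VV: "V z ** adj (V z) = mat 1" if z: "z \<in> W" for z
 proof -
  have "V z ** adj (V z) = matrix_inv (J z) ** (J' z ** adj (J' z)) ** adj (matrix_inv (J z))"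
   by (simp add: V_def adj_mult matrix_mul_assoc)
  also have "... = (matrix_inv (J z) ** J z) ** adj (matrix_inv (J z) ** J z)"
   unfolding JJJ[OF subsetD[OF W(3) z], symmetric] by (simp add: adj_mult matrix_mul_assoc)
  finally show ?thesis by (simp add: matrix_inv_mat(1)[OF Ji[OF z]] matrix_mul_lid)
 qed
 have sV: "smooth_on W (%z. V z $ i $ j)" for i j
  unfolding V_def matrix_matrix_mult_def vec_lambda_beta
  by (intro smooth_on_sum smooth_on_mult smooth_on_matrix_inv W(1) smooth_on_mono[OF sJ(1) W(3)] smooth_on_mono[OF sJ(2) W(3)] Ji)
 note dV = smooth_on_differentiable[OF sV]
 have cJ: "chol (%z. J z $ i $ j) W" "chol (%z. J' z $ i $ j) W" for i j
  unfolding J_def J'_def vec_lambda_beta by (intro chol_mono[OF chol_dz[OF B(1)] W(3)] phB ph'B)+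
 have bV: "dzbar bt (%z. V z $ i $ j) z = 0" if z: "z \<in> W" for bt i j z
 proof -
  have "(\<Sum>mu. J z $ al $ mu * dzbar bt (%z. V z $ mu $ j) z) = 0" for al
  proof -
   have "dzbar bt (%z. \<Sum>mu. J z $ al $ mu * V z $ mu $ j) z = dzbar bt (%z. J' z $ al $ j) z"
    by (rule dz_cong[OF W(1) z]) (simp add: JV[symmetric] matrix_matrix_mult_def)
   then show ?thesis using cholD[OF cJ(1) z] cholD[OF cJ(2) z] dV[OF z] by (simp add: dz_sum dz_mult)
  qed
  then have "J z *v (\<chi> mu. dzbar bt (%z. V z $ mu $ j) z) = 0" by (simp add: matrix_vector_mult_def vec_eq_iff)
  from invertible_ker[OF Ji[OF z] this] show ?thesis by (simp add: vec_eq_iff)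
 qed
 \<comment> \<open>Differentiating the relation that \<open>V z\<close> times its adjoint is the
   identity: the adjoint is antiholomorphic, so only the derivative of the first factor remains, and
   the other factor is invertible.\<close>
 have zV: "dz ga (%z. V z $ i $ j) z = 0" if z: "z \<in> W" for ga i j z
 proof -
  have "(\<Sum>nu. dz ga (%z. V z $ i $ nu) z * cnj (V z $ k $ nu)) = 0" for k
  proof -
   have "dz ga (%z. \<Sum>nu. V z $ i $ nu * cnj (V z $ k $ nu)) z = dz ga (%z. if i = k then 1 else 0) z"
    using VV by (intro dz_cong[OF W(1) z]) (simp add: matrix_matrix_mult_def adj_def vec_eq_iff mat_def)
   then show ?thesis by (simp add: dz_sum dz_mult dV[OF z] differentiable_cnj dz_cnj bV[OF z])
  qed
  from arg_cong[OF this, of cnj]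
  have "(\<Sum>nu. V z $ k $ nu * cnj (dz ga (%z. V z $ i $ nu) z)) = 0" for k
   by (simp add: mult.commute)
  then have "V z *v (\<chi> nu. cnj (dz ga (%z. V z $ i $ nu) z)) = 0"
   by (simp add: matrix_vector_mult_def vec_eq_iff)
  moreover have "invertible (V z)" using VV[OF z] invertible_right_inverse by blast
  ultimately have "(\<chi> nu. cnj (dz ga (%z. V z $ i $ nu) z)) = 0" using invertible_ker by blast
  then show ?thesis by (simp add: vec_eq_iff)
 qed
 have Vc: "V z $ i $ j = V p $ i $ j" if z: "z \<in> W" for z i j
  by (rule chol_const_on_ball[where r = R and F = "%z. V z $ i $ j"]) (use z dV zV bV in \<open>auto simp: W_def\<close>)
 have phV: "ph' nu z = (\<Sum>mu. ph mu z * V p $ mu $ nu)" if z: "z \<in> W" for z nu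
 proof -
  define ps where "ps = (%z. ph' nu z - (\<Sum>mu. ph mu z * V p $ mu $ nu))"
  have c: "chol ps W" unfolding ps_def
   by (intro chol_diff chol_sum chol_mult chol_const chol_mono[OF phB W(3)] chol_mono[OF ph'B W(3)])
  have "ps z = ps p"
  proof (rule chol_const_on_ball[where r = R])
   fix x ga assume "x \<in> ball p R"
   then have x: "x \<in> W" "x \<in> B" using W by (auto simp: W_def)
   show "ps differentiable (at x)" "dzbar ga ps x = 0" using cholD[OF c x(1)] by auto
   have "dz ga ps x = J' x $ ga $ nu - (J x ** V x) $ ga $ nu"
    unfolding ps_def matrix_matrix_mult_def vec_lambda_beta Vc[OF x(1)]
    by (simp add: dz_diff dz_sum dz_mult cholD[OF phB x(2)] cholD[OF ph'B x(2)] differentiable_sum differentiable_mult J_def J'_def)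
   then show "dz ga ps x = 0" by (simp add: JV[OF x(1)])
  qed (use z in \<open>simp add: W_def\<close>)
  also have "ps p = 0" by (simp add: ps_def ph_def ph'_def P P')
  finally show ?thesis by (simp add: ps_def)
 qed
 \<comment> \<open>The constant matrix multiplies row vectors of affine coordinates from the right,
   hence the transpose; the coordinate \<open>None\<close> is 1 for both maps and is fixed.\<close>
 define M :: "complex^('m option)^('m option)" where
  "M = (\<chi> i j. case (i, j) of (None, None) => 1 | (Some nu, Some mu) => V p $ mu $ nu | _ => 0)"
 have Ms: "M $ None $ None = 1" "M $ None $ Some mu = 0" "M $ Some nu $ None = 0" "M $ Some nu $ Some mu = V p $ mu $ nu" for mu nu
  by (simp_all add: M_def)
 have "unitary M"
 proof -
  have "(\<Sum>nu. V p $ j $ nu * cnj (V p $ i $ nu)) = (if j = i then 1 else 0)" for i j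
   using VV[OF W(2)] by (simp add: matrix_matrix_mult_def adj_def vec_eq_iff mat_def)
  then have "(adj M ** M) $ i $ j = (mat 1 :: complex^('m option)^('m option)) $ i $ j" for i j
   by (cases i; cases j) (auto simp: matrix_matrix_mult_def adj_def mat_def sum_option Ms mult.commute)
  then show ?thesis by (simp add: unitary_def vec_eq_iff)
 qed
 moreover have "f' z = M *v f z" if z: "z \<in> W" for z
 proof -
  have zU: "z \<in> U" using z W B by blast
  have "f' z $ i = (M *v f z) $ i" for i
  proof (cases i)
   case None
   show ?thesis unfolding None using N[OF zU] N'[OF zU] by (simp add: matrix_vector_mult_def sum_option Ms)
  next
   case (Some nu)
   show ?thesis unfolding Some using phV[OF z, of nu]
    by (simp add: matrix_vector_mult_def sum_option Ms ph_def ph'_def mult.commute)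
  qed
  then show ?thesis by (simp add: vec_eq_iff)
 qed
 ultimately show ?thesis using W B by blast
qed

lemma liftD:
 assumes "lift ka h U f"
 shows "open U" "chol (%z. f z $ i) U" "z \<in> U ==> f z ~= 0"
  "z \<in> U ==> fsform f z $ al $ bt = cor ka * h z $ al $ bt"
 using assms unfolding lift_def by auto

lemma lift_mono: "lift ka h U f ==> open W ==> W \<subseteq> U ==> lift ka h W f"
 unfolding lift_def using chol_mono by blast

lemma lift_unitary: 
 assumes "lift ka h U f" "unitary V" shows "lift ka h U (%z. V *v f z)"
proof -
 have "V *v f z ~= 0" if "z \<in> U" for z
  using liftD(3)[OF assms(1) that] unitary_norm[OF assms(2), of "f z"] by (metis norm_eq_zero)
 then show ?thesis
  using assms(1) unfolding lift_def fsform_unitary[OF assms(2)] by (blast intro: chol_matrix)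
qed

lemma lift_posdef:
 assumes "lift ka h U f" "ka > 0" "z \<in> U" "hermitian_posdef (h z)"
 shows "hermitian_posdef (fsform f z)"
 unfolding hermitian_posdef_def
proof (intro conjI allI impI)
 note L = liftD(4)[OF assms(1,3)]
 have "h z $ bt $ al = cnj (h z $ al $ bt)" for al bt using assms(4) unfolding hermitian_posdef_def by blast
 from this[of bt al for al bt] show "fsform f z $ bt $ al = cnj (fsform f z $ al $ bt)" for al bt
  unfolding L complex_cnj_mult complex_cnj_complex_of_real by (rule arg_cong)
 fix v :: "complex^'a" assume "v ~= 0"
 then have "0 < Re (\<Sum>al bt. h z $ al $ bt * v $ al * cnj (v $ bt))"
  using assms(4) unfolding hermitian_posdef_def by blast
 then have "0 < Re (cor ka * (\<Sum>al bt. h z $ al $ bt * v $ al * cnj (v $ bt)))"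
  using assms(2) by simp
 then show "0 < Re (\<Sum>al bt. fsform f z $ al $ bt * v $ al * cnj (v $ bt))"
  unfolding L sum_distrib_left by (simp add: mult_ac)
qed

text \<open>Rotate \<open>f p\<close> onto the axis \<open>None\<close>, then divide by that
  coordinate. Neither operation changes the Fubini-Study form, and the affine coordinates of the
  result vanish at \<open>p\<close>.\<close>

lemma normalise:
 fixes f :: "complex^'m::finite => complex^('m option)"
 assumes "lift ka h U f" "p \<in> U"
 obtains A W f1 where "unitary A" "open W" "p \<in> W" "W \<subseteq> U" "!!i. chol (%z. f1 z $ i) W"
  "!!z. z \<in> W ==> f1 z $ None = 1" "!!al. f1 p $ Some al = 0"
  "!!z. z \<in> W ==> par (f1 z) (A *v f z)" "!!z. z \<in> W ==> fsform f1 z = fsform f z"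
proof -
 note L = liftD[OF assms(1)]
 have n0: "norm (f p) > 0" using L(3)[OF assms(2)] by simp
 define u where "u = cor (inverse (norm (f p))) *s f p"
 have uf: "u = inverse (norm (f p)) *\<^sub>R f p" by (simp add: u_def vec_eq_iff scaleR_conv_of_real[where 'a = complex])
 have "norm u = 1" unfolding uf using n0 by simp
 then obtain A where A: "unitary A" "A *v u = axis None 1"
  using unitary_transitive[of u "axis None 1"] by (auto simp: norm_axis_complex)
 define F where "F = (%z. A *v f z)"
 have "F p = cor (norm (f p)) *s (A *v u)"
  using n0 by (simp add: F_def u_def matrix_vector_smult vec_eq_iff)
 then have Fp: "F p $ None = cor (norm (f p))" "F p $ Some al = 0" for al
  unfolding A(2) by (simp_all add: axis_def)
 have cF: "chol (%z. F z $ i) U" for i unfolding F_def by (intro chol_matrix L(2))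
 define W where "W = {z \<in> U. F z $ None ~= 0}"
 have W: "open W" "p \<in> W" "W \<subseteq> U"
 proof -
  have "W = U \<inter> (%z. F z $ None) -` (- {0})" by (auto simp: W_def)
  then show "open W" using continuous_open_preimage[OF chol_continuous_on[OF cF] L(1), of "- {0}"] by (simp add: open_Compl)
  show "p \<in> W" using assms(2) Fp n0 by (simp add: W_def)
 qed (auto simp: W_def)
 have Wn: "F z $ None ~= 0" if "z \<in> W" for z using that by (simp add: W_def)
 define f1 where "f1 = (%z. inverse (F z $ None) *s F z)"
 have ic: "chol (%z. inverse (F z $ None)) W" by (intro chol_inverse chol_mono[OF cF W(3)] Wn)
 show thesis
 proof (rule that[OF A(1) W])
  show "chol (%z. f1 z $ i) W" for i unfolding f1_def using chol_mult[OF ic chol_mono[OF cF W(3)]] by simp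
  show "f1 z $ None = 1" if "z \<in> W" for z using Wn[OF that] by (simp add: f1_def)
  show "f1 p $ Some al = 0" for al by (simp add: f1_def Fp)
  show "par (f1 z) (A *v f z)" if "z \<in> W" for z
   using par_scale[of "inverse (F z $ None)" "F z"] Wn[OF that] by (simp add: f1_def F_def)
  show "fsform f1 z = fsform f z" if z: "z \<in> W" for z
  proof -
   have nz: "F z ~= 0" if "z \<in> W" for z using Wn[OF that] by (metis zero_index)
   have "fsform f1 z = fsform F z" unfolding f1_def
    by (rule fsform_scale[OF W(1) chol_mono[OF cF W(3)] nz ic _ z]) (use Wn in auto)
   then show ?thesis unfolding F_def fsform_unitary[OF A(1)] .
  qed
 qed
qed

theorem rigidity:
 fixes f f' :: "complex^'m::finite => complex^('m option)"
 assumes l: "lift ka h U f" "lift ka h U' f'" and p: "p \<in> U" "p \<in> U'" and ka: "ka > 0" and pd: "hermitian_posdef (h p)"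
 obtains W V where "open W" "p \<in> W" "W \<subseteq> U \<inter> U'" "unitary V" "!!z. z \<in> W ==> par (f' z) (V *v f z)"
proof -
 obtain A W1 f1 where A: "unitary A" "open W1" "p \<in> W1" "W1 \<subseteq> U" "!!i. chol (%z. f1 z $ i) W1"
  "!!z. z \<in> W1 ==> f1 z $ None = 1" "!!al. f1 p $ Some al = 0"
  "!!z. z \<in> W1 ==> par (f1 z) (A *v f z)" "!!z. z \<in> W1 ==> fsform f1 z = fsform f z"
  using normalise[OF l(1) p(1)] by blast
 obtain A' W2 f2 where A': "unitary A'" "open W2" "p \<in> W2" "W2 \<subseteq> U'" "!!i. chol (%z. f2 z $ i) W2"
  "!!z. z \<in> W2 ==> f2 z $ None = 1" "!!al. f2 p $ Some al = 0"
  "!!z. z \<in> W2 ==> par (f2 z) (A' *v f' z)" "!!z. z \<in> W2 ==> fsform f2 z = fsform f' z"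
  using normalise[OF l(2) p(2)] by blast
 have "\<exists>W V. open W & p \<in> W & W \<subseteq> W1 \<inter> W2 & unitary V & (\<forall>z\<in>W. f2 z = V *v f1 z)"
 proof (rule rigidity_normalised)
  show "open (W1 \<inter> W2)" "p \<in> W1 \<inter> W2" using A A' by auto
  show "chol (%z. f1 z $ i) (W1 \<inter> W2)" "chol (%z. f2 z $ i) (W1 \<inter> W2)" for i
   using chol_mono[OF A(5)] chol_mono[OF A'(5)] by blast+
  show "hermitian_posdef (fsform f1 p)" using lift_posdef[OF l(1) ka p(1) pd] A(9)[OF A(3)] by simp
  show "fsform f1 z = fsform f2 z" if "z \<in> W1 \<inter> W2" for z
   using that A(4,9) A'(4,9) liftD(4)[OF l(1)] liftD(4)[OF l(2)] by (auto simp: vec_eq_iff subset_iff)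
 qed (use A A' in auto)
 then obtain W V where V: "open W" "p \<in> W" "W \<subseteq> W1 \<inter> W2" "unitary V" "!!z. z \<in> W ==> f2 z = V *v f1 z" by blast
 show thesis
 proof (rule that[OF V(1,2)])
  show "W \<subseteq> U \<inter> U'" using V(3) A(4) A'(4) by blast
  show "unitary (adj A' ** (V ** A))" by (intro unitary_mult unitary_adj A(1) A'(1) V(4))
  fix z assume z: "z \<in> W"
  have "par (A' *v f' z) (f2 z)" by (rule par_sym, rule A'(8)) (use z V(3) in blast)
  also have "f2 z = V *v f1 z" by (rule V(5)[OF z])
  also have "par ... (V *v (A *v f z))" by (rule par_matrix, rule A(8)) (use z V(3) in blast)
  finally (par_trans) have "par (adj A' *v (A' *v f' z)) (adj A' *v (V *v (A *v f z)))" by (rule par_matrix)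
  then show "par (f' z) (adj A' ** (V ** A) *v f z)"
   unfolding unitary_cancel(1)[OF A'(1)] by (simp add: matrix_vector_mul_assoc matrix_mul_assoc)
 qed
qed

section \<open>Local inverses of lifts\<close>

lemma chol_inverse_function:
 fixes ph :: "complex^'m::finite => complex^'m"
 assumes U: "open U" "p \<in> U" and ph: "!!i. chol (%z. ph z $ i) U" and inv: "invertible (\<chi> mu al. dz al (%w. ph w $ mu) p)"
 obtains U' V g where "open U'" "U' \<subseteq> U" "p \<in> U'" "open V" "homeomorphism U' V ph g" "!!i. chol (%v. g v $ i) V"
proof -
 define M where "M = (%z. \<chi> mu al. dz al (%w. ph w $ mu) z)"
 define D where "D = (%z. Blinfun (%v. M z *v v))"
 have bl: "bounded_linear (%v. A *v v)" for A :: "complex^'m^'m"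
  by (rule linear_conv_bounded_linear[THEN iffD1], rule linearI)
   (simp_all add: vec_eq_iff matrix_vector_mult_def scaleR_sum_right distrib_left sum.distrib)
 have D: "blinfun_apply (D z) = (%v. M z *v v)" for z unfolding D_def by (rule bounded_linear_Blinfun_apply[OF bl])
 have der: "(ph has_derivative blinfun_apply (D z)) (at z)" if "z \<in> U" for z
  unfolding D by (rule has_derivative_vec, rule has_derivative_eq_rhs[OF chol_has_derivative[OF ph that]])
   (simp add: M_def matrix_vector_mult_def)
 have cont: "continuous_on U D"
 proof (rule continuous_on_blinfun_componentwise)
  fix e :: "complex^'m"
  have "continuous_on U (%z. \<chi> mu. \<Sum>al. dz al (%w. ph w $ mu) z * e $ al)"
   by (intro continuous_on_vec_lambda continuous_on_sum continuous_on_mult continuous_on_const chol_dz_continuous[OF U(1) ph])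
  then show "continuous_on U (%z. blinfun_apply (D z) e)" by (simp add: D M_def matrix_vector_mult_def)
 qed
 have invM: "invertible (M p)" using inv by (simp add: M_def)
 have "Blinfun (%v. matrix_inv (M p) *v v) o\<^sub>L D p = id_blinfun"
  by (rule blinfun_eqI)
   (simp add: bounded_linear_Blinfun_apply[OF bl] D matrix_vector_mul_assoc matrix_inv_mat(1)[OF invM] matrix_vector_mul_lid)
 from inverse_function_theorem[OF U(1) der cont U(2) this]
 obtain U' V g g' where g: "open U'" "U' \<subseteq> U" "p \<in> U'" "open V" "homeomorphism U' V ph g"
  "!!y. y \<in> V ==> (g has_derivative (g' y)) (at y)"
  "!!y. y \<in> V ==> g' y = Hilbert_Choice.inv (blinfun_apply (D (g y)))"
  "!!y. y \<in> V ==> bij (blinfun_apply (D (g y)))" by metis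
 have "cholomorphic_on g V" unfolding cholomorphic_on_def
 proof (intro ballI exI conjI allI)
  fix y c v assume y: "y \<in> V"
  show "(g has_derivative (g' y)) (at y)" by (rule g(6)[OF y])
  let ?T = "blinfun_apply (D (g y))"
  have "?T (c *s Hilbert_Choice.inv ?T v) = c *s v"
   using g(8)[OF y] unfolding D by (simp add: matrix_vector_smult bij_is_surj surj_f_inv_f)
  then show "g' y (c *s v) = c *s g' y v"
   unfolding g(7)[OF y] using g(8)[OF y] by (metis bij_inv_eq_iff)
 qed
 then show thesis using that g(1-5) unfolding cholomorphic_on_iff_chol by blast
qed

lemma par_nonzero: "par u w ==> u ~= 0 \<longleftrightarrow> w ~= 0"
 unfolding par_def by (auto simp: vec_eq_iff)

text \<open>The lift makes the metric the pullback of a Fubini-Study form, so positive definiteness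
  forces the affine coordinates of the lift to have an invertible Jacobian. Inverting them gives a
  map on lines, which is extended to the cone over the image.\<close>

lemma local_inverse:
 fixes f :: "complex^'m::finite => complex^('m option)"
 assumes l: "lift ka h U f" and p: "p \<in> U" and ka: "ka > 0" and pd: "hermitian_posdef (h p)"
 obtains W N ps where "open W" "p \<in> W" "W \<subseteq> U" "open N"
  "!!i. chol (%v. ps v $ i) N" "!!v. v \<in> N ==> ps v \<in> W & par (f (ps v)) v"
  "!!z v. z \<in> W ==> par (f z) v ==> v \<in> N & ps v = z"
proof -
 obtain A W1 f1 where A: "unitary A" and W1: "open W1" "p \<in> W1" "W1 \<subseteq> U" and f1: "!!i. chol (%z. f1 z $ i) W1"
  "!!z. z \<in> W1 ==> f1 z $ None = 1" "!!al. f1 p $ Some al = 0"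
  "!!z. z \<in> W1 ==> par (f1 z) (A *v f z)" "!!z. z \<in> W1 ==> fsform f1 z = fsform f z"
  using normalise[OF l p] by blast
 define ph where "ph = (%z. \<chi> mu. f1 z $ Some mu)"
 have cph: "chol (%z. ph z $ mu) W1" for mu using f1(1)[of "Some mu"] by (simp add: ph_def)
 have nz: "f1 z ~= 0" if "z \<in> W1" for z using f1(2)[OF that] by (metis zero_index zero_neq_one)
 define M where "M = (\<chi> mu al. dz al (%w. ph w $ mu) p)"
 have dN: "dz al (%w. f1 w $ None) p = 0" for al
  using dz_cong(1)[OF W1(1,2), of "%w. f1 w $ None" "%w. 1" al] f1(2) by simp
 \<comment> \<open>At the normalised point the second term of \<open>fsform_formula\<close> vanishes
   and the form is the Gram matrix of the affine Jacobian.\<close>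
 have "fsform f1 p = transpose M ** (\<chi> i j. cnj (M $ i $ j))"
 proof -
  have "norm (f1 p) = 1"
  proof -
   have "cor ((norm (f1 p))\<^sup>2) = 1" unfolding norm_vec_sq by (simp add: sum_option f1(2)[OF W1(2)] f1(3))
   then have "(norm (f1 p))\<^sup>2 = 1" by (metis of_real_eq_1_iff)
   then show ?thesis using norm_ge_zero[of "f1 p"] unfolding power2_eq_1_iff by linarith
  qed
  then have "fsform f1 p $ al $ bt = (\<Sum>mu. dz al (%w. ph w $ mu) p * cnj (dz bt (%w. ph w $ mu) p))" for al bt
   by (intro trans[OF fsform_formula[OF W1(1) f1(1) nz W1(2)]]) (simp_all add: sum_option dN f1(3) ph_def)
  then show ?thesis by (simp add: vec_eq_iff matrix_matrix_mult_def transpose_def M_def)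
 qed
 moreover have "hermitian_posdef (fsform f1 p)" using lift_posdef[OF l ka p pd] f1(5)[OF W1(2)] by simp
 ultimately have "invertible (transpose M)"
  using hermitian_posdef_invertible invertible_right_inverse by (metis matrix_mul_assoc)
 then obtain B where "transpose M ** B = mat 1" unfolding invertible_right_inverse by blast
 then have "transpose B ** M = mat 1" by (metis matrix_transpose_mul transpose_mat transpose_transpose)
 then have "invertible M" unfolding invertible_left_inverse by blast
 then obtain W V0 g where W: "open W" "W \<subseteq> W1" "p \<in> W" "open V0" "homeomorphism W V0 ph g" "!!i. chol (%v. g v $ i) V0"
  using chol_inverse_function[OF W1(1,2) cph] unfolding M_def by metis
 note hom = homeomorphism_apply1[OF W(5)] homeomorphism_apply2[OF W(5)] homeomorphism_image1[OF W(5)] homeomorphism_image2[OF W(5)]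
 define Q :: "complex^('m option) => complex^'m" where "Q = (%v. \<chi> al. (A *v v) $ Some al * inverse ((A *v v) $ None))"
 define N0 where "N0 = {v. (A *v v) $ None ~= 0}"
 have cA: "chol (%v. (A *v v) $ i) S" for i S by (intro chol_matrix chol_coord)
 have N0: "open N0"
 proof -
  have "N0 = UNIV \<inter> (%v. (A *v v) $ None) -` (- {0})" by (auto simp: N0_def)
  then show ?thesis using continuous_open_preimage[OF chol_continuous_on[OF cA] open_UNIV, of "- {0}"]
   by (metis closed_singleton open_Compl)
 qed
 have cQ: "chol (%v. Q v $ i) N0" for i
  unfolding Q_def vec_lambda_beta by (intro chol_mult chol_inverse cA) (simp add: N0_def)
 \<comment> \<open>The vectors whose line has affine coordinates, after the rotation
   \<open>A\<close>, in the image of the local chart: a cone, so the inverse does not see the scale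
   of \<open>v\<close>.\<close>
 define N where "N = N0 \<inter> Q -` V0"
 define ps where "ps = (%v. g (Q v))"
 have "continuous_on N0 (%v. \<chi> i. Q v $ i)" by (intro continuous_on_vec_lambda chol_continuous_on[OF cQ])
 then have "continuous_on N0 Q" by simp
 then have oN: "open N" unfolding N_def by (rule continuous_open_preimage[OF _ N0 W(4)])
 have key: "par (f1 z) (A *v v) \<longleftrightarrow> v \<in> N0 & ph z = Q v" if z: "z \<in> W1" for z v
 proof
  assume "par (f1 z) (A *v v)"
  then obtain c where c: "c ~= 0" "f1 z = c *s (A *v v)" unfolding par_def by blast
  then have n: "c * (A *v v) $ None = 1" using f1(2)[OF z] by simp
  then have 0: "(A *v v) $ None ~= 0" by auto
  then have "c = inverse ((A *v v) $ None)" using n by (simp add: field_simps)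
  then have "ph z = Q v" using c by (simp add: ph_def Q_def vec_eq_iff)
  then show "v \<in> N0 & ph z = Q v" using 0 by (simp add: N0_def)
 next
  assume R: "v \<in> N0 & ph z = Q v"
  then have n: "(A *v v) $ None ~= 0" by (simp add: N0_def)
  have "f1 z $ i = (inverse ((A *v v) $ None) *s (A *v v)) $ i" for i
  proof (cases i)
   case None then show ?thesis using f1(2)[OF z] n by simp
  next
   case (Some al)
   have "ph z $ al = Q v $ al" using R by simp
   then show ?thesis unfolding Some by (simp add: ph_def Q_def)
  qed
  then show "par (f1 z) (A *v v)" unfolding par_def using n by (intro exI[of _ "inverse ((A *v v) $ None)"]) (simp add: vec_eq_iff)
 qed
 have key2: "par (f z) v \<longleftrightarrow> v \<in> N0 & ph z = Q v" if z: "z \<in> W1" for z v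
 proof -
  have "par (f z) v \<longleftrightarrow> par (A *v f z) (A *v v)"
   using par_matrix[of "f z" v A] par_matrix[of "A *v f z" "A *v v" "adj A"] unitary_cancel(1)[OF A] by metis
  also have "... \<longleftrightarrow> par (f1 z) (A *v v)" using f1(4)[OF z] par_sym par_trans by blast
  finally show ?thesis unfolding key[OF z] .
 qed
 show thesis
 proof (rule that[OF W(1,3) _ oN])
  show "W \<subseteq> U" using W(2) W1(3) by blast
  show "chol (%v. ps v $ i) N" for i unfolding ps_def
   by (rule chol_compose[OF chol_mono[OF cQ] W(6)]) (auto simp: N_def)
  show "ps v \<in> W & par (f (ps v)) v" if "v \<in> N" for v
  proof -
   have v: "v \<in> N0" "Q v \<in> V0" using that by (auto simp: N_def)
   then have "ps v \<in> W" "ph (ps v) = Q v" using hom unfolding ps_def by auto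
   then show ?thesis using key2 v W(2) by blast
  qed
  show "v \<in> N & ps v = z" if "z \<in> W" "par (f z) v" for z v
  proof -
   have "v \<in> N0" "ph z = Q v" using key2 that W(2) by blast+
   moreover have "ph z \<in> V0" "g (ph z) = z" using hom that(1) by auto
   ultimately show ?thesis by (auto simp: N_def ps_def)
  qed
 qed
qed

section \<open>Pinched Kaehler--Einstein manifolds\<close>

lemma curvature_cong:
 fixes h h' :: "'m::finite local_metric"
 assumes U: "open U" and e: "!!z. z \<in> U ==> h z = h' z" and z: "z \<in> U"
 shows "cscal h z = cscal h' z" "bochner_norm h z = bochner_norm h' z"
proof -
 have g: "ginv h al bt x = ginv h' al bt x" if "x \<in> U" for al bt x using e[OF that] by (simp add: ginv_def)
 have d: "dz ga (%w. h w $ al $ nu) x = dz ga (%w. h' w $ al $ nu) x" if "x \<in> U" for ga al nu x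
  by (rule dz_cong[OF U that]) (simp add: e)
 have c: "christoffel h mu ga al x = christoffel h' mu ga al x" if "x \<in> U" for mu ga al x
  by (simp add: christoffel_def g[OF that] d[OF that])
 have k: "curv h al bt ga dt z = curv h' al bt ga dt z" for al bt ga dt
  unfolding curv_def by (simp add: e[OF z] dz_cong(2)[OF U z c])
 have r: "ricci h al bt z = ricci h' al bt z" for al bt by (simp add: ricci_def k g[OF z])
 show s: "cscal h z = cscal h' z" by (simp add: cscal_def r g[OF z])
 have b: "bochner h al bt ga dt z = bochner h' al bt ga dt z" for al bt ga dt
  unfolding bochner_def Let_def by (simp only: k r s e[OF z])
 show "bochner_norm h z = bochner_norm h' z" by (simp add: bochner_norm_def e[OF z] b)
qed

section \<open>Charts, transition maps and globally defined scalar invariants\<close>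

locale kaehler_atlas =
 fixes X :: "'a topology" and A :: "('a, 'm::finite) chart set" and g :: "('a, 'm) metric"
 assumes kaehler: "kaehler_manifold X A g"
begin

lemma cm: "complex_manifold X A" and hm: "hermitian_metric A g" and fc: "fundamental_form_closed A g"
 using kaehler by (auto simp: kaehler_manifold_def)

lemma atlas: "c \<in> A ==> openin X (dom_of c)" "c \<in> A ==> open (codom_of c)"
 "c \<in> A ==> homeomorphic_map (subtopology X (dom_of c)) (top_of_set (codom_of c)) (coord c)"
 "(\<Union>c\<in>A. dom_of c) = topspace X"
 "c \<in> A ==> d \<in> A ==> cholomorphic_on (local_rep c d id) (local_rep_dom c d id)"
 using cm unfolding complex_manifold_def holomorphic_atlas_def by auto

lemma hausdorff: "Hausdorff_space X" and connected: "connected_space X" and nonempty: "topspace X ~= {}"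
 using cm unfolding complex_manifold_def by auto

lemma chart_ex: "x \<in> topspace X ==> \<exists>c\<in>A. x \<in> dom_of c" using atlas(4) by blast

lemma dom_sub: "c \<in> A ==> dom_of c \<subseteq> topspace X" using atlas(4) by blast

abbreviation cinv :: "('a, 'm) chart => complex^'m => 'a" where "cinv c \<equiv> inv_into (dom_of c) (coord c)"

lemma coord_inj: "c \<in> A ==> inj_on (coord c) (dom_of c)"
 using homeomorphic_imp_injective_map[OF atlas(3)] dom_sub by (simp add: topspace_subtopology Int_absorb1)

lemma cinv: "c \<in> A ==> x \<in> dom_of c ==> cinv c (coord c x) = x"
 by (simp add: inv_into_f_f[OF coord_inj])

lemma cinv': "z \<in> codom_of c ==> cinv c z \<in> dom_of c" "z \<in> codom_of c ==> coord c (cinv c z) = z"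
 by (auto intro: inv_into_into f_inv_into_f)

lemma coord_cont: "c \<in> A ==> continuous_map (subtopology X (dom_of c)) euclidean (coord c)"
 using homeomorphic_imp_continuous_map[OF atlas(3)] continuous_map_in_subtopology by blast

lemma open_coord_image:
 assumes "c \<in> A" "openin X N" shows "open (coord c ` (N \<inter> dom_of c))"
proof -
 have "openin (subtopology X (dom_of c)) (N \<inter> dom_of c)" using assms(2) by (auto simp: openin_subtopology)
 then have "openin (top_of_set (codom_of c)) (coord c ` (N \<inter> dom_of c))"
  using homeomorphic_imp_open_map[OF atlas(3)[OF assms(1)]] by (simp add: open_map_def)
 then show ?thesis using openin_open_trans atlas(2)[OF assms(1)] by blast
qed

lemma open_coord_preimage:
 assumes "c \<in> A" "open U" shows "openin X {x \<in> dom_of c. coord c x \<in> U}"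
proof -
 have "openin (subtopology X (dom_of c)) {x \<in> topspace (subtopology X (dom_of c)). coord c x \<in> U}"
  by (rule openin_continuous_map_preimage[OF coord_cont[OF assms(1)]]) (use assms in simp)
 moreover have "{x \<in> topspace (subtopology X (dom_of c)). coord c x \<in> U} = {x \<in> dom_of c. coord c x \<in> U}"
  using dom_sub[OF assms(1)] by auto
 ultimately show ?thesis using atlas(1)[OF assms(1)] openin_trans_full by fastforce
qed

lemma cinv_cont: "c \<in> A ==> continuous_map (top_of_set (codom_of c)) X (cinv c)"
 unfolding continuous_map_def
proof (intro conjI allI impI)
 assume c: "c \<in> A"
 show "cinv c \<in> topspace (top_of_set (codom_of c)) \<rightarrow> topspace X" using cinv'(1)[of _ c] dom_sub[OF c] by auto
 fix N assume "openin X N"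
 from open_coord_image[OF c this]
 have "openin (top_of_set (codom_of c)) (coord c ` (N \<inter> dom_of c))" by (intro open_subset) auto
 moreover have "{z \<in> topspace (top_of_set (codom_of c)). cinv c z \<in> N} = coord c ` (N \<inter> dom_of c)"
 proof (intro equalityI subsetI)
  fix z assume z: "z \<in> {z \<in> topspace (top_of_set (codom_of c)). cinv c z \<in> N}"
  then have "z \<in> codom_of c" by simp
  from cinv'[OF this] z show "z \<in> coord c ` (N \<inter> dom_of c)" by (metis (mono_tags, lifting) IntI imageI mem_Collect_eq)
 qed (use cinv[OF c] in auto)
 ultimately show "openin (top_of_set (codom_of c)) {z \<in> topspace (top_of_set (codom_of c)). cinv c z \<in> N}" by (simp only:)
qed

lemma kmetric_chart: "c \<in> A ==> kmetric (codom_of c) (g c)"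
 using bspec[OF conjunct1[OF hm[unfolded hermitian_metric_def]]] bspec[OF fc[unfolded fundamental_form_closed_def]] atlas(2)
 unfolding kmetric_def by simp

lemma overlap: "local_rep_dom c d id = coord c ` (dom_of d \<inter> dom_of c)"
 by (auto simp: local_rep_dom_def)

lemma transition:
 assumes c: "c \<in> A" and d: "d \<in> A"
 shows "pb (codom_of d) (g d) (coord c ` (dom_of d \<inter> dom_of c)) (local_rep c d id)"
  "z \<in> coord c ` (dom_of d \<inter> dom_of c) ==> g c z = pullback_form (local_rep c d id) (g d) z"
  "x \<in> dom_of c ==> local_rep c d id (coord c x) = coord d x"
proof -
 have gp: "g c z = pullback_form (local_rep c d id) (g d) z" if "z \<in> coord c ` (dom_of d \<inter> dom_of c)" for z
  using conjunct2[OF hm[unfolded hermitian_metric_def]] c d that unfolding overlap[symmetric] by simp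
 have lr: "local_rep c d id (coord c x) = coord d x" if "x \<in> dom_of c" for x
  using cinv[OF c that] by (simp add: local_rep_def)
 show "x \<in> dom_of c ==> local_rep c d id (coord c x) = coord d x" by (rule lr)
 show "z \<in> coord c ` (dom_of d \<inter> dom_of c) ==> g c z = pullback_form (local_rep c d id) (g d) z" by (rule gp)
 show "pb (codom_of d) (g d) (coord c ` (dom_of d \<inter> dom_of c)) (local_rep c d id)"
 proof unfold_locales
  show "kmetric (codom_of d) (g d)" by (rule kmetric_chart[OF d])
  show "open (coord c ` (dom_of d \<inter> dom_of c))" by (rule open_coord_image[OF c atlas(1)[OF d]])
  show "chol (%w. local_rep c d id w $ i) (coord c ` (dom_of d \<inter> dom_of c))" for i
   using atlas(5)[OF c d] unfolding overlap cholomorphic_on_iff_chol by blast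
  fix z assume z: "z \<in> coord c ` (dom_of d \<inter> dom_of c)"
  then show "local_rep c d id z \<in> codom_of d" using lr by auto
  have "hermitian_posdef (g c z)" using kmetric_chart[OF c] z unfolding kmetric_def by blast
  then show "invertible (jac (local_rep c d id) z)" unfolding gp[OF z] by (rule pullback_posdef_invertible)
 qed
qed

lemma invariants:
 assumes c: "c \<in> A" "x \<in> dom_of c" and d: "d \<in> A" "x \<in> dom_of d"
 shows "cscal (g c) (coord c x) = cscal (g d) (coord d x)" "bochner_norm (g c) (coord c x) = bochner_norm (g d) (coord d x)"
proof -
 interpret pb "codom_of d" "g d" "coord c ` (dom_of d \<inter> dom_of c)" "local_rep c d id" by (rule transition(1)[OF c(1) d(1)])
 have z: "coord c x \<in> coord c ` (dom_of d \<inter> dom_of c)" using c d by blast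
 note cong = curvature_cong[OF U transition(2)[OF c(1) d(1)] z]
 show "cscal (g c) (coord c x) = cscal (g d) (coord d x)"
  using cong(1) cscal_pullback[OF z] transition(3)[OF c(1) d(1) c(2)] by simp
 show "bochner_norm (g c) (coord c x) = bochner_norm (g d) (coord d x)"
  using cong(2) bochner_norm_pullback[OF z] transition(3)[OF c(1) d(1) c(2)] by simp
qed

lemma locally_constant:
 assumes "!!x. x \<in> topspace X ==> \<exists>N. openin X N & x \<in> N & (\<forall>y\<in>N. F y = F x)" and "x \<in> topspace X" "y \<in> topspace X"
 shows "F x = F y"
proof -
 have o: "openin X {z \<in> topspace X. P (F z)}" for P
 proof (subst openin_subopen, intro ballI)
  fix z assume z: "z \<in> {z \<in> topspace X. P (F z)}"
  then obtain N where N: "openin X N" "z \<in> N" "!!y. y \<in> N ==> F y = F z" using assms(1)[of z] by auto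
  have "N \<subseteq> {z \<in> topspace X. P (F z)}"
  proof
   fix y assume y: "y \<in> N"
   then show "y \<in> {z \<in> topspace X. P (F z)}" using z openin_subset[OF N(1)] by (auto simp: N(3)[OF y])
  qed
  then show "\<exists>T. openin X T & z \<in> T & T \<subseteq> {z \<in> topspace X. P (F z)}" using N(1,2) by blast
 qed
 let ?T = "{z \<in> topspace X. F z = F x}"
 have "topspace X - ?T = {z \<in> topspace X. F z ~= F x}" by auto
 then have "closedin X ?T" unfolding closedin_def using o[of "%v. v ~= F x"] by auto
 then have "?T = {} \<or> ?T = topspace X" using connected o[of "%v. v = F x"] unfolding connected_space_clopen_in by blast
 moreover have "x \<in> ?T" using assms(2) by simp
 ultimately have "y \<in> ?T" using assms(3) by blast
 then show ?thesis by simp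
qed

end

locale pinched = kaehler_atlas X A g for X :: "'a topology" and A :: "('a, 'm::finite) chart set" and g +
 assumes m2: "CARD('m) \<ge> 2" and compact: "compact_space X" and einstein: "kaehler_einstein A g"
  and pos: "!!c z. c \<in> A ==> z \<in> codom_of c ==> cscal (g c) z > 0"
  and pinch: "!!c z. c \<in> A ==> z \<in> codom_of c ==> bochner_norm (g c) z <
   2 * sqrt ((real CARD('m))\<^sup>2 - 1) * cscal (g c) z / (3 * ((real CARD('m))\<^sup>2 - 2))"
begin

definition chart_at :: "'a => ('a, 'm) chart" where "chart_at x = (SOME c. c \<in> A & x \<in> dom_of c)"

lemma chart_at: "x \<in> topspace X ==> chart_at x \<in> A & x \<in> dom_of (chart_at x)"
 unfolding chart_at_def by (rule someI_ex) (use chart_ex in blast)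

lemma ricci_chart: "c \<in> A ==> z \<in> codom_of c ==> ricci (g c) al bt z = cor (cscal (g c) z / real CARD('m)) * g c z $ al $ bt"
 using einstein unfolding kaehler_einstein_def by blast

text \<open>The norm attains its maximum by compactness, and a chart around a maximum point brings
  \<open>bochner_vanish_at_max\<close> into play; a nonnegative function with maximum zero
  vanishes.\<close>

lemma bochner_norm_0:
 assumes "c \<in> A" "z \<in> codom_of c" shows "bochner_norm (g c) z = 0"
proof -
 \<comment> \<open>A function on the manifold itself, through an arbitrary chart at each point; by
   \<open>invariants\<close> the choice of chart does not matter.\<close>
 define n where "n = (%x. bochner_norm (g (chart_at x)) (coord (chart_at x) x))"
 have n: "n x = bochner_norm (g c) (coord c x)" if "c \<in> A" "x \<in> dom_of c" for c x
  unfolding n_def using chart_at dom_sub that by (intro invariants(2)) blast+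
 have cont: "continuous_map X euclideanreal n"
 proof -
  have *: "continuous_on (codom_of c) (bochner_norm (g c))" if c: "c \<in> A" for c
  proof -
   interpret km "codom_of c" "g c" by (rule km.intro[OF kmetric_chart[OF c]])
   have "continuous_on (codom_of c) (%z. sqrt (Re (cor ((bochner_norm (g c) z)\<^sup>2))))"
    by (intro continuous_intros smooth_on_continuous_on[OF bochner_norm_sq_smooth])
   then show ?thesis by (simp add: bochner_norm_nonneg)
  qed
  have "openin X {x \<in> topspace X. n x \<in> T}" if T: "open T" for T
  proof (subst openin_subopen, intro ballI)
   fix x assume x: "x \<in> {x \<in> topspace X. n x \<in> T}"
   then obtain c where c: "c \<in> A" "x \<in> dom_of c" using chart_ex by blast
   have "open (codom_of c \<inter> bochner_norm (g c) -` T)" by (rule continuous_open_preimage[OF *[OF c(1)] atlas(2)[OF c(1)] T])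
   note O = open_coord_preimage[OF c(1) this]
   show "\<exists>S. openin X S & x \<in> S & S \<subseteq> {x \<in> topspace X. n x \<in> T}"
    by (rule exI, intro conjI, rule O) (use n[OF c(1)] c x dom_sub[OF c(1)] in auto)
  qed
  then show ?thesis unfolding continuous_map_def by auto
 qed
 have "compactin euclideanreal (n ` topspace X)"
  using image_compactin[OF _ cont] compact by (simp add: compact_space_def)
 then obtain x where x: "x \<in> topspace X" "!!y. y \<in> topspace X ==> n y \<le> n x"
  using compact_attains_sup[of "n ` topspace X"] nonempty by (auto simp: compactin_euclidean_iff)
 obtain d where d: "d \<in> A" "x \<in> dom_of d" using chart_ex x(1) by blast
 have "bochner_norm (g d) (coord d x) = 0"
 proof (rule bochner_vanish_at_max[OF kmetric_chart[OF d(1)] m2 ricci_chart[OF d(1)]])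
  show "bochner_norm (g d) z \<le> bochner_norm (g d) (coord d x)" if z: "z \<in> codom_of d" for z
  proof -
   obtain y where y: "y \<in> dom_of d" "z = coord d y" using z by blast
   show ?thesis using x(2)[of y] y n[OF d(1) y(1)] n[OF d] dom_sub[OF d(1)] by auto
  qed
 qed (use d pinch in auto)
 then have "n x = 0" using n[OF d] by simp
 moreover obtain y where y: "y \<in> dom_of c" "z = coord c y" using assms(2) by blast
 ultimately show ?thesis
  using x(2)[of y] n[OF assms(1) y(1)] dom_sub[OF assms(1)] bochner_norm_nonneg[of "g c" z] y by auto
qed

lemma curvature_constant:
 obtains ka where "ka > 0" "!!c. c \<in> A ==> chc (codom_of c) (g c) ka"
proof -
 define s where "s = (%x. cscal (g (chart_at x)) (coord (chart_at x) x))"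
 have s: "s x = cscal (g c) (coord c x)" if "c \<in> A" "x \<in> dom_of c" for c x
  unfolding s_def using chart_at dom_sub that by (intro invariants(1)) blast+
 have loc: "\<exists>N. openin X N & x \<in> N & (\<forall>y\<in>N. s y = s x)" if x: "x \<in> topspace X" for x
 proof -
  obtain c where c: "c \<in> A" "x \<in> dom_of c" using chart_ex x by blast
  obtain r where r: "r > 0" "ball (coord c x) r \<subseteq> codom_of c" using atlas(2)[OF c(1)] c(2) openE by blast
  have "cor (cscal (g c) z) = cor (cscal (g c) (coord c x))" if z: "z \<in> ball (coord c x) r" for z
  proof (rule has_derivative_zero_unique[OF convex_ball _ z])
   show "coord c x \<in> ball (coord c x) r" using r by simp
   show "((%z. cor (cscal (g c) z)) has_derivative (%v. 0)) (at y within ball (coord c x) r)"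
    if "y \<in> ball (coord c x) r" for y
    by (rule has_derivative_at_withinI, rule schur[OF kmetric_chart[OF c(1)] ricci_chart[OF c(1)] m2]) (use that r(2) in auto)
  qed
  note K = this
  have "\<forall>y\<in>{y \<in> dom_of c. coord c y \<in> ball (coord c x) r}. s y = s x"
  proof (intro ballI, clarify)
   fix y assume that: "y \<in> dom_of c" "coord c y \<in> ball (coord c x) r"
   show "s y = s x" unfolding s[OF c(1) that(1)] s[OF c] using K[OF that(2)] unfolding of_real_eq_iff .
  qed
  moreover have "x \<in> {y \<in> dom_of c. coord c y \<in> ball (coord c x) r}" using c(2) r(1) by simp
  ultimately show ?thesis using open_coord_preimage[OF c(1) open_ball] by blast
 qed
 obtain x0 where x0: "x0 \<in> topspace X" using nonempty by blast
 define ka where "ka = s x0 / (real CARD('m) * (real CARD('m) + 1))"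
 have sc: "cscal (g c) z = s x0" if c: "c \<in> A" and z: "z \<in> codom_of c" for c z
 proof -
  obtain y where y: "y \<in> dom_of c" "z = coord c y" using z by blast
  have "s y = s x0" by (rule locally_constant[where F = s, OF loc _ x0]) (use y dom_sub[OF c] in auto)
  then show ?thesis using s[OF c y(1)] y(2) by simp
 qed
 show thesis
 proof (rule that)
  obtain c where c: "c \<in> A" "x0 \<in> dom_of c" using chart_ex x0 by blast
  then have "s x0 > 0" using pos[of c "coord c x0"] s by simp
  then show "ka > 0" by (simp add: ka_def)
  then show "chc (codom_of c) (g c) ka" if c: "c \<in> A" for c
  proof (unfold_locales)
   show "kmetric (codom_of c) (g c)" by (rule kmetric_chart[OF c])
   fix z al bt ga dt assume z: "z \<in> codom_of c"
   show "curv (g c) al bt ga dt z = - cor ka * (g c z $ al $ bt * g c z $ ga $ dt + g c z $ ga $ bt * g c z $ al $ dt)"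
    unfolding ka_def sc[OF c z, symmetric]
    by (rule constant_holomorphic_curvature[OF ricci_chart[OF c z] bochner_norm_zero[OF kmetric_chart[OF c] z bochner_norm_0[OF c z]]])
  qed
 qed
qed

end

section \<open>Developing maps\<close>

lemma lift_pullback:
 fixes f :: "complex^'m::finite => complex^'n::finite" and ta :: "complex^'m => complex^'m"
 assumes l: "lift ka h U f" and T: "open T" and ta: "!!i. chol (%z. ta z $ i) T" "ta ` T \<subseteq> U"
  and h': "!!z. z \<in> T ==> h' z = pullback_form ta h z"
 shows "lift ka h' T (%z. f (ta z))"
 unfolding lift_def
proof (intro conjI ballI allI)
 note L = liftD[OF l]
 show "chol (%z. f (ta z) $ i) T" for i by (rule chol_compose[OF ta(1) L(2) ta(2)])
 fix z al bt assume z: "z \<in> T"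
 then have taz: "ta z \<in> U" using ta(2) by blast
 then show "f (ta z) ~= 0" by (rule L(3))
 have "fsform (%z. f (ta z)) z = pullback_form ta (fsform f) z" by (rule fsform_compose[OF L(1,2,3) T z ta])
 then show "fsform (%z. f (ta z)) z $ al $ bt = cor ka * h' z $ al $ bt"
  unfolding h'[OF z] pullback_form_def vec_lambda_beta
  by (simp add: L(4)[OF taz] sum_distrib_left mult_ac)
qed (rule T)

locale model = kaehler_atlas X A g for X :: "'a topology" and A :: "('a, 'm::finite) chart set" and g +
 fixes ka :: real
 assumes ka: "ka > 0" and compact: "compact_space X" and chc: "!!c. c \<in> A ==> chc (codom_of c) (g c) ka"
begin

text \<open>Homogeneous coordinates, over the set \<open>N\<close> of the manifold, of a local
  homothety to projective space. All charts are required at once so that the notion does not depend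
  on coordinates.\<close>

definition dev :: "'a set => ('a => complex^('m option)) => bool" where
 "dev N L \<longleftrightarrow> openin X N & (\<forall>c\<in>A. lift ka (g c) (coord c ` (N \<inter> dom_of c)) (%z. L (cinv c z)))"

lemma posdef_chart: "c \<in> A ==> z \<in> codom_of c ==> hermitian_posdef (g c z)"
 using kmetric_chart unfolding kmetric_def by blast

lemma dev_mono: "dev N L ==> openin X N' ==> N' \<subseteq> N ==> dev N' L"
 unfolding dev_def by (meson Int_mono image_mono lift_mono open_coord_image order_refl)

lemma dev_nonzero: 
 assumes "dev N L" "y \<in> N" shows "L y ~= 0"
proof -
 have "y \<in> topspace X" using assms openin_subset unfolding dev_def by blast
 then obtain c where c: "c \<in> A" "y \<in> dom_of c" using chart_ex by blast
 have "L (cinv c (coord c y)) ~= 0" using assms c unfolding dev_def by (intro liftD(3)) auto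
 then show ?thesis by (simp add: cinv[OF c])
qed

lemma dev_unitary: "dev N L ==> unitary V ==> dev N (%y. V *v L y)"
 unfolding dev_def using lift_unitary by blast

lemma dev_exists:
 assumes x: "x \<in> topspace X" shows "\<exists>N L. dev N L & x \<in> N"
proof -
 obtain c where c: "c \<in> A" "x \<in> dom_of c" using chart_ex x by blast
 obtain U and f :: "complex^'m => complex^('m option)" where U: "coord c x \<in> U" "U \<subseteq> codom_of c" and f: "lift ka (g c) U f"
  using chc.lift_exists[OF chc[OF c(1)]] c(2) by blast
 define N where "N = {y \<in> dom_of c. coord c y \<in> U}"
 have N: "openin X N" unfolding N_def by (rule open_coord_preimage[OF c(1) liftD(1)[OF f]])
 have "lift ka (g d) (coord d ` (N \<inter> dom_of d)) (%z. f (coord c (cinv d z)))" if d: "d \<in> A" for d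
 proof -
  interpret t: pb "codom_of c" "g c" "coord d ` (dom_of c \<inter> dom_of d)" "local_rep d c id" by (rule transition(1)[OF d c(1)])
  have sub: "coord d ` (N \<inter> dom_of d) \<subseteq> coord d ` (dom_of c \<inter> dom_of d)" by (auto simp: N_def)
  have "lift ka (g d) (coord d ` (N \<inter> dom_of d)) (%z. f (local_rep d c id z))"
  proof (rule lift_pullback[OF f open_coord_image[OF d N]])
   show "chol (%z. local_rep d c id z $ i) (coord d ` (N \<inter> dom_of d))" for i by (rule chol_mono[OF t.f sub])
   show "local_rep d c id ` coord d ` (N \<inter> dom_of d) \<subseteq> U" using transition(3)[OF d c(1)] by (auto simp: N_def)
   show "g d z = pullback_form (local_rep d c id) (g c) z" if "z \<in> coord d ` (N \<inter> dom_of d)" for z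
    by (rule transition(2)[OF d c(1)]) (use that sub in blast)
  qed
  then show ?thesis by (simp add: local_rep_def)
 qed
 then have "dev N (%y. f (coord c y))" unfolding dev_def using N by blast
 then show ?thesis using c(2) U(1) N_def by blast
qed

lemma dev_rigidity:
 assumes d: "dev N L" "dev N' L'" and x: "x \<in> N" "x \<in> N'"
 obtains W V where "openin X W" "x \<in> W" "W \<subseteq> N \<inter> N'" "unitary V" "!!y. y \<in> W ==> par (L' y) (V *v L y)"
proof -
 have "x \<in> topspace X" using d(1) x(1) openin_subset unfolding dev_def by blast
 then obtain c where c: "c \<in> A" "x \<in> dom_of c" using chart_ex by blast
 have l: "lift ka (g c) (coord c ` (N \<inter> dom_of c)) (%z. L (cinv c z))" "lift ka (g c) (coord c ` (N' \<inter> dom_of c)) (%z. L' (cinv c z))"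
  using d c(1) unfolding dev_def by blast+
 have p: "coord c x \<in> coord c ` (N \<inter> dom_of c)" "coord c x \<in> coord c ` (N' \<inter> dom_of c)" using c(2) x by auto
 have pd: "hermitian_posdef (g c (coord c x))" by (rule posdef_chart[OF c(1)]) (use c(2) in blast)
 obtain W0 V where W: "open W0" "coord c x \<in> W0" "W0 \<subseteq> coord c ` (N \<inter> dom_of c) \<inter> coord c ` (N' \<inter> dom_of c)" "unitary V"
  "!!z. z \<in> W0 ==> par (L' (cinv c z)) (V *v L (cinv c z))" using rigidity[OF l p ka pd] by blast
 show thesis
 proof (rule that[OF open_coord_preimage[OF c(1) W(1)] _ _ W(4)])
  show "x \<in> {y \<in> dom_of c. coord c y \<in> W0}" using c(2) W(2) by simp
  show "{y \<in> dom_of c. coord c y \<in> W0} \<subseteq> N \<inter> N'"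
  proof
   fix y assume y: "y \<in> {y \<in> dom_of c. coord c y \<in> W0}"
   then obtain u v where "u \<in> N" "u \<in> dom_of c" "coord c y = coord c u" "v \<in> N'" "v \<in> dom_of c" "coord c y = coord c v"
    using W(3) by blast
   moreover have "y \<in> dom_of c" using y by simp
   ultimately show "y \<in> N \<inter> N'" using coord_inj[OF c(1)] by (metis IntI inj_onD)
  qed
  show "par (L' y) (V *v L y)" if "y \<in> {y \<in> dom_of c. coord c y \<in> W0}" for y
   using W(5)[of "coord c y"] that cinv[OF c(1), of y] by simp
 qed
qed

text \<open>\<open>li N L M ps\<close>: the map $[L]$ embeds \<open>N\<close> onto an open set of lines, \<open>M\<close> is the cone over the
 image, and \<open>ps\<close> is the inverse of $[L]$ on \<open>M\<close>.\<close>

definition li :: "'a set => ('a => complex^('m option)) => (complex^('m option)) set => (complex^('m option) => 'a) => bool" where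
 "li N L M ps \<longleftrightarrow> dev N L & open M & continuous_map (subtopology X N) euclidean L &
   continuous_map (top_of_set M) X ps & (\<forall>v\<in>M. ps v \<in> N & par (L (ps v)) v) &
   (\<forall>y\<in>N. \<forall>v. par (L y) v \<longrightarrow> v \<in> M & ps v = y) &
   (\<forall>c\<in>A. \<forall>i. chol (%v. coord c (ps v) $ i) {v \<in> M. ps v \<in> dom_of c})"

lemma liD:
 assumes "li N L M ps"
 shows "dev N L" "open M" "continuous_map (subtopology X N) euclidean L" "continuous_map (top_of_set M) X ps"
  "v \<in> M ==> ps v \<in> N" "v \<in> M ==> par (L (ps v)) v" "y \<in> N ==> par (L y) v ==> v \<in> M"
  "y \<in> N ==> par (L y) v ==> ps v = y" "c \<in> A ==> chol (%v. coord c (ps v) $ i) {v \<in> M. ps v \<in> dom_of c}"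
  "openin X N" "N \<subseteq> topspace X"
 using assms openin_subset unfolding li_def dev_def by blast+

lemma li_exists:
 assumes x: "x \<in> topspace X" shows "\<exists>N L M ps. li N L M ps & x \<in> N"
proof -
 obtain N0 L where N0: "dev N0 L" "x \<in> N0" using dev_exists[OF x] by blast
 obtain c where c: "c \<in> A" "x \<in> dom_of c" using chart_ex x by blast
 have l: "lift ka (g c) (coord c ` (N0 \<inter> dom_of c)) (%z. L (cinv c z))" using N0(1) c(1) unfolding dev_def by blast
 have p: "coord c x \<in> coord c ` (N0 \<inter> dom_of c)" using c(2) N0(2) by blast
 have pd: "hermitian_posdef (g c (coord c x))" by (rule posdef_chart[OF c(1)]) (use c(2) in blast)
 obtain W M ps where W: "open W" "coord c x \<in> W" "W \<subseteq> coord c ` (N0 \<inter> dom_of c)" "open M" and ps: "!!i. chol (%v. ps v $ i) M"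
  "!!v. v \<in> M ==> ps v \<in> W & par (L (cinv c (ps v))) v"
  "!!z v. z \<in> W ==> par (L (cinv c z)) v ==> v \<in> M & ps v = z"
  by (rule local_inverse[OF l p ka pd]) blast
 define N where "N = {y \<in> dom_of c. coord c y \<in> W}"
 have N: "openin X N" unfolding N_def by (rule open_coord_preimage[OF c(1) W(1)])
 have NN: "N \<subseteq> N0"
 proof
  fix y assume y: "y \<in> N"
  then obtain u where "u \<in> N0" "u \<in> dom_of c" "coord c y = coord c u" using W(3) unfolding N_def by blast
  moreover have "y \<in> dom_of c" using y by (simp add: N_def)
  ultimately show "y \<in> N0" using coord_inj[OF c(1)] by (metis inj_onD)
 qed
 have Wc: "W \<subseteq> codom_of c" using W(3) by blast
 have in_N: "cinv c z \<in> N" if "z \<in> W" for z using that Wc cinv'[of z c] by (auto simp: N_def)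
 have cd: "coord c (cinv c z) = z" if "z \<in> W" for z using that Wc cinv'(2)[of z c] by blast
 have "li N L M (%v. cinv c (ps v))"
  unfolding li_def
 proof (intro conjI ballI allI impI)
  show "dev N L" by (rule dev_mono[OF N0(1) N NN])
  show "open M" by (rule W(4))
  have cL: "continuous_on W (%z. L (cinv c z))"
  proof -
   have "continuous_on W (%z. \<chi> i. L (cinv c z) $ i)"
    by (intro continuous_on_vec_lambda chol_continuous_on chol_mono[OF liftD(2)[OF l] W(3)])
   then show ?thesis by simp
  qed
  have "continuous_map (subtopology X N) (top_of_set W) (coord c)"
  proof -
   have "continuous_map (subtopology X N) euclidean (coord c)"
    using continuous_map_from_subtopology_mono[OF coord_cont[OF c(1)]] by (simp add: N_def subset_iff)
   then show ?thesis by (rule continuous_map_into_subtopology) (auto simp: N_def)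
  qed
  from continuous_map_compose[OF this, of euclidean "%z. L (cinv c z)"] cL
  have "continuous_map (subtopology X N) euclidean ((%z. L (cinv c z)) \<circ> coord c)" by simp
  then show "continuous_map (subtopology X N) euclidean L"
   by (rule continuous_map_eq) (use cinv[OF c(1)] in \<open>auto simp: N_def\<close>)
  have "continuous_on M (%v. \<chi> i. ps v $ i)" by (intro continuous_on_vec_lambda chol_continuous_on ps(1))
  then have "continuous_map (top_of_set M) (top_of_set (codom_of c)) ps"
   using ps(2) Wc by (auto simp: continuous_map_in_subtopology)
  from continuous_map_compose[OF this cinv_cont[OF c(1)]]
  show "continuous_map (top_of_set M) X (%v. cinv c (ps v))" by (simp add: comp_def)
  show "cinv c (ps v) \<in> N" "par (L (cinv c (ps v))) v" if "v \<in> M" for v using ps(2)[OF that] in_N by blast+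
  show "v \<in> M" "cinv c (ps v) = y" if "y \<in> N" "par (L y) v" for y v
  proof -
   have y: "y \<in> dom_of c" "coord c y \<in> W" using that(1) by (auto simp: N_def)
   have "par (L (cinv c (coord c y))) v" using that(2) cinv[OF c(1) y(1)] by simp
   from ps(3)[OF y(2) this] show "v \<in> M" "cinv c (ps v) = y" using cinv[OF c(1) y(1)] by auto
  qed
  fix d i assume d: "d \<in> A"
  interpret t: pb "codom_of d" "g d" "coord c ` (dom_of d \<inter> dom_of c)" "local_rep c d id" by (rule transition(1)[OF c(1) d])
  let ?S = "{v \<in> M. cinv c (ps v) \<in> dom_of d}"
  have "chol (%v. local_rep c d id (ps v) $ i) ?S"
  proof (rule chol_compose[OF chol_mono[OF ps(1)] t.f])
   show "ps ` ?S \<subseteq> coord c ` (dom_of d \<inter> dom_of c)"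
   proof clarify
    fix v assume v: "v \<in> M" "cinv c (ps v) \<in> dom_of d"
    then have "cinv c (ps v) \<in> dom_of d \<inter> dom_of c" "ps v = coord c (cinv c (ps v))"
     using in_N ps(2) cd unfolding N_def by auto
    then show "ps v \<in> coord c ` (dom_of d \<inter> dom_of c)" by (rule rev_image_eqI)
   qed
  qed auto
  then show "chol (%v. coord d (cinv c (ps v)) $ i) ?S" by (simp add: local_rep_def)
 qed
 then show ?thesis using c(2) W(2) N_def by blast
qed

text \<open>Provides enough inverses for analytic continuation: a fixed local inverse can be matched
  with any given one by the unitary matrix from rigidity, and rescaled by \<open>c\<close> to a
  convenient place in its cone.\<close>

lemma li_transform:
 assumes l: "li N L M ps" and V: "unitary V" and c: "c ~= 0"
 shows "li N (%y. adj V *v L y) {w. c *s (V *v w) \<in> M} (%w. ps (c *s (V *v w)))"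
proof -
 note D = liD[OF l]
 define T where "T = (%w. c *s (V *v w))"
 have cT: "chol (%w. T w $ i) S" for i S unfolding T_def using chol_mult[OF chol_const chol_matrix[OF chol_coord]] by simp
 have contT: "continuous_on S T" for S
 proof -
  have "continuous_on S (%v. \<chi> i. T v $ i)" by (intro continuous_on_vec_lambda chol_continuous_on cT)
  then show ?thesis by simp
 qed
 have pT: "par (adj V *v u) w \<longleftrightarrow> par u (T w)" for u w
 proof -
  have "par (adj V *v u) w \<longleftrightarrow> par u (V *v w)"
   using par_matrix[of "adj V *v u" w V] par_matrix[of u "V *v w" "adj V"] unitary_cancel[OF V] by metis
  also have "... \<longleftrightarrow> par u (T w)" unfolding T_def using par_scale[OF c] par_sym par_trans by blast
  finally show ?thesis .
 qed
 have "li N (%y. adj V *v L y) {w. T w \<in> M} (%w. ps (T w))"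
  unfolding li_def pT
 proof (intro conjI ballI allI impI)
  show "dev N (%y. adj V *v L y)" by (rule dev_unitary[OF D(1) unitary_adj[OF V]])
  show "open {w. T w \<in> M}" using open_vimage[OF D(2) contT] by (simp add: vimage_def)
  have cm: "continuous_on UNIV (%v. B *v v)" for B :: "complex^('m option)^('m option)"
   by (rule linear_continuous_on, rule linear_conv_bounded_linear[THEN iffD1], rule linearI)
    (simp_all add: vec_eq_iff matrix_vector_mult_def scaleR_sum_right distrib_left sum.distrib)
  show "continuous_map (subtopology X N) euclidean (%y. adj V *v L y)"
   using continuous_map_compose[OF D(3), of euclidean "%v. adj V *v v"] cm by (simp add: comp_def)
  have "continuous_map (top_of_set {w. T w \<in> M}) (top_of_set M) T"
   using contT by (auto simp: continuous_map_in_subtopology)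
  from continuous_map_compose[OF this D(4)]
  show "continuous_map (top_of_set {w. T w \<in> M}) X (%w. ps (T w))" by (simp add: comp_def)
  show "chol (%v. coord d (ps (T v)) $ i) {v \<in> {w. T w \<in> M}. ps (T v) \<in> dom_of d}" if "d \<in> A" for d i
   by (rule chol_compose[OF cT D(9)[OF that]]) auto
 qed (use D in auto)
 then show ?thesis by (simp add: T_def)
qed

end

text \<open>If \<open>u\<close> is independent of \<open>w0\<close>, comparing the eigenvalues at
  the two points \<open>w0 + cor s *s u\<close> and \<open>w0 + cor (s/2) *s u\<close> of the same
  line shows that they agree with each other and with the eigenvalue at \<open>w0\<close>.\<close>

lemma scalar_of_par:
 fixes V :: "complex^'n::finite^'n"
 assumes B: "open B" "w0 \<in> B" "w0 ~= 0" and par: "!!w. w \<in> B ==> \<exists>c. V *v w = c *s w"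
 obtains mu where "!!w. V *v w = mu *s w"
proof -
 obtain c0 where c0: "V *v w0 = c0 *s w0" using par B(2) by blast
 have "V *v u = c0 *s u" for u
 proof (cases "\<exists>a. u = a *s w0")
  case True
  then show ?thesis using c0 by (auto simp: matrix_vector_smult mult.commute)
 next
  case False
  obtain e where e: "e > 0" "ball w0 e \<subseteq> B" using B openE by blast
  define s where "s = e / (2 * (norm u + 1))"
  have s: "s > 0" using e by (simp add: s_def add_nonneg_pos)
  have sn: "s * norm u < e"
  proof -
   have "2 * (norm u + 1) > 0" by (simp add: add_nonneg_pos)
   then have "norm u / (2 * (norm u + 1)) \<le> 1 / 2" unfolding pos_divide_le_eq[OF \<open>2 * (norm u + 1) > 0\<close>] by simp
   then have "e * (norm u / (2 * (norm u + 1))) \<le> e * (1 / 2)" using e(1) by (intro mult_left_mono) auto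
   also have "... < e" using e(1) by simp
   finally show ?thesis by (simp add: s_def)
  qed
  have lin: "V *v (w0 + cor t *s u) = c0 *s w0 + cor t *s (V *v u)" for t
   by (simp add: matrix_vector_right_distrib matrix_vector_smult c0)
  have inB: "w0 + cor t *s u \<in> B" if "0 \<le> t" "t \<le> s" for t
  proof -
   have "cor t *s u = t *\<^sub>R u" by (simp add: vec_eq_iff scaleR_conv_of_real[where 'a = complex])
   then have "norm (cor t *s u) \<le> s * norm u" using that by (simp add: mult_right_mono)
   then show ?thesis using sn e by (auto simp: dist_norm)
  qed
  obtain c where c: "c0 *s w0 + cor s *s (V *v u) = c *s (w0 + cor s *s u)"
   using par[OF inB[of s]] s unfolding lin by auto
  obtain c' where c': "c0 *s w0 + cor (s/2) *s (V *v u) = c' *s (w0 + cor (s/2) *s u)"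
   using par[OF inB[of "s/2"]] s unfolding lin by auto
  have e1: "c0 * w0 $ i + cor s * (V *v u) $ i = c * (w0 $ i + cor s * u $ i)" for i
   using arg_cong[OF c, of "%v. v $ i"] by (simp add: distrib_left mult.assoc)
  have e2: "2 * c0 * w0 $ i + cor s * (V *v u) $ i = 2 * c' * w0 $ i + c' * cor s * u $ i" for i
   using arg_cong[OF c', of "%v. 2 * v $ i"] by (simp add: algebra_simps)
  have e3: "cor s * (c - c') * u $ i = (2 * c' - c0 - c) * w0 $ i" for i
   using e1[of i] e2[of i] by algebra
  have "c = c'"
  proof (rule ccontr)
   assume ne: "c ~= c'"
   then have "u $ i = ((2 * c' - c0 - c) / (cor s * (c - c'))) * w0 $ i" for i
    using e3[of i] s by (simp add: nonzero_eq_divide_eq mult_ac)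
   then have "u = ((2 * c' - c0 - c) / (cor s * (c - c'))) *s w0" by (simp add: vec_eq_iff)
   then show False using False by blast
  qed
  moreover obtain i where "w0 $ i ~= 0" using B(3) by (auto simp: vec_eq_iff)
  ultimately have "c = c0" using e3[of i] by simp
  then have "cor s * (V *v u) $ i = cor s * (c0 * u $ i)" for i
   using e1[of i] by (simp add: algebra_simps)
  then show ?thesis using s by (simp add: vec_eq_iff)
 qed
 then show thesis using that by blast
qed

section \<open>Branches of the inverse and their analytic continuation\<close>

context model
begin

text \<open>\<open>Ps\<close> is near every point of \<open>D\<close> one of the local inverses.
  Such maps behave like branches of an analytic function with values in the manifold: they can be
  restricted, glued, and compared by an identity theorem.\<close>

definition LI :: "(complex^('m option)) set => (complex^('m option) => 'a) => bool" where
 "LI D Ps \<longleftrightarrow> open D & (\<forall>v\<in>D. \<exists>N L M ps B. li N L M ps & open B & v \<in> B & B \<subseteq> D \<inter> M & (\<forall>w\<in>B. Ps w = ps w))"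

lemma LI_E:
 assumes "LI D Ps" "v \<in> D"
 obtains N L M ps B where "li N L M ps" "open B" "v \<in> B" "B \<subseteq> D" "B \<subseteq> M" "\<forall>w\<in>B. Ps w = ps w"
 using assms unfolding LI_def by (meson le_inf_iff)

lemma LI_open: "LI D Ps ==> open D" by (simp add: LI_def)

lemma LI_I:
 assumes "open D" "!!v. v \<in> D ==> \<exists>N L M ps B. li N L M ps & open B & v \<in> B & B \<subseteq> M & (\<forall>w\<in>B \<inter> D. Ps w = ps w)"
 shows "LI D Ps"
 unfolding LI_def
proof (intro conjI ballI)
 fix v assume v: "v \<in> D"
 obtain N L M ps B where "li N L M ps" "open B" "v \<in> B" "B \<subseteq> M" "\<forall>w\<in>B \<inter> D. Ps w = ps w" using assms(2)[OF v] by blast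
 then have "li N L M ps & open (B \<inter> D) & v \<in> B \<inter> D & B \<inter> D \<subseteq> D \<inter> M & (\<forall>w\<in>B \<inter> D. Ps w = ps w)" using v assms(1) by blast
 then show "\<exists>N L M ps B. li N L M ps & open B & v \<in> B & B \<subseteq> D \<inter> M & (\<forall>w\<in>B. Ps w = ps w)" by blast
qed (rule assms(1))

lemma LI_mono: assumes "LI D Ps" "open E" "E \<subseteq> D" shows "LI E Ps"
proof (rule LI_I[OF assms(2)])
 fix v assume "v \<in> E"
 then have "v \<in> D" using assms(3) by blast
 then obtain N L M ps B where "li N L M ps" "open B" "v \<in> B" "B \<subseteq> D" "B \<subseteq> M" "\<forall>w\<in>B. Ps w = ps w"
  by (rule LI_E[OF assms(1)])
 then show "\<exists>N L M ps B. li N L M ps & open B & v \<in> B & B \<subseteq> M & (\<forall>w\<in>B \<inter> E. Ps w = ps w)"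
  by (intro exI[of _ N] exI[of _ L] exI[of _ M] exI[of _ ps] exI[of _ B]) auto
qed

lemma LI_top: assumes "LI D Ps" "v \<in> D" shows "Ps v \<in> topspace X"
proof -
 obtain N L M ps B where l: "li N L M ps" and B: "open B" "v \<in> B" "B \<subseteq> D" "B \<subseteq> M" "\<forall>w\<in>B. Ps w = ps w"
  by (rule LI_E[OF assms])
 then show ?thesis using liD(5)[OF l, of v] liD(11)[OF l] by auto
qed

lemma LI_nonzero: assumes "LI D Ps" "v \<in> D" shows "v ~= 0"
proof -
 obtain N L M ps B where "li N L M ps" "open B" "v \<in> B" "B \<subseteq> D" "B \<subseteq> M" "\<forall>w\<in>B. Ps w = ps w"
  by (rule LI_E[OF assms])
 then have l: "li N L M ps" "v \<in> M" by auto
 show ?thesis using par_nonzero[OF liD(6)[OF l]] dev_nonzero[OF liD(1)[OF l(1)] liD(5)[OF l]] by blast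
qed

lemma LI_nbhd:
 assumes "LI D Ps" "v \<in> D" "openin X T" "Ps v \<in> T"
 obtains B where "open B" "v \<in> B" "B \<subseteq> D" "!!w. w \<in> B ==> Ps w \<in> T"
proof -
 obtain N L M ps B where l: "li N L M ps" and B: "open B" "v \<in> B" "B \<subseteq> D" "B \<subseteq> M" "\<forall>w\<in>B. Ps w = ps w"
  by (rule LI_E[OF assms(1,2)])
 have "openin (top_of_set M) {w \<in> topspace (top_of_set M). ps w \<in> T}"
  by (rule openin_continuous_map_preimage[OF liD(4)[OF l] assms(3)])
 then have "open {w \<in> M. ps w \<in> T}" using openin_open_trans[OF _ liD(2)[OF l]] by simp
 then have "open (B \<inter> {w \<in> M. ps w \<in> T})" using B(1) by blast
 then show thesis using B assms(4) that[of "B \<inter> {w \<in> M. ps w \<in> T}"] by auto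
qed

lemma LI_glue:
 assumes LI: "!!i. i \<in> I ==> LI (D i) (Ps i)" and agree: "!!i j v. i \<in> I ==> j \<in> I ==> v \<in> D i ==> v \<in> D j ==> Ps i v = Ps j v"
 obtains Ph where "LI (\<Union>i\<in>I. D i) Ph" "\<forall>i\<in>I. \<forall>v\<in>D i. Ph v = Ps i v"
proof -
 define Ph where "Ph = (%v. Ps (SOME i. i \<in> I & v \<in> D i) v)"
 have Ph: "Ph v = Ps i v" if "i \<in> I" "v \<in> D i" for i v
 proof -
  have "(SOME i. i \<in> I & v \<in> D i) \<in> I & v \<in> D (SOME i. i \<in> I & v \<in> D i)" by (rule someI[of _ i]) (use that in blast)
  then show ?thesis unfolding Ph_def using agree that by blast
 qed
 have "LI (\<Union>i\<in>I. D i) Ph"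
  unfolding LI_def
 proof (intro conjI ballI)
  show "open (\<Union>i\<in>I. D i)" using LI LI_open by blast
  fix v assume "v \<in> (\<Union>i\<in>I. D i)"
  then obtain i where i: "i \<in> I" "v \<in> D i" by blast
  obtain N L M ps B where "li N L M ps" "open B" "v \<in> B" "B \<subseteq> D i" "B \<subseteq> M" "\<forall>w\<in>B. Ps i w = ps w"
   by (rule LI_E[OF LI[OF i(1)] i(2)])
  then have "li N L M ps & open B & v \<in> B & B \<subseteq> (\<Union>i\<in>I. D i) \<inter> M & (\<forall>w\<in>B. Ph w = ps w)"
   using i(1) Ph[OF i(1)] by (auto simp: subset_iff)
  then show "\<exists>N L M ps B. li N L M ps & open B & v \<in> B & B \<subseteq> (\<Union>i\<in>I. D i) \<inter> M & (\<forall>w\<in>B. Ph w = ps w)" by blast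
 qed
 then show thesis using Ph that by blast
qed

text \<open>The identity theorem. Near a limit point of the set of agreement, the two lifts differ
  by a unitary matrix that preserves the lines where the branches agree; it is a scalar there, and
  the branches agree on a whole neighbourhood.\<close>

lemma LI_unique:
 assumes l1: "LI D Ps" and l2: "LI D Ph" and conn: "connected D" and B0: "open B0" "v0 \<in> B0" "B0 \<subseteq> D" "!!w. w \<in> B0 ==> Ps w = Ph w"
  and v: "v \<in> D"
 shows "Ps v = Ph v"
proof -
 define S where "S = \<Union>{B. open B & B \<subseteq> D & (\<forall>w\<in>B. Ps w = Ph w)}"
 have S: "open S" "S \<subseteq> D" "v0 \<in> S" and eqS: "!!w. w \<in> S ==> Ps w = Ph w" using B0 unfolding S_def by auto
 have SI: "w \<in> S" if "open B" "w \<in> B" "B \<subseteq> D" "!!u. u \<in> B ==> Ps u = Ph u" for B w using that unfolding S_def by blast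
 have closed: "w \<in> S" if w: "w \<in> D" "w \<in> closure S" for w
 proof -
  have near: "\<exists>u. u \<in> B & u \<in> S" if "open B" "w \<in> B" for B
   using open_Int_closure_eq_empty[OF that(1), of S] w(2) that(2) by auto
  \<comment> \<open>The values agree at the limit point because the manifold is Hausdorff; this
    makes both lifts available on a common neighbourhood of one point.\<close>
  have x: "Ps w = Ph w"
  proof (rule ccontr)
   assume ne: "Ps w ~= Ph w"
   then obtain T T' where T: "openin X T" "openin X T'" "Ps w \<in> T" "Ph w \<in> T'" "disjnt T T'"
    using hausdorff LI_top[OF l1 w(1)] LI_top[OF l2 w(1)] unfolding Hausdorff_space_def by blast
   obtain B where B: "open B" "w \<in> B" "B \<subseteq> D" "!!u. u \<in> B ==> Ps u \<in> T" by (rule LI_nbhd[OF l1 w(1) T(1,3)]) blast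
   obtain B' where B': "open B'" "w \<in> B'" "B' \<subseteq> D" "!!u. u \<in> B' ==> Ph u \<in> T'" by (rule LI_nbhd[OF l2 w(1) T(2,4)]) blast
   obtain u where "u \<in> B \<inter> B'" "u \<in> S" using near[of "B \<inter> B'"] B B' by blast
   then show False using B(4)[of u] B'(4)[of u] eqS[of u] T(5) unfolding disjnt_iff by auto
  qed
  obtain N L M ps B where l: "li N L M ps" and B: "open B" "w \<in> B" "B \<subseteq> D" "B \<subseteq> M" "\<forall>u\<in>B. Ps u = ps u"
   by (rule LI_E[OF l1 w(1)])
  obtain N' L' M' ps' B' where l': "li N' L' M' ps'" and B': "open B'" "w \<in> B'" "B' \<subseteq> D" "B' \<subseteq> M'" "\<forall>u\<in>B'. Ph u = ps' u"
   by (rule LI_E[OF l2 w(1)])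
  have xN: "Ps w \<in> N" "Ps w \<in> N'" using liD(5)[OF l, of w] B liD(5)[OF l', of w] B' x by auto
  obtain W V where W: "openin X W" "Ps w \<in> W" "W \<subseteq> N \<inter> N'" "unitary V" "!!y. y \<in> W ==> par (L' y) (V *v L y)"
   by (rule dev_rigidity[OF liD(1)[OF l] liD(1)[OF l'] xN]) blast
  obtain B1 where B1: "open B1" "w \<in> B1" "B1 \<subseteq> D" "!!u. u \<in> B1 ==> Ps u \<in> W" by (rule LI_nbhd[OF l1 w(1) W(1,2)]) blast
  obtain B2 where B2: "open B2" "w \<in> B2" "B2 \<subseteq> D" "!!u. u \<in> B2 ==> Ph u \<in> W"
   by (rule LI_nbhd[OF l2 w(1) W(1) W(2)[unfolded x]]) blast
  define C where "C = B \<inter> B' \<inter> B1 \<inter> B2"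
  have C: "open C" "w \<in> C" "C \<subseteq> B" "C \<subseteq> B'" "C \<subseteq> B1" "C \<subseteq> B2" using B B' B1 B2 by (auto simp: C_def)
  have p1: "par (L (Ps u)) u" and p2: "par (L' (Ph u)) u" if "u \<in> C" for u
  proof -
   have u: "u \<in> B" "u \<in> B'" using that C(3,4) by auto
   then show "par (L (Ps u)) u" "par (L' (Ph u)) u"
    using liD(6)[OF l, of u] liD(6)[OF l', of u] subsetD[OF B(4)] subsetD[OF B'(4)] B(5) B'(5) by auto
  qed
  obtain u0 where u0: "u0 \<in> C" "u0 \<in> S" using near[OF C(1,2)] by blast
  have "\<exists>c. V *v u = c *s u" if "u \<in> C \<inter> S" for u
  proof -
   have u: "u \<in> C" "u \<in> S" using that by auto
   have "par (V *v u) (V *v L (Ps u))" by (rule par_matrix[OF par_sym[OF p1[OF u(1)]]])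
   moreover have "par (V *v L (Ps u)) (L' (Ps u))" using par_sym[OF W(5)[OF B1(4)]] C u(1) by blast
   moreover have "par (L' (Ps u)) u" using p2[OF u(1)] eqS[OF u(2)] by simp
   ultimately have "par (V *v u) u" using par_trans by blast
   then show ?thesis unfolding par_def by blast
  qed
  moreover have "u0 ~= 0" using LI_nonzero[OF l1] u0 S(2) by blast
  ultimately obtain mu where mu: "!!u. V *v u = mu *s u"
   using scalar_of_par[of "C \<inter> S" u0 V] C(1) S(1) u0 by (metis (no_types, lifting) IntI open_Int)
  have "Ps u = Ph u" if u: "u \<in> C" for u
  proof -
   have PhW: "Ph u \<in> W" using B2(4) C u by blast
   then have "par (L' (Ph u)) (mu *s L (Ph u))" using W(5)[OF PhW] unfolding mu by simp
   then have "par u (mu *s L (Ph u))" using p2[OF u] par_sym par_trans by blast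
   moreover have "u ~= 0" using LI_nonzero[OF l1] u C B by blast
   ultimately have "mu ~= 0" using par_nonzero[of u "mu *s L (Ph u)"] by auto
   then have "par u (L (Ph u))" using \<open>par u (mu *s L (Ph u))\<close> par_scale par_trans by blast
   then have "ps u = Ph u" using liD(8)[OF l _ par_sym] PhW W(3) by blast
   then show ?thesis using B(5) C u by auto
  qed
  then show ?thesis using SI[OF C(1,2)] C B by blast
 qed
 have "openin (top_of_set D) S" using S by (intro open_subset)
 moreover have "closedin (top_of_set D) S"
 proof -
  have "S = D \<inter> closure S" using closed S(2) closure_subset by blast
  then show ?thesis unfolding closedin_closed by (metis closed_closure)
 qed
 ultimately have "S = D" using conn S(3) unfolding connected_clopen by blast
 then show ?thesis using eqS v by blast
qed

end

lemma norm_smult: "norm (c *s (v :: complex^'n::finite)) = cmod c * norm v"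
 by (simp add: norm_vec_def L2_set_def norm_mult power_mult_distrib sum_distrib_left[symmetric] real_sqrt_mult)

context model
begin

text \<open>One radius of continuation for all branches with value in \<open>N\<close>. The lower
  bound on \<open>norm q\<close> cannot be dispensed with by homogeneity: near the origin the
  available balls shrink with the scale.\<close>

definition extends :: "'a set => real => bool" where
 "extends N r \<longleftrightarrow> (\<forall>D Ps q. LI D Ps \<longrightarrow> q \<in> D \<longrightarrow> norm q \<ge> 1/2 \<longrightarrow> Ps q \<in> N \<longrightarrow>
   (\<exists>Ph B. LI (ball q r) Ph & open B & q \<in> B & B \<subseteq> D \<inter> ball q r & (\<forall>w\<in>B. Ph w = Ps w)))"

lemma extendsD:
 "extends N r ==> LI D Ps ==> q \<in> D ==> norm q \<ge> 1/2 ==> Ps q \<in> N ==>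
   \<exists>Ph B. LI (ball q r) Ph & open B & q \<in> B & B \<subseteq> D \<inter> ball q r & (\<forall>w\<in>B. Ph w = Ps w)"
 unfolding extends_def by blast

lemma extends_mono:
 assumes "extends N r" "0 < s" "s \<le> r" shows "extends N s"
 unfolding extends_def
proof (intro allI impI)
 fix D Ps q assume a: "LI D Ps" "q \<in> D" "1/2 \<le> norm q" "Ps q \<in> N"
 obtain Ph B where b: "LI (ball q r) Ph" "open B" "q \<in> B" "B \<subseteq> D \<inter> ball q r" "\<forall>w\<in>B. Ph w = Ps w"
  using assms(1) a unfolding extends_def by blast
 have "LI (ball q s) Ph" by (rule LI_mono[OF b(1) open_ball]) (use assms(3) in auto)
 moreover have "open (B \<inter> ball q s)" "q \<in> B \<inter> ball q s" "B \<inter> ball q s \<subseteq> D \<inter> ball q s" "\<forall>w\<in>B \<inter> ball q s. Ph w = Ps w"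
  using b assms(2) by auto
 ultimately show "\<exists>Ph B. LI (ball q s) Ph & open B & q \<in> B & B \<subseteq> D \<inter> ball q s & (\<forall>w\<in>B. Ph w = Ps w)" by blast
qed

text \<open>The given branch at \<open>q\<close> is matched with a fixed local inverse by a unitary
  map and a factor \<open>c\<close>. Since \<open>cmod c * norm q\<close> is the norm of a lift
  value near \<open>L x\<close>, the lower bound on \<open>norm q\<close> bounds \<open>c\<close>,
  and with it the distortion of balls.\<close>

lemma extends_local:
 assumes x: "x \<in> topspace X" shows "\<exists>N r. openin X N & x \<in> N & r > 0 & extends N r"
proof -
 obtain N L M ps where l: "li N L M ps" and xN: "x \<in> N" using li_exists[OF x] by blast
 have "L x \<in> M" by (rule liD(7)[OF l xN]) simp
 then obtain e2 where "e2 > 0" "ball (L x) e2 \<subseteq> M" using liD(2)[OF l] openE by blast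
 then obtain e where e: "e > 0" "ball (L x) (2 * e) \<subseteq> M" by (intro that[of "e2/2"]) auto
 define N' where "N' = {y \<in> N. L y \<in> ball (L x) e}"
 have "openin (subtopology X N) {y \<in> topspace (subtopology X N). L y \<in> ball (L x) e}"
  by (rule openin_continuous_map_preimage[OF liD(3)[OF l]]) simp
 moreover have "{y \<in> topspace (subtopology X N). L y \<in> ball (L x) e} = N'" using liD(11)[OF l] by (auto simp: N'_def)
 ultimately have N': "openin X N'" using openin_trans_full[OF _ liD(10)[OF l]] by simp
 define R where "R = norm (L x) + e"
 have R: "R > 0" using e by (simp add: R_def add_nonneg_pos)
 \<comment> \<open>With \<open>cmod c < 2 * R\<close> the map
   \<open>w \<mapsto> c *s (V *v w)\<close> sends a ball of this radius into one of radius
   \<open>e\<close> around the value of the lift, which lies within \<open>e\<close> of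
   \<open>L x\<close>.\<close>
 define r where "r = e / (2 * R)"
 have r: "r > 0" using e R by (simp add: r_def)
 have "extends N' r"
  unfolding extends_def
 proof (intro allI impI)
  fix D Ps q assume a: "LI D Ps" "q \<in> D" "1/2 \<le> norm q" "Ps q \<in> N'"
  obtain N0 L0 M0 ps0 B where l0: "li N0 L0 M0 ps0" and B: "open B" "q \<in> B" "B \<subseteq> D" "B \<subseteq> M0" "\<forall>w\<in>B. Ps w = ps0 w"
   by (rule LI_E[OF a(1,2)])
  have y: "Ps q \<in> N0" "Ps q \<in> N" using liD(5)[OF l0, of q] B a(4) by (auto simp: N'_def)
  obtain W V where W: "openin X W" "Ps q \<in> W" "W \<subseteq> N0 \<inter> N" and V: "unitary V" and p: "!!z. z \<in> W ==> par (L z) (V *v L0 z)"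
   by (rule dev_rigidity[OF liD(1)[OF l0] liD(1)[OF l] y]) blast
  obtain B1 where B1: "open B1" "q \<in> B1" "B1 \<subseteq> D" "!!w. w \<in> B1 ==> Ps w \<in> W" by (rule LI_nbhd[OF a(1,2) W(1,2)]) blast
  have par: "par (L (Ps w)) (V *v w)" if "w \<in> B" "w \<in> B1" for w
  proof -
   have "par (L0 (Ps w)) w" using liD(6)[OF l0, of w] B(4,5) that(1) by auto
   then show ?thesis using par_trans[OF p[OF B1(4)[OF that(2)]] par_matrix] by blast
  qed
  obtain c where c: "c ~= 0" "L (Ps q) = c *s (V *v q)" using par[OF B(2) B1(2)] unfolding par_def by blast
  let ?Ph = "%w. ps (c *s (V *v w))"
  note lt = li_transform[OF l V c(1)]
  have Ly: "dist (L x) (L (Ps q)) < e" using a(4) by (simp add: N'_def)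
  have cq: "cmod c * norm q < R"
  proof -
   have "cmod c * norm q = norm (L (Ps q))" by (simp add: c(2) norm_smult unitary_norm[OF V])
   also have "... < R" using Ly norm_triangle_ineq2[of "L (Ps q)" "L x"] unfolding R_def dist_norm by (simp add: norm_minus_commute)
   finally show ?thesis .
  qed
  have "cmod c * (1/2) \<le> cmod c * norm q" using a(3) by (intro mult_left_mono) auto
  then have c2: "cmod c < 2 * R" using cq by simp
  have inM: "c *s (V *v w) \<in> M" if "w \<in> ball q r" for w
  proof -
   have "c *s (V *v w) - L (Ps q) = c *s (V *v (w - q))"
    by (simp add: c(2) matrix_vector_mult_diff_distrib vector_sub_rdistrib vec_eq_iff algebra_simps)
   then have "dist (L (Ps q)) (c *s (V *v w)) = cmod c * norm (w - q)"
    by (metis dist_commute dist_norm norm_smult unitary_norm[OF V])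
   also have "... \<le> cmod c * r" using that by (intro mult_left_mono) (auto simp: dist_norm norm_minus_commute)
   also have "... < 2 * R * r" using c2 r by simp
   also have "... = e" using R by (simp add: r_def)
   finally have "dist (L x) (c *s (V *v w)) < e + e" using Ly dist_triangle[of "L x" "c *s (V *v w)" "L (Ps q)"] by linarith
   then show ?thesis using e(2) by auto
  qed
  have "LI (ball q r) ?Ph"
  proof (rule LI_I[OF open_ball])
   fix v assume "v \<in> ball q r"
   then have "li N (%y. adj V *v L y) {w. c *s (V *v w) \<in> M} ?Ph & open (ball q r) & v \<in> ball q r
    & ball q r \<subseteq> {w. c *s (V *v w) \<in> M} & (\<forall>w\<in>ball q r \<inter> ball q r. ?Ph w = ?Ph w)"
    using lt inM by auto
   then show "\<exists>N L M ps B. li N L M ps & open B & v \<in> B & B \<subseteq> M & (\<forall>w\<in>B \<inter> ball q r. ?Ph w = ps w)" by blast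
  qed
  moreover have "?Ph w = Ps w" if "w \<in> B" "w \<in> B1" for w
  proof (rule liD(8)[OF l])
   show "Ps w \<in> N" using B1(4)[OF that(2)] W(3) by blast
   show "par (L (Ps w)) (c *s (V *v w))" using par_trans[OF par[OF that] par_sym[OF par_scale[OF c(1)]]] .
  qed
  moreover have "open (B \<inter> B1 \<inter> ball q r)" "q \<in> B \<inter> B1 \<inter> ball q r" "B \<inter> B1 \<inter> ball q r \<subseteq> D \<inter> ball q r" using B B1 r by auto
  ultimately show "\<exists>Ph B. LI (ball q r) Ph & open B & q \<in> B & B \<subseteq> D \<inter> ball q r & (\<forall>w\<in>B. Ph w = Ps w)"
   by (intro exI[of _ ?Ph] exI[of _ "B \<inter> B1 \<inter> ball q r"] conjI ballI) auto
 qed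
 moreover have "x \<in> N'" using xN e by (simp add: N'_def)
 ultimately show ?thesis using N' r by blast
qed

lemma LI_radius: obtains rh where "rh > 0" "extends (topspace X) rh"
proof -
 define \<U> where "\<U> = {N. openin X N & (\<exists>r>0. extends N r)}"
 have "topspace X \<subseteq> \<Union>\<U>" using extends_local unfolding \<U>_def by blast
 moreover have "\<forall>U\<in>\<U>. openin X U" by (simp add: \<U>_def)
 ultimately obtain \<F> where F: "finite \<F>" "\<F> \<subseteq> \<U>" "topspace X \<subseteq> \<Union>\<F>"
  using compact unfolding compact_space_alt by meson
 have "\<forall>N\<in>\<F>. \<exists>r>0. extends N r" using F(2) by (auto simp: \<U>_def)
 then obtain r where r: "!!N. N \<in> \<F> ==> r N > 0 & extends N (r N)" by metis
 define rh where "rh = Min (r ` \<F>)"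
 have ne: "r ` \<F> ~= {}" using F(3) nonempty by auto
 have rh: "rh > 0" unfolding rh_def using F(1) ne r by simp
 have e: "extends N rh" if N: "N \<in> \<F>" for N
  by (rule extends_mono[of N "r N"]) (use r[OF N] rh N F(1) in \<open>auto simp: rh_def\<close>)
 have "extends (topspace X) rh"
  unfolding extends_def
 proof (intro allI impI)
  fix D Ps q assume a: "LI D Ps" "q \<in> D" "1/2 \<le> norm q" "Ps q \<in> topspace X"
  then obtain N where "N \<in> \<F>" "Ps q \<in> N" using F(3) by blast
  then show "\<exists>Ph B. LI (ball q rh) Ph & open B & q \<in> B & B \<subseteq> D \<inter> ball q rh & (\<forall>w\<in>B. Ph w = Ps w)"
   using e[of N] a unfolding extends_def by blast
 qed
 then show thesis using rh that by blast
qed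

text \<open>Two balls of equal radius that meet and have their centres in a convex set also meet inside
 that set, at the midpoint of the centres; so the local extensions agree.\<close>

lemma LI_extend_step:
 assumes rh: "rh > 0" "extends (topspace X) rh" and H: "convex H" "open H" "!!v. v \<in> H ==> norm v \<ge> 1/2"
  and D: "LI D Ps" "convex D" "D \<subseteq> H"
 obtains Ph where "LI {x \<in> H. \<exists>q\<in>D. dist q x < rh} Ph" "!!v. v \<in> D ==> Ph v = Ps v"
proof -
 define P where "P = (%q Ph. LI (ball q rh) Ph & (\<exists>B. open B & q \<in> B & B \<subseteq> D \<inter> ball q rh & (\<forall>w\<in>B. Ph w = Ps w)))"
 have "\<forall>q\<in>D. \<exists>Ph. P q Ph"
 proof
  fix q assume q: "q \<in> D"
  then show "\<exists>Ph. P q Ph"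
   using extendsD[OF rh(2) D(1) q H(3) LI_top[OF D(1) q]] D(3) unfolding P_def by blast
 qed
 then obtain Ph where "\<forall>q\<in>D. P q (Ph q)" by (rule bchoice[THEN exE])
 then have Ph: "!!q. q \<in> D ==> LI (ball q rh) (Ph q)"
  and ex: "!!q. q \<in> D ==> \<exists>B. open B & q \<in> B & B \<subseteq> D \<inter> ball q rh & (\<forall>w\<in>B. Ph q w = Ps w)"
  unfolding P_def by blast+
 note oD = LI_open[OF D(1)]
 have on_D: "Ph q w = Ps w" if q: "q \<in> D" and w: "w \<in> D" "w \<in> ball q rh" for q w
 proof -
  obtain B where B: "open B" "q \<in> B" "B \<subseteq> D \<inter> ball q rh" "\<forall>w\<in>B. Ph q w = Ps w" using ex[OF q] by blast
  have o: "open (D \<inter> ball q rh)" using oD by blast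
  show ?thesis
  proof (rule LI_unique[OF LI_mono[OF Ph[OF q] o] LI_mono[OF D(1) o] _ B(1,2,3)])
   show "connected (D \<inter> ball q rh)" by (intro convex_connected convex_Int D(2) convex_ball)
  qed (use B(4) w in auto)
 qed
 have agree: "Ph q x = Ph q' x" if q: "q \<in> D" "q' \<in> D" and x: "x \<in> H \<inter> ball q rh" "x \<in> H \<inter> ball q' rh" for q q' x
 proof -
  define m where "m = midpoint q q'"
  have o: "open (ball q rh \<inter> ball q' rh)" by blast
  have "dist q q' < 2 * rh" using x dist_triangle[of q q' x] by (simp add: dist_commute)
  then have "dist q m < rh" "dist q' m < rh" unfolding m_def dist_midpoint by (simp_all add: dist_commute)
  then have m: "m \<in> ball q rh \<inter> ball q' rh \<inter> D"
   using subsetD[OF closed_segment_subset[OF q D(2)], of m] midpoint_in_closed_segment[of q q'] unfolding m_def by auto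
  show ?thesis
  proof (rule LI_unique[OF LI_mono[OF Ph[OF q(1)] o] LI_mono[OF Ph[OF q(2)] o]])
   show "connected (ball q rh \<inter> ball q' rh)" by (intro convex_connected convex_Int convex_ball)
   show "open (ball q rh \<inter> ball q' rh \<inter> D)" using oD by blast
   show "Ph q w = Ph q' w" if "w \<in> ball q rh \<inter> ball q' rh \<inter> D" for w using on_D q that by auto
  qed (use m x in auto)
 qed
 have "LI (H \<inter> ball q rh) (Ph q)" if "q \<in> D" for q by (rule LI_mono[OF Ph[OF that]]) (use H(2) in auto)
 from LI_glue[of D "%q. H \<inter> ball q rh" Ph, OF this agree]
 obtain Xi where Xi: "LI (\<Union>q\<in>D. H \<inter> ball q rh) Xi" "\<forall>q\<in>D. \<forall>v\<in>H \<inter> ball q rh. Xi v = Ph q v" by blast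
 have "(\<Union>q\<in>D. H \<inter> ball q rh) = {x \<in> H. \<exists>q\<in>D. dist q x < rh}" by auto
 moreover have "Xi v = Ps v" if "v \<in> D" for v using bspec[OF bspec[OF Xi(2) that], of v] on_D[OF that that] that rh(1) D(3) by auto
 ultimately show thesis using Xi(1) that by auto
qed

text \<open>The branch is continued to the intersections of \<open>H\<close> with balls about
  \<open>w\<close> whose radii grow by \<open>rh\<close> in each step. These intersections are
  convex, and their union is \<open>H\<close>.\<close>

lemma LI_extend_convex:
 assumes H: "convex H" "open H" "!!v. v \<in> H ==> norm v \<ge> 1/2" and l: "LI B0 Ps0" and w: "w \<in> B0" "w \<in> H"
 obtains Ps B where "LI H Ps" "open B" "w \<in> B" "B \<subseteq> B0 \<inter> H" "!!v. v \<in> B ==> Ps v = Ps0 v"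
proof -
 obtain rh where rh: "rh > 0" "extends (topspace X) rh" by (rule LI_radius)
 obtain Ph B where Ph: "LI (ball w rh) Ph" and B: "open B" "w \<in> B" "B \<subseteq> B0 \<inter> ball w rh" "\<forall>v\<in>B. Ph v = Ps0 v"
  using extendsD[OF rh(2) l w(1) H(3)[OF w(2)] LI_top[OF l w(1)]] by blast
 define D where "D = (%k. H \<inter> ball w (real (Suc k) * rh))"
 have D: "open (D k)" "convex (D k)" "D k \<subseteq> H" "w \<in> D k" for k
  using H w(2) rh(1) by (auto simp: D_def convex_Int)
 have Dmono: "D j \<subseteq> D k" if "j \<le> k" for j k
  using mult_right_mono[of "real (Suc j)" "real (Suc k)" rh] that rh(1) unfolding D_def by (intro Int_mono subset_ball) auto
 have "\<exists>Ps. LI (D k) Ps & (\<forall>v\<in>D 0. Ps v = Ph v)" for k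
 proof (induction k)
  case 0
  have "LI (D 0) Ph" by (rule LI_mono[OF Ph D(1)]) (auto simp: D_def)
  then show ?case by blast
 next
  case (Suc k)
  then obtain Ps where Ps: "LI (D k) Ps" "\<forall>v\<in>D 0. Ps v = Ph v" by blast
  obtain Xi where Xi: "LI {x \<in> H. \<exists>q\<in>D k. dist q x < rh} Xi" "!!v. v \<in> D k ==> Xi v = Ps v"
   using LI_extend_step[OF rh H Ps(1) D(2,3)] by blast
  have "D (Suc k) \<subseteq> {x \<in> H. \<exists>q\<in>D k. dist q x < rh}"
  proof
   fix x assume x: "x \<in> D (Suc k)"
   \<comment> \<open>The ratio of consecutive radii: the point dividing the segment from
     \<open>w\<close> to \<open>x\<close> in this ratio lies in \<open>D k\<close> by convexity of
     \<open>H\<close>, and at distance less than \<open>rh\<close> from \<open>x\<close>.\<close>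
   define t where "t = real (Suc k) / real (Suc (Suc k))"
   have t: "0 \<le> t" "t \<le> 1" "1 - t = 1 / real (Suc (Suc k))" by (simp_all add: t_def field_simps)
   define q where "q = (1 - t) *\<^sub>R w + t *\<^sub>R x"
   have d: "dist w x < real (Suc (Suc k)) * rh" "x \<in> H" using x by (simp_all add: D_def)
   have "q \<in> H" unfolding q_def by (rule convexD_alt[OF H(1) w(2) d(2) t(1,2)])
   moreover have "dist w q = t * dist w x"
   proof -
    have "w - q = t *\<^sub>R (w - x)" by (simp add: q_def algebra_simps)
    then show ?thesis using t(1) by (simp add: dist_norm)
   qed
   moreover have "dist q x = (1 - t) * dist w x"
   proof -
    have "q - x = (1 - t) *\<^sub>R (w - x)" by (simp add: q_def algebra_simps)
    then show ?thesis using t(2) by (simp add: dist_norm)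
   qed
   moreover have "t * dist w x < real (Suc k) * rh"
   proof -
    have "t * dist w x < t * (real (Suc (Suc k)) * rh)" using d(1) by (intro mult_strict_left_mono) (simp_all add: t_def)
    then show ?thesis by (simp add: t_def)
   qed
   moreover have "(1 - t) * dist w x < rh" unfolding t(3) using d(1) by (simp add: field_simps)
   ultimately have "q \<in> D k" "dist q x < rh" by (simp_all add: D_def)
   then show "x \<in> {x \<in> H. \<exists>q\<in>D k. dist q x < rh}" using d(2) by blast
  qed
  then have "LI (D (Suc k)) Xi" by (rule LI_mono[OF Xi(1) D(1)])
  moreover have "\<forall>v\<in>D 0. Xi v = Ph v" using Xi(2) Ps(2) Dmono[of 0 k] by (auto simp: subset_iff)
  ultimately show ?case by blast
 qed
 then have "\<exists>Ps. \<forall>k. LI (D k) (Ps k) & (\<forall>v\<in>D 0. Ps k v = Ph v)" by (intro choice allI)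
 then obtain Ps where Ps: "!!k. LI (D k) (Ps k)" "!!k v. v \<in> D 0 ==> Ps k v = Ph v" by blast
 have agree: "Ps j v = Ps k v" if v: "v \<in> D j" "v \<in> D k" for j k v
 proof -
  have o: "open (D j \<inter> D k)" using D(1) by blast
  show ?thesis
  proof (rule LI_unique[OF LI_mono[OF Ps(1) o] LI_mono[OF Ps(1) o] _ D(1)[of 0] D(4)])
   show "connected (D j \<inter> D k)" by (intro convex_connected convex_Int D(2))
   show "D 0 \<subseteq> D j \<inter> D k" using Dmono by blast
  qed (use Ps(2) v in auto)
 qed
 obtain Xi where Xi: "LI (\<Union>k\<in>UNIV. D k) Xi" "\<forall>k\<in>UNIV. \<forall>v\<in>D k. Xi v = Ps k v"
 proof (rule LI_glue[of UNIV D Ps])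
  show "LI (D k) (Ps k)" for k by (rule Ps(1))
  show "Ps i v = Ps j v" if "v \<in> D i" "v \<in> D j" for i j v by (rule agree[OF that])
 qed
 have "(\<Union>k\<in>UNIV. D k) = H"
 proof
  show "(\<Union>k\<in>UNIV. D k) \<subseteq> H" using D(3) by blast
  show "H \<subseteq> (\<Union>k\<in>UNIV. D k)"
  proof
   fix v assume v: "v \<in> H"
   obtain n where n: "dist w v / rh < real n" using reals_Archimedean2 by blast
   then have "dist w v < real n * rh" using rh(1) by (simp add: field_simps)
   also have "... \<le> real (Suc n) * rh" using rh(1) by simp
   finally show "v \<in> (\<Union>k\<in>UNIV. D k)" using v by (auto simp: D_def)
  qed
 qed
 then have "LI H Xi" using Xi(1) by simp
 then show thesis
 proof (rule that[of Xi "B \<inter> D 0"])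
  show "open (B \<inter> D 0)" using B(1) D(1) by blast
  show "Xi v = Ps0 v" if "v \<in> B \<inter> D 0" for v using that Xi(2) Ps(2)[of v 0] B(4) by auto
 qed (use B D(3)[of 0] D(4)[of 0] in auto)
qed

end

text \<open>Without eigenvalues the characteristic polynomial has no root and is constant. Then
  det(y V - 1), which equals y^n times that constant for nonzero y, would tend to 0 as y tends to 0,
  whereas its value at 0 is a power of -1.\<close>

lemma eigenvector_exists:
 fixes V :: "complex^'n::finite^'n"
 shows "\<exists>u mu. u ~= 0 & V *v u = mu *s u"
proof (rule ccontr)
 assume none: "\<not> ?thesis"
 have nz: "det (\<chi> i j. V $ i $ j - (if i = j then x else 0)) ~= 0" for x
 proof -
  have "u = 0" if "(\<chi> i j. V $ i $ j - (if i = j then x else 0)) *v u = 0" for u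
  proof -
   have "V *v u = x *s u"
    using that by (simp add: vec_eq_iff matrix_vector_mult_def left_diff_distrib sum_subtractf mult_delta_left)
   then show ?thesis using none by blast
  qed
  then show ?thesis using matrix_left_invertible_ker invertible_left_inverse invertible_det_nz by blast
 qed
 define P where "P = det (\<chi> i j. [:V $ i $ j, if i = j then -1 else 0:])"
 have P: "poly P x = det (\<chi> i j. V $ i $ j - (if i = j then x else 0))" for x
  unfolding P_def det_def by (auto simp: poly_sum poly_prod intro!: sum.cong prod.cong)
 have "degree P = 0"
 proof (rule ccontr)
  assume d: "degree P ~= 0"
  then have "\<exists>i\<in>{1..degree P}. coeff P i ~= 0" by (intro bexI[of _ "degree P"]) auto
  then obtain z where "(\<Sum>i\<le>degree P. coeff P i * z ^ i) = 0"
   using fundamental_theorem_of_algebra[of "coeff P" "degree P"] by blast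
  then show False using nz[of z] by (simp add: P[symmetric] poly_altdef)
 qed
 then have const: "poly P x = poly P 0" for x by (metis degree_eq_zeroE mult_zero_right poly_pCons poly_0 add.right_neutral)
 define n where "n = CARD('n)"
 \<comment> \<open>The characteristic polynomial in the reciprocal variable; at \<open>y = 0\<close>
   it exposes the leading coefficient without any computation of degrees.\<close>
 define Q where "Q = (%y. det (\<chi> i j. y * V $ i $ j - (if i = j then 1 else 0)))"
 have Q: "Q y = y ^ n * poly P 0" if "y ~= 0" for y
 proof -
  have "Q y = det (\<chi> i. y *s (\<chi> j. V $ i $ j - (if i = j then inverse y else 0)))"
   unfolding Q_def using that by (intro arg_cong[of _ _ det]) (simp add: vec_eq_iff algebra_simps)
  also have "... = prod (%i. y) (UNIV :: 'n set) * det (\<chi> i. \<chi> j. V $ i $ j - (if i = j then inverse y else 0))"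
   by (rule det_rows_mul)
  also have "... = y ^ n * poly P (inverse y)" by (simp add: P n_def)
  finally show ?thesis unfolding const[of "inverse y"] .
 qed
 have "continuous (at 0) Q" unfolding Q_def det_def vec_lambda_beta by (intro continuous_intros)
 then have "(Q \<longlongrightarrow> Q 0) (at 0)" by (simp add: continuous_at)
 moreover have "((%y. y ^ n * poly P 0) \<longlongrightarrow> 0 ^ n * poly P 0) (at 0)" by (intro tendsto_intros)
 then have "(Q \<longlongrightarrow> 0 ^ n * poly P 0) (at 0)"
  by (rule Lim_transform_eventually) (simp add: eventually_at_filter Q)
 ultimately have "Q 0 = 0 ^ n * poly P 0" using LIM_unique by blast
 moreover have "n > 0" by (simp add: n_def)
 ultimately have "Q 0 = 0" by simp
 moreover have "Q 0 = prod (%i. - 1) (UNIV :: 'n set)"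
 proof -
  have "Q 0 = det ((\<chi> i. (- 1) *s (\<chi> j. if i = j then 1 else 0)) :: complex^'n^'n)"
   unfolding Q_def by (intro arg_cong[of _ _ det]) (simp add: vec_eq_iff)
  also have "... = prod (%i. - 1) (UNIV :: 'n set) * det ((\<chi> i. \<chi> j. if i = j then 1 else 0) :: complex^'n^'n)"
   by (rule det_rows_mul)
  also have "det ((\<chi> i. \<chi> j. if i = j then 1 else 0) :: complex^'n^'n) = det (mat 1 :: complex^'n^'n)" by (simp add: mat_def)
  finally show ?thesis by (simp add: det_I)
 qed
 ultimately show False by simp
qed

text \<open>The complex line through two points of the set meets each of the two hyperplanes at most
  once, and the complex plane without finitely many points is connected.\<close>

lemma connected_nonzero_coordinates: "connected {v :: complex^'n::finite. v $ i ~= 0 & v $ j ~= 0}" (is "connected ?S")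
proof (subst connected_iff_connected_component, intro ballI)
 fix a b assume ab: "a \<in> ?S" "b \<in> ?S"
 define f where "f = (%t. (1 - t) *s a + t *s b)"
 define Z where "Z = (%k. {t. f t $ k = 0})"
 have fin: "finite (Z k)" if "a $ k ~= 0" for k
 proof (cases "b $ k = a $ k")
  case True
  then have "Z k = {}" using that by (auto simp: Z_def f_def algebra_simps)
  then show ?thesis by simp
 next
  case False
  have "Z k \<subseteq> {a $ k / (a $ k - b $ k)}"
  proof
   fix t assume "t \<in> Z k"
   then have "t * (a $ k - b $ k) = a $ k" by (simp add: Z_def f_def algebra_simps)
   then show "t \<in> {a $ k / (a $ k - b $ k)}" using False by (simp add: nonzero_eq_divide_eq)
  qed
  then show ?thesis using finite_subset by blast
 qed
 have "connected (UNIV - (Z i \<union> Z j))"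
  by (rule connected_open_delete_finite) (use ab fin in auto)
 moreover have "continuous_on T f" for T
 proof -
  have "continuous_on T (%t. \<chi> k. f t $ k)" unfolding f_def by (intro continuous_on_vec_lambda) (auto intro!: continuous_intros)
  then show ?thesis by simp
 qed
 ultimately have "connected (f ` (UNIV - (Z i \<union> Z j)))" by (intro connected_continuous_image)
 moreover have "f ` (UNIV - (Z i \<union> Z j)) \<subseteq> ?S" by (auto simp: Z_def)
 moreover have "f 0 = a" "f 1 = b" by (simp_all add: f_def vec_eq_iff)
 then have "a \<in> f ` (UNIV - (Z i \<union> Z j))" "b \<in> f ` (UNIV - (Z i \<union> Z j))"
  using ab by (auto simp: Z_def intro: rev_image_eqI[of 0] rev_image_eqI[of 1])
 ultimately show "connected_component ?S a b" unfolding connected_component_def by blast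
qed

section \<open>The developing map on nonzero homogeneous coordinates\<close>

context model
begin

lemma li_cone:
 assumes l: "li N L M ps" and v: "v \<in> M" "par v w" shows "w \<in> M" "ps w = ps v"
 using liD(7)[OF l liD(5)[OF l v(1)] par_trans[OF liD(6)[OF l v(1)] v(2)]]
  liD(8)[OF l liD(5)[OF l v(1)] par_trans[OF liD(6)[OF l v(1)] v(2)]] by auto

text \<open>One germ at the vector \<open>e\<close> with all coordinates 1 is continued over convex
  half-spaces, one for each coordinate, and each continuation is made homogeneous. The resulting
  maps agree wherever two coordinates are nonzero, since that set is connected and contains
  \<open>e\<close>.\<close>

lemma developing_map:
 obtains F where "LI (- {0}) F" "\<forall>c v. c ~= 0 \<longrightarrow> v ~= 0 \<longrightarrow> F (c *s v) = F v"
proof -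
 define e :: "complex^('m option)" where "e = (\<chi> i. 1)"
 have e0: "e ~= 0" by (simp add: e_def vec_eq_iff)
 obtain x0 where x0: "x0 \<in> topspace X" using nonempty by blast
 obtain N0 L0 M0 ps0 where l0: "li N0 L0 M0 ps0" and xN: "x0 \<in> N0" using li_exists[OF x0] by blast
 have L0: "L0 x0 ~= 0" by (rule dev_nonzero[OF liD(1)[OF l0] xN])
 have unit: "norm (cor (inverse (norm v)) *s v) = 1" if "v ~= 0" for v :: "complex^('m option)"
  using that by (simp add: norm_smult norm_inverse)
 \<comment> \<open>Rotates a local inverse so that its cone contains \<open>e\<close>; by
   homogeneity of the cone only the directions of the two vectors matter.\<close>
 obtain V where V: "unitary V" "V *v (cor (inverse (norm e)) *s e) = cor (inverse (norm (L0 x0))) *s L0 x0"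
  using unitary_transitive[OF unit[OF e0] unit[OF L0]] by blast
 define M1 where "M1 = {w. 1 *s (V *v w) \<in> M0}"
 define ps1 where "ps1 = (%w. ps0 (1 *s (V *v w)))"
 have l1: "li N0 (%y. adj V *v L0 y) M1 ps1" unfolding M1_def ps1_def by (rule li_transform[OF l0 V(1)]) simp
 have eM: "e \<in> M1"
 proof (rule liD(7)[OF l1 xN])
  have p1: "par (cor (inverse (norm e)) *s e) e" by (rule par_scale) (use e0 in simp)
  have p2: "par (cor (inverse (norm (L0 x0))) *s L0 x0) (L0 x0)" by (rule par_scale) (use L0 in simp)
  have "par (L0 x0) (V *v e)" using par_trans[OF par_sym[OF p2[folded V(2)]] par_matrix[OF p1]] .
  from par_matrix[OF this, of "adj V"] show "par (adj V *v L0 x0) e" unfolding unitary_cancel(1)[OF V(1)] .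
 qed
 have LI1: "LI M1 ps1"
  by (rule LI_I[OF liD(2)[OF l1]]) (use l1 liD(2)[OF l1] in blast)
 \<comment> \<open>Convex, bounded away from the origin as the continuation requires, and containing
   a representative of every line whose coordinate \<open>i\<close> is nonzero.\<close>
 define H where "H = (%i. {v :: complex^('m option). 1/2 < Re (v $ i)})"
 have H: "convex (H i)" "open (H i)" "e \<in> H i" "!!v. v \<in> H i ==> norm v \<ge> 1/2" for i
 proof -
  have lin: "bounded_linear (%v :: complex^('m option). Re (v $ i))"
   by (rule bounded_linear_compose[OF bounded_linear_Re bounded_linear_vec_nth])
  have Hv: "H i = (%v. Re (v $ i)) -` {1/2<..}" by (auto simp: H_def)
  show "convex (H i)" unfolding Hv by (rule convex_linear_vimage[OF bounded_linear.linear[OF lin]]) simp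
  show "open (H i)" unfolding Hv by (rule open_vimage[OF open_greaterThan linear_continuous_on[OF lin]])
  show "e \<in> H i" by (simp add: H_def e_def)
  show "norm v \<ge> 1/2" if "v \<in> H i" for v
   using that abs_Re_le_cmod[of "v $ i"] Finite_Cartesian_Product.norm_nth_le[of v i] by (simp add: H_def)
 qed
 have "\<exists>Ps. LI (H i) Ps & (\<exists>B. open B & e \<in> B & B \<subseteq> M1 \<inter> H i & (\<forall>v\<in>B. Ps v = ps1 v))" for i
  by (rule LI_extend_convex[OF H(1,2) H(4) LI1 eM H(3)]) blast+
 then have "\<exists>Ps. \<forall>i. LI (H i) (Ps i) & (\<exists>B. open B & e \<in> B & B \<subseteq> M1 \<inter> H i & (\<forall>v\<in>B. Ps i v = ps1 v))"
  by (intro choice allI)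
 then obtain Ps where Ps: "!!i. LI (H i) (Ps i)"
  and nearB: "!!i. \<exists>B. open B & e \<in> B & B \<subseteq> M1 \<inter> H i & (\<forall>v\<in>B. Ps i v = ps1 v)" by blast
 define C where "C = (%i. {v :: complex^('m option). v $ i ~= 0})"
 define \<pi> where "\<pi> = (%i (v :: complex^('m option)). inverse (v $ i) *s v)"
 \<comment> \<open>Evaluation at the representative with coordinate \<open>i\<close> equal to 1.
   This defines the map on all vectors with that coordinate nonzero and makes it
   homogeneous.\<close>
 define F where "F = (%i v. Ps i (\<pi> i v))"
 have \<pi>par: "par (\<pi> i v) v" if "v \<in> C i" for i v unfolding \<pi>_def by (rule par_scale) (use that in \<open>simp add: C_def\<close>)
 have \<pi>H: "\<pi> i v \<in> H i" if "v \<in> C i" for i v using that by (simp add: \<pi>_def H_def C_def)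
 have \<pi>e: "\<pi> i e = e" for i by (simp add: \<pi>_def e_def vec_eq_iff)
 have Co: "open (C i)" for i
 proof -
  have "C i = (%v. v $ i) -` (- {0})" by (auto simp: C_def)
  then show ?thesis using open_vimage[of "- {0}" "%v :: complex^('m option). v $ i"]
   by (simp add: open_Compl linear_continuous_on[OF bounded_linear_vec_nth])
 qed
 have eC: "e \<in> C i" for i by (simp add: C_def e_def)
 have \<pi>o: "open {v \<in> C i. \<pi> i v \<in> B}" if "open B" for B i
 proof -
  have "continuous_on (C i) (%v. \<chi> k. \<pi> i v $ k)"
   unfolding \<pi>_def by (intro continuous_on_vec_lambda) (auto intro!: continuous_intros linear_continuous_on[OF bounded_linear_vec_nth] simp: C_def)
  then have "continuous_on (C i) (\<pi> i)" by simp
  from continuous_open_preimage[OF this Co that] show ?thesis by (simp add: vimage_def Int_def)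
 qed
 have LIF: "LI (C i) (F i)" for i
 proof (rule LI_I[OF Co])
  fix v assume v: "v \<in> C i"
  obtain N L M ps B where l: "li N L M ps" and B: "open B" "\<pi> i v \<in> B" "B \<subseteq> H i" "B \<subseteq> M" "\<forall>w\<in>B. Ps i w = ps w"
   by (rule LI_E[OF Ps \<pi>H[OF v]])
  let ?B = "{v \<in> C i. \<pi> i v \<in> B}"
  have "w \<in> M & F i w = ps w" if "w \<in> ?B" for w
  proof -
   have w: "w \<in> C i" "\<pi> i w \<in> B" using that by auto
   then have "\<pi> i w \<in> M" using B(4) by blast
   from li_cone[OF l this \<pi>par[OF w(1)]] show ?thesis using B(5) w(2) by (simp add: F_def)
  qed
  then have "open ?B & v \<in> ?B & ?B \<subseteq> M & (\<forall>w\<in>?B \<inter> C i. F i w = ps w)" using \<pi>o[OF B(1)] v B(2) by blast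
  with l show "\<exists>N L M ps B. li N L M ps & open B & v \<in> B & B \<subseteq> M & (\<forall>w\<in>B \<inter> C i. F i w = ps w)" by blast
 qed
 have nearF: "\<exists>B. open B & e \<in> B & B \<subseteq> C i & (\<forall>v\<in>B. F i v = ps1 v)" for i
 proof -
  obtain B where B: "open B" "e \<in> B" "B \<subseteq> M1 \<inter> H i" "\<forall>v\<in>B. Ps i v = ps1 v" using nearB by blast
  have "F i w = ps1 w" if w: "w \<in> C i" "\<pi> i w \<in> B" for w
  proof -
   have "\<pi> i w \<in> M1" using w(2) B(3) by blast
   from li_cone[OF l1 this \<pi>par[OF w(1)]] show ?thesis using B(4) w(2) by (simp add: F_def)
  qed
  then show ?thesis using \<pi>o[OF B(1)] eC \<pi>e B(2) by (intro exI[of _ "{v \<in> C i. \<pi> i v \<in> B}"]) auto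
 qed
 have agree: "F i v = F j v" if v: "v \<in> C i" "v \<in> C j" for i j v
 proof -
  obtain B B' where B: "open B" "e \<in> B" "B \<subseteq> C i" "\<forall>v\<in>B. F i v = ps1 v"
   and B': "open B'" "e \<in> B'" "B' \<subseteq> C j" "\<forall>v\<in>B'. F j v = ps1 v" using nearF[of i] nearF[of j] by blast
  have o: "open (C i \<inter> C j)" using Co by blast
  show ?thesis
  proof (rule LI_unique[OF LI_mono[OF LIF o] LI_mono[OF LIF o]])
   have "C i \<inter> C j = {v. v $ i ~= 0 & v $ j ~= 0}" by (auto simp: C_def)
   then show "connected (C i \<inter> C j)" by (simp only: connected_nonzero_coordinates)
   show "open (B \<inter> B')" using B(1) B'(1) by blast
  qed (use B B' v in auto)
 qed
 obtain G where G: "LI (\<Union>i\<in>UNIV. C i) G" "\<forall>i\<in>UNIV. \<forall>v\<in>C i. G v = F i v"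
 proof (rule LI_glue[of UNIV C F])
  show "LI (C i) (F i)" for i by (rule LIF)
  show "F i v = F j v" if "v \<in> C i" "v \<in> C j" for i j v by (rule agree[OF that])
 qed
 have "(\<Union>i\<in>UNIV. C i) = - {0}" by (auto simp: C_def vec_eq_iff)
 then have "LI (- {0}) G" using G(1) by simp
 moreover have "G (c *s v) = G v" if c: "c ~= 0" and "v ~= 0" for c v
 proof -
  obtain i where i: "v $ i ~= 0" using \<open>v ~= 0\<close> by (auto simp: vec_eq_iff)
  then have "\<pi> i (c *s v) = \<pi> i v" using c by (simp add: \<pi>_def vec_eq_iff field_simps)
  moreover have "v \<in> C i" "c *s v \<in> C i" using i c by (simp_all add: C_def)
  ultimately show ?thesis using G(2) by (simp add: F_def)
 qed
 ultimately show thesis using that by blast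
qed

end

section \<open>Affine charts of projective space\<close>

lemma continuous_smult: "continuous_on S (%v :: complex^'n::finite. b *s v)"
 by (rule linear_continuous_on, rule linear_conv_bounded_linear[THEN iffD1], rule linearI)
  (simp_all add: vec_eq_iff algebra_simps)

lemma chol_local: "(!!z. z \<in> S ==> \<exists>Z f'. open Z & z \<in> Z & chol f' Z & (\<forall>w\<in>Z. f w = f' w)) ==> chol f S"
proof -
 assume a: "!!z. z \<in> S ==> \<exists>Z f'. open Z & z \<in> Z & chol f' Z & (\<forall>w\<in>Z. f w = f' w)"
 have "f differentiable (at z) & (\<forall>al. dzbar al f z = 0)" if z: "z \<in> S" for z
 proof -
  obtain Z f' where Z: "open Z" "z \<in> Z" "chol f' Z" "\<forall>w\<in>Z. f w = f' w" using a[OF z] by blast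
  have "chol f Z" by (rule chol_cong[OF Z(1) _ Z(3)]) (use Z(4) in simp)
  then show ?thesis using cholD Z(2) by blast
 qed
 then show ?thesis unfolding chol_def by blast
qed

lemma cline_par: assumes "par u w" shows "cline u = cline w"
proof -
 have *: "cline u \<subseteq> cline w" if "par u w" for u w :: "complex^'n"
  using that unfolding par_def cline_def by (auto simp: vector_smult_assoc)
 show ?thesis using *[OF assms] *[OF par_sym[OF assms]] by blast
qed

lemma par_cline: assumes "cline u = cline w" "u ~= 0" shows "par u w"
proof -
 have "u \<in> cline u" unfolding cline_def by (rule range_eqI[of _ _ 1]) simp
 then obtain c where "u = c *s w" using assms(1) unfolding cline_def by blast
 then show ?thesis using assms(2) unfolding par_def by (metis vector_smult_lzero)
qed

text \<open>A holomorphic choice of homogeneous coordinates inverting the affine chart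
  \<open>i\<close>; it transfers statements about \<open>F\<close> to affine coordinates.\<close>

definition emb :: "'m option => complex^'m => complex^('m::finite option)" where
 "emb i u = (\<chi> j. if j = i then 1 else u $ inv_into UNIV (affine_index i) j)"

lemma emb: "emb i u $ i = 1" "emb i u $ affine_index i al = u $ al"
proof -
 have "inj (affine_index i)" "affine_index i al ~= i" using bij_betw_affine_index[of i] unfolding bij_betw_def by auto
 then show "emb i u $ i = 1" "emb i u $ affine_index i al = u $ al" by (simp_all add: emb_def)
qed

lemma emb_unique:
 assumes "w $ i ~= 0" shows "emb i (\<chi> al. w $ affine_index i al / w $ i) = inverse (w $ i) *s w"
proof -
 have "j = i \<or> (\<exists>al. j = affine_index i al)" for j using bij_betw_affine_index[of i] unfolding bij_betw_def by blast
 then have "emb i (\<chi> al. w $ affine_index i al / w $ i) $ j = (inverse (w $ i) *s w) $ j" for j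
  using assms emb[of i] by (metis (no_types, lifting) divide_inverse mult.commute right_inverse vec_lambda_beta vector_smult_component)
 then show ?thesis by (simp add: vec_eq_iff)
qed

lemma affine_dom_iff: "w ~= 0 ==> cline w \<in> dom_of (affine_chart i) \<longleftrightarrow> w $ i ~= 0"
 using affine_chart_cline(1)[of w i] by (auto simp: affine_chart_def cline_def)

lemma affine_inverse:
 "inv_into (dom_of (affine_chart i)) (coord (affine_chart i)) u = cline (emb i u)"
 "coord (affine_chart i) (cline (emb i u)) = u" "cline (emb i u) \<in> dom_of (affine_chart i)"
 "l \<in> dom_of (affine_chart i) ==> l = cline (emb i (coord (affine_chart i) l))"
proof -
 have n: "emb i u $ i ~= 0" for u by (simp add: emb)
 show c: "coord (affine_chart i) (cline (emb i u)) = u" for u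
  using affine_chart_cline(2)[OF n[of u]] by (simp add: vec_eq_iff emb)
 show d: "cline (emb i u) \<in> dom_of (affine_chart i)" for u by (rule affine_chart_cline(1)[OF n])
 have e: "l = cline (emb i (coord (affine_chart i) l))" if l: "l \<in> dom_of (affine_chart i)" for l
 proof -
  obtain w where w: "w ~= 0" "l = cline w" using l by (auto simp: affine_chart_def cproj_space_def)
  then have wi: "w $ i ~= 0" using affine_dom_iff l by blast
  have "coord (affine_chart i) l = (\<chi> al. w $ affine_index i al / w $ i)"
   using affine_chart_cline(2)[OF wi] by (simp add: vec_eq_iff w(2))
  then have "emb i (coord (affine_chart i) l) = inverse (w $ i) *s w" using emb_unique[OF wi] by simp
  then show ?thesis using cline_par[OF par_scale[of "inverse (w $ i)" w]] wi w(2) by simp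
 qed
 show "l \<in> dom_of (affine_chart i) ==> l = cline (emb i (coord (affine_chart i) l))" by (rule e)
 have "inj_on (coord (affine_chart i)) (dom_of (affine_chart i))" by (rule inj_onI) (metis e)
 then show "inv_into (dom_of (affine_chart i)) (coord (affine_chart i)) u = cline (emb i u)"
  using inv_into_f_f[OF _ d] c by metis
qed

text \<open>Dividing \<open>f\<close> by its coordinate \<open>i\<close> turns |f|^2 into 1 +
  |ph|^2, the argument of the potential in the affine chart, and such a division does not affect the
  form.\<close>

lemma pullback_fubini_study:
 fixes f :: "complex^'m::finite => complex^('m option)"
 assumes Z: "open Z" "z \<in> Z" and f: "!!j. chol (%z. f z $ j) Z" "!!z. z \<in> Z ==> f z $ i ~= 0"
 shows "pullback_form (%z. \<chi> al. f z $ affine_index i al / f z $ i) (fubini_study c) z = fsform f z"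
proof -
 define ph where "ph = (%z. \<chi> al. f z $ affine_index i al / f z $ i)"
 define s where "s = (%z. inverse (f z $ i))"
 have s: "chol s Z" "!!z. z \<in> Z ==> s z ~= 0" unfolding s_def using f by (auto intro!: chol_inverse)
 have nz: "f z ~= 0" if "z \<in> Z" for z using f(2)[OF that] by (metis zero_index)
 have cph: "chol (%w. ph w $ al) Z" for al unfolding ph_def vec_lambda_beta by (intro chol_divide f)
 have n: "(norm (s z *s f z))\<^sup>2 = 1 + (norm (ph z))\<^sup>2" if z: "z \<in> Z" for z
 proof -
  have "cor ((norm (s z *s f z))\<^sup>2) = (\<Sum>j\<in>insert i (- {i}). (s z *s f z) $ j * cnj ((s z *s f z) $ j))"
   unfolding norm_vec_sq by (intro sum.cong) auto
  also have "... = 1 + (\<Sum>j\<in>- {i}. (s z *s f z) $ j * cnj ((s z *s f z) $ j))"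
   using f(2)[OF z] by (subst sum.insert) (auto simp: s_def)
  also have "(\<Sum>j\<in>- {i}. (s z *s f z) $ j * cnj ((s z *s f z) $ j)) = (\<Sum>al. ph z $ al * cnj (ph z $ al))"
   by (subst sum.reindex_bij_betw[OF bij_betw_affine_index[of i], symmetric])
    (simp add: s_def ph_def divide_inverse mult_ac)
  also have "... = cor ((norm (ph z))\<^sup>2)" unfolding norm_vec_sq ..
  finally show ?thesis by (metis of_real_1 of_real_add of_real_eq_iff)
 qed
 define u where "u = (%w :: complex^'m. cor (ln (1 + (norm w)\<^sup>2)))"
 have u: "smooth_on UNIV u" unfolding u_def
  by (intro smooth_on_linear_compose[OF open_UNIV bounded_linear_of_real] smooth_on_ln smooth_on_add smooth_on_const
    smooth_on_norm_sq smooth_on_coord open_UNIV) (simp add: add_pos_nonneg)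
 have "pullback_form ph (fubini_study c) z $ al $ bt = fsform f z $ al $ bt" for al bt
 proof -
  have "pullback_form ph (fubini_study c) z $ al $ bt = dz al (dzbar bt (%w. u (ph w))) z"
   unfolding pullback_form_def fubini_study_def vec_lambda_beta u_def[symmetric]
   by (rule ddbar_chain[OF Z open_UNIV u cph, symmetric]) simp
  also have "... = fsform (%z. s z *s f z) z $ al $ bt"
   unfolding fsform_def vec_lambda_beta by (intro dz_cong[OF Z] dz_cong[OF Z(1)]) (simp_all add: n u_def)
  also have "fsform (%z. s z *s f z) z = fsform f z" by (rule fsform_scale[OF Z(1) f(1) nz s Z(2)])
  finally show ?thesis .
 qed
 then show ?thesis unfolding ph_def[symmetric] by (simp add: vec_eq_iff)
qed

section \<open>Bijectivity of the developing map on lines\<close>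

locale developed = model X A g ka for X :: "'a topology" and A :: "('a, 'm::finite) chart set" and g ka +
 fixes F :: "complex^('m option) => 'a"
 assumes F: "LI (- {0}) F" and hom: "!!c v. c ~= 0 ==> v ~= 0 ==> F (c *s v) = F v"
begin

lemma F_par: "par u v ==> v ~= 0 ==> F u = F v"
 unfolding par_def using hom by blast

lemma F_top: "v ~= 0 ==> F v \<in> topspace X" using LI_top[OF F] by simp

text \<open>A lift belonging to a branch of \<open>F\<close> is, after homogeneity absorbs its scale
  \<open>c\<close>, a continuous local section of \<open>F\<close>. This gives openness of
  \<open>F\<close> and later the coordinate expressions of its inverse.\<close>

lemma F_section:
 assumes w: "w ~= 0"
 obtains N L M ps T where "li N L M ps" "openin X T" "F w \<in> T" "T \<subseteq> N" "\<forall>y\<in>T. F (L y) = y" "par (L (F w)) w"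
proof -
 have w': "w \<in> - {0}" using w by simp
 obtain N L M ps B where l: "li N L M ps" and B: "open B" "w \<in> B" "B \<subseteq> - {0}" "B \<subseteq> M" "\<forall>v\<in>B. F v = ps v"
  by (rule LI_E[OF F w'])
 have p: "par (L (F w)) w" and FN: "F w \<in> N" using liD(5,6)[OF l, of w] B by auto
 then obtain c where c: "c ~= 0" "L (F w) = c *s w" unfolding par_def by blast
 have cc: "inverse c *s L (F w) = w" using c by (simp add: vec_eq_iff)
 define T where "T = {y \<in> N. inverse c *s L y \<in> B}"
 have "openin (subtopology X N) {y \<in> topspace (subtopology X N). L y \<in> (%v. inverse c *s v) -` B}"
 proof (rule openin_continuous_map_preimage[OF liD(3)[OF l]])
  show "openin euclidean ((%v. inverse c *s v) -` B)" using open_vimage[OF B(1) continuous_smult] by simp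
 qed
 moreover have "{y \<in> topspace (subtopology X N). L y \<in> (%v. inverse c *s v) -` B} = T" using liD(11)[OF l] by (auto simp: T_def)
 ultimately have T: "openin X T" using openin_trans_full[OF _ liD(10)[OF l]] by simp
 have "F (L y) = y" if y: "y \<in> T" for y
 proof -
  have yN: "y \<in> N" and yB: "inverse c *s L y \<in> B" using y by (auto simp: T_def)
  have ly: "L y ~= 0" by (rule dev_nonzero[OF liD(1)[OF l] yN])
  have "par (L y) (inverse c *s L y)" by (rule par_sym, rule par_scale) (use c in simp)
  from liD(8)[OF l yN this] have "F (inverse c *s L y) = y" using B(5) yB by simp
  then show ?thesis using hom[OF _ ly, of "inverse c"] c(1) by simp
 qed
 then show thesis using that[OF l T _ _ _ p] FN cc B(2) by (auto simp: T_def)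
qed

lemma F_open: assumes S: "open S" "S \<subseteq> - {0}" shows "openin X (F ` S)"
proof (subst openin_subopen, intro ballI)
 fix x assume "x \<in> F ` S"
 then obtain w where w: "w \<in> S" "x = F w" by blast
 then have "w ~= 0" using S(2) by auto
 then obtain N L M ps T where l: "li N L M ps" and T: "openin X T" "F w \<in> T" "T \<subseteq> N" "\<forall>y\<in>T. F (L y) = y" and p: "par (L (F w)) w"
  by (rule F_section)
 obtain c where c: "c ~= 0" "L (F w) = c *s w" using p unfolding par_def by blast
 define T' where "T' = {y \<in> T. inverse c *s L y \<in> S}"
 have o: "open ((%v. inverse c *s v) -` S)" by (rule open_vimage[OF S(1) continuous_smult])
 have "openin (subtopology X T) {y \<in> topspace (subtopology X T). L y \<in> (%v. inverse c *s v) -` S}"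
  by (rule openin_continuous_map_preimage[OF continuous_map_from_subtopology_mono[OF liD(3)[OF l] T(3)]]) (use o in simp)
 moreover have "{y \<in> topspace (subtopology X T). L y \<in> (%v. inverse c *s v) -` S} = T'"
  using openin_subset[OF T(1)] by (auto simp: T'_def)
 ultimately have "openin X T'" using openin_trans_full[OF _ T(1)] by simp
 moreover have "x \<in> T'" using w T(2) c by (simp add: T'_def)
 moreover have "T' \<subseteq> F ` S"
 proof
  fix y assume "y \<in> T'"
  then have y: "y \<in> T" "inverse c *s L y \<in> S" by (auto simp: T'_def)
  have "L y ~= 0" using dev_nonzero[OF liD(1)[OF l]] y(1) T(3) by blast
  then have "F (inverse c *s L y) = y" using hom[of "inverse c" "L y"] c(1) T(4) y(1) by simp
  then show "y \<in> F ` S" using y(2) by (metis imageI)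
 qed
 ultimately show "\<exists>T. openin X T & x \<in> T & T \<subseteq> F ` S" by blast
qed

lemma F_continuous: "continuous_map (top_of_set (- {0})) X F"
 unfolding continuous_map_def
proof (intro conjI allI impI)
 show "F \<in> topspace (top_of_set (- {0})) \<rightarrow> topspace X" using F_top by auto
 fix T assume T: "openin X T"
 have "open {v \<in> - {0}. F v \<in> T}"
 proof (subst open_subopen, intro ballI)
  fix v assume "v \<in> {v \<in> - {0}. F v \<in> T}"
  then have v: "v \<in> - {0}" "F v \<in> T" by auto
  obtain B where "open B" "v \<in> B" "B \<subseteq> - {0}" "!!w. w \<in> B ==> F w \<in> T" by (rule LI_nbhd[OF F v(1) T v(2)]) blast
  then show "\<exists>B. open B & v \<in> B & B \<subseteq> {v \<in> - {0}. F v \<in> T}" by (intro exI[of _ B]) auto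
 qed
 then show "openin (top_of_set (- {0})) {v \<in> topspace (top_of_set (- {0})). F v \<in> T}"
  by (intro open_subset) auto
qed

text \<open>By homogeneity the image equals that of the unit sphere, so it is compact and hence
  closed; it is also open and nonempty, and the manifold is connected.\<close>

lemma F_surj: "F ` (- {0}) = topspace X"
proof -
 have "F v \<in> F ` sphere 0 1" if "v ~= 0" for v
 proof -
  have "norm (cor (inverse (norm v)) *s v) = 1" using that by (simp add: norm_smult norm_inverse)
  moreover have "F (cor (inverse (norm v)) *s v) = F v" using that by (intro hom) simp_all
  ultimately show ?thesis by (metis imageI mem_sphere_0)
 qed
 moreover have "sphere 0 1 \<subseteq> - {0 :: complex^('m option)}" by auto
 ultimately have eq: "F ` (- {0}) = F ` sphere 0 1" by blast
 have "compactin (top_of_set (- {0})) (sphere (0 :: complex^('m option)) 1)"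
  by (auto simp: compactin_subtopology)
 from image_compactin[OF this F_continuous] have "closedin X (F ` (- {0}))"
  unfolding eq by (rule compactin_imp_closedin[OF hausdorff])
 moreover have "openin X (F ` (- {0}))" by (rule F_open) (auto simp: open_Compl)
 moreover have "F ` (- {0}) ~= {}"
 proof -
  have "(\<chi> i. 1 :: complex^('m option)) ~= 0" by (simp add: vec_eq_iff)
  then show ?thesis by blast
 qed
 ultimately show ?thesis using connected unfolding connected_space_clopen_in by blast
qed

lemma F_inj:
 assumes w: "w ~= 0" "w' ~= 0" and e: "F w = F w'" shows "par w w'"
proof -
 have "w \<in> - {0}" "w' \<in> - {0}" using w by auto
 obtain N L M ps B where l: "li N L M ps" and B: "open B" "w \<in> B" "B \<subseteq> - {0}" "B \<subseteq> M" "\<forall>v\<in>B. F v = ps v"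
  by (rule LI_E[OF F \<open>w \<in> - {0}\<close>])
 obtain N' L' M' ps' B' where l': "li N' L' M' ps'" and B': "open B'" "w' \<in> B'" "B' \<subseteq> - {0}" "B' \<subseteq> M'" "\<forall>v\<in>B'. F v = ps' v"
  by (rule LI_E[OF F \<open>w' \<in> - {0}\<close>])
 have x: "F w \<in> N" "F w \<in> N'" using liD(5)[OF l, of w] B liD(5)[OF l', of w'] B' e by auto
 obtain W V where W: "openin X W" "F w \<in> W" "W \<subseteq> N \<inter> N'" and V: "unitary V" and p: "!!y. y \<in> W ==> par (L' y) (V *v L y)"
  by (rule dev_rigidity[OF liD(1)[OF l] liD(1)[OF l'] x]) blast
 have Vnz: "V *v v ~= 0" if "v ~= 0" for v using that unitary_norm[OF V, of v] by (metis norm_eq_zero)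
 have cV: "continuous_on UNIV (%v. b *s (V *v v))" for b
  by (rule continuous_on_compose2[OF continuous_smult[of UNIV]], rule linear_continuous_on,
    rule linear_conv_bounded_linear[THEN iffD1], rule linearI)
   (simp_all add: vec_eq_iff matrix_vector_mult_def scaleR_sum_right distrib_left sum.distrib)
 have Lw: "par (L (F w)) w" using liD(6)[OF l, of w] B by auto
 have "par (L' (F w)) w'" using liD(6)[OF l', of w'] B' e by auto
 then have Vw: "par (V *v w) w'"
  using par_trans[OF par_matrix[OF par_sym[OF Lw]] par_trans[OF par_sym[OF p[OF W(2)]]]] by blast
 obtain B1 where B1: "open B1" "w \<in> B1" "B1 \<subseteq> - {0}" "!!v. v \<in> B1 ==> F v \<in> W"
  by (rule LI_nbhd[OF F \<open>w \<in> - {0}\<close> W(1,2)]) blast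
 obtain c where c: "c ~= 0" "V *v w = c *s w'" using Vw unfolding par_def by blast
 have cw: "inverse c *s (V *v w) = w'" using c by (simp add: vec_eq_iff)
 define D where "D = B \<inter> B1 \<inter> (%v. inverse c *s (V *v v)) -` B'"
 have D: "open D" "w \<in> D" "D \<subseteq> - {0}" using B B1 open_vimage[OF B'(1) cV] B'(2) cw by (auto simp: D_def)
 have near: "F (V *v v) = F v" if "v \<in> D" for v
 proof -
  have v: "v \<in> B" "v \<in> B1" "inverse c *s (V *v v) \<in> B'" using that by (auto simp: D_def)
  have nz: "V *v v ~= 0" by (rule Vnz) (use v(1) B(3) in auto)
  have "par (L (F v)) v" using liD(6)[OF l, of v] v(1) B by auto
  then have "par (L' (F v)) (V *v v)" using par_trans[OF p[OF B1(4)[OF v(2)]] par_matrix] by blast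
  moreover have "par (V *v v) (inverse c *s (V *v v))" by (rule par_sym, rule par_scale) (use c in simp)
  ultimately have "par (L' (F v)) (inverse c *s (V *v v))" by (rule par_trans)
  from liD(8)[OF l' _ this] have "F (inverse c *s (V *v v)) = F v" using W(3) B1(4)[OF v(2)] B'(5) v(3) by auto
  then show ?thesis using hom[OF _ nz, of "inverse c"] c(1) by simp
 qed
 \<comment> \<open>Composition with a unitary matrix gives a branch again, so the identity theorem
   spreads the agreement with \<open>F\<close> from a neighbourhood of \<open>w\<close> over the
   connected punctured space.\<close>
 have "LI (- {0}) (%v. F (V *v v))"
 proof (rule LI_I)
  fix v :: "complex^('m option)" assume "v \<in> - {0}"
  then have "V *v v \<in> - {0}" using Vnz[of v] by simp
  then obtain N L M ps B where l: "li N L M ps" and B: "open B" "V *v v \<in> B" "B \<subseteq> - {0}" "B \<subseteq> M" "\<forall>u\<in>B. F u = ps u"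
   by (rule LI_E[OF F])
  have lt: "li N (%y. adj V *v L y) {u. V *v u \<in> M} (%u. ps (V *v u))" using li_transform[OF l V, of 1] by simp
  have "open ((%v. V *v v) -` B)" using open_vimage[OF B(1) cV[of 1]] by simp
  then show "\<exists>N L M ps B. li N L M ps & open B & v \<in> B & B \<subseteq> M & (\<forall>u\<in>B \<inter> - {0}. F (V *v u) = ps u)"
   using B lt by (intro exI[of _ N] exI[of _ "%y. adj V *v L y"] exI[of _ "{u. V *v u \<in> M}"] exI[of _ "%u. ps (V *v u)"]
    exI[of _ "(%v. V *v v) -` B"]) auto
 qed (simp add: open_Compl)
 moreover have "connected (- {0 :: complex^('m option)})" by (rule connected_punctured_universe) simp
 ultimately have FV: "F (V *v v) = F v" if "v ~= 0" for v
  using LI_unique[OF _ F _ D(1,2,3) near, of v] that by simp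
 \<comment> \<open>At a general point, \<open>v\<close> and \<open>V *v v\<close> may be far apart,
   and nothing prevents \<open>F\<close> from identifying their lines. Near an eigenvector both have
   representatives in one set on which \<open>F\<close> separates lines.\<close>
 obtain u mu where u: "u ~= 0" "V *v u = mu *s u" using eigenvector_exists by blast
 have "mu ~= 0" using Vnz[OF u(1)] u(2) by auto
 have "u \<in> - {0}" using u(1) by simp
 then obtain N2 L2 M2 ps2 B2 where l2: "li N2 L2 M2 ps2" and B2: "open B2" "u \<in> B2" "B2 \<subseteq> - {0}" "B2 \<subseteq> M2" "\<forall>v\<in>B2. F v = ps2 v"
  by (rule LI_E[OF F])
 define E where "E = B2 \<inter> (%v. inverse mu *s (V *v v)) -` B2"
 have "inverse mu *s (V *v u) = u" using u \<open>mu ~= 0\<close> by (simp add: vec_eq_iff)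
 then have E: "open E" "u \<in> E" using B2 open_vimage[OF B2(1) cV] by (auto simp: E_def)
 have "\<exists>b. V *v v = b *s v" if "v \<in> E" for v
 proof -
  have v: "v \<in> B2" "inverse mu *s (V *v v) \<in> B2" using that by (auto simp: E_def)
  have nz: "v ~= 0" using v(1) B2(3) by auto
  note nz = nz Vnz[OF nz]
  have "F (inverse mu *s (V *v v)) = F v" using hom[OF _ nz(2), of "inverse mu"] FV[OF nz(1)] \<open>mu ~= 0\<close> by simp
  then have "par (L2 (F v)) (inverse mu *s (V *v v))" using liD(6)[OF l2, of "inverse mu *s (V *v v)"] v(2) B2 by auto
  moreover have "par (L2 (F v)) v" using liD(6)[OF l2, of v] v(1) B2 by auto
  moreover have "par (V *v v) (inverse mu *s (V *v v))" by (rule par_sym, rule par_scale) (use \<open>mu ~= 0\<close> in simp)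
  ultimately have "par (V *v v) v" using par_sym par_trans by blast
  then show ?thesis unfolding par_def by blast
 qed
 then obtain nu where nu: "!!v. V *v v = nu *s v" using scalar_of_par[OF E u(1)] by blast
 have "nu ~= 0" using Vnz[OF w(1)] nu[of w] by auto
 then have "par w (V *v w)" unfolding nu by (rule par_sym[OF par_scale])
 then show ?thesis using Vw by (rule par_trans)
qed

end

section \<open>The induced biholomorphism and its scale factor\<close>

context developed
begin

text \<open>Inverse of the map that \<open>F\<close> induces on lines; by \<open>F_inj\<close> the
  chosen preimage affects only the representative of the line.\<close>

definition G :: "'a => (complex^('m option)) set" where
 "G x = cline (SOME w. w ~= 0 & F w = x)"

lemma G_F: assumes "w ~= 0" shows "G (F w) = cline w"
proof -
 have "(SOME v. v ~= 0 & F v = F w) ~= 0 & F (SOME v. v ~= 0 & F v = F w) = F w"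
  by (rule someI[of _ w]) (use assms in simp)
 then show ?thesis unfolding G_def using F_inj assms cline_par by metis
qed

lemma F_ex: "x \<in> topspace X ==> \<exists>w. w ~= 0 & x = F w"
 using F_surj by blast

lemma G_bij: "bij_betw G (topspace X) cproj_space"
 unfolding bij_betw_def
proof
 show "inj_on G (topspace X)"
 proof (rule inj_onI)
  fix x y assume "x \<in> topspace X" "y \<in> topspace X" and e: "G x = G y"
  then obtain v w where v: "v ~= 0" "x = F v" and w: "w ~= 0" "y = F w" using F_ex by metis
  have "par v w" using par_cline[OF _ v(1)] e unfolding v(2) w(2) G_F[OF v(1)] G_F[OF w(1)] by blast
  then show "x = y" using F_par v w by blast
 qed
 show "G ` topspace X = cproj_space"
 proof (intro equalityI subsetI)
  fix l assume "l \<in> G ` topspace X"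
  then obtain w where "w ~= 0" "l = G (F w)" using F_ex by blast
  then show "l \<in> cproj_space" using G_F by (auto simp: cproj_space_def)
 next
  fix l :: "(complex^('m option)) set" assume "l \<in> cproj_space"
  then obtain w where "w ~= 0" "l = cline w" by (auto simp: cproj_space_def)
  then show "l \<in> G ` topspace X" using G_F F_top by (metis imageI)
 qed
qed

abbreviation P :: "(complex^('m option)) set => 'a" where "P \<equiv> inv_into (topspace X) G"

lemma P_cline: assumes "w ~= 0" shows "P (cline w) = F w"
 using inv_into_f_f[OF bij_betw_imp_inj_on[OF G_bij] F_top[OF assms]] G_F[OF assms] by simp

lemma G_continuous: "continuous_map X cproj_topology G"
 unfolding continuous_map_def
proof (intro conjI allI impI)
 show "G \<in> topspace X \<rightarrow> topspace cproj_topology"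
  using G_bij unfolding topspace_cproj_topology bij_betw_def by auto
 fix U :: "(complex^('m option)) set set" assume U: "openin cproj_topology U"
 have "{x \<in> topspace X. G x \<in> U} = F ` {w. w ~= 0 & cline w \<in> U}"
 proof (intro equalityI subsetI)
  fix x assume x: "x \<in> {x \<in> topspace X. G x \<in> U}"
  then obtain w where "w ~= 0" "x = F w" using F_ex by blast
  then show "x \<in> F ` {w. w ~= 0 & cline w \<in> U}" using x G_F by auto
 qed (use F_top G_F in auto)
 then show "openin X {x \<in> topspace X. G x \<in> U}"
  using U unfolding openin_cproj_topology by (simp add: F_open Collect_mono_iff subset_iff)
qed

lemma P_continuous: "continuous_map cproj_topology X P"
 unfolding continuous_map_def
proof (intro conjI allI impI)
 show "P \<in> topspace cproj_topology \<rightarrow> topspace X"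
  using bij_betw_apply[OF bij_betw_inv_into[OF G_bij]] unfolding topspace_cproj_topology by auto
 fix T assume T: "openin X T"
 have "{w. w ~= 0 & cline w \<in> {l \<in> topspace cproj_topology. P l \<in> T}} = {w \<in> topspace (top_of_set (- {0})). F w \<in> T}"
  using P_cline by (auto simp: topspace_cproj_topology cproj_space_def)
 moreover have "open {w \<in> topspace (top_of_set (- {0})). F w \<in> T}"
  using openin_open_trans[OF openin_continuous_map_preimage[OF F_continuous T]] by (simp add: open_Compl)
 ultimately show "openin cproj_topology {l \<in> topspace cproj_topology. P l \<in> T}"
  unfolding openin_cproj_topology by (auto simp: topspace_cproj_topology)
qed

text \<open>The local sections of \<open>F\<close> are lifts, so in charts \<open>G\<close> is the
  quotient of coordinates of a lift. Both its holomorphy and its effect on the metric are read off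
  from this.\<close>

lemma G_local:
 assumes c: "c \<in> A" and z: "z \<in> local_rep_dom c (affine_chart i) G"
 obtains Z f where "open Z" "z \<in> Z" "lift ka (g c) Z f" "!!w. w \<in> Z ==> f w $ i ~= 0"
  "!!w. w \<in> Z ==> local_rep c (affine_chart i) G w = (\<chi> al. f w $ affine_index i al / f w $ i)"
proof -
 obtain x where x: "x \<in> dom_of c" "G x \<in> dom_of (affine_chart i)" "z = coord c x" using z by (auto simp: local_rep_dom_def)
 obtain w0 where w0: "w0 ~= 0" "x = F w0" using F_ex x(1) dom_sub[OF c] by blast
 obtain N L M ps T where l: "li N L M ps" and T: "openin X T" "F w0 \<in> T" "T \<subseteq> N" "\<forall>y\<in>T. F (L y) = y" and p: "par (L (F w0)) w0"
  by (rule F_section[OF w0(1)])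
 have Lnz: "L y ~= 0" if "y \<in> N" for y by (rule dev_nonzero[OF liD(1)[OF l] that])
 define f where "f = (%z. L (cinv c z))"
 have d: "lift ka (g c) (coord c ` (T \<inter> dom_of c)) f"
  using dev_mono[OF liD(1)[OF l] T(1,3)] c unfolding dev_def f_def by blast
 have GL: "G y = cline (L y)" if "y \<in> T" for y using G_F[OF Lnz, of y] T(3,4) that by auto
 define Z where "Z = coord c ` (T \<inter> dom_of c) \<inter> (%z. f z $ i) -` (- {0})"
 show thesis
 proof (rule that)
  show Z: "open Z" unfolding Z_def
   by (rule continuous_open_preimage[OF chol_continuous_on[OF liftD(2)[OF d]] liftD(1)[OF d]]) (simp add: open_Compl)
  have xT: "x \<in> T" using T(2) w0(2) by simp
  have "cline (L x) \<in> dom_of (affine_chart i)" using x(2) GL[OF xT] by simp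
  then have "L x $ i ~= 0" using affine_dom_iff[OF Lnz] xT T(3) by blast
  then show "z \<in> Z" using xT x(1,3) cinv[OF c x(1)] by (auto simp: Z_def f_def)
  show "lift ka (g c) Z f" by (rule lift_mono[OF d Z]) (auto simp: Z_def)
  show nz: "f w $ i ~= 0" if "w \<in> Z" for w using that by (simp add: Z_def)
  fix w assume w: "w \<in> Z"
  then obtain y where y: "y \<in> T" "y \<in> dom_of c" "w = coord c y" by (auto simp: Z_def)
  have "local_rep c (affine_chart i) G w = coord (affine_chart i) (cline (f w))"
   using GL[OF y(1)] cinv[OF c y(2)] by (simp add: local_rep_def f_def y(3))
  then show "local_rep c (affine_chart i) G w = (\<chi> al. f w $ affine_index i al / f w $ i)"
   using affine_chart_cline(2)[OF nz[OF w]] by (simp add: vec_eq_iff)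
 qed
qed

lemma G_holomorphic:
 assumes c: "c \<in> A" shows "cholomorphic_on (local_rep c (affine_chart i) G) (local_rep_dom c (affine_chart i) G)"
 unfolding cholomorphic_on_iff_chol
proof (intro allI chol_local)
 fix k z assume z: "z \<in> local_rep_dom c (affine_chart i) G"
 obtain Z f where Z: "open Z" "z \<in> Z" "lift ka (g c) Z f" "!!w. w \<in> Z ==> f w $ i ~= 0"
  "!!w. w \<in> Z ==> local_rep c (affine_chart i) G w = (\<chi> al. f w $ affine_index i al / f w $ i)"
  by (rule G_local[OF c z]) blast
 have "chol (%w. f w $ affine_index i k / f w $ i) Z" by (intro chol_divide liftD(2)[OF Z(3)] Z(4))
 then show "\<exists>Z f'. open Z & z \<in> Z & chol f' Z & (\<forall>w\<in>Z. local_rep c (affine_chart i) G w $ k = f' w)"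
  using Z(1,2,5) by (intro exI[of _ Z] exI[of _ "%w. f w $ affine_index i k / f w $ i"]) simp
qed

lemma G_homothety:
 assumes c: "c \<in> A" and z: "z \<in> local_rep_dom c (affine_chart i) G"
 shows "pullback_form (local_rep c (affine_chart i) G) (fubini_study d) z $ al $ bt = cor ka * g c z $ al $ bt"
proof -
 obtain Z f where Z: "open Z" "z \<in> Z" "lift ka (g c) Z f" "!!w. w \<in> Z ==> f w $ i ~= 0"
  "!!w. w \<in> Z ==> local_rep c (affine_chart i) G w = (\<chi> al. f w $ affine_index i al / f w $ i)"
  by (rule G_local[OF c z]) blast
 let ?ph = "%w. \<chi> al. f w $ affine_index i al / f w $ i"
 have "dz al (%w. local_rep c (affine_chart i) G w $ mu) z = dz al (%w. ?ph w $ mu) z" for al mu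
  by (rule dz_cong[OF Z(1,2)]) (simp add: Z(5))
 then have "pullback_form (local_rep c (affine_chart i) G) (fubini_study d) z = pullback_form ?ph (fubini_study d) z"
  unfolding pullback_form_def Z(5)[OF Z(2)] by simp
 also have "... = fsform f z" by (rule pullback_fubini_study[OF Z(1,2) liftD(2)[OF Z(3)] Z(4)])
 finally show ?thesis using liftD(4)[OF Z(3,2)] by simp
qed

lemma P_holomorphic:
 assumes c: "c \<in> A" shows "cholomorphic_on (local_rep (affine_chart i) c P) (local_rep_dom (affine_chart i) c P)"
 unfolding cholomorphic_on_iff_chol
proof (intro allI chol_local)
 fix k u assume "u \<in> local_rep_dom (affine_chart i) c P"
 then obtain l where l: "l \<in> dom_of (affine_chart i)" "P l \<in> dom_of c" "u = coord (affine_chart i) l" by (auto simp: local_rep_dom_def)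
 have e0: "emb i v ~= 0" for v using emb(1)[of i v] by (metis zero_index zero_neq_one)
 have "l = cline (emb i u)" unfolding l(3) by (rule affine_inverse(4)[OF l(1)])
 then have w: "emb i u \<in> - {0}" "F (emb i u) \<in> dom_of c" using l(2) P_cline[OF e0] e0 by auto
 obtain N L M ps B where li: "li N L M ps" and B: "open B" "emb i u \<in> B" "B \<subseteq> - {0}" "B \<subseteq> M" "\<forall>v\<in>B. F v = ps v"
  by (rule LI_E[OF F w(1)])
 obtain B1 where B1: "open B1" "emb i u \<in> B1" "B1 \<subseteq> - {0}" "!!v. v \<in> B1 ==> F v \<in> dom_of c"
  by (rule LI_nbhd[OF F w(1) atlas(1)[OF c] w(2)]) blast
 have ce: "chol (%v. emb i v $ j) S" for j S
  by (cases "j = i") (simp_all add: emb_def chol_const chol_coord)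
 have "continuous_on UNIV (%v. \<chi> j. emb i v $ j)" by (intro continuous_on_vec_lambda chol_continuous_on ce)
 then have "continuous_on UNIV (emb i)" by simp
 then have oZ: "open (emb i -` (B \<inter> B1))" by (intro open_vimage open_Int B(1) B1(1))
 have pd: "ps v \<in> dom_of c" if "v \<in> B" "v \<in> B1" for v using B1(4)[OF that(2)] B(5) that(1) by simp
 have "chol (%v. coord c (ps (emb i v)) $ k) (emb i -` (B \<inter> B1))"
 proof (rule chol_compose[OF ce liD(9)[OF li c]])
  show "emb i ` (emb i -` (B \<inter> B1)) \<subseteq> {v \<in> M. ps v \<in> dom_of c}" using B(4) pd by auto
 qed
 moreover have "local_rep (affine_chart i) c P v $ k = coord c (ps (emb i v)) $ k" if "v \<in> emb i -` (B \<inter> B1)" for v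
  using that B(5) by (simp add: local_rep_def affine_inverse(1) P_cline[OF e0])
 ultimately show "\<exists>Z f'. open Z & u \<in> Z & chol f' Z & (\<forall>v\<in>Z. local_rep (affine_chart i) c P v $ k = f' v)"
  using oZ B(2) B1(2) by (intro exI[of _ "emb i -` (B \<inter> B1)"] exI[of _ "%v. coord c (ps (emb i v)) $ k"]) auto
qed

text \<open>The scale factor is \<open>ka\<close>, the curvature constant, since each lift pulls the
  Fubini-Study form back to \<open>ka\<close> times the metric.\<close>

lemma homothetic:
 "biholomorphically_homothetic X A g (cproj_topology :: (complex^('m option)) set topology) cproj_atlas fubini_study"
 unfolding biholomorphically_homothetic_def biholomorphic_map_def holomorphic_map_def topspace_cproj_topology cproj_atlas_def
 using G_bij G_continuous P_continuous G_holomorphic P_holomorphic G_homothety ka by (intro exI[of _ G] exI[of _ ka] conjI) auto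

end

theorem theorem4p4:
  fixes X :: "'a topology"
    and A :: "('a, 'm::finite) chart set"
    and g :: "('a, 'm) metric"
  assumes "CARD('m) \<ge> 2"
    and "compact_space X"
    and "kaehler_manifold X A g"
    and "kaehler_einstein A g"
    and "\<And>c z. c \<in> A \<Longrightarrow> z \<in> codom_of c \<Longrightarrow> cscal (g c) z > 0"
    and "\<And>c z. c \<in> A \<Longrightarrow> z \<in> codom_of c \<Longrightarrow>
           bochner_norm (g c) z <
             2 * sqrt ((real CARD('m))\<^sup>2 - 1) * cscal (g c) z / (3 * ((real CARD('m))\<^sup>2 - 2))"
  shows "biholomorphically_homothetic X A g
           (cproj_topology :: (complex^('m option)) set topology) cproj_atlas fubini_study"
proof -
 interpret pinched X A g
  using assms by unfold_locales
 obtain ka where "ka > 0" "!!c. c \<in> A ==> chc (codom_of c) (g c) ka" by (rule curvature_constant) blast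
 then interpret model X A g ka
  using assms(2) by (intro model.intro model_axioms.intro kaehler_atlas_axioms) auto
 obtain F where "LI (- {0}) F" "\<forall>c v. c ~= 0 \<longrightarrow> v ~= 0 \<longrightarrow> F (c *s v) = F v" by (rule developing_map)
 then interpret developed X A g ka F
  by unfold_locales auto
 show ?thesis by (rule homothetic)
qed

end
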